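(* Assume: (I) $\|\varphi(\cdot,t-\tau)\|_{G^{3/2}}\le C$ and $\|\partial_t\varphi(\cdot,t-\tau)\|_{G^{1/2}}\le C(1+t^{\alpha-1})$ for $t\in[0,\tau]$ (the second bound being vacuous at $t=0$, where its right-hand side is $+\infty$); (II) $\|f(\cdot,t)\|_{G^{3/2}}\le C$ for $t\in[0,K\tau]$, $\|\partial_t f(\cdot,t)\|_{G^{1/2}}\le C$ for $t\in(0,\tau]$, and $\|\partial_t f(\cdot,t)\|_{G^{1/2}}\le C(1+(t-\tau)^{\alpha-1})$ for $t\in(\tau,K\tau]$. Let $u$ be the solution of the delay problem, given on $[0,L]\times((k-1)\tau,k\tau]$ by the series $u_{k\tau}$ described in the context. Then there is a constant $C$, independent of $x$ and $t$, such that for $x\in[0,L]$ and $t\in((k-1)\tau,k\tau]$: $$|\partial_t^{l}u_{k\tau}(x,t)|\le C(1+t^{\alpha-l}),\quad k=1,\dots,K,\ l=0,1,$$ $$|\partial_t^{2}u_{\tau}(x,t)|\le C(1+t^{\alpha-2})\quad (k=1),$$ $$|\partial_t^{2}u_{k\tau}(x,t)|\le C(1+(t-\tau)^{\alpha-1}),\quad k=2,3,\dots,K,$$ $$|\partial_x^{n}u_{k\tau}(x,t)|\le C,\quad k=1,\dots,K,\ n=0,1,2.$$ Furthermore, let $m$ be the smallest positive integer with $(m+1)\alpha>1$. If, in addition to (I) and (II), $|G^{m+1}(\varphi(x,0))|\le C$ for $x\in[0,L]$, then $u$ can be decomposed as $$u(x,t)=\sum_{j=0}^m\gamma_j t^{j\alpha}+\tilde\gamma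 t+Y(x,t),\quad (x,t)\in[0,L]\times[0,K\tau],$$ where $\gamma_j=\gamma_j(x)$ and $\tilde\gamma=\tilde\gamma(x)$ are bounded functions of $x$, and $Y$ satisfies $Y(\cdot,0)=\partial_tY(\cdot,t)|_{t=0}=0$, $Y(\cdot,t)\in C^1[0,K\tau]$ (as a function of $t$), $|\partial_tY(\cdot,t)|\le C(1+t^{(m+1)\alpha-1})$, and $\partial_t^2Y(\cdot,t)\in L^1[0,K\tau]$ (as a function of $t$).
   Context: Problem. Let $0<\alpha<1$, $\Omega=(0,L)$ with $L>0$, constants $p>0$, $a\le0$, $b\ne0$, delay $\tau>0$, $K$ a given positive integer, $f$ continuous and $\varphi$ continuous on $\bar\Omega\times[-\tau,0]$. The delay problem is $$\partial_tu(x,t)=\partial_t^{1-\alpha}\big(p\Delta u(x,t)+au(x,t)\big)+bu(x,t-\tau)+f(x,t),\quad (x,t)\in\Omega\times(0,K\tau],$$ $u(x,t)=\varphi(x,t)$ on $\bar\Omega\times[-\tau,0]$, and $u(0,t)=u(L,t)=0$ for $t\in[-\tau,K\tau]$. Here $\partial_t^{1-\alpha}v(t)=\frac{\partial}{\partial t}\int_0^t\frac{(t-s)^{\alpha-1}}{\Gamma(\alpha)}v(s)\,ds$ is the Riemann–Liouville derivative, and $\partial_t^l$ is the ordinary $l$-th derivative in $t$. Spectral notation. $G(v)=-p\Delta v-av$ (Dirichlet conditions), with eigenvalues $\lambda_i>0$ and eigenfunctions $X_i$, $i\ge1$: $G(X_i)=\lambda_iX_i$, $X_i(0)=X_i(L)=0$,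 $\|X_i\|_{L^2(0,L)}=1$. $G^{m+1}$ denotes the $(m+1)$-fold application of $G$. For $\gamma>0$, $\|g\|_{G^\gamma}=\big(\sum_{i\ge1}\lambda_i^{2\gamma}|(X_i,g)|^2\big)^{1/2}$, where $(\cdot,\cdot)$ is the $L^2(0,L)$ inner product. $E_{\mu,\nu}(z)=\sum_{j\ge0}\frac{z^j}{\Gamma(j\mu+\nu)}$ is the Mittag-Leffler function and $E_\alpha=E_{\alpha,1}$. The solution. $u_{k\tau}$ denotes $u$ restricted to $t\in((k-1)\tau,k\tau]$, and $u_\tau:=u_{1\tau}$. It is defined recursively by $$u_{k\tau}(x,t)=\sum_{i=1}^\infty\Big(\varphi_i(0)E_\alpha(-\lambda_it^\alpha)+\int_0^tE_\alpha(-\lambda_is^\alpha)F_{k\tau,i}(t-s)\,ds\Big)X_i(x),$$ where $\varphi_i(0)=(\varphi(\cdot,0),X_i)$, $F_{k\tau,i}(t)=(F_{k\tau}(\cdot,t),X_i)$, and $F_{k\tau}(x,t)=b\varphi(x,t-\tau)+f(x,t)$ for $0\le t\le\tau$, $F_{k\tau}(x,t)=bu_{j\tau}(x,t-\tau)+f(x,t)$ for $j\tau<t\le(j+1)\tau$, $1\le j\le k-1$. $C$ denotes a generic positive constant, independent of $x$ and $t$, which may differ from one occurrence to another. In the notation $\partial_t\varphi(\cdot,t-\tau)$ the derivative is with respect to $t$. *)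

theory Defs
  imports "HOL-Analysis.Analysis"
begin

definition mittag_leffler :: "real \<Rightarrow> real \<Rightarrow> real \<Rightarrow> real" where
  "mittag_leffler \<mu> \<nu> z = (\<Sum>j. z ^ j / Gamma (real j * \<mu> + \<nu>))"

definition l2_inner :: "real \<Rightarrow> (real \<Rightarrow> real) \<Rightarrow> (real \<Rightarrow> real) \<Rightarrow> real" where
  "l2_inner L v w = integral {0..L} (\<lambda>x. v x * w x)"

definition square_integrable_on :: "real \<Rightarrow> (real \<Rightarrow> real) \<Rightarrow> bool" where
  "square_integrable_on L v \<longleftrightarrow>
     v \<in> borel_measurable (lebesgue_on {0..L}) \<and> integrable (lebesgue_on {0..L}) (\<lambda>x. (v x)\<^sup>2)"

text \<open>The graph of the Dirichlet operator $G(v) = -p v'' - a v$ on $[0,L]$: \<open>dirichlet_op p a L v w\<close>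
  says that \<open>v\<close> is in the domain of $G$ (twice differentiable, vanishing at both endpoints) and that
  \<open>w\<close> is $G(v)$ on $[0,L]$. Derivatives at the endpoints are one-sided. The $n$-fold application of
  $G$ is the relational power \<open>dirichlet_op p a L ^^ n\<close>; in it every intermediate function
  $v, G v, \dots, G^{n-1} v$ satisfies the Dirichlet conditions.\<close>

definition dirichlet_op ::
  "real \<Rightarrow> real \<Rightarrow> real \<Rightarrow> (real \<Rightarrow> real) \<Rightarrow> (real \<Rightarrow> real) \<Rightarrow> bool" where
  "dirichlet_op p a L v w \<longleftrightarrow>
     v 0 = 0 \<and> v L = 0 \<and>
     (\<exists>v' v''. \<forall>x\<in>{0..L}.
        (v has_real_derivative v' x) (at x within {0..L}) \<and>
        (v' has_real_derivative v'' x) (at x within {0..L}) \<and>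
        w x = - p * v'' x - a * v x)"

text \<open>The sequences are indexed by $i \ge 1$ and their values at \<open>0\<close> are irrelevant. The eigenvalues of
  the one-dimensional problem are simple, so \<open>inj_on\<close> says that no eigenvalue is repeated and the
  last clause that none is missing; no ordering is imposed.\<close>

definition dirichlet_eigensystem ::
  "real \<Rightarrow> real \<Rightarrow> real \<Rightarrow> (nat \<Rightarrow> real) \<Rightarrow> (nat \<Rightarrow> real \<Rightarrow> real) \<Rightarrow> bool" where
  "dirichlet_eigensystem p a L lam X \<longleftrightarrow>
     (\<forall>i\<ge>1. lam i > 0 \<and> dirichlet_op p a L (X i) (\<lambda>x. lam i * X i x) \<and>
             sqrt (l2_inner L (X i) (X i)) = 1) \<and>
     inj_on lam {1..} \<and>
     (\<forall>\<mu> v. dirichlet_op p a L v (\<lambda>x. \<mu> * v x) \<and> (\<exists>x\<in>{0..L}. v x \<noteq> 0) \<longrightarrow> \<mu> \<in> lam ` {1..})"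

text \<open>The norm is extended-valued: it is infinite unless \<open>g\<close> lies in $L^2(0,L)$ and the defining series
  converges. Hence a bound by a real constant asserts membership in the space as well.\<close>

definition G_norm ::
  "real \<Rightarrow> (nat \<Rightarrow> real) \<Rightarrow> (nat \<Rightarrow> real \<Rightarrow> real) \<Rightarrow> real \<Rightarrow> (real \<Rightarrow> real) \<Rightarrow> ennreal" where
  "G_norm L lam X \<gamma> g =
     (let c = (\<lambda>i. lam i powr (2 * \<gamma>) * \<bar>l2_inner L (X i) g\<bar>\<^sup>2)
      in if square_integrable_on L g \<and> summable (\<lambda>n. c (Suc n))
         then ennreal (sqrt (\<Sum>n. c (Suc n))) else \<infinity>)"

definition mild_series ::
  "real \<Rightarrow> real \<Rightarrow> (nat \<Rightarrow> real) \<Rightarrow> (nat \<Rightarrow> real \<Rightarrow> real) \<Rightarrow>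
   (real \<Rightarrow> real) \<Rightarrow> (real \<Rightarrow> real \<Rightarrow> real) \<Rightarrow> real \<Rightarrow> real \<Rightarrow> real" where
  "mild_series L \<alpha> lam X v0 F x t =
     (let c = (\<lambda>i. l2_inner L v0 (X i) * mittag_leffler \<alpha> 1 (- lam i * t powr \<alpha>) +
                  integral {0..t} (\<lambda>s. mittag_leffler \<alpha> 1 (- lam i * s powr \<alpha>) *
                                       l2_inner L (\<lambda>y. F y (t - s)) (X i)))
      in \<Sum>n. c (Suc n) * X (Suc n) x)"

text \<open>\<open>delay_sol \<dots> k\<close> is the solution $u$ on $[-\tau, k\tau]$: it equals \<open>\<phi>\<close> on $[-\tau,0]$ and
  $u_{j\tau}$ on $((j-1)\tau, j\tau]$ for $1 \le j \le k$. Thus $b\,u(x,t-\tau) + f(x,t)$ with $u$ the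
  solution up to time $k\tau$ is the source $F_{(k+1)\tau}$ on all of $[0,(k+1)\tau]$.\<close>

primrec delay_sol ::
  "real \<Rightarrow> real \<Rightarrow> (nat \<Rightarrow> real) \<Rightarrow> (nat \<Rightarrow> real \<Rightarrow> real) \<Rightarrow> real \<Rightarrow> real \<Rightarrow>
   (real \<Rightarrow> real \<Rightarrow> real) \<Rightarrow> (real \<Rightarrow> real \<Rightarrow> real) \<Rightarrow> nat \<Rightarrow> real \<Rightarrow> real \<Rightarrow> real" where
  "delay_sol L \<alpha> lam X b \<tau> \<phi> f 0 = \<phi>"
| "delay_sol L \<alpha> lam X b \<tau> \<phi> f (Suc k) =
     (\<lambda>x t. if t \<le> real k * \<tau> then delay_sol L \<alpha> lam X b \<tau> \<phi> f k x t
            else mild_series L \<alpha> lam X (\<lambda>y. \<phi> y 0)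
                   (\<lambda>y s. b * delay_sol L \<alpha> lam X b \<tau> \<phi> f k y (s - \<tau>) + f y s) x t)"

end

theory Submission
  imports Defs
begin

text \<open>Everything reduces to the scalar coefficients
  $u_i(t) = \varphi_i E_\alpha(-\lambda_i t^\alpha) + \int_0^t E_\alpha(-\lambda_i s^\alpha) F_i(t-s)\,ds$.
  The functions $(y\,d/dy)^k E_\alpha(-y)$ are bounded on $y \ge 0$ by a maximum principle; hence
  $\partial_t E_\alpha(-\lambda t^\alpha)$ is at most a multiple of $\lambda^\theta t^{\theta\alpha-1}$ for every
  $\theta \in [0,1]$. Against the weight $1 + t^{\alpha-1} + (t-\tau)_+^{\alpha-1}$ for $F_i'$ this
  controls two time derivatives of $u_i$ on each interval $((k-1)\tau, k\tau]$. By Cauchy-Schwarz the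
  norms of orders $3/2$ and $1/2$ give $\ell^1$ bounds on $\lambda_i^{9/8} F_i$ and $\lambda_i^{1/8} F_i'$, since
  $\sum_i \lambda_i^{-3/4}$ converges; the $u_i$ inherit these bounds, so the induction on $k$ closes and
  all series may be differentiated termwise.

  For the decomposition, subtract from $E_\alpha(-\lambda_i t^\alpha)$ its Taylor polynomial of degree $m$ in
  $\lambda_i t^\alpha$. The remainder is $(\lambda_i t^\alpha)^{m+1}$ times a multiplier $N(\lambda_i t^\alpha)$,
  and $\lambda_i^{m+1}\varphi_i$ are the coefficients of the bounded function $g = G^{m+1}\varphi(\cdot,0)$,
  which need not be summable. Two summations by parts bound
  $\sum_i N(\lambda_i h)\, g_i X_i$ uniformly in $h$ by the Fejer means of $g$.\<close>

text \<open>The exponents leave one degree of freedom. As \<lambda>_i grows like i^2, the sum of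
  \<lambda>_i^(-s) converges for s > 1/2, and Cauchy-Schwarz lowers the order of a norm by s/2; with
  s = 3/4 the orders 3/2 and 1/2 become 9/8 and 1/8. The first must be at least 1, for two
  derivatives in x. The second must be positive: the derivative of the relaxation kernel becomes
  integrable in time, uniformly in i, only at the price of a positive power of \<lambda>_i, and the
  power paid is 1/8. Any s strictly between 1/2 and 1 would serve. Two obstacles shape the rest. The
  derivative of the kernel is singular at 0, so convolutions are differentiated with the kernel
  shifted by a small \<delta>, the derivative is moved to the source by parts, and then \<delta>
  tends to 0. Moreover, the hypotheses bound the time derivatives of the data in a norm over x for
  each fixed t, which gives no majorant for differentiating a Fourier coefficient under the integral
  sign; one has to be constructed.\<close>

section \<open>Mittag-Leffler functions on the negative axis\<close>

text \<open>\<open>I\<close> is a positive multiple of the Caputo derivative, at its maximum point on the interval, of the series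
  in $t^\alpha$.\<close>

lemma power_series_max_principle:
  fixes \<alpha> x :: real and b :: "nat \<Rightarrow> real"
  assumes \<alpha>: "0 < \<alpha>" "\<alpha> < 1" and x: "x > 0"
    and conv: "\<And>y. summable (\<lambda>j. b j * y ^ j)"
    and max: "\<And>y. y \<in> {0..x} \<Longrightarrow> (\<Sum>j. b j * y ^ j) \<le> (\<Sum>j. b j * x ^ j)"
  shows "\<exists>I\<ge>0. (\<lambda>j. diffs b j * x ^ j * Beta (real (Suc j) * \<alpha>) (1 - \<alpha>)) sums I"
proof -
  define g where "g y = (\<Sum>j. b j * y ^ j)" for y
  define h where "h y = (\<Sum>j. diffs b j * y ^ j)" for y
  have g': "(g has_field_derivative h y) (at y)" for y
    unfolding g_def h_def by (rule termdiffs_strong_converges_everywhere[OF conv])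
  have convd: "summable (\<lambda>j. diffs b j * y ^ j)" for y
    by (rule termdiff_converges_all[OF conv])
  define W where "W s = s powr (\<alpha> - 1) * (1 - s) powr (- \<alpha>)" for s
  have Wnn: "W s \<ge> 0" for s by (simp add: W_def)
  have Wint: "W integrable_on {0..1}"
    using has_integral_Beta_real[of \<alpha> "1 - \<alpha>"] \<alpha> unfolding W_def by (auto simp: integrable_on_def)
  define q where "q j s = diffs b j * x ^ j * (s powr (real (Suc j) * \<alpha> - 1) * (1 - s) powr (- \<alpha>))" for j s
  have qint: "(q j has_integral diffs b j * x ^ j * Beta (real (Suc j) * \<alpha>) (1 - \<alpha>)) {0..1}" for j
    using has_integral_Beta_real[of "real (Suc j) * \<alpha>" "1 - \<alpha>"] \<alpha> unfolding q_def
    by (intro has_integral_mult_right) auto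
  have qW: "q j s = W s * (diffs b j * (x * s powr \<alpha>) ^ j)" if "s \<in> {0..1}" for j s
  proof (cases "s = 0")
    case False
    then have "s > 0" using that by simp
    have "s powr (real (Suc j) * \<alpha> - 1) = s powr (\<alpha> - 1) * (s powr \<alpha>) ^ j"
      using \<open>s > 0\<close> by (simp add: powr_realpow[symmetric] powr_powr powr_add[symmetric] algebra_simps)
    then show ?thesis by (simp add: q_def W_def power_mult_distrib)
  qed (simp add: q_def W_def)
  have Pint: "(\<lambda>s. \<Sum>j<n. q j s) integrable_on {0..1}" for n
    using qint by (intro integrable_sum) (auto simp: integrable_on_def)
  define H where "H = (\<Sum>j. norm (diffs b j * x ^ j))"
  have sH: "summable (\<lambda>j. norm (diffs b j * x ^ j))"
    using powser_insidea[OF convd[of "x+1"], of x] x by simp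
  have dom: "norm (\<Sum>j<n. q j s) \<le> H * W s" if "s \<in> {0..1}" for n s
  proof -
    have s1: "0 \<le> s powr \<alpha>" "s powr \<alpha> \<le> 1" using that \<alpha> by (auto intro: powr_le1)
    have "norm (\<Sum>j<n. q j s) \<le> (\<Sum>j<n. norm (q j s))" by (rule norm_sum)
    also have "\<dots> \<le> (\<Sum>j<n. W s * norm (diffs b j * x ^ j))"
    proof (rule sum_mono)
      fix j
      have "(x * s powr \<alpha>) ^ j \<le> x ^ j" using s1 x by (intro power_mono) (auto intro: mult_left_le)
      then show "norm (q j s) \<le> W s * norm (diffs b j * x ^ j)"
        unfolding qW[OF that] using Wnn[of s] x s1 by (auto simp: abs_mult intro!: mult_left_mono)
    qed
    also have "\<dots> = W s * (\<Sum>j<n. norm (diffs b j * x ^ j))" by (simp add: sum_distrib_left)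
    also have "\<dots> \<le> W s * H" unfolding H_def
      using Wnn by (intro mult_left_mono sum_le_suminf sH) auto
    finally show ?thesis by (simp add: mult.commute)
  qed
  have lim: "(\<lambda>n. \<Sum>j<n. q j s) \<longlonglongrightarrow> W s * h (x * s powr \<alpha>)" if "s \<in> {0..1}" for s
  proof -
    have "(\<lambda>j. diffs b j * (x * s powr \<alpha>) ^ j) sums h (x * s powr \<alpha>)"
      unfolding h_def using convd summable_sums by blast
    then have "(\<lambda>j. W s * (diffs b j * (x * s powr \<alpha>) ^ j)) sums (W s * h (x * s powr \<alpha>))"
      by (rule sums_mult)
    then show ?thesis unfolding sums_def using qW[OF that] by simp
  qed
  note DC = dominated_convergence[OF Pint integrable_on_mult_right[OF Wint, of H], simplified, OF dom[simplified] lim[simplified]]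
  define I where "I = integral {0..1} (\<lambda>s. W s * h (x * s powr \<alpha>))"
  have Ihas: "((\<lambda>s. W s * h (x * s powr \<alpha>)) has_integral I) {0..1}"
    unfolding I_def using DC(1) by (auto intro: integrable_integral)
  have "integral {0..1} (\<lambda>s. \<Sum>j<n. q j s) = (\<Sum>j<n. diffs b j * x ^ j * Beta (real (Suc j) * \<alpha>) (1 - \<alpha>))" for n
    using has_integral_sum[of "{..<n}" q, OF _ qint] by (intro integral_unique) auto
  with DC(2) have sums: "(\<lambda>j. diffs b j * x ^ j * Beta (real (Suc j) * \<alpha>) (1 - \<alpha>)) sums I"
    unfolding sums_def I_def by simp
  \<comment> \<open>Integration by parts against the singular weight. As \<Phi> is nonpositive, so
    is the second term of \<open>\<psi>'\<close>, and the integral of \<open>\<psi>'\<close> is at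
    most \<alpha> x I. Its boundary values are \<open>\<psi> 1 = 0\<close> and
    \<open>\<psi> 0 = \<Phi> 0\<close>, the latter nonpositive.\<close>
  define \<Phi> where "\<Phi> s = g (x * s powr \<alpha>) - g x" for s
  define \<psi> where "\<psi> s = (1 - s) powr (- \<alpha>) * \<Phi> s" for s
  define \<psi>' where "\<psi>' s = \<alpha> * x * (W s * h (x * s powr \<alpha>)) + \<alpha> * (1 - s) powr (- \<alpha> - 1) * \<Phi> s" for s
  have \<Phi>le: "\<Phi> s \<le> 0" if "s \<in> {0..1}" for s
  proof -
    have "x * s powr \<alpha> \<in> {0..x}" using that \<alpha> x by (auto intro: mult_left_le powr_le1)
    then show ?thesis using max unfolding \<Phi>_def g_def by fastforce
  qed
  have \<Phi>': "(\<Phi> has_field_derivative h (x * s powr \<alpha>) * (x * (\<alpha> * s powr (\<alpha> - 1)))) (at s)" if "s > 0" for s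
    unfolding \<Phi>_def by (rule derivative_eq_intros DERIV_chain2[OF g'] refl that | simp)+
  have \<psi>'d: "(\<psi> has_field_derivative \<psi>' s) (at s)" if "s \<in> {0<..<1}" for s
    unfolding \<psi>_def \<psi>'_def W_def
    by (rule derivative_eq_intros \<Phi>' refl | use that in \<open>simp add: algebra_simps\<close>)+
  have gcont: "continuous_on A g" for A using g' by (meson DERIV_isCont continuous_at_imp_continuous_on)
  have \<Phi>cont: "continuous_on {0..1} \<Phi>"
    unfolding \<Phi>_def using \<alpha>
    by (intro continuous_intros continuous_on_compose2[OF gcont[of UNIV]] continuous_on_powr') auto
  have "continuous_on {0..1} \<psi>"
    unfolding continuous_on_eq_continuous_within
  proof
    fix s :: real assume s: "s \<in> {0..1}"
    show "continuous (at s within {0..1}) \<psi>"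
    proof (cases "s = 1")
      case False
      have "continuous (at s within {0..1}) \<Phi>" using \<Phi>cont s by (simp add: continuous_on_eq_continuous_within)
      then show ?thesis unfolding \<psi>_def using False s by (intro continuous_intros) auto
    next
      case True
      \<comment> \<open>\<Phi> vanishes to first order at 1, which beats a weight of order \<alpha>
        < 1.\<close>
      have "((\<lambda>s. (\<Phi> s - \<Phi> 1) / (s - 1)) \<longlongrightarrow> h (x * 1 powr \<alpha>) * (x * (\<alpha> * 1 powr (\<alpha> - 1)))) (at 1 within {0..1})"
        using \<Phi>'[of 1] unfolding has_field_derivative_iff by (auto intro: tendsto_within_subset)
      moreover have "((\<lambda>s::real. - ((1 - s) powr (1 - \<alpha>))) \<longlongrightarrow> - ((1 - 1) powr (1 - \<alpha>))) (at 1 within {0..1})"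
        using \<alpha> by (intro tendsto_intros tendsto_powr') (auto simp: eventually_at_filter)
      ultimately have "((\<lambda>s. - ((1 - s) powr (1 - \<alpha>)) * ((\<Phi> s - \<Phi> 1) / (s - 1))) \<longlongrightarrow> 
          - ((1 - 1) powr (1 - \<alpha>)) * (h (x * 1 powr \<alpha>) * (x * (\<alpha> * 1 powr (\<alpha> - 1))))) (at 1 within {0..1})"
        by (intro tendsto_mult)
      moreover have "\<psi> 1 = - ((1 - 1) powr (1 - \<alpha>)) * (h (x * 1 powr \<alpha>) * (x * (\<alpha> * 1 powr (\<alpha> - 1))))"
        by (simp add: \<psi>_def)
      moreover have "- ((1 - s) powr (1 - \<alpha>)) * ((\<Phi> s - \<Phi> 1) / (s - 1)) = \<psi> s" if "s \<in> {0..1}" "s \<noteq> 1" for s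
      proof -
        have "(1 - s) powr (1 - \<alpha>) = (1 - s) * (1 - s) powr (- \<alpha>)"
          using that by (simp add: powr_diff powr_minus_divide)
        moreover have "\<Phi> 1 = 0" by (simp add: \<Phi>_def)
        ultimately show ?thesis unfolding \<psi>_def using that by (simp add: divide_simps) (simp add: algebra_simps)
      qed
      ultimately have "(\<psi> \<longlongrightarrow> \<psi> 1) (at 1 within {0..1})"
        by (metis (no_types, lifting) Lim_cong_within)
      then show ?thesis using True by (simp add: continuous_within)
    qed
  qed
  then have "(\<psi>' has_integral (\<psi> 1 - \<psi> 0)) {0..1}"
    using \<psi>'d by (intro fundamental_theorem_of_calculus_interior)
      (auto simp: has_real_derivative_iff_has_vector_derivative)
  moreover have "((\<lambda>s. \<alpha> * x * (W s * h (x * s powr \<alpha>))) has_integral \<alpha> * x * I) {0..1}"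
    using Ihas by (rule has_integral_mult_right)
  moreover have "\<psi>' s \<le> \<alpha> * x * (W s * h (x * s powr \<alpha>))" if "s \<in> {0..1}" for s
    unfolding \<psi>'_def using \<Phi>le[OF that] \<alpha> by (simp add: mult_nonneg_nonpos)
  ultimately have "\<psi> 1 - \<psi> 0 \<le> \<alpha> * x * I" by (rule has_integral_le)
  moreover have "\<psi> 1 - \<psi> 0 \<ge> 0" using \<Phi>le[of 0] by (simp add: \<psi>_def)
  ultimately have "I \<ge> 0" using x \<alpha> by (smt (verit) mult_pos_neg mult_pos_pos)
  then show ?thesis using sums by blast
qed

section \<open>Series coefficients and Euler derivatives of E_\<alpha>(-y)\<close>

definition mlc :: "real \<Rightarrow> nat \<Rightarrow> real" where
  "mlc \<alpha> j = 1 / Gamma (real j * \<alpha> + 1)"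

lemma mlc_pos: "0 < \<alpha> \<Longrightarrow> mlc \<alpha> j > 0"
  unfolding mlc_def by (intro divide_pos_pos Gamma_real_pos) (auto simp: add_nonneg_pos)

text \<open>A Gautschi-type inequality: log-convexity of Gamma at x = \<alpha> z + (1 - \<alpha>)(z
  + 1) with z = x + \<alpha> - 1. It controls the ratio of consecutive coefficients in
  \<open>summable_mlc\<close>.\<close>

lemma Gamma_le_shift:
  fixes x \<alpha> :: real
  assumes "0 < \<alpha>" "\<alpha> < 1" "x + \<alpha> > 1"
  shows "Gamma x \<le> Gamma (x + \<alpha>) / (x + \<alpha> - 1) powr \<alpha>"
proof -
  define z where "z = x + \<alpha> - 1"
  have z: "z > 0" using assms by (simp add: z_def)
  have xp: "x > 0" using assms by simp
  have "convex_on {0<..} (ln \<circ> Gamma :: real \<Rightarrow> real)" by (rule log_convex_Gamma_real)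
  from convex_onD[OF this, of "1 - \<alpha>" z "z + 1"] assms z
  have "ln (Gamma (\<alpha> * z + (1 - \<alpha>) * (z + 1))) \<le> \<alpha> * ln (Gamma z) + (1 - \<alpha>) * ln (Gamma (z + 1))"
    by simp
  also have "\<alpha> * z + (1 - \<alpha>) * (z + 1) = x" by (simp add: z_def algebra_simps)
  also have "Gamma (z + 1) = z * Gamma z" using z by (intro Gamma_plus1) (auto elim: nonpos_Ints_cases)
  also have "\<alpha> * ln (Gamma z) + (1 - \<alpha>) * ln (z * Gamma z) = ln (z * Gamma z) - \<alpha> * ln z"
    using z less_imp_neq[OF Gamma_real_pos[OF z], symmetric] by (simp add: ln_mult algebra_simps)
  also have "z * Gamma z = Gamma (z + 1)"
    using z by (intro Gamma_plus1[symmetric]) (auto elim: nonpos_Ints_cases)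
  also have "ln (Gamma (z + 1)) - \<alpha> * ln z = ln (Gamma (z + 1) / z powr \<alpha>)"
    using z less_imp_neq[OF Gamma_real_pos[of "z + 1"], symmetric] by (simp add: ln_div ln_powr)
  finally have "Gamma x \<le> Gamma (z + 1) / z powr \<alpha>"
    using Gamma_real_pos[OF xp] Gamma_real_pos[of "z + 1"] z by (subst (asm) ln_le_cancel_iff) auto
  then show ?thesis by (simp add: z_def)
qed

lemma summable_mlc:
  fixes \<alpha> y :: real
  assumes "0 < \<alpha>" "\<alpha> < 1"
  shows "summable (\<lambda>j. mlc \<alpha> j * y ^ j)"
proof -
  have "filterlim (\<lambda>j. (real (Suc j) * \<alpha>) powr \<alpha>) at_top sequentially"
    using assms by real_asymp
  then have "eventually (\<lambda>j. (real (Suc j) * \<alpha>) powr \<alpha> \<ge> 2 * \<bar>y\<bar>) sequentially"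
    by (simp add: filterlim_at_top)
  then obtain N where N: "\<And>j. j \<ge> N \<Longrightarrow> (real (Suc j) * \<alpha>) powr \<alpha> \<ge> 2 * \<bar>y\<bar>"
    by (auto simp: eventually_sequentially)
  show ?thesis
  proof (rule summable_ratio_test[of "1/2" N])
    fix j assume j: "N \<le> j"
    have g: "Gamma (real j * \<alpha> + 1) > 0" "Gamma (real (Suc j) * \<alpha> + 1) > 0"
      using assms by (auto intro!: Gamma_real_pos simp: add_nonneg_pos)
    have p: "(real (Suc j) * \<alpha>) powr \<alpha> > 0" using assms by simp
    have "Gamma (real j * \<alpha> + 1) \<le> Gamma (real (Suc j) * \<alpha> + 1) / (real (Suc j) * \<alpha>) powr \<alpha>"
      using Gamma_le_shift[of \<alpha> "real j * \<alpha> + 1"] assms by (simp add: algebra_simps add_pos_nonneg)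
    then have "(real (Suc j) * \<alpha>) powr \<alpha> * Gamma (real j * \<alpha> + 1) \<le> Gamma (real (Suc j) * \<alpha> + 1)"
      using p by (simp add: pos_le_divide_eq mult.commute)
    moreover have "2 * \<bar>y\<bar> * Gamma (real j * \<alpha> + 1) \<le> (real (Suc j) * \<alpha>) powr \<alpha> * Gamma (real j * \<alpha> + 1)"
      using N[OF j] g by (intro mult_right_mono) auto
    ultimately have "2 * \<bar>y\<bar> * Gamma (real j * \<alpha> + 1) \<le> Gamma (real (Suc j) * \<alpha> + 1)" by linarith
    then have "\<bar>y\<bar> * mlc \<alpha> (Suc j) \<le> 1 / 2 * mlc \<alpha> j"
      using g unfolding mlc_def by (simp add: field_simps)
    then have "\<bar>y\<bar> ^ j * (\<bar>y\<bar> * mlc \<alpha> (Suc j)) \<le> \<bar>y\<bar> ^ j * (1 / 2 * mlc \<alpha> j)"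
      by (intro mult_left_mono) auto
    then show "norm (mlc \<alpha> (Suc j) * y ^ Suc j) \<le> 1 / 2 * norm (mlc \<alpha> j * y ^ j)"
      using mlc_pos[of \<alpha>] assms by (simp add: abs_mult power_abs mult_ac abs_of_pos)
  qed simp
qed

lemma summable_power_mlc:
  fixes \<alpha> y :: real
  assumes "0 < \<alpha>" "\<alpha> < 1"
  shows "summable (\<lambda>j. real j ^ k * mlc \<alpha> j * y ^ j)"
proof (induction k arbitrary: y)
  case (Suc k)
  have "summable (\<lambda>j. diffs (\<lambda>j. real j ^ k * mlc \<alpha> j) j * y ^ j)"
    by (rule termdiff_converges_all[OF Suc])
  then have "summable (\<lambda>j. y * (diffs (\<lambda>j. real j ^ k * mlc \<alpha> j) j * y ^ j))" by (rule summable_mult)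
  then have "summable (\<lambda>j. real (Suc j) ^ Suc k * mlc \<alpha> (Suc j) * y ^ Suc j)"
    by (simp add: diffs_def mult_ac)
  then show ?case by (subst (asm) summable_Suc_iff)
qed (use summable_mlc[OF assms] in simp)

text \<open>\<open>mlt \<alpha> k\<close> is $(y\,d/dy)^k$ applied to $y \mapsto E_\alpha(-y)$.\<close>

definition mlt :: "real \<Rightarrow> nat \<Rightarrow> real \<Rightarrow> real" where
  "mlt \<alpha> k y = (\<Sum>j. real j ^ k * mlc \<alpha> j * (- 1) ^ j * y ^ j)"

lemma mittag_leffler_mlt: "mittag_leffler \<alpha> 1 (- y) = mlt \<alpha> 0 y"
proof -
  have "(- y) ^ j = (- 1) ^ j * y ^ j" for j by (rule power_minus)
  then show ?thesis unfolding mittag_leffler_def mlt_def mlc_def by (simp add: mult.commute)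
qed

lemma summable_mlt:
  assumes "0 < \<alpha>" "\<alpha> < 1"
  shows "summable (\<lambda>j. real j ^ k * mlc \<alpha> j * (- 1) ^ j * y ^ j)"
  using summable_power_mlc[OF assms, of k "- y"] by (simp add: power_minus[of y] mult.assoc)

lemma mlt_sums:
  assumes "0 < \<alpha>" "\<alpha> < 1"
  shows "(\<lambda>j. real j ^ k * mlc \<alpha> j * (- 1) ^ j * y ^ j) sums mlt \<alpha> k y"
  unfolding mlt_def using summable_mlt[OF assms] by (rule summable_sums)

lemma mlt_0: "mlt \<alpha> 0 0 = 1" "k > 0 \<Longrightarrow> mlt \<alpha> k 0 = 0"
  unfolding mlt_def powser_zero by (simp_all add: mlc_def)

text \<open>The product form \<open>y * D y\<close> avoids a quotient that says nothing at 0;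
  continuity of \<open>D\<close> there gives first-order vanishing of the next Euler derivative in
  \<open>mlt_bound_powr\<close>.\<close>

lemma mlt_deriv_ex:
  assumes "0 < \<alpha>" "\<alpha> < 1"
  shows "\<exists>D. continuous_on UNIV D \<and> (\<forall>y. (mlt \<alpha> k has_real_derivative D y) (at y)) \<and> (\<forall>y. y * D y = mlt \<alpha> (Suc k) y)"
proof -
  let ?b = "\<lambda>j. real j ^ k * mlc \<alpha> j * (- 1) ^ j"
  define D where "D y = (\<Sum>j. diffs ?b j * y ^ j)" for y
  have s: "summable (\<lambda>j. diffs ?b j * y ^ j)" for y
    by (rule termdiff_converges_all) (rule summable_mlt[OF assms])
  have "(mlt \<alpha> k has_real_derivative D y) (at y)" for y
    using termdiffs_strong_converges_everywhere[OF summable_mlt[OF assms, of k]]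
    unfolding D_def mlt_def[abs_def] .
  moreover have "continuous_on UNIV D"
    unfolding D_def by (intro continuous_at_imp_continuous_on ballI isCont_powser_converges_everywhere s)
  moreover have "y * D y = mlt \<alpha> (Suc k) y" for y
  proof -
    have "(\<lambda>j. y * (diffs ?b j * y ^ j)) sums (y * D y)"
      unfolding D_def by (intro sums_mult summable_sums s)
    then have "(\<lambda>j. real (Suc j) ^ Suc k * mlc \<alpha> (Suc j) * (- 1) ^ (Suc j) * y ^ (Suc j)) sums (y * D y)"
      by (simp add: diffs_def mult_ac)
    from sums_unique[OF this] show ?thesis
      unfolding mlt_def using suminf_split_head[OF summable_mlt[OF assms, of "Suc k" y]] by simp
  qed
  ultimately show ?thesis by blast
qed

lemma continuous_on_mlt:
  assumes "0 < \<alpha>" "\<alpha> < 1"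
  shows "continuous_on A (mlt \<alpha> k)"
  using mlt_deriv_ex[OF assms, of k] by (meson DERIV_isCont continuous_at_imp_continuous_on)

lemma mlt_deriv:
  assumes "0 < \<alpha>" "\<alpha> < 1" "y \<noteq> 0"
  shows "(mlt \<alpha> k has_real_derivative mlt \<alpha> (Suc k) y / y) (at y)"
  using mlt_deriv_ex[OF assms(1,2), of k] assms(3) by (metis nonzero_mult_div_cancel_left)

text \<open>The relaxation equation at a maximum. The Caputo derivative shifts the coefficient index
  by one, which turns j^k into (j + 1)^k; the binomial theorem expresses the result by the functions
  of order at most k. The sign \<sigma> treats maxima and minima together.\<close>

lemma mlt_at_max:
  fixes \<sigma> :: real
  assumes \<alpha>: "0 < \<alpha>" "\<alpha> < 1" and x: "x > 0" and \<sigma>: "\<sigma> = 1 \<or> \<sigma> = - 1"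
    and max: "\<And>y. y \<in> {0..x} \<Longrightarrow> \<sigma> * mlt \<alpha> k y \<le> \<sigma> * mlt \<alpha> k x"
  shows "\<sigma> * (\<Sum>l\<le>k. real (k choose l) * mlt \<alpha> l x) \<le> 0"
proof -
  let ?b = "\<lambda>j. \<sigma> * (real j ^ k * mlc \<alpha> j * (- 1) ^ j)"
  have sb: "(\<lambda>j. ?b j * y ^ j) sums (\<sigma> * mlt \<alpha> k y)" for y
    using sums_mult[OF mlt_sums[OF \<alpha>, of k y], of \<sigma>] by (simp add: mult.assoc)
  then have eq: "(\<Sum>j. ?b j * y ^ j) = \<sigma> * mlt \<alpha> k y" for y by (rule sums_unique[symmetric])
  have "summable (\<lambda>j. ?b j * y ^ j)" for y using sb by (rule sums_summable)
  then obtain I where I: "I \<ge> 0" "(\<lambda>j. diffs ?b j * x ^ j * Beta (real (Suc j) * \<alpha>) (1 - \<alpha>)) sums I"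
    using power_series_max_principle[OF \<alpha> x, of ?b] max eq by auto
  define c where "c = Gamma (1 - \<alpha>) / \<alpha>"
  have c: "c > 0" using \<alpha> by (simp add: c_def Gamma_real_pos)
  have "diffs ?b j * x ^ j * Beta (real (Suc j) * \<alpha>) (1 - \<alpha>) =
     - \<sigma> * c * (\<Sum>l\<le>k. real (k choose l) * (real j ^ l * mlc \<alpha> j * (- 1) ^ j * x ^ j))" for j
  proof -
    have pos: "real (Suc j) * \<alpha> > 0" using \<alpha> by simp
    then have G: "Gamma (real (Suc j) * \<alpha> + 1) = real (Suc j) * \<alpha> * Gamma (real (Suc j) * \<alpha>)"
      by (intro Gamma_plus1) (auto elim: nonpos_Ints_cases)
    have gp: "Gamma (real (Suc j) * \<alpha>) > 0" using pos by (rule Gamma_real_pos)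
    have eqB: "Beta (real (Suc j) * \<alpha>) (1 - \<alpha>) = Gamma (real (Suc j) * \<alpha>) * Gamma (1 - \<alpha>) / Gamma (real j * \<alpha> + 1)"
      unfolding Beta_def by (simp add: algebra_simps)
    have "mlc \<alpha> (Suc j) * Beta (real (Suc j) * \<alpha>) (1 - \<alpha>) * real (Suc j) = c * mlc \<alpha> j"
      unfolding eqB mlc_def G c_def using less_imp_neq[OF gp, symmetric] \<alpha>
      by (simp add: divide_simps del: of_nat_Suc)
    then have "diffs ?b j * x ^ j * Beta (real (Suc j) * \<alpha>) (1 - \<alpha>) =
        - \<sigma> * c * (real (Suc j) ^ k * (mlc \<alpha> j * (- 1) ^ j * x ^ j))"
      unfolding diffs_def by (simp del: of_nat_Suc add: mult_ac)
    also have "real (Suc j) ^ k = (\<Sum>l\<le>k. real (k choose l) * real j ^ l)"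
      using binomial_ring[of "real j" 1 k] by (simp add: add.commute)
    finally show ?thesis by (simp only: sum_distrib_right mult.assoc)
  qed
  moreover have "(\<lambda>j. - \<sigma> * c * (\<Sum>l\<le>k. real (k choose l) * (real j ^ l * mlc \<alpha> j * (- 1) ^ j * x ^ j)))
      sums (- \<sigma> * c * (\<Sum>l\<le>k. real (k choose l) * mlt \<alpha> l x))"
    by (intro sums_mult sums_sum mlt_sums \<alpha>)
  ultimately have "I = - \<sigma> * c * (\<Sum>l\<le>k. real (k choose l) * mlt \<alpha> l x)"
    using I(2) sums_unique2 by auto
  then show ?thesis using I(1) c by (smt (verit) mult_minus_left mult_pos_pos mult.assoc mult.commute)
qed

text \<open>At a maximum point x > 0 over [0, y], \<open>mlt_at_max\<close> bounds the function of
  order k by those of lower order. At x = 0 the value is 1 or 0, which explains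
  \<open>max 1 S\<close>.\<close>

lemma mlt_bounded:
  assumes \<alpha>: "0 < \<alpha>" "\<alpha> < 1"
  shows "\<exists>B. \<forall>y\<ge>0. \<bar>mlt \<alpha> k y\<bar> \<le> B"
proof (induction k rule: less_induct)
  case (less k)
  then have "\<forall>l\<in>{..<k}. \<exists>B. \<forall>y\<ge>0. \<bar>mlt \<alpha> l y\<bar> \<le> B" by simp
  then obtain B where B: "\<And>l y. l < k \<Longrightarrow> y \<ge> 0 \<Longrightarrow> \<bar>mlt \<alpha> l y\<bar> \<le> B l"
    unfolding bchoice_iff by auto
  define S where "S = (\<Sum>l<k. real (k choose l) * B l)"
  have one: "\<sigma> * mlt \<alpha> k y \<le> max 1 S" if \<sigma>: "\<sigma> = 1 \<or> \<sigma> = - 1" and y: "y \<ge> 0" for \<sigma> y :: real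
  proof -
    have "continuous_on {0..y} (\<lambda>y. \<sigma> * mlt \<alpha> k y)"
      by (intro continuous_intros continuous_on_mlt \<alpha>)
    then obtain x where x: "x \<in> {0..y}" "\<And>z. z \<in> {0..y} \<Longrightarrow> \<sigma> * mlt \<alpha> k z \<le> \<sigma> * mlt \<alpha> k x"
      using continuous_attains_sup[of "{0..y}" "\<lambda>y. \<sigma> * mlt \<alpha> k y"] y by auto
    have "\<sigma> * mlt \<alpha> k x \<le> max 1 S"
    proof (cases "x = 0")
      case True
      then show ?thesis using \<sigma> by (cases "k = 0") (auto simp: mlt_0)
    next
      case False
      then have "x > 0" using x by simp
      then have "\<sigma> * (\<Sum>l\<le>k. real (k choose l) * mlt \<alpha> l x) \<le> 0"
        using x by (intro mlt_at_max[OF \<alpha> _ \<sigma>]) auto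
      also have "(\<Sum>l\<le>k. real (k choose l) * mlt \<alpha> l x) = mlt \<alpha> k x + (\<Sum>l<k. real (k choose l) * mlt \<alpha> l x)"
        by (simp add: lessThan_Suc_atMost[symmetric])
      finally have "\<sigma> * mlt \<alpha> k x \<le> (\<Sum>l<k. real (k choose l) * (- \<sigma> * mlt \<alpha> l x))"
        by (simp add: algebra_simps sum_distrib_left sum_negf)
      also have "\<dots> \<le> S" unfolding S_def
      proof (intro sum_mono mult_left_mono)
        fix l assume "l \<in> {..<k}"
        then have "\<bar>mlt \<alpha> l x\<bar> \<le> B l" using B x by auto
        then show "- \<sigma> * mlt \<alpha> l x \<le> B l" using \<sigma> by auto
      qed auto
      finally show ?thesis by simp
    qed
    then show ?thesis using x(2)[of y] y by fastforce
  qed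
  have "\<bar>mlt \<alpha> k y\<bar> \<le> max 1 S" if "y \<ge> 0" for y
    using one[of 1 y] one[of "-1" y] that by auto
  then show ?case by blast
qed

text \<open>Linear vanishing at 0 and boundedness at infinity give every power in between, with one
  constant for all \<theta>.\<close>

lemma mlt_bound_powr:
  assumes \<alpha>: "0 < \<alpha>" "\<alpha> < 1" and k: "k > 0"
  shows "\<exists>B>0. \<forall>\<theta>\<in>{0..1}. \<forall>y>0. \<bar>mlt \<alpha> k y\<bar> \<le> B * y powr \<theta>"
proof -
  obtain B where B: "\<And>y. y \<ge> 0 \<Longrightarrow> \<bar>mlt \<alpha> k y\<bar> \<le> B" using mlt_bounded[OF \<alpha>] by blast
  obtain k' where k': "k = Suc k'" using k by (cases k) auto
  obtain D where D: "continuous_on UNIV D" "\<And>y. y * D y = mlt \<alpha> k y"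
    using mlt_deriv_ex[OF \<alpha>, of k'] k' by auto
  have "compact (D ` {0..1})"
    using D(1) by (intro compact_continuous_image) (auto intro: continuous_on_subset)
  then obtain M where M: "\<forall>y\<in>{0..1}. \<bar>D y\<bar> \<le> M"
    by (auto dest!: compact_imp_bounded simp: bounded_iff)
  define C where "C = max 1 (max B M)"
  have C: "C > 0" "B \<le> C" "M \<le> C" unfolding C_def by auto
  have "\<bar>mlt \<alpha> k y\<bar> \<le> C * y powr \<theta>" if \<theta>: "\<theta> \<in> {0..1}" and y: "y > 0" for \<theta> y
  proof (cases "y \<le> 1")
    case True
    then have "\<bar>mlt \<alpha> k y\<bar> = y * \<bar>D y\<bar>" using D(2)[of y] y by (metis abs_mult abs_of_pos)
    also have "\<dots> \<le> y * C" using bspec[OF M, of y] True y C by (intro mult_left_mono) auto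
    also have "y \<le> y powr \<theta>" using powr_mono'[of \<theta> 1 y] True y \<theta> by simp
    then have "y * C \<le> y powr \<theta> * C" using C by (intro mult_right_mono) auto
    finally show ?thesis by (simp add: mult.commute)
  next
    case False
    then have "1 \<le> y powr \<theta>" using \<theta> by (simp add: ge_one_powr_ge_zero)
    then have "C * 1 \<le> C * y powr \<theta>" using C by (intro mult_left_mono) auto
    then show ?thesis using B[of y] y C by linarith
  qed
  then show ?thesis using C by blast
qed

section \<open>The relaxation function and its time derivatives\<close>

definition relax :: "real \<Rightarrow> real \<Rightarrow> real \<Rightarrow> real" where
  "relax \<alpha> l t = mlt \<alpha> 0 (l * t powr \<alpha>)"

text \<open>By the chain rule t d/dt acts on \<open>mlt \<alpha> k (l * t powr \<alpha>)\<close> as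
  \<alpha> times the step from k to k + 1. This yields closed forms for the first two time
  derivatives of \<open>relax\<close>.\<close>

definition relax1 :: "real \<Rightarrow> real \<Rightarrow> real \<Rightarrow> real" where
  "relax1 \<alpha> l t = \<alpha> * mlt \<alpha> 1 (l * t powr \<alpha>) / t"

definition relax2 :: "real \<Rightarrow> real \<Rightarrow> real \<Rightarrow> real" where
  "relax2 \<alpha> l t = (\<alpha>\<^sup>2 * mlt \<alpha> 2 (l * t powr \<alpha>) - \<alpha> * mlt \<alpha> 1 (l * t powr \<alpha>)) / t\<^sup>2"

lemma relax_0: "relax \<alpha> l 0 = 1"
  by (simp add: relax_def mlt_0)

lemma continuous_on_relax:
  assumes "0 < \<alpha>" "\<alpha> < 1"
  shows "continuous_on {0..} (relax \<alpha> l)"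
  unfolding relax_def using assms
  by (intro continuous_on_compose2[OF continuous_on_mlt[of \<alpha> UNIV]] continuous_intros continuous_on_powr') auto

lemma mlt_powr_deriv:
  assumes "0 < \<alpha>" "\<alpha> < 1" "l > 0" "t > 0"
  shows "((\<lambda>t. mlt \<alpha> k (l * t powr \<alpha>)) has_real_derivative \<alpha> * mlt \<alpha> (Suc k) (l * t powr \<alpha>) / t) (at t)"
proof -
  have "l * t powr \<alpha> \<noteq> 0" using assms by simp
  note d = DERIV_chain2[where f = "mlt \<alpha> k" and g = "\<lambda>t. l * t powr \<alpha>", OF mlt_deriv[OF assms(1,2) this, of k]]
  have "((\<lambda>t. l * t powr \<alpha>) has_real_derivative l * (\<alpha> * t powr (\<alpha> - 1))) (at t)"
    using assms by (auto intro!: derivative_eq_intros)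
  from d[OF this] show ?thesis
    using assms by (simp add: powr_diff field_simps)
qed

lemma relax_deriv:
  assumes "0 < \<alpha>" "\<alpha> < 1" "l > 0" "t > 0"
  shows "(relax \<alpha> l has_real_derivative relax1 \<alpha> l t) (at t)"
  using mlt_powr_deriv[OF assms, of 0] unfolding relax_def[abs_def] relax1_def by simp

lemma relax1_deriv:
  assumes "0 < \<alpha>" "\<alpha> < 1" "l > 0" "t > 0"
  shows "(relax1 \<alpha> l has_real_derivative relax2 \<alpha> l t) (at t)"
  unfolding relax1_def[abs_def] relax2_def
  apply (rule derivative_eq_intros mlt_powr_deriv[OF assms, of 1] refl)+
  using assms by (simp_all add: field_simps power2_eq_square numeral_2_eq_2)

lemma borel_measurable_mlt [measurable]:
  assumes "0 < \<alpha>" "\<alpha> < 1"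
  shows "mlt \<alpha> k \<in> borel_measurable borel"
  using continuous_on_mlt[OF assms] by (rule borel_measurable_continuous_onI)

lemma borel_measurable_relax1:
  assumes "0 < \<alpha>" "\<alpha> < 1"
  shows "relax1 \<alpha> l \<in> borel_measurable borel"
  unfolding relax1_def using borel_measurable_mlt[OF assms, of 1] by measurable

text \<open>The parameter l enters only through y = l t^\<alpha>, so powers of l are traded for
  powers of t. The choices made later are \<theta> = 1, which gives the true singularity at 0, and
  \<theta> = 1/8, which is cheap in l.\<close>

lemma relax_bounds:
  assumes \<alpha>: "0 < \<alpha>" "\<alpha> < 1"
  shows "\<exists>B>0. (\<forall>l>0. \<forall>t\<ge>0. \<bar>relax \<alpha> l t\<bar> \<le> B) \<and>
     (\<forall>\<theta>\<in>{0..1}. \<forall>l>0. \<forall>t>0. \<bar>relax1 \<alpha> l t\<bar> \<le> B * (l powr \<theta> * t powr (\<theta> * \<alpha> - 1))) \<and>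
     (\<forall>\<theta>\<in>{0..1}. \<forall>l>0. \<forall>t>0. \<bar>relax2 \<alpha> l t\<bar> \<le> B * (l powr \<theta> * t powr (\<theta> * \<alpha> - 2)))"
proof -
  obtain B0 where B0: "\<And>y. y \<ge> 0 \<Longrightarrow> \<bar>mlt \<alpha> 0 y\<bar> \<le> B0" using mlt_bounded[OF \<alpha>] by blast
  obtain B1 where B1: "B1 > 0" "\<And>\<theta> y. \<theta> \<in> {0..1} \<Longrightarrow> y > 0 \<Longrightarrow> \<bar>mlt \<alpha> 1 y\<bar> \<le> B1 * y powr \<theta>"
    using mlt_bound_powr[OF \<alpha>, of 1] by auto
  obtain B2 where B2: "B2 > 0" "\<And>\<theta> y. \<theta> \<in> {0..1} \<Longrightarrow> y > 0 \<Longrightarrow> \<bar>mlt \<alpha> 2 y\<bar> \<le> B2 * y powr \<theta>"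
    using mlt_bound_powr[OF \<alpha>, of 2] by auto
  define B where "B = \<bar>B0\<bar> + B1 + B2"
  have B: "B > 0" using B1 B2 by (simp add: B_def)
  have y: "(l * t powr \<alpha>) powr \<theta> = l powr \<theta> * t powr (\<theta> * \<alpha>)" if "l > 0" "t > 0" for l t \<theta>
    using that by (simp add: powr_mult powr_powr mult.commute)
  have "\<bar>relax \<alpha> l t\<bar> \<le> B" if "l > 0" "t \<ge> 0" for l t
    using B0[of "l * t powr \<alpha>"] that B1 B2 unfolding relax_def B_def by simp
  moreover have "\<bar>relax1 \<alpha> l t\<bar> \<le> B * (l powr \<theta> * t powr (\<theta> * \<alpha> - 1))"
    if "\<theta> \<in> {0..1}" "l > 0" "t > 0" for \<theta> l t
  proof -
    have "\<bar>relax1 \<alpha> l t\<bar> = \<alpha> * \<bar>mlt \<alpha> 1 (l * t powr \<alpha>)\<bar> / t"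
      using \<alpha> that by (simp add: relax1_def abs_mult)
    also have "\<dots> \<le> 1 * (B1 * (l * t powr \<alpha>) powr \<theta>) / t"
      using B1(2)[of \<theta> "l * t powr \<alpha>"] that \<alpha> B1(1) by (intro divide_right_mono mult_mono) auto
    also have "\<dots> = B1 * (l powr \<theta> * t powr (\<theta> * \<alpha> - 1))"
      using that y by (simp add: powr_diff)
    also have "\<dots> \<le> B * (l powr \<theta> * t powr (\<theta> * \<alpha> - 1))"
      using B2 by (intro mult_right_mono) (auto simp: B_def)
    finally show ?thesis .
  qed
  moreover have "\<bar>relax2 \<alpha> l t\<bar> \<le> B * (l powr \<theta> * t powr (\<theta> * \<alpha> - 2))"
    if "\<theta> \<in> {0..1}" "l > 0" "t > 0" for \<theta> l t
  proof -
    have a2: "\<alpha>\<^sup>2 \<le> 1" using \<alpha> by (simp add: power_le_one)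
    have "\<bar>relax2 \<alpha> l t\<bar> \<le> (\<alpha>\<^sup>2 * \<bar>mlt \<alpha> 2 (l * t powr \<alpha>)\<bar> + \<alpha> * \<bar>mlt \<alpha> 1 (l * t powr \<alpha>)\<bar>) / t\<^sup>2"
      unfolding relax2_def abs_divide using \<alpha> that
      by (simp add: divide_right_mono abs_mult order.trans[OF abs_triangle_ineq4])
    also have "\<dots> \<le> (1 * (B2 * (l * t powr \<alpha>) powr \<theta>) + 1 * (B1 * (l * t powr \<alpha>) powr \<theta>)) / t\<^sup>2"
      using B1(2)[of \<theta> "l * t powr \<alpha>"] B2(2)[of \<theta> "l * t powr \<alpha>"] that \<alpha> B1(1) B2(1) a2
      by (intro divide_right_mono add_mono mult_mono) auto
    also have "\<dots> = (B1 + B2) * (l powr \<theta> * t powr (\<theta> * \<alpha> - 2))"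
      using that y by (simp add: powr_diff field_simps)
    also have "\<dots> \<le> B * (l powr \<theta> * t powr (\<theta> * \<alpha> - 2))"
      by (intro mult_right_mono) (auto simp: B_def)
    finally show ?thesis .
  qed
  ultimately show ?thesis using B by blast
qed

section \<open>Taylor remainders of E_\<alpha>(-y) and their decay\<close>

text \<open>For $k = 0$ this is the Taylor remainder of $E_\alpha(-y)$ after \<open>y ^ m\<close>, divided by
  \<open>y ^ (m + 1)\<close>; the index \<open>k\<close> counts applications of $y\,d/dy$ to the remainder.\<close>

definition mlr :: "real \<Rightarrow> nat \<Rightarrow> nat \<Rightarrow> real \<Rightarrow> real" where
  "mlr \<alpha> m k y = (\<Sum>j. real (j + Suc m) ^ k * mlc \<alpha> (j + Suc m) * (- 1) ^ (j + Suc m) * y ^ j)"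

lemma mlr_eq:
  assumes \<alpha>: "0 < \<alpha>" "\<alpha> < 1"
  shows "y ^ Suc m * mlr \<alpha> m k y = mlt \<alpha> k y - (\<Sum>j\<le>m. real j ^ k * mlc \<alpha> j * (- 1) ^ j * y ^ j)"
proof -
  let ?f = "\<lambda>j. real j ^ k * mlc \<alpha> j * (- 1) ^ j * y ^ j"
  have "(\<lambda>j. ?f (j + Suc m)) sums (mlt \<alpha> k y - (\<Sum>j<Suc m. ?f j))"
    using mlt_sums[OF \<alpha>, of k y] by (rule sums_split_initial_segment)
  then have s: "(\<lambda>j. y ^ Suc m * (real (j + Suc m) ^ k * mlc \<alpha> (j + Suc m) * (- 1) ^ (j + Suc m) * y ^ j)) sums
      (mlt \<alpha> k y - (\<Sum>j\<le>m. ?f j))"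
    by (simp only: power_add mult_ac lessThan_Suc_atMost)
  show ?thesis
  proof (cases "y = 0")
    case True
    have "(\<Sum>j\<le>m. ?f j) = (\<Sum>j\<in>{0}. ?f j)"
      using True by (intro sum.mono_neutral_right) auto
    then show ?thesis using True mlt_0(1)[of \<alpha>] mlt_0(2)[of k \<alpha>] by (cases k) (auto simp: mlc_def)
  next
    case False
    then have "y ^ Suc m \<noteq> 0" by simp
    then have "mlr \<alpha> m k y = (mlt \<alpha> k y - (\<Sum>j\<le>m. ?f j)) / y ^ Suc m"
      unfolding mlr_def by (rule sums_unique[OF sums_mult_D[OF s], symmetric])
    then show ?thesis using \<open>y ^ Suc m \<noteq> 0\<close> by (simp del: power_Suc)
  qed
qed

text \<open>Applied to y^(m+1) r(y), the operator y d/dy gives y^(m+1) ((m + 1) r + y r'); this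
  accounts for the term with \<open>Suc m\<close>.\<close>

lemma mlr_deriv_ex:
  assumes \<alpha>: "0 < \<alpha>" "\<alpha> < 1"
  shows "\<exists>D D2. continuous_on UNIV D \<and> continuous_on UNIV D2 \<and>
     (\<forall>y. (mlr \<alpha> m k has_real_derivative D y) (at y)) \<and> (\<forall>y. (D has_real_derivative D2 y) (at y)) \<and>
     (\<forall>y. y * D y = mlr \<alpha> m (Suc k) y - real (Suc m) * mlr \<alpha> m k y)"
proof -
  let ?b = "\<lambda>k j. real (j + Suc m) ^ k * mlc \<alpha> (j + Suc m) * (- 1) ^ (j + Suc m)"
  have s0: "summable (\<lambda>j. ?b k j * y ^ j)" for k y
  proof (cases "y = 0")
    case False
    have "summable (\<lambda>j. real (j + Suc m) ^ k * mlc \<alpha> (j + Suc m) * (- 1) ^ (j + Suc m) * y ^ (j + Suc m))"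
      using summable_mlt[OF \<alpha>, of k y] by (rule summable_ignore_initial_segment)
    then have "summable (\<lambda>j. y ^ Suc m * (?b k j * y ^ j))" by (simp only: power_add mult_ac)
    then show ?thesis using False by (subst (asm) summable_cmult_iff) auto
  qed (use powser_zero[of "?b k"] summable_finite[of "{0::nat}" "\<lambda>j. ?b k j * y ^ j"] in auto)
  define D where "D y = (\<Sum>j. diffs (?b k) j * y ^ j)" for y
  define D2 where "D2 y = (\<Sum>j. diffs (diffs (?b k)) j * y ^ j)" for y
  have s1: "summable (\<lambda>j. diffs (?b k) j * y ^ j)" for y by (rule termdiff_converges_all[OF s0])
  have s2: "summable (\<lambda>j. diffs (diffs (?b k)) j * y ^ j)" for y by (rule termdiff_converges_all[OF s1])
  have "(mlr \<alpha> m k has_real_derivative D y) (at y)" for y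
    using termdiffs_strong_converges_everywhere[OF s0[of k]] unfolding D_def mlr_def[abs_def] .
  moreover have "(D has_real_derivative D2 y) (at y)" for y
    using termdiffs_strong_converges_everywhere[OF s1] unfolding D_def[abs_def] D2_def .
  moreover have "continuous_on UNIV D" "continuous_on UNIV D2"
    unfolding D_def D2_def by (intro continuous_at_imp_continuous_on ballI isCont_powser_converges_everywhere s1 s2)+
  moreover have "y * D y = mlr \<alpha> m (Suc k) y - real (Suc m) * mlr \<alpha> m k y" for y
  proof -
    have "(\<lambda>j. y * (diffs (?b k) j * y ^ j)) sums (y * D y)"
      unfolding D_def by (intro sums_mult summable_sums s1)
    then have "(\<lambda>j. real (Suc j) * ?b k (Suc j) * y ^ (Suc j)) sums (y * D y)"
      unfolding diffs_def by (simp only: power_Suc mult_ac)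
    then have 1: "(\<lambda>j. real j * ?b k j * y ^ j) sums (y * D y)"
      by (subst (asm) sums_Suc_iff) simp
    have "(\<lambda>j. ?b (Suc k) j * y ^ j - real (Suc m) * (?b k j * y ^ j)) sums (mlr \<alpha> m (Suc k) y - real (Suc m) * mlr \<alpha> m k y)"
      unfolding mlr_def by (intro sums_diff sums_mult summable_sums s0)
    also have "(\<lambda>j. ?b (Suc k) j * y ^ j - real (Suc m) * (?b k j * y ^ j)) = (\<lambda>j. real j * ?b k j * y ^ j)"
      by (rule ext) (simp add: algebra_simps)
    finally have "(\<lambda>j. real j * ?b k j * y ^ j) sums (mlr \<alpha> m (Suc k) y - real (Suc m) * mlr \<alpha> m k y)" .
    with 1 show ?thesis by (rule sums_unique2)
  qed
  ultimately show ?thesis by blast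
qed

lemma bounded_near_zero:
  fixes D :: "real \<Rightarrow> real"
  assumes "continuous_on UNIV D" and "\<And>y. y \<ge> 1 \<Longrightarrow> \<bar>D y\<bar> \<le> C / y ^ n"
  shows "\<exists>C'>0. \<forall>y\<ge>0. \<bar>D y\<bar> \<le> C' / (1 + y) ^ n"
proof -
  have "compact (D ` {0..1})"
    using assms(1) by (intro compact_continuous_image) (auto intro: continuous_on_subset)
  then obtain M where M: "\<forall>y\<in>{0..1}. \<bar>D y\<bar> \<le> M"
    by (auto dest!: compact_imp_bounded simp: bounded_iff)
  \<comment> \<open>The factor 2^n covers (1 + y)^n on [0,1] and the bound 1 + y \<le> 2 y beyond
    1.\<close>
  define C' where "C' = 2 ^ n * (\<bar>M\<bar> + \<bar>C\<bar> + 1)"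
  have "\<bar>D y\<bar> \<le> C' / (1 + y) ^ n" if y: "y \<ge> 0" for y
  proof -
    have pos: "(1 + y) ^ n > 0" using y by simp
    have "\<bar>D y\<bar> * (1 + y) ^ n \<le> C'"
    proof (cases "y \<le> 1")
      case True
      then have "\<bar>D y\<bar> * (1 + y) ^ n \<le> \<bar>M\<bar> * 2 ^ n"
        using bspec[OF M, of y] y by (intro mult_mono power_mono) auto
      also have "\<dots> \<le> C'" by (simp add: C'_def algebra_simps)
      finally show ?thesis .
    next
      case False
      then have "\<bar>D y\<bar> * (1 + y) ^ n \<le> (\<bar>C\<bar> / y ^ n) * (2 * y) ^ n"
        using assms(2)[of y] y by (intro mult_mono power_mono order.trans[OF assms(2)] divide_right_mono) auto
      also have "\<dots> = \<bar>C\<bar> * 2 ^ n" using False by (simp add: power_mult_distrib)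
      also have "\<dots> \<le> C'" by (simp add: C'_def algebra_simps)
      finally show ?thesis .
    qed
    then show ?thesis using pos by (simp add: pos_le_divide_eq)
  qed
  moreover have "C' > 0" by (simp add: C'_def add_nonneg_pos)
  ultimately show ?thesis by blast
qed

text \<open>For y \<ge> 1 both the bounded function and the subtracted polynomial are of order y^m;
  dividing by y^(m+1) leaves 1/y.\<close>

lemma mlr_bound:
  assumes \<alpha>: "0 < \<alpha>" "\<alpha> < 1"
  shows "\<exists>C>0. \<forall>y\<ge>0. \<bar>mlr \<alpha> m k y\<bar> \<le> C / (1 + y)"
proof -
  obtain B where B: "\<And>y. y \<ge> 0 \<Longrightarrow> \<bar>mlt \<alpha> k y\<bar> \<le> B" using mlt_bounded[OF \<alpha>] by blast
  define P where "P = (\<Sum>j\<le>m. real j ^ k * mlc \<alpha> j)"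
  have "\<bar>mlr \<alpha> m k y\<bar> \<le> (B + P) / y ^ 1" if y: "y \<ge> 1" for y
  proof -
    have "\<bar>\<Sum>j\<le>m. real j ^ k * mlc \<alpha> j * (- 1) ^ j * y ^ j\<bar> \<le> (\<Sum>j\<le>m. real j ^ k * mlc \<alpha> j * y ^ m)"
    proof (rule order.trans[OF sum_abs], rule sum_mono)
      fix j assume "j \<in> {..m}"
      then have "y ^ j \<le> y ^ m" using y by (intro power_increasing) auto
      then show "\<bar>real j ^ k * mlc \<alpha> j * (- 1) ^ j * y ^ j\<bar> \<le> real j ^ k * mlc \<alpha> j * y ^ m"
        using mlc_pos[OF \<alpha>(1), of j] y by (auto simp: abs_mult power_abs intro!: mult_left_mono)
    qed
    also have "\<dots> = P * y ^ m" by (simp add: P_def sum_distrib_right)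
    finally have "\<bar>y ^ Suc m * mlr \<alpha> m k y\<bar> \<le> B + P * y ^ m"
      unfolding mlr_eq[OF \<alpha>] using B[of y] y by (auto intro: order.trans[OF abs_triangle_ineq4])
    also have "\<dots> \<le> (B + P) * y ^ m"
      using B[of y] y one_le_power[OF y, of m] mult_left_mono[of 1 "y ^ m" B] order.trans[OF abs_ge_zero B[of y]] by (simp add: distrib_right)
    finally have "y ^ m * (y * \<bar>mlr \<alpha> m k y\<bar>) \<le> y ^ m * (B + P)"
      using y by (simp add: abs_mult mult_ac)
    then have "y * \<bar>mlr \<alpha> m k y\<bar> \<le> B + P" using y by simp
    then show ?thesis using y by (simp add: pos_le_divide_eq mult.commute)
  qed
  moreover have "continuous_on UNIV (mlr \<alpha> m k)"
    using mlr_deriv_ex[OF \<alpha>, of m k] by (meson DERIV_isCont continuous_at_imp_continuous_on)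
  ultimately show ?thesis using bounded_near_zero[of "mlr \<alpha> m k" "B + P" 1] by simp
qed

text \<open>The first derivative gains a factor 1/(1 + y). The second one is needed only in the
  product with y, because the multipliers are evaluated along a quadratic function of the
  index.\<close>

lemma mlr_deriv_bounds:
  assumes \<alpha>: "0 < \<alpha>" "\<alpha> < 1"
  shows "\<exists>D D2 C. C > 0 \<and> (\<forall>y. (mlr \<alpha> m k has_real_derivative D y) (at y)) \<and> (\<forall>y. (D has_real_derivative D2 y) (at y)) \<and>
     (\<forall>y\<ge>0. \<bar>mlr \<alpha> m k y\<bar> \<le> C / (1 + y) \<and> \<bar>D y\<bar> \<le> C / (1 + y)\<^sup>2 \<and> y * \<bar>D2 y\<bar> \<le> C / (1 + y)\<^sup>2)"
proof -
  have step: "\<exists>C>0. \<forall>y\<ge>0. \<bar>D y\<bar> \<le> C / (1 + y)\<^sup>2"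
    if D: "continuous_on UNIV D" "\<And>y. y * D y = mlr \<alpha> m (Suc k) y - real (Suc m) * mlr \<alpha> m k y" for D k
  proof -
    obtain C0 where C0: "C0 > 0" "\<And>y. y \<ge> 0 \<Longrightarrow> \<bar>mlr \<alpha> m k y\<bar> \<le> C0 / (1 + y)" using mlr_bound[OF \<alpha>] by blast
    obtain C1 where C1: "C1 > 0" "\<And>y. y \<ge> 0 \<Longrightarrow> \<bar>mlr \<alpha> m (Suc k) y\<bar> \<le> C1 / (1 + y)" using mlr_bound[OF \<alpha>] by blast
    have "\<bar>D y\<bar> \<le> (C1 + real (Suc m) * C0) / y ^ 2" if y: "y \<ge> 1" for y
    proof -
      have "y * \<bar>D y\<bar> = \<bar>mlr \<alpha> m (Suc k) y - real (Suc m) * mlr \<alpha> m k y\<bar>"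
        unfolding D(2)[symmetric] using y by (simp add: abs_mult)
      also have "\<dots> \<le> C1 / (1 + y) + real (Suc m) * (C0 / (1 + y))"
      proof (rule order.trans[OF abs_triangle_ineq4])
        have "real (Suc m) * \<bar>mlr \<alpha> m k y\<bar> \<le> real (Suc m) * (C0 / (1 + y))"
          using C0(2)[of y] y by (intro mult_left_mono) auto
        then show "\<bar>mlr \<alpha> m (Suc k) y\<bar> + \<bar>real (Suc m) * mlr \<alpha> m k y\<bar> \<le> C1 / (1 + y) + real (Suc m) * (C0 / (1 + y))"
          using C1(2)[of y] y unfolding abs_mult by (intro add_mono) auto
      qed
      also have "\<dots> = (C1 + real (Suc m) * C0) / (1 + y)" by (simp add: add_divide_distrib)
      also have "\<dots> \<le> (C1 + real (Suc m) * C0) / y"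
        using y C0(1) C1(1) by (intro divide_left_mono add_nonneg_nonneg mult_nonneg_nonneg) auto
      finally have "y * (y * \<bar>D y\<bar>) \<le> C1 + real (Suc m) * C0" using y by (simp add: pos_le_divide_eq mult.commute)
      then show ?thesis using y by (simp add: pos_le_divide_eq power2_eq_square mult_ac)
    qed
    then show ?thesis using bounded_near_zero[OF D(1), of _ 2] by blast
  qed
  obtain D D2 where D: "continuous_on UNIV D" "\<And>y. (mlr \<alpha> m k has_real_derivative D y) (at y)"
     "\<And>y. (D has_real_derivative D2 y) (at y)" "\<And>y. y * D y = mlr \<alpha> m (Suc k) y - real (Suc m) * mlr \<alpha> m k y"
    using mlr_deriv_ex[OF \<alpha>, of m k] by metis
  obtain D' where D': "continuous_on UNIV D'" "\<And>y. (mlr \<alpha> m (Suc k) has_real_derivative D' y) (at y)"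
     "\<And>y. y * D' y = mlr \<alpha> m (Suc (Suc k)) y - real (Suc m) * mlr \<alpha> m (Suc k) y"
    using mlr_deriv_ex[OF \<alpha>, of m "Suc k"] by metis
  obtain C where C: "C > 0" "\<And>y. y \<ge> 0 \<Longrightarrow> \<bar>D y\<bar> \<le> C / (1 + y)\<^sup>2" using step[OF D(1,4)] by blast
  obtain C' where C': "C' > 0" "\<And>y. y \<ge> 0 \<Longrightarrow> \<bar>D' y\<bar> \<le> C' / (1 + y)\<^sup>2" using step[OF D'(1,3)] by blast
  obtain C0 where C0: "C0 > 0" "\<And>y. y \<ge> 0 \<Longrightarrow> \<bar>mlr \<alpha> m k y\<bar> \<le> C0 / (1 + y)" using mlr_bound[OF \<alpha>] by blast
  \<comment> \<open>Differentiates the identity for \<open>y * D y\<close>, so that no estimate of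
    the second power series is needed.\<close>
  have D2: "y * D2 y = D' y - real (Suc (Suc m)) * D y" for y
  proof -
    have "((\<lambda>y. y * D y) has_real_derivative D y + y * D2 y) (at y)"
      by (rule derivative_eq_intros D(3) refl | simp)+
    moreover have "((\<lambda>y. mlr \<alpha> m (Suc k) y - real (Suc m) * mlr \<alpha> m k y) has_real_derivative D' y - real (Suc m) * D y) (at y)"
      by (intro DERIV_diff DERIV_cmult D D')
    ultimately have "D y + y * D2 y = D' y - real (Suc m) * D y"
      unfolding D(4) by (rule DERIV_unique)
    then show ?thesis by (simp add: algebra_simps)
  qed
  define A where "A = C0 + C + (C' + real (Suc (Suc m)) * C)"
  have A: "A > 0" "C0 \<le> A" "C \<le> A" "C' + real (Suc (Suc m)) * C \<le> A"
    using C C' C0 by (auto simp: A_def add_pos_pos intro!: add_nonneg_nonneg mult_nonneg_nonneg)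
  have "y * \<bar>D2 y\<bar> \<le> (C' + real (Suc (Suc m)) * C) / (1 + y)\<^sup>2" if y: "y \<ge> 0" for y
  proof -
    have "y * \<bar>D2 y\<bar> = \<bar>D' y - real (Suc (Suc m)) * D y\<bar>" unfolding D2[symmetric] using y by (simp add: abs_mult)
    also have "\<dots> \<le> C' / (1 + y)\<^sup>2 + real (Suc (Suc m)) * (C / (1 + y)\<^sup>2)"
    proof (rule order.trans[OF abs_triangle_ineq4])
      have "real (Suc (Suc m)) * \<bar>D y\<bar> \<le> real (Suc (Suc m)) * (C / (1 + y)\<^sup>2)"
        using C(2)[OF y] by (intro mult_left_mono) auto
      then show "\<bar>D' y\<bar> + \<bar>real (Suc (Suc m)) * D y\<bar> \<le> C' / (1 + y)\<^sup>2 + real (Suc (Suc m)) * (C / (1 + y)\<^sup>2)"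
        using C'(2)[OF y] unfolding abs_mult by (intro add_mono) auto
    qed
    finally show ?thesis by (simp add: add_divide_distrib)
  qed
  then have "y * \<bar>D2 y\<bar> \<le> A / (1 + y)\<^sup>2" if "y \<ge> 0" for y
    using that A(4) by (meson divide_right_mono order.trans zero_le_power2)
  moreover have "\<bar>D y\<bar> \<le> A / (1 + y)\<^sup>2" if "y \<ge> 0" for y
    using C(2)[OF that] A(3) by (meson divide_right_mono order.trans zero_le_power2)
  moreover have "\<bar>mlr \<alpha> m k y\<bar> \<le> A / (1 + y)" if "y \<ge> 0" for y
    using order.trans[OF C0(2)[OF that] divide_right_mono[OF A(2)]] that by simp
  ultimately show ?thesis using A(1) D(2,3) by blast
qed

section \<open>The Dirichlet eigensystem\<close>

text \<open>Green's second identity: the integrand is the derivative of -p (v' y - v y'), which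
  vanishes at both ends. \<open>w\<close> need not be continuous, as the gauge integral of a
  derivative always exists.\<close>

lemma dirichlet_op_green:
  assumes L: "L > 0" and v: "dirichlet_op p a L v w" and y: "dirichlet_op p a L y (\<lambda>x. l * y x)"
  shows "((\<lambda>x. w x * y x - l * (v x * y x)) has_integral 0) {0..L}"
proof -
  obtain v' v'' where v0: "v 0 = 0" "v L = 0"
    and v': "\<And>x. x \<in> {0..L} \<Longrightarrow> (v has_real_derivative v' x) (at x within {0..L}) \<and>
        (v' has_real_derivative v'' x) (at x within {0..L}) \<and> w x = - p * v'' x - a * v x"
    using v unfolding dirichlet_op_def by blast
  obtain y' y'' where y0: "y 0 = 0" "y L = 0"
    and y': "\<And>x. x \<in> {0..L} \<Longrightarrow> (y has_real_derivative y' x) (at x within {0..L}) \<and>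
        (y' has_real_derivative y'' x) (at x within {0..L}) \<and> l * y x = - p * y'' x - a * y x"
    using y unfolding dirichlet_op_def by blast
  define h where "h x = - p * (v' x * y x - v x * y' x)" for x
  have d: "(h has_real_derivative - p * (v'' x * y x - v x * y'' x)) (at x within {0..L})" if "x \<in> {0..L}" for x
    unfolding h_def using v'[OF that] y'[OF that] by (auto intro!: derivative_eq_intros simp: algebra_simps)
  have eq: "- p * (v'' x * y x - v x * y'' x) = w x * y x - l * (v x * y x)" if "x \<in> {0..L}" for x
  proof -
    have w: "w x = - p * v'' x - a * v x" and ly: "l * y x = - p * y'' x - a * y x" using v'[OF that] y'[OF that] by auto
    have "w x * y x - v x * (l * y x) = - p * (v'' x * y x - v x * y'' x)"
      unfolding w ly by (simp add: algebra_simps)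
    then show ?thesis by (simp add: mult_ac)
  qed
  have "((\<lambda>x. - p * (v'' x * y x - v x * y'' x)) has_integral (h L - h 0)) {0..L}"
    using L d by (intro fundamental_theorem_of_calculus) (auto simp: has_real_derivative_iff_has_vector_derivative)
  moreover have "h L - h 0 = 0" using v0 y0 by (simp add: h_def)
  ultimately have "((\<lambda>x. - p * (v'' x * y x - v x * y'' x)) has_integral 0) {0..L}" by simp
  then show ?thesis by (rule has_integral_eq[rotated]) (use eq in auto)
qed

text \<open>An energy argument excludes exponential and linear solutions; two first integrals of the
  oscillator then determine \<open>y\<close>, and the condition at L quantizes the
  frequency.\<close>

lemma dirichlet_eigenfunction_form:
  assumes L: "L > 0" and p: "p > 0" and y: "dirichlet_op p a L y (\<lambda>x. l * y x)"
    and nz: "\<exists>x\<in>{0..L}. y x \<noteq> 0"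
  shows "\<exists>n c. n \<ge> 1 \<and> l = p * (real n * pi / L)\<^sup>2 - a \<and> (\<forall>x\<in>{0..L}. y x = c * sin (real n * pi / L * x))"
proof -
  obtain y' y'' where y0: "y 0 = 0" "y L = 0"
    and y': "\<And>x. x \<in> {0..L} \<Longrightarrow> (y has_real_derivative y' x) (at x within {0..L}) \<and>
        (y' has_real_derivative y'' x) (at x within {0..L}) \<and> l * y x = - p * y'' x - a * y x"
    using y unfolding dirichlet_op_def by blast
  define \<kappa> where "\<kappa> = (l + a) / p"
  have y2: "y'' x = - \<kappa> * y x" if "x \<in> {0..L}" for x
    using y'[OF that] p by (simp add: \<kappa>_def field_simps)
  have dy: "(y has_real_derivative y' x) (at x within {0..L})" "(y' has_real_derivative - \<kappa> * y x) (at x within {0..L})"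
    if "x \<in> {0..L}" for x using y'[OF that] y2[OF that] by auto
  have \<kappa>: "\<kappa> > 0"
  proof (rule ccontr)
    assume "\<not> \<kappa> > 0"
    then have k: "\<kappa> \<le> 0" by simp
    \<comment> \<open>For \<kappa> \<le> 0 this product is nondecreasing and vanishes at both ends,
      hence everywhere. The square of y, whose derivative is 2 h, is then constant, so it is
      0.\<close>
    define h where "h x = y x * y' x" for x
    have dh: "(h has_real_derivative (y' x)\<^sup>2 - \<kappa> * (y x)\<^sup>2) (at x within {0..L})" if "x \<in> {0..L}" for x
      unfolding h_def by (rule derivative_eq_intros dy[OF that] refl | simp add: power2_eq_square)+
    have hc: "continuous_on {0..L} h" using dh by (meson DERIV_continuous continuous_on_eq_continuous_within)
    have mono: "h s \<le> h t" if "0 \<le> s" "s \<le> t" "t \<le> L" for s t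
    proof (rule DERIV_nonneg_imp_increasing_open[OF that(2)])
      show "continuous_on {s..t} h" using that by (intro continuous_on_subset[OF hc]) auto
      fix x assume x: "s < x" "x < t"
      then have "(h has_real_derivative (y' x)\<^sup>2 - \<kappa> * (y x)\<^sup>2) (at x)"
        using dh[of x] that by (simp add: at_within_Icc_at)
      moreover have "(y' x)\<^sup>2 - \<kappa> * (y x)\<^sup>2 \<ge> 0" using mult_nonpos_nonneg[OF k, of "(y x)\<^sup>2"] zero_le_power2[of "y' x"] zero_le_power2[of "y x"] by linarith
      ultimately show "\<exists>y. DERIV h x :> y \<and> y \<ge> 0" by blast
    qed
    have h0: "h x = 0" if "x \<in> {0..L}" for x
      using mono[of 0 x] mono[of x L] that L y0 by (auto simp: h_def)
    have "\<exists>c. \<forall>x\<in>{0..L}. (y x)\<^sup>2 = c"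
    proof (rule has_field_derivative_zero_constant)
      fix x assume x: "x \<in> {0..L}"
      have "((\<lambda>x. (y x)\<^sup>2) has_real_derivative 2 * h x) (at x within {0..L})"
        by (rule derivative_eq_intros dy[OF x] refl | simp add: h_def)+
      then show "((\<lambda>x. (y x)\<^sup>2) has_real_derivative 0) (at x within {0..L})" using h0[OF x] by simp
    qed simp
    then have "\<forall>x\<in>{0..L}. (y x)\<^sup>2 = 0" using y0 L by (metis atLeastAtMost_iff less_imp_le order_refl zero_power2)
    then show False using nz by simp
  qed
  define \<omega> where "\<omega> = sqrt \<kappa>"
  have \<omega>: "\<omega> > 0" "\<omega> * \<omega> = \<kappa>" using \<kappa> by (simp_all add: \<omega>_def)
  \<comment> \<open>First integrals of y'' = -\<omega>^2 y. This one is 0 by the condition at 0; the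
    other is the amplitude d up to the factor \<omega>.\<close>
  have "\<exists>c. \<forall>x\<in>{0..L}. y x * \<omega> * cos (\<omega> * x) - y' x * sin (\<omega> * x) = c"
  proof (rule has_field_derivative_zero_constant)
    fix x assume x: "x \<in> {0..L}"
    show "((\<lambda>x. y x * \<omega> * cos (\<omega> * x) - y' x * sin (\<omega> * x)) has_real_derivative 0) (at x within {0..L})"
      by (rule derivative_eq_intros dy[OF x] refl | simp add: \<omega>(2)[symmetric] algebra_simps)+
  qed simp
  then obtain q where "\<forall>x\<in>{0..L}. y x * \<omega> * cos (\<omega> * x) - y' x * sin (\<omega> * x) = q" by blast
  moreover from bspec[OF this, of 0] have "q = 0" using y0 L by simp
  ultimately have Q: "y x * \<omega> * cos (\<omega> * x) - y' x * sin (\<omega> * x) = 0" if "x \<in> {0..L}" for x using that by blast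
  have "\<exists>c. \<forall>x\<in>{0..L}. y x * \<omega> * sin (\<omega> * x) + y' x * cos (\<omega> * x) = c"
  proof (rule has_field_derivative_zero_constant)
    fix x assume x: "x \<in> {0..L}"
    show "((\<lambda>x. y x * \<omega> * sin (\<omega> * x) + y' x * cos (\<omega> * x)) has_real_derivative 0) (at x within {0..L})"
      by (rule derivative_eq_intros dy[OF x] refl | simp add: \<omega>(2)[symmetric] algebra_simps)+
  qed simp
  then obtain d where P: "\<And>x. x \<in> {0..L} \<Longrightarrow> y x * \<omega> * sin (\<omega> * x) + y' x * cos (\<omega> * x) = d" by blast
  have form: "y x = d / \<omega> * sin (\<omega> * x)" if "x \<in> {0..L}" for x
  proof -
    have "\<omega> * y x * ((sin (\<omega> * x))\<^sup>2 + (cos (\<omega> * x))\<^sup>2) =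
      (y x * \<omega> * sin (\<omega> * x) + y' x * cos (\<omega> * x)) * sin (\<omega> * x) +
      (y x * \<omega> * cos (\<omega> * x) - y' x * sin (\<omega> * x)) * cos (\<omega> * x)"
      by algebra
    then show ?thesis unfolding P[OF that] Q[OF that] using \<omega> by (simp add: field_simps)
  qed
  have "d \<noteq> 0" using nz form by auto
  then have "sin (\<omega> * L) = 0" using form[of L] y0 L \<omega> by auto
  then obtain i :: int where i: "\<omega> * L = of_int i * pi" by (auto simp: sin_zero_iff_int2)
  have "of_int i * pi > 0" using i \<omega> L by (metis mult_pos_pos)
  then have "i > 0" by (simp add: zero_less_mult_iff)
  then obtain n where n: "n \<ge> 1" "i = int n" by (metis of_nat_0_less_iff nat_0_le less_imp_le less_one not_le zero_less_imp_eq_int)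
  then have \<omega>n: "\<omega> = real n * pi / L" using i L by (simp add: field_simps)
  have "l = p * \<omega>\<^sup>2 - a" using \<omega> p by (simp add: power2_eq_square \<kappa>_def)
  then show ?thesis using n form unfolding \<omega>n by blast
qed

lemma dirichlet_op_sin:
  assumes L: "L > 0"
  shows "dirichlet_op p a L (\<lambda>x. sin (real n * pi / L * x)) (\<lambda>x. (p * (real n * pi / L)\<^sup>2 - a) * sin (real n * pi / L * x))"
proof -
  define \<omega> where "\<omega> = real n * pi / L"
  have "\<omega> * L = real n * pi" using L by (simp add: \<omega>_def)
  then have "sin (\<omega> * L) = 0" by (simp add: sin_npi)
  moreover have "((\<lambda>x. sin (\<omega> * x)) has_real_derivative \<omega> * cos (\<omega> * x)) (at x within {0..L})"
    and "((\<lambda>x. \<omega> * cos (\<omega> * x)) has_real_derivative - (\<omega>\<^sup>2 * sin (\<omega> * x))) (at x within {0..L})" for x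
    by (auto intro!: derivative_eq_intros simp: power2_eq_square)
  moreover have "(p * \<omega>\<^sup>2 - a) * sin (\<omega> * x) = - p * (- (\<omega>\<^sup>2 * sin (\<omega> * x))) - a * sin (\<omega> * x)" for x
    by (simp add: algebra_simps)
  ultimately show ?thesis unfolding dirichlet_op_def \<omega>_def[symmetric]
    by (intro conjI exI[of _ "\<lambda>x. \<omega> * cos (\<omega> * x)"] exI[of _ "\<lambda>x. - (\<omega>\<^sup>2 * sin (\<omega> * x))"] ballI) auto
qed

lemma has_integral_sin_squared:
  assumes L: "L > 0" and n: "n \<ge> 1"
  shows "((\<lambda>x. (sin (real n * pi / L * x))\<^sup>2) has_integral (L / 2)) {0..L}"
proof -
  define \<omega> where "\<omega> = real n * pi / L"
  have \<omega>: "\<omega> > 0" using L n by (simp add: \<omega>_def)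
  have "\<omega> * L = real n * pi" using L by (simp add: \<omega>_def)
  then have s0: "sin (\<omega> * L) = 0" by (simp add: sin_npi)
  define h where "h x = x / 2 - sin (\<omega> * x) * cos (\<omega> * x) / (2 * \<omega>)" for x
  have "((\<lambda>x. (sin (\<omega> * x))\<^sup>2) has_integral (h L - h 0)) {0..L}"
  proof (rule fundamental_theorem_of_calculus)
    fix x assume "x \<in> {0..L}"
    have "(h has_real_derivative 1 / 2 - (\<omega> * cos (\<omega> * x) * cos (\<omega> * x) - \<omega> * sin (\<omega> * x) * sin (\<omega> * x)) / (2 * \<omega>)) (at x within {0..L})"
      unfolding h_def using \<omega> by (auto intro!: derivative_eq_intros simp: field_simps)
    also have "1 / 2 - (\<omega> * cos (\<omega> * x) * cos (\<omega> * x) - \<omega> * sin (\<omega> * x) * sin (\<omega> * x)) / (2 * \<omega>)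
        = (1 - (cos (\<omega> * x))\<^sup>2 + (sin (\<omega> * x))\<^sup>2) / 2"
      using \<omega> by (simp add: field_simps power2_eq_square)
    also have "\<dots> = (sin (\<omega> * x))\<^sup>2" by (simp add: cos_squared_eq)
    finally show "(h has_vector_derivative (sin (\<omega> * x))\<^sup>2) (at x within {0..L})"
      by (simp add: has_real_derivative_iff_has_vector_derivative)
  qed (use L in auto)
  then show ?thesis using s0 by (simp add: h_def \<omega>_def)
qed

text \<open>An eigensystem is the normalized sine system up to order and sign: the permutation
  \<sigma> appears because no ordering is imposed, the signs s because the normalization leaves them
  free.\<close>

lemma eigensystem_form:
  assumes L: "L > 0" and p: "p > 0" and es: "dirichlet_eigensystem p a L lam X"
  obtains \<sigma> s where "bij_betw \<sigma> {1..} {1::nat..}"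
    "\<And>i. i \<ge> 1 \<Longrightarrow> lam i = p * (real (\<sigma> i) * pi / L)\<^sup>2 - a"
    "\<And>i. i \<ge> 1 \<Longrightarrow> s i = 1 \<or> s i = (-1 :: real)"
    "\<And>i x. i \<ge> 1 \<Longrightarrow> x \<in> {0..L} \<Longrightarrow> X i x = s i * sqrt (2 / L) * sin (real (\<sigma> i) * pi / L * x)"
proof -
  have E: "dirichlet_op p a L (X i) (\<lambda>x. lam i * X i x)" "l2_inner L (X i) (X i) = 1" if "i \<ge> 1" for i
    using es that unfolding dirichlet_eigensystem_def by auto
  have "\<exists>n c. n \<ge> 1 \<and> lam i = p * (real n * pi / L)\<^sup>2 - a \<and> (\<forall>x\<in>{0..L}. X i x = c * sin (real n * pi / L * x))"
    if i: "i \<ge> 1" for i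
  proof (rule dirichlet_eigenfunction_form[OF L p E(1)[OF i]])
    show "\<exists>x\<in>{0..L}. X i x \<noteq> 0"
    proof (rule ccontr)
      assume "\<not> (\<exists>x\<in>{0..L}. X i x \<noteq> 0)"
      then have "l2_inner L (X i) (X i) = integral {0..L} (\<lambda>x. 0)"
        unfolding l2_inner_def by (intro integral_cong) auto
      then show False using E(2)[OF i] by simp
    qed
  qed
  then obtain \<sigma> c where \<sigma>: "\<And>i. i \<ge> 1 \<Longrightarrow> \<sigma> i \<ge> 1" "\<And>i. i \<ge> 1 \<Longrightarrow> lam i = p * (real (\<sigma> i) * pi / L)\<^sup>2 - a"
     "\<And>i x. i \<ge> 1 \<Longrightarrow> x \<in> {0..L} \<Longrightarrow> X i x = c i * sin (real (\<sigma> i) * pi / L * x)"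
    by metis
  have c: "(c i)\<^sup>2 * (L / 2) = 1" if i: "i \<ge> 1" for i
  proof -
    have "((\<lambda>x. (c i)\<^sup>2 * (sin (real (\<sigma> i) * pi / L * x))\<^sup>2) has_integral ((c i)\<^sup>2 * (L / 2))) {0..L}"
      by (intro has_integral_mult_right has_integral_sin_squared L \<sigma> i)
    then have "((\<lambda>x. X i x * X i x) has_integral ((c i)\<^sup>2 * (L / 2))) {0..L}"
      by (rule has_integral_eq[rotated]) (use \<sigma>(3)[OF i] in \<open>simp add: power2_eq_square\<close>)
    then show ?thesis using E(2)[OF i] unfolding l2_inner_def by (metis integral_unique)
  qed
  have inj: "inj_on \<sigma> {1..}"
  proof (rule inj_onI)
    fix i j assume ij: "i \<in> {1..}" "j \<in> {1::nat..}" "\<sigma> i = \<sigma> j"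
    then have "lam i = lam j" using \<sigma>(2) by simp
    moreover have "inj_on lam {1..}" using es unfolding dirichlet_eigensystem_def by blast
    ultimately show "i = j" using ij by (auto dest: inj_onD)
  qed
  have surj: "n \<in> \<sigma> ` {1..}" if n: "n \<ge> 1" for n
  proof -
    \<comment> \<open>The point L/(2n), where the n-th sine equals 1, shows that it is not the zero
      function.\<close>
    have "real n * pi / L * (L / (2 * real n)) = pi / 2" using n L by (simp add: field_simps)
    then have "sin (real n * pi / L * (L / (2 * real n))) \<noteq> 0" by (simp only: sin_pi_half)
    moreover have "L / (2 * real n) \<in> {0..L}" using n L by (simp add: field_simps)
    ultimately have "\<exists>x\<in>{0..L}. sin (real n * pi / L * x) \<noteq> 0" by blast
    moreover have all: "\<forall>\<mu> v. dirichlet_op p a L v (\<lambda>x. \<mu> * v x) \<and> (\<exists>x\<in>{0..L}. v x \<noteq> 0) \<longrightarrow> \<mu> \<in> lam ` {1..}"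
      using es unfolding dirichlet_eigensystem_def by blast
    ultimately have "p * (real n * pi / L)\<^sup>2 - a \<in> lam ` {1..}"
      using dirichlet_op_sin[OF L, of p a n] by blast
    then obtain i where i: "i \<ge> 1" "p * (real n * pi / L)\<^sup>2 - a = p * (real (\<sigma> i) * pi / L)\<^sup>2 - a"
      using \<sigma>(2) by auto
    then have "(real n * pi / L)\<^sup>2 = (real (\<sigma> i) * pi / L)\<^sup>2" using p by simp
    then have "real n * pi / L = real (\<sigma> i) * pi / L"
      using L by (subst (asm) power2_eq_iff_nonneg) auto
    then have "n = \<sigma> i" using L by simp
    then show ?thesis using i by auto
  qed
  define s where "s i = c i / sqrt (2 / L)" for i
  have "s i = 1 \<or> s i = -1" if i: "i \<ge> 1" for i
  proof -
    have "(s i)\<^sup>2 = 1" using c[OF i] L by (simp add: s_def power_divide field_simps)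
    then show ?thesis by (simp add: power2_eq_1_iff)
  qed
  moreover have "X i x = s i * sqrt (2 / L) * sin (real (\<sigma> i) * pi / L * x)" if "i \<ge> 1" "x \<in> {0..L}" for i x
    using \<sigma>(3)[OF that] L by (simp add: s_def)
  moreover have "bij_betw \<sigma> {1..} {1..}"
    unfolding bij_betw_def using inj \<sigma>(1) surj by auto
  ultimately show ?thesis using \<sigma>(2) by (intro that[of \<sigma> s]) auto
qed

lemma eigenfunctions_orthonormal:
  assumes L: "L > 0" and p: "p > 0" and es: "dirichlet_eigensystem p a L lam X" and i: "i \<ge> 1" "j \<ge> 1"
  shows "((\<lambda>x. X i x * X j x) has_integral (if i = j then 1 else 0)) {0..L}"
proof -
  have E: "dirichlet_op p a L (X i) (\<lambda>x. lam i * X i x)" "l2_inner L (X i) (X i) = 1" if "i \<ge> 1" for i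
    using es that unfolding dirichlet_eigensystem_def by auto
  have c: "continuous_on {0..L} (X i)" if "i \<ge> 1" for i
    using E(1)[OF that] unfolding dirichlet_op_def continuous_on_eq_continuous_within by (meson DERIV_continuous)
  have int: "(\<lambda>x. X i x * X j x) integrable_on {0..L}"
    using c i by (intro integrable_continuous_real continuous_intros)
  show ?thesis
  proof (cases "i = j")
    case True
    then show ?thesis using integrable_integral[OF int] E(2)[OF i(1)] by (simp add: l2_inner_def)
  next
    case False
    moreover have "inj_on lam {1..}" using es unfolding dirichlet_eigensystem_def by blast
    ultimately have ne: "lam i - lam j \<noteq> 0" using i by (auto dest: inj_onD)
    have "((\<lambda>x. lam i * X i x * X j x - lam j * (X i x * X j x)) has_integral 0) {0..L}"
      using dirichlet_op_green[OF L E(1)[OF i(1)] E(1)[OF i(2)]] .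
    then have "((\<lambda>x. (lam i - lam j) * (X i x * X j x)) has_integral 0) {0..L}"
      by (simp add: algebra_simps)
    then have "((\<lambda>x. 1 / (lam i - lam j) * ((lam i - lam j) * (X i x * X j x))) has_integral 1 / (lam i - lam j) * 0) {0..L}"
      by (rule has_integral_mult_right)
    then show ?thesis using ne False by (simp add: mult.assoc[symmetric])
  qed
qed

section \<open>Completeness of the sine system\<close>

lemma absolutely_integrable_mult_continuous:
  fixes \<eta> h :: "real \<Rightarrow> real"
  assumes "\<eta> absolutely_integrable_on {a..b}" "continuous_on {a..b} h"
  shows "(\<lambda>x. h x * \<eta> x) absolutely_integrable_on {a..b}"
proof (rule absolutely_integrable_bounded_measurable_product_real[OF _ _ _ assms(1)])
  show "h \<in> borel_measurable (lebesgue_on {a..b})"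
    using assms(2) by (intro continuous_imp_measurable_on_sets_lebesgue) auto
  show "bounded (h ` {a..b})"
    using assms(2) by (intro compact_imp_bounded compact_continuous_image) auto
qed auto

text \<open>Induction on n through 2 sin(k x) cos x = sin((k + 1) x) + sin((k - 1) x); the frequency
  must vary in the induction, and frequency 0 contributes nothing.\<close>

lemma integral_sin_cos_power_zero:
  fixes \<eta> :: "real \<Rightarrow> real"
  assumes \<eta>: "\<eta> absolutely_integrable_on {0..L}"
    and z: "\<And>n::nat. n \<ge> 1 \<Longrightarrow> integral {0..L} (\<lambda>x. sin (real n * c * x) * \<eta> x) = 0"
  shows "integral {0..L} (\<lambda>x. (sin (real k * c * x) * cos (c * x) ^ n) * \<eta> x) = 0"
proof (induction n arbitrary: k)
  case 0
  show ?case using z[of k] by (cases "k = 0") auto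
next
  case (Suc n)
  have i: "(\<lambda>x. (sin (real k * c * x) * cos (c * x) ^ n) * \<eta> x) integrable_on {0..L}" for k
  proof -
    have "(\<lambda>x. (sin (real k * c * x) * cos (c * x) ^ n) * \<eta> x) absolutely_integrable_on {0..L}"
      by (intro absolutely_integrable_mult_continuous \<eta> continuous_intros)
    then show ?thesis by (simp add: absolutely_integrable_on_def)
  qed
  show ?case
  proof (cases "k = 0")
    case False
    then obtain k' where k': "k = Suc k'" by (cases k) auto
    have eq: "(sin (real k * c * x) * cos (c * x) ^ Suc n) * \<eta> x =
        1 / 2 * ((sin (real (Suc k) * c * x) * cos (c * x) ^ n) * \<eta> x) +
        1 / 2 * ((sin (real k' * c * x) * cos (c * x) ^ n) * \<eta> x)" for x
    proof -
      have e: "real (Suc k) * c * x = real k * c * x + c * x" "real k' * c * x = real k * c * x - c * x"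
        using k' by (simp_all add: algebra_simps)
      show ?thesis unfolding e sin_add sin_diff by (simp add: algebra_simps)
    qed
    have "integral {0..L} (\<lambda>x. (sin (real k * c * x) * cos (c * x) ^ Suc n) * \<eta> x) =
      1 / 2 * integral {0..L} (\<lambda>x. (sin (real (Suc k) * c * x) * cos (c * x) ^ n) * \<eta> x) +
      1 / 2 * integral {0..L} (\<lambda>x. (sin (real k' * c * x) * cos (c * x) ^ n) * \<eta> x)"
      by (simp only: eq) (rule integral_unique, intro has_integral_add has_integral_mult_right integrable_integral i)
    then show ?thesis unfolding Suc by simp
  qed simp
qed

text \<open>Multiplying by the sine and writing a continuous function as $H(\cos(\pi x/L))$ reduces the
  completeness of the sine system to the Weierstrass theorem on $[-1,1]$.\<close>

lemma sine_coefficients_zero_imp_negligible: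
  fixes \<eta> :: "real \<Rightarrow> real"
  assumes L: "L > 0" and \<eta>: "\<eta> absolutely_integrable_on {0..L}"
    and z: "\<And>n::nat. n \<ge> 1 \<Longrightarrow> integral {0..L} (\<lambda>x. sin (real n * pi / L * x) * \<eta> x) = 0"
  shows "negligible {x \<in> {0..L}. \<eta> x \<noteq> 0}"
proof -
  define c where "c = pi / L"
  have c: "c > 0" "c * L = pi" using L by (auto simp: c_def)
  \<comment> \<open>One sine factor is moved into the function, so that orthogonality to sines
    becomes orthogonality to all powers of the cosine, the constant 1 included.\<close>
  define \<xi> where "\<xi> x = sin (c * x) * \<eta> x" for x
  have \<xi>: "\<xi> absolutely_integrable_on {0..L}" unfolding \<xi>_def
    by (intro absolutely_integrable_mult_continuous \<eta> continuous_intros)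
  have abs\<xi>: "(\<lambda>x. \<bar>\<xi> x\<bar>) integrable_on {0..L}" using \<xi> by (simp add: absolutely_integrable_on_def)
  have hi: "(\<lambda>x. h x * \<xi> x) integrable_on {0..L}" if "continuous_on {0..L} h" for h
    using absolutely_integrable_mult_continuous[OF \<xi> that] by (simp add: absolutely_integrable_on_def)
  have pow: "integral {0..L} (\<lambda>x. cos (c * x) ^ n * \<xi> x) = 0" for n
  proof -
    have "integral {0..L} (\<lambda>x. (sin (real 1 * c * x) * cos (c * x) ^ n) * \<eta> x) = 0"
      by (rule integral_sin_cos_power_zero[OF \<eta>]) (use z in \<open>simp add: c_def\<close>)
    then show ?thesis by (simp add: \<xi>_def mult_ac)
  qed
  have cont0: "integral {0..L} (\<lambda>x. h x * \<xi> x) = 0" if h: "continuous_on {0..L} h" for h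
  proof -
    define H where "H y = h (arccos y / c)" for y
    have Hc: "continuous_on {-1..1} H"
      unfolding H_def
    proof (intro continuous_on_compose2[OF h] continuous_intros)
      show "(\<lambda>y. arccos y / c) ` {-1..1} \<subseteq> {0..L}"
        using c arccos_bounded L by (auto simp: pos_divide_le_eq mult.commute intro!: divide_nonneg_nonneg arccos_lbound arccos_ubound)
    qed (use c in auto)
    have hH: "h x = H (cos (c * x))" if "x \<in> {0..L}" for x
    proof -
      have "c * x \<le> pi" using that c by (metis atLeastAtMost_iff less_imp_le mult_left_mono)
      then show ?thesis using that c by (simp add: H_def arccos_cos)
    qed
    have "\<bar>integral {0..L} (\<lambda>x. h x * \<xi> x)\<bar> \<le> e * integral {0..L} (\<lambda>x. \<bar>\<xi> x\<bar>)" if e: "e > 0" for e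
    proof -
      obtain q where "real_polynomial_function q" and q: "\<And>y. y \<in> {-1..1} \<Longrightarrow> \<bar>H y - q y\<bar> < e"
        using Stone_Weierstrass_real_polynomial_function[OF _ Hc e] by auto
      then obtain a n where qa: "q = (\<lambda>y. \<Sum>i\<le>n. a i * y ^ i)" by (auto simp: real_polynomial_function_iff_sum)
      have "integral {0..L} (\<lambda>x. q (cos (c * x)) * \<xi> x) = integral {0..L} (\<lambda>x. \<Sum>i\<le>n. a i * (cos (c * x) ^ i * \<xi> x))"
        unfolding qa by (simp add: sum_distrib_right mult.assoc)
      also have "\<dots> = (\<Sum>i\<le>n. integral {0..L} (\<lambda>x. a i * (cos (c * x) ^ i * \<xi> x)))"
        by (intro integral_sum integrable_on_mult_right hi continuous_intros) auto
      also have "\<dots> = 0" using pow by simp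
      finally have q0: "integral {0..L} (\<lambda>x. q (cos (c * x)) * \<xi> x) = 0" .
      have qi: "(\<lambda>x. q (cos (c * x)) * \<xi> x) integrable_on {0..L}"
        unfolding qa by (intro hi continuous_intros)
      have "norm (integral {0..L} (\<lambda>x. h x * \<xi> x - q (cos (c * x)) * \<xi> x)) \<le> integral {0..L} (\<lambda>x. e * \<bar>\<xi> x\<bar>)"
      proof (rule Henstock_Kurzweil_Integration.integral_norm_bound_integral)
        show "(\<lambda>x. h x * \<xi> x - q (cos (c * x)) * \<xi> x) integrable_on {0..L}" using hi[OF h] qi by (rule integrable_diff)
        show "(\<lambda>x. e * \<bar>\<xi> x\<bar>) integrable_on {0..L}" using abs\<xi> by (rule integrable_on_mult_right)
        fix x assume x: "x \<in> {0..L}"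
        have "\<bar>h x - q (cos (c * x))\<bar> \<le> e" using hH[OF x] q[of "cos (c * x)"] by simp
        then have "\<bar>h x - q (cos (c * x))\<bar> * \<bar>\<xi> x\<bar> \<le> e * \<bar>\<xi> x\<bar>" by (rule mult_right_mono) simp
        then show "norm (h x * \<xi> x - q (cos (c * x)) * \<xi> x) \<le> e * \<bar>\<xi> x\<bar>"
          by (simp add: left_diff_distrib[symmetric] abs_mult)
      qed
      then show ?thesis using q0 by (simp add: integral_diff[OF hi[OF h] qi])
    qed
    then have le: "\<bar>integral {0..L} (\<lambda>x. h x * \<xi> x)\<bar> \<le> e * integral {0..L} (\<lambda>x. \<bar>\<xi> x\<bar>)" if "e > 0" for e
      using that by blast
    have nn: "integral {0..L} (\<lambda>x. \<bar>\<xi> x\<bar>) \<ge> 0" by (intro integral_nonneg abs\<xi>) auto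
    have "\<bar>integral {0..L} (\<lambda>x. h x * \<xi> x)\<bar> \<le> 0"
    proof (rule field_le_epsilon)
      fix e :: real assume e: "e > 0"
      define I where "I = integral {0..L} (\<lambda>x. \<bar>\<xi> x\<bar>)"
      have I: "I \<ge> 0" using nn by (simp add: I_def)
      have "\<bar>integral {0..L} (\<lambda>x. h x * \<xi> x)\<bar> \<le> e / (I + 1) * I"
        unfolding I_def using e I by (intro le) (simp add: I_def)
      also have "\<dots> \<le> e" using e I by (simp add: field_simps)
      finally show "\<bar>integral {0..L} (\<lambda>x. h x * \<xi> x)\<bar> \<le> 0 + e" by simp
    qed
    then show ?thesis by simp
  qed
  \<comment> \<open>Continuous approximations of sgn \<xi>, clipped to [-1,1], are orthogonal to
    \<xi>; dominated convergence turns this into a vanishing integral of the absolute value of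
    \<xi>.\<close>
  have "(\<lambda>x. sgn (\<xi> x)) \<in> borel_measurable (lebesgue_on {0..L})"
    using \<xi> by (auto simp: absolutely_integrable_measurable_real)
  then have "(\<lambda>x. sgn (\<xi> x)) measurable_on {0..L}" by (simp add: measurable_on_iff_borel_measurable)
  then obtain N g where N: "negligible N" and gc: "\<And>n. continuous_on UNIV (g n)"
    and g: "\<And>x. x \<notin> N \<Longrightarrow> (\<lambda>n. g n x) \<longlonglongrightarrow> (if x \<in> {0..L} then sgn (\<xi> x) else 0)"
    unfolding measurable_on_def by blast
  define k where "k n x = max (-1) (min 1 (g n x))" for n x
  have kc: "continuous_on A (k n)" for A n unfolding k_def
    by (intro continuous_intros continuous_on_subset[OF gc]) auto
  define \<xi>' where "\<xi>' x = (if x \<in> N then 0 else \<xi> x)" for x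
  have spike: "integral {0..L} (\<lambda>x. h x * \<xi>' x) = integral {0..L} (\<lambda>x. h x * \<xi> x)" for h
    by (rule integral_spike[OF N]) (auto simp: \<xi>'_def)
  have "(\<lambda>n. integral {0..L} (\<lambda>x. k n x * \<xi>' x)) \<longlonglongrightarrow> integral {0..L} (\<lambda>x. \<bar>\<xi>' x\<bar>)"
  proof (rule dominated_convergence(2))
    show "(\<lambda>x. k n x * \<xi>' x) integrable_on {0..L}" for n
      using hi[OF kc] by (rule integrable_spike[OF _ N]) (auto simp: \<xi>'_def)
    show "(\<lambda>x. \<bar>\<xi> x\<bar>) integrable_on {0..L}" by (rule abs\<xi>)
    fix x assume x: "x \<in> {0..L}"
    show "norm (k n x * \<xi>' x) \<le> \<bar>\<xi> x\<bar>" for n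
    proof -
      have "\<bar>k n x\<bar> * \<bar>\<xi>' x\<bar> \<le> 1 * \<bar>\<xi> x\<bar>" by (intro mult_mono) (auto simp: k_def \<xi>'_def)
      then show ?thesis by (simp add: abs_mult)
    qed
    show "(\<lambda>n. k n x * \<xi>' x) \<longlonglongrightarrow> \<bar>\<xi>' x\<bar>"
    proof (cases "x \<in> N")
      case False
      then have "(\<lambda>n. g n x) \<longlonglongrightarrow> sgn (\<xi> x)" using g[of x] x by simp
      then have "(\<lambda>n. k n x * \<xi>' x) \<longlonglongrightarrow> max (-1) (min 1 (sgn (\<xi> x))) * \<xi>' x"
        unfolding k_def by (intro tendsto_intros)
      also have "max (-1) (min 1 (sgn (\<xi> x))) * \<xi>' x = \<bar>\<xi>' x\<bar>" using False by (auto simp: \<xi>'_def sgn_if)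
      finally show ?thesis .
    qed (simp add: \<xi>'_def)
  qed
  moreover have "integral {0..L} (\<lambda>x. k n x * \<xi>' x) = 0" for n using spike[of "k n"] cont0[OF kc] by simp
  ultimately have "integral {0..L} (\<lambda>x. \<bar>\<xi>' x\<bar>) = 0" by (simp add: LIMSEQ_const_iff)
  moreover have "integral {0..L} (\<lambda>x. \<bar>\<xi>' x\<bar>) = integral {0..L} (\<lambda>x. \<bar>\<xi> x\<bar>)"
    by (rule integral_spike[OF N]) (auto simp: \<xi>'_def)
  ultimately have I0: "integral {0..L} (\<lambda>x. \<bar>\<xi> x\<bar>) = 0" by simp
  have ai: "(\<lambda>x. \<bar>\<xi> x\<bar>) absolutely_integrable_on {0..L}" using \<xi> by (simp add: absolutely_integrable_on_def)
  then have "integral\<^sup>L (lebesgue_on {0..L}) (\<lambda>x. \<bar>\<xi> x\<bar>) = 0"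
    using I0 by (simp add: lebesgue_integral_eq_integral absolutely_integrable_imp_integrable)
  then have "AE x in lebesgue_on {0..L}. \<bar>\<xi> x\<bar> = 0"
    using ai by (subst (asm) integral_nonneg_eq_0_iff_AE) (auto simp: absolutely_integrable_imp_integrable)
  then have "AE x in lebesgue. x \<in> {0..L} \<longrightarrow> \<xi> x = 0"
    by (subst (asm) AE_restrict_space_iff) auto
  then have "negligible {x. \<not> (x \<in> {0..L} \<longrightarrow> \<xi> x = 0)}"
    by (simp add: completion.AE_iff_null_sets negligible_iff_null_sets)
  \<comment> \<open>The sine factor is positive in the interior, so only the two endpoints are lost
    in passing from \<xi> back to \<eta>.\<close>
  then have "negligible ({x. \<not> (x \<in> {0..L} \<longrightarrow> \<xi> x = 0)} \<union> {0, L})" by (intro negligible_Un) auto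
  then show ?thesis
  proof (rule negligible_subset)
    show "{x \<in> {0..L}. \<eta> x \<noteq> 0} \<subseteq> {x. \<not> (x \<in> {0..L} \<longrightarrow> \<xi> x = 0)} \<union> {0, L}"
    proof
      fix x assume x: "x \<in> {x \<in> {0..L}. \<eta> x \<noteq> 0}"
      show "x \<in> {x. \<not> (x \<in> {0..L} \<longrightarrow> \<xi> x = 0)} \<union> {0, L}"
      proof (cases "x \<in> {0, L}")
        case False
        then have "c * x > 0" "c * x < pi" using x c by (auto simp: mult_strict_left_mono[of x L c, unfolded c(2)])
        then have "sin (c * x) > 0" by (rule sin_gt_zero)
        then show ?thesis using x by (simp add: \<xi>_def)
      qed auto
    qed
  qed
qed

section \<open>Fejer means and summation by parts\<close>

text \<open>The sum of the first n Dirichlet kernels, that is, n times the Fejer kernel.\<close>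

definition fejer :: "nat \<Rightarrow> real \<Rightarrow> real" where
  "fejer n \<theta> = (\<Sum>j<n. 1 + 2 * (\<Sum>k<j. cos (real (Suc k) * \<theta>)))"

text \<open>The right-hand side is the squared modulus of the sum of exp(i k \<theta>) over k < n;
  its purpose is the nonnegativity of the kernel.\<close>

lemma fejer_eq: "fejer n \<theta> = (\<Sum>k<n. cos (real k * \<theta>))\<^sup>2 + (\<Sum>k<n. sin (real k * \<theta>))\<^sup>2"
proof (induction n)
  case (Suc n)
  define C S where "C = (\<Sum>k<n. cos (real k * \<theta>))" and "S = (\<Sum>k<n. sin (real k * \<theta>))"
  have "(\<Sum>k<n. cos (real (Suc k) * \<theta>)) = (\<Sum>k<n. cos (real (Suc (n - Suc k)) * \<theta>))"
    by (rule sum.nat_diff_reindex[symmetric])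
  also have "\<dots> = (\<Sum>k<n. cos (real n * \<theta>) * cos (real k * \<theta>) + sin (real n * \<theta>) * sin (real k * \<theta>))"
  proof (rule sum.cong)
    fix k assume "k \<in> {..<n}"
    then have "real (Suc (n - Suc k)) * \<theta> = real n * \<theta> - real k * \<theta>"
      by (simp add: of_nat_diff algebra_simps Suc_diff_Suc)
    then show "cos (real (Suc (n - Suc k)) * \<theta>) = cos (real n * \<theta>) * cos (real k * \<theta>) + sin (real n * \<theta>) * sin (real k * \<theta>)"
      by (simp only: cos_diff)
  qed simp
  also have "\<dots> = cos (real n * \<theta>) * C + sin (real n * \<theta>) * S"
    by (simp add: C_def S_def sum.distrib sum_distrib_left)
  finally have "fejer (Suc n) \<theta> = C\<^sup>2 + S\<^sup>2 + (1 + 2 * (cos (real n * \<theta>) * C + sin (real n * \<theta>) * S))"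
    using Suc by (simp add: fejer_def C_def S_def)
  also have "\<dots> = (C + cos (real n * \<theta>))\<^sup>2 + (S + sin (real n * \<theta>))\<^sup>2"
    by (simp add: power2_sum algebra_simps)
  finally show ?case by (simp add: C_def S_def)
qed (simp add: fejer_def)

lemma fejer_nonneg: "fejer n \<theta> \<ge> 0"
  by (simp add: fejer_eq)

lemma has_integral_cos:
  assumes L: "L > 0" and k: "k \<ge> 1"
  shows "((\<lambda>y. cos (real k * pi / L * y)) has_integral 0) {0..L}"
proof -
  define \<omega> where "\<omega> = real k * pi / L"
  have \<omega>: "\<omega> > 0" "\<omega> * L = real k * pi" using L k by (auto simp: \<omega>_def)
  have "((\<lambda>y. cos (\<omega> * y)) has_integral (sin (\<omega> * L) / \<omega> - sin (\<omega> * 0) / \<omega>)) {0..L}"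
  proof (rule fundamental_theorem_of_calculus)
    show "((\<lambda>x. sin (\<omega> * x) / \<omega>) has_vector_derivative cos (\<omega> * x)) (at x within {0..L})" for x
      unfolding has_real_derivative_iff_has_vector_derivative[symmetric]
      using \<omega> by (auto intro!: derivative_eq_intros)
  qed (use L in auto)
  then show ?thesis using \<omega> by (simp add: \<omega>_def[symmetric] sin_npi)
qed

text \<open>The sum of partial sums has a kernel that is a multiple of the difference of two Fejer
  kernels, at x - y and x + y. It is dominated by their sum \<open>R\<close>, in whose integral all
  cosines drop out; the mass 2 L n does not depend on x.\<close>

lemma fejer_sine_bound:
  fixes g :: "real \<Rightarrow> real"
  assumes L: "L > 0" and B: "\<And>y. y \<in> {0..L} \<Longrightarrow> \<bar>g y\<bar> \<le> B"
    and gi: "\<And>k::nat. k \<ge> 1 \<Longrightarrow> (\<lambda>y. g y * sin (real k * pi / L * y)) integrable_on {0..L}"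
  shows "\<bar>\<Sum>j<n. \<Sum>k<j. 2 / L * integral {0..L} (\<lambda>y. g y * sin (real (Suc k) * pi / L * y)) * sin (real (Suc k) * pi / L * x)\<bar> \<le> real n * B"
proof -
  have B0: "B \<ge> 0" using B[of 0] L by simp
  define P where "P y = (\<Sum>j<n. \<Sum>k<j. sin (real (Suc k) * pi / L * x) * sin (real (Suc k) * pi / L * y))" for y
  define R where "R y = fejer n (pi / L * x - pi / L * y) + fejer n (pi / L * x + pi / L * y)" for y
  have P: "4 * P y = fejer n (pi / L * x - pi / L * y) - fejer n (pi / L * x + pi / L * y)" for y
  proof -
    have "4 * (\<Sum>k<j. sin (real (Suc k) * pi / L * x) * sin (real (Suc k) * pi / L * y)) =
      (1 + 2 * (\<Sum>k<j. cos (real (Suc k) * (pi / L * x - pi / L * y)))) - (1 + 2 * (\<Sum>k<j. cos (real (Suc k) * (pi / L * x + pi / L * y))))" for j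
    proof -
      have "2 * (sin (real (Suc k) * pi / L * x) * sin (real (Suc k) * pi / L * y)) =
        cos (real (Suc k) * (pi / L * x - pi / L * y)) - cos (real (Suc k) * (pi / L * x + pi / L * y))" for k
      proof -
        have "cos (real (Suc k) * (pi / L * x - pi / L * y)) = cos (real (Suc k) * pi / L * x - real (Suc k) * pi / L * y)"
          "cos (real (Suc k) * (pi / L * x + pi / L * y)) = cos (real (Suc k) * pi / L * x + real (Suc k) * pi / L * y)"
          by (simp_all add: algebra_simps)
        then show ?thesis by (simp only: cos_add cos_diff)
      qed
      then have "2 * (\<Sum>k<j. 2 * (sin (real (Suc k) * pi / L * x) * sin (real (Suc k) * pi / L * y))) =
        2 * (\<Sum>k<j. cos (real (Suc k) * (pi / L * x - pi / L * y)) - cos (real (Suc k) * (pi / L * x + pi / L * y)))"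
        by presburger
      moreover have "4 * a = (1 + 2 * b) - (1 + 2 * c)" if "2 * (2 * a) = 2 * (b - c)" for a b c :: real
        using that by simp
      ultimately show ?thesis by (simp only: sum_subtractf sum_distrib_left[symmetric])
    qed
    then show ?thesis unfolding P_def fejer_def sum_distrib_left[of 4] by (simp only: sum_subtractf)
  qed
  have R: "(R has_integral (2 * L * real n)) {0..L}"
  proof -
    have eqR: "R y = (\<Sum>j<n. 2 + (\<Sum>k<j. 4 * cos (real (Suc k) * pi / L * x) * cos (real (Suc k) * pi / L * y)))" for y
    proof -
      have "cos (real (Suc k) * (pi / L * x - pi / L * y)) + cos (real (Suc k) * (pi / L * x + pi / L * y))
          = 2 * cos (real (Suc k) * pi / L * x) * cos (real (Suc k) * pi / L * y)" for k
      proof -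
        have "cos (real (Suc k) * (pi / L * x - pi / L * y)) = cos (real (Suc k) * pi / L * x - real (Suc k) * pi / L * y)"
          "cos (real (Suc k) * (pi / L * x + pi / L * y)) = cos (real (Suc k) * pi / L * x + real (Suc k) * pi / L * y)"
          by (simp_all add: algebra_simps)
        then show ?thesis by (simp only: cos_add cos_diff)
      qed
      then have "2 * (\<Sum>k<j. cos (real (Suc k) * (pi / L * x - pi / L * y))) + 2 * (\<Sum>k<j. cos (real (Suc k) * (pi / L * x + pi / L * y)))
        = (\<Sum>k<j. 4 * cos (real (Suc k) * pi / L * x) * cos (real (Suc k) * pi / L * y))" for j
        unfolding distrib_left[symmetric] sum.distrib[symmetric] sum_distrib_left by (simp add: mult.assoc del: of_nat_Suc)
      then have "(1 + 2 * (\<Sum>k<j. cos (real (Suc k) * (pi / L * x - pi / L * y)))) + (1 + 2 * (\<Sum>k<j. cos (real (Suc k) * (pi / L * x + pi / L * y))))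
        = 2 + (\<Sum>k<j. 4 * cos (real (Suc k) * pi / L * x) * cos (real (Suc k) * pi / L * y))" for j
        by (smt (verit))
      then show ?thesis unfolding R_def fejer_def sum.distrib[symmetric] by (simp only:)
    qed
    have "((\<lambda>y. \<Sum>j<n. 2 + (\<Sum>k<j. 4 * cos (real (Suc k) * pi / L * x) * cos (real (Suc k) * pi / L * y))) has_integral
      (\<Sum>j<n. 2 * L + (\<Sum>k<j. 4 * cos (real (Suc k) * pi / L * x) * 0))) {0..L}"
      using L has_integral_const_real[of "2::real" 0 L]
      by (intro has_integral_sum has_integral_add has_integral_mult_right has_integral_cos) (auto simp: mult.commute)
    then have "(R has_integral (\<Sum>j<n. 2 * L + (\<Sum>k<j. 4 * cos (real (Suc k) * pi / L * x) * 0))) {0..L}"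
      by (rule has_integral_eq[rotated]) (simp only: eqR)
    then show ?thesis by (simp add: mult_ac)
  qed
  have gP: "((\<lambda>y. g y * P y) has_integral (\<Sum>j<n. \<Sum>k<j. sin (real (Suc k) * pi / L * x) *
     integral {0..L} (\<lambda>y. g y * sin (real (Suc k) * pi / L * y)))) {0..L}"
  proof -
    have "g y * P y = (\<Sum>j<n. \<Sum>k<j. sin (real (Suc k) * pi / L * x) * (g y * sin (real (Suc k) * pi / L * y)))" for y
      unfolding P_def sum_distrib_left by (simp only: mult_ac)
    then show ?thesis
      by (simp only:) (intro has_integral_sum has_integral_mult_right integrable_integral gi; simp)
  qed
  have "norm (integral {0..L} (\<lambda>y. g y * P y)) \<le> integral {0..L} (\<lambda>y. B / 4 * R y)"
  proof (rule Henstock_Kurzweil_Integration.integral_norm_bound_integral)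
    show "(\<lambda>y. g y * P y) integrable_on {0..L}" using gP by (rule has_integral_integrable)
    show "(\<lambda>y. B / 4 * R y) integrable_on {0..L}"
      using R by (intro integrable_on_mult_right has_integral_integrable)
    fix y assume y: "y \<in> {0..L}"
    have "\<bar>4 * P y\<bar> \<le> R y" unfolding P R_def using fejer_nonneg[of n "pi / L * x - pi / L * y"] fejer_nonneg[of n "pi / L * x + pi / L * y"]
      by linarith
    then have "\<bar>P y\<bar> \<le> R y / 4" by simp
    then have "\<bar>g y\<bar> * \<bar>P y\<bar> \<le> B * (R y / 4)" using B[OF y] B0 by (intro mult_mono) auto
    then show "norm (g y * P y) \<le> B / 4 * R y" by (simp add: abs_mult)
  qed
  also have "\<dots> = B / 4 * (2 * L * real n)"
    using has_integral_mult_right[OF R, of "B / 4"] by (rule integral_unique)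
  finally have "\<bar>integral {0..L} (\<lambda>y. g y * P y)\<bar> \<le> B * L * real n / 2" by simp
  then have "2 / L * \<bar>integral {0..L} (\<lambda>y. g y * P y)\<bar> \<le> 2 / L * (B * L * real n / 2)"
    using L by (intro mult_left_mono) auto
  also have "\<dots> = real n * B" using L by simp
  finally have "\<bar>2 / L * integral {0..L} (\<lambda>y. g y * P y)\<bar> \<le> real n * B" using L by (simp add: abs_mult)
  also have "2 / L * integral {0..L} (\<lambda>y. g y * P y) = (\<Sum>j<n. \<Sum>k<j. 2 / L * integral {0..L} (\<lambda>y. g y * sin (real (Suc k) * pi / L * y)) * sin (real (Suc k) * pi / L * x))"
    unfolding integral_unique[OF gP] sum_distrib_left by (simp only: mult_ac)
  finally show ?thesis .
qed

section \<open>Double summation by parts\<close>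

lemma summation_by_parts_twice:
  fixes m a :: "nat \<Rightarrow> real"
  defines "s j \<equiv> \<Sum>k<j. a k" and "S n \<equiv> \<Sum>j<n. \<Sum>k<j. a k"
  shows "(\<Sum>k<N. m k * a k) = m N * s N + (m N - m (Suc N)) * S (Suc N)
     + (\<Sum>k<N. (m k - 2 * m (Suc k) + m (Suc (Suc k))) * S (Suc (Suc k)))"
proof (induction N)
  case 0
  show ?case by (simp add: s_def S_def)
next
  case (Suc N)
  have "s (Suc N) = s N + a N" "S (Suc (Suc N)) = S (Suc N) + s (Suc N)" "S (Suc (Suc (Suc N))) = S (Suc (Suc N)) + s (Suc (Suc N))"
    by (simp_all add: s_def S_def)
  then show ?case using Suc by (simp add: algebra_simps)
qed

text \<open>The sums of the a k are O(k), so decay of order 1/k^2 makes the boundary terms vanish in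
  the limit. The constant \<open>A\<close> is absent from the conclusion; this is essential, since
  it will blow up as h tends to 0 while \<open>V\<close> stays fixed.\<close>

lemma abel_bound:
  fixes m a :: "nat \<Rightarrow> real"
  assumes S: "\<And>n. \<bar>\<Sum>j<n. \<Sum>k<j. a k\<bar> \<le> real n * B"
    and m: "\<And>k. \<bar>m k\<bar> \<le> A / (real (Suc k))\<^sup>2"
    and V: "\<And>N. (\<Sum>k<N. real (Suc (Suc k)) * \<bar>m k - 2 * m (Suc k) + m (Suc (Suc k))\<bar>) \<le> V"
    and sum: "summable (\<lambda>k. m k * a k)"
  shows "\<bar>\<Sum>k. m k * a k\<bar> \<le> B * V"
proof -
  define S where "S n = (\<Sum>j<n. \<Sum>k<j. a k)" for n
  define s where "s j = (\<Sum>k<j. a k)" for j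
  have B0: "B \<ge> 0" using S[of 1] by simp
  have A0: "A \<ge> 0" using order.trans[OF abs_ge_zero m[of 0]] by simp
  have SB: "\<bar>S n\<bar> \<le> real n * B" for n using S by (simp add: S_def)
  have s: "\<bar>s n\<bar> \<le> 2 * real (Suc n) * B" for n
  proof -
    have "s n = S (Suc n) - S n" by (simp add: s_def S_def)
    then have "\<bar>s n\<bar> \<le> real (Suc n) * B + real n * B" using SB[of "Suc n"] SB[of n] by linarith
    also have "\<dots> \<le> 2 * real (Suc n) * B" using B0 by (simp add: algebra_simps)
    finally show ?thesis .
  qed
  have bd: "\<bar>\<Sum>k<N. m k * a k\<bar> \<le> 4 * A * B * (1 / real (Suc N)) + B * V" for N
  proof -
    have "\<bar>m N * s N\<bar> \<le> A / (real (Suc N))\<^sup>2 * (2 * real (Suc N) * B)"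
      unfolding abs_mult using A0 by (intro mult_mono m s) auto
    also have "\<dots> = 2 * A * B * (1 / real (Suc N))" by (simp add: power2_eq_square field_simps del: of_nat_Suc)
    finally have 1: "\<bar>m N * s N\<bar> \<le> 2 * A * B * (1 / real (Suc N))" .
    have "A / (real (Suc (Suc N)))\<^sup>2 \<le> A / (real (Suc N))\<^sup>2"
      using A0 by (intro divide_left_mono power_mono) auto
    then have "\<bar>m N - m (Suc N)\<bar> \<le> 2 * (A / (real (Suc N))\<^sup>2)" using m[of N] m[of "Suc N"] by linarith
    then have "\<bar>(m N - m (Suc N)) * S (Suc N)\<bar> \<le> 2 * (A / (real (Suc N))\<^sup>2) * (real (Suc N) * B)"
      unfolding abs_mult using A0 by (intro mult_mono SB) auto
    also have "\<dots> = 2 * A * B * (1 / real (Suc N))" by (simp add: power2_eq_square field_simps del: of_nat_Suc)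
    finally have 2: "\<bar>(m N - m (Suc N)) * S (Suc N)\<bar> \<le> 2 * A * B * (1 / real (Suc N))" .
    have "\<bar>\<Sum>k<N. (m k - 2 * m (Suc k) + m (Suc (Suc k))) * S (Suc (Suc k))\<bar> \<le>
       (\<Sum>k<N. \<bar>(m k - 2 * m (Suc k) + m (Suc (Suc k))) * S (Suc (Suc k))\<bar>)" by (rule sum_abs)
    also have "\<dots> \<le> (\<Sum>k<N. \<bar>m k - 2 * m (Suc k) + m (Suc (Suc k))\<bar> * (real (Suc (Suc k)) * B))"
      unfolding abs_mult by (intro sum_mono mult_left_mono SB) auto
    also have "\<dots> = B * (\<Sum>k<N. real (Suc (Suc k)) * \<bar>m k - 2 * m (Suc k) + m (Suc (Suc k))\<bar>)"
      by (simp only: sum_distrib_left mult_ac)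
    also have "\<dots> \<le> B * V" by (intro mult_left_mono V B0)
    finally have 3: "\<bar>\<Sum>k<N. (m k - 2 * m (Suc k) + m (Suc (Suc k))) * S (Suc (Suc k))\<bar> \<le> B * V" .
    show ?thesis
      using 1 2 3 summation_by_parts_twice[where N = N and m = m and a = a] unfolding s_def S_def by linarith
  qed
  have "(\<lambda>N. \<bar>\<Sum>k<N. m k * a k\<bar>) \<longlonglongrightarrow> \<bar>\<Sum>k. m k * a k\<bar>"
    using sum by (intro tendsto_rabs summable_LIMSEQ)
  moreover have "(\<lambda>N. 4 * A * B * (1 / real (Suc N)) + B * V) \<longlonglongrightarrow> 4 * A * B * 0 + B * V"
    using LIMSEQ_inverse_real_of_nat unfolding inverse_eq_divide by (intro tendsto_intros)
  ultimately have "\<bar>\<Sum>k. m k * a k\<bar> \<le> 4 * A * B * 0 + B * V"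
    by (rule LIMSEQ_le) (use bd in blast)
  then show ?thesis by simp
qed

text \<open>The mean value theorem twice: for u \<mapsto> M(u + 1) - M(u), then for
  \<open>M1\<close>.\<close>

lemma second_difference_bound:
  fixes M M1 M2 :: "real \<Rightarrow> real"
  assumes M1: "\<And>u. u \<in> {x..x+2} \<Longrightarrow> (M has_real_derivative M1 u) (at u)"
    and M2: "\<And>u. u \<in> {x..x+2} \<Longrightarrow> (M1 has_real_derivative M2 u) (at u)"
    and S: "\<And>u. u \<in> {x..x+2} \<Longrightarrow> \<bar>M2 u\<bar> \<le> S"
  shows "\<bar>M x - 2 * M (x + 1) + M (x + 2)\<bar> \<le> S"
proof -
  have d: "((\<lambda>u. M (u + 1) - M u) has_real_derivative M1 (u + 1) - M1 u) (at u)" if "x \<le> u" "u \<le> x + 1" for u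
    using M1[of u] M1[of "u + 1"] that by (intro DERIV_diff) (auto simp: DERIV_shift[symmetric])
  obtain u where u: "x < u" "u < x + 1"
    "(\<lambda>u. M (u + 1) - M u) (x + 1) - (\<lambda>u. M (u + 1) - M u) x = (x + 1 - x) * (M1 (u + 1) - M1 u)"
    using MVT2[of x "x + 1" "\<lambda>u. M (u + 1) - M u" "\<lambda>u. M1 (u + 1) - M1 u"] d by auto
  obtain v where v: "u < v" "v < u + 1" "M1 (u + 1) - M1 u = (u + 1 - u) * M2 v"
    using MVT2[of u "u + 1" M1 M2] M2 u by auto
  have "M x - 2 * M (x + 1) + M (x + 2) = M2 v" using u(3) v(3) by (simp add: add.assoc)
  then show ?thesis using S[of v] u v by simp
qed

text \<open>Each term is at most the decrement of 1/(1 + c k^2 h) from k to k + 1, and the sum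
  telescopes. Hence the bound is uniform in h.\<close>

lemma resolvent_sum_bound:
  fixes c h :: real
  assumes "c > 0" "h > 0"
  shows "(\<Sum>k<N. real (Suc k) * (c * h) / (1 + c * (real (Suc k))\<^sup>2 * h)\<^sup>2) \<le> 1"
proof -
  define r where "r k = 1 / (1 + c * (real k)\<^sup>2 * h)" for k
  have "real (Suc k) * (c * h) / (1 + c * (real (Suc k))\<^sup>2 * h)\<^sup>2 \<le> r k - r (Suc k)" for k
  proof -
    define P Q where "P = 1 + c * (real k)\<^sup>2 * h" and "Q = 1 + c * (real (Suc k))\<^sup>2 * h"
    have pos: "P > 0" "Q > 0" using assms by (auto simp: P_def Q_def add_pos_nonneg)
    have PQ: "P \<le> Q" using assms unfolding P_def Q_def by (auto intro!: mult_right_mono mult_left_mono power_mono)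
    have QP: "Q - P = (2 * real k + 1) * (c * h)" unfolding P_def Q_def by (simp add: power2_eq_square algebra_simps)
    have "real (Suc k) * (c * h) / Q\<^sup>2 \<le> (2 * real k + 1) * (c * h) / Q\<^sup>2"
      using assms by (intro divide_right_mono mult_right_mono) auto
    also have "\<dots> = (Q - P) / (Q * Q)" by (simp add: QP power2_eq_square)
    also have "\<dots> \<le> (Q - P) / (P * Q)"
      using pos PQ by (intro divide_left_mono mult_right_mono mult_pos_pos) auto
    also have "\<dots> = 1 / P - 1 / Q" using pos by (simp add: field_simps)
    finally show ?thesis by (simp add: r_def P_def Q_def)
  qed
  then have "(\<Sum>k<N. real (Suc k) * (c * h) / (1 + c * (real (Suc k))\<^sup>2 * h)\<^sup>2) \<le> (\<Sum>k<N. r k - r (Suc k))"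
    by (intro sum_mono)
  also have "\<dots> = r 0 - r N" by (rule sum_lessThan_telescope')
  also have "\<dots> \<le> 1" using assms by (simp add: r_def)
  finally show ?thesis .
qed

section \<open>Convolution with a weakly singular source\<close>

lemma has_integral_powr_left:
  fixes c t q :: real
  assumes "q > 0" "c \<le> t"
  shows "((\<lambda>s. (s - c) powr (q - 1)) has_integral ((t - c) powr q / q)) {c..t}"
proof -
  have "((\<lambda>s. (s - c) powr (q - 1)) has_integral ((t - c) powr q / q - (c - c) powr q / q)) {c..t}"
  proof (rule fundamental_theorem_of_calculus_interior)
    show "continuous_on {c..t} (\<lambda>s. (s - c) powr q / q)"
      using assms by (intro continuous_intros continuous_on_powr') auto
    fix s assume "s \<in> {c<..<t}"
    then show "((\<lambda>s. (s - c) powr q / q) has_vector_derivative (s - c) powr (q - 1)) (at s)"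
      unfolding has_real_derivative_iff_has_vector_derivative[symmetric]
      using assms by (auto intro!: derivative_eq_intros)
  qed (use assms in auto)
  then show ?thesis using assms by simp
qed

lemma has_integral_powr_right:
  fixes c t p :: real
  assumes "p > 0" "c \<le> t"
  shows "((\<lambda>s. (t - s) powr (p - 1)) has_integral ((t - c) powr p / p)) {c..t}"
proof -
  have "((\<lambda>s. (t - s) powr (p - 1)) has_integral (- ((t - t) powr p / p) - - ((t - c) powr p / p))) {c..t}"
  proof (rule fundamental_theorem_of_calculus_interior)
    show "continuous_on {c..t} (\<lambda>s. - ((t - s) powr p / p))"
      using assms by (intro continuous_intros continuous_on_powr') auto
    fix s assume "s \<in> {c<..<t}"
    then show "((\<lambda>s. - ((t - s) powr p / p)) has_vector_derivative (t - s) powr (p - 1)) (at s)"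
      unfolding has_real_derivative_iff_has_vector_derivative[symmetric]
      using assms by (auto intro!: derivative_eq_intros)
  qed (use assms in auto)
  then show ?thesis using assms by simp
qed

lemma borel_measurable_imp_lebesgue_on:
  fixes f :: "real \<Rightarrow> real"
  assumes "f \<in> borel_measurable borel"
  shows "f \<in> borel_measurable (lebesgue_on S)"
  using assms by (simp add: measurable_completion measurable_restrict_space1)

text \<open>At distance at least half the interval length from one singularity, the corresponding
  factor is bounded by a power of that half length. This crude split replaces the exact Beta
  value.\<close>

lemma integral_powr_convolution:
  fixes p q c t :: real
  assumes p: "0 < p" "p \<le> 1" and q: "0 < q" "q \<le> 1" and ct: "c < t"
  shows "(\<lambda>s. (t - s) powr (p - 1) * (s - c) powr (q - 1)) integrable_on {c..t}"
    and "integral {c..t} (\<lambda>s. (t - s) powr (p - 1) * (s - c) powr (q - 1)) \<le>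
           (2 / q + 2 / p) * (t - c) powr (p + q - 1)"
proof -
  define h where "h = (t - c) / 2"
  have h: "h > 0" using ct by (simp add: h_def)
  define g where "g s = h powr (p - 1) * (s - c) powr (q - 1) + h powr (q - 1) * (t - s) powr (p - 1)" for s
  have gi: "(g has_integral (h powr (p - 1) * ((t - c) powr q / q) + h powr (q - 1) * ((t - c) powr p / p))) {c..t}"
    unfolding g_def using ct p q
    by (intro has_integral_add has_integral_mult_right has_integral_powr_left has_integral_powr_right) auto
  have le: "norm ((t - s) powr (p - 1) * (s - c) powr (q - 1)) \<le> g s" if s: "s \<in> {c..t}" for s
  proof (cases "t - s \<ge> h")
    case True
    then have "(t - s) powr (p - 1) \<le> h powr (p - 1)" using p h by (intro powr_mono2') auto
    then have "(t - s) powr (p - 1) * (s - c) powr (q - 1) \<le> h powr (p - 1) * (s - c) powr (q - 1)"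
      by (intro mult_right_mono) auto
    then show ?thesis by (simp add: g_def add_increasing2)
  next
    case False
    then have "s - c \<ge> h" by (simp add: h_def field_simps)
    then have "(s - c) powr (q - 1) \<le> h powr (q - 1)" using q h by (intro powr_mono2') auto
    then have "(t - s) powr (p - 1) * (s - c) powr (q - 1) \<le> (t - s) powr (p - 1) * h powr (q - 1)"
      by (intro mult_left_mono) auto
    then show ?thesis by (simp add: g_def add_increasing mult.commute)
  qed
  have "(\<lambda>s. (t - s) powr (p - 1) * (s - c) powr (q - 1)) absolutely_integrable_on {c..t}"
  proof (rule measurable_bounded_by_integrable_imp_absolutely_integrable)
    show "(\<lambda>s. (t - s) powr (p - 1) * (s - c) powr (q - 1)) \<in> borel_measurable (lebesgue_on {c..t})"
      by (intro borel_measurable_imp_lebesgue_on) measurable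
    show "g integrable_on {c..t}" using gi by (rule has_integral_integrable)
  qed (use le in auto)
  then show i: "(\<lambda>s. (t - s) powr (p - 1) * (s - c) powr (q - 1)) integrable_on {c..t}"
    by (simp add: absolutely_integrable_on_def)
  have hp: "h powr (r - 1) \<le> 2 * (t - c) powr (r - 1)" if "0 < r" "r \<le> 1" for r
  proof -
    have "h powr (r - 1) = (t - c) powr (r - 1) * (1 / 2) powr (r - 1)"
      using ct unfolding h_def by (metis (no_types) powr_mult diff_ge_0_iff_ge divide_inverse inverse_eq_divide less_imp_le zero_le_divide_1_iff zero_le_numeral)
    also have half: "(1 / 2 :: real) powr (r - 1) = 2 powr (1 - r)"
      by (simp add: powr_divide powr_minus_divide[of 2 "r - 1", symmetric])
    also have "(t - c) powr (r - 1) * 2 powr (1 - r) \<le> (t - c) powr (r - 1) * 2 powr 1"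
      using that by (intro mult_left_mono powr_mono) auto
    finally show ?thesis by simp
  qed
  have "integral {c..t} (\<lambda>s. (t - s) powr (p - 1) * (s - c) powr (q - 1)) \<le> integral {c..t} g"
    using i gi le by (intro integral_le) (auto simp: has_integral_integrable)
  also have "\<dots> = h powr (p - 1) * ((t - c) powr q / q) + h powr (q - 1) * ((t - c) powr p / p)"
    using gi by (rule integral_unique)
  also have "\<dots> \<le> (2 * (t - c) powr (p - 1)) * ((t - c) powr q / q) + (2 * (t - c) powr (q - 1)) * ((t - c) powr p / p)"
    using hp[OF p] hp[OF q] p q by (intro add_mono mult_right_mono) auto
  also have "\<dots> = (2 / q + 2 / p) * (t - c) powr (p + q - 1)"
    using ct p q by (simp add: powr_add[symmetric] field_simps)
  finally show "integral {c..t} (\<lambda>s. (t - s) powr (p - 1) * (s - c) powr (q - 1)) \<le>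
           (2 / q + 2 / p) * (t - c) powr (p + q - 1)" .
qed

text \<open>The weight controls the time derivative of the source: it is singular at $0$, and at $\tau$ from
  the right only, since \<open>0 powr (\<alpha> - 1) = 0\<close>.\<close>

definition wt :: "real \<Rightarrow> real \<Rightarrow> real \<Rightarrow> real" where
  "wt \<alpha> \<tau> s = 1 + s powr (\<alpha> - 1) + (max 0 (s - \<tau>)) powr (\<alpha> - 1)"

lemma wt_ge_1: "wt \<alpha> \<tau> s \<ge> 1"
  by (simp add: wt_def)

text \<open>Convolution with r^(p-1) improves each singularity by the power p, which is bounded on
  [0, T] and thus harmless. So the weight reproduces itself, which is what lets the estimates pass
  through the convolution.\<close>

lemma wt_convolution:
  fixes p \<alpha> \<tau> T :: real
  assumes p: "0 < p" "p \<le> 1" and \<alpha>: "0 < \<alpha>" "\<alpha> < 1" and \<tau>: "\<tau> > 0" and T: "T > 0"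
  shows "\<exists>C>0. \<forall>t\<in>{0<..T}. (\<lambda>s. (t - s) powr (p - 1) * wt \<alpha> \<tau> s) integrable_on {0..t} \<and>
           integral {0..t} (\<lambda>s. (t - s) powr (p - 1) * wt \<alpha> \<tau> s) \<le> C * wt \<alpha> \<tau> t"
proof -
  define Q where "Q = 2 / \<alpha> + 2 / p"
  have Q: "Q > 0" using p \<alpha> by (simp add: Q_def add_pos_pos)
  define C where "C = T powr p / p + Q * T powr p"
  have C: "C > 0" using p Q T by (simp add: C_def add_pos_pos)
  have Cge: "T powr p / p \<le> C" "Q * T powr p \<le> C" using p Q T by (auto simp: C_def)
  have pow: "Q * r powr (p + \<alpha> - 1) \<le> C * r powr (\<alpha> - 1)" if "0 < r" "r \<le> T" for r
  proof -
    have "r powr (p + \<alpha> - 1) = r powr p * r powr (\<alpha> - 1)" using that by (simp add: powr_add[symmetric] algebra_simps)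
    also have "\<dots> \<le> T powr p * r powr (\<alpha> - 1)" using that p by (intro mult_right_mono powr_mono2) auto
    finally have "Q * r powr (p + \<alpha> - 1) \<le> Q * (T powr p * r powr (\<alpha> - 1))" using Q by (intro mult_left_mono) auto
    also have "\<dots> \<le> C * r powr (\<alpha> - 1)" using Cge by (simp add: mult.assoc[symmetric] mult_right_mono)
    finally show ?thesis .
  qed
  have "(\<lambda>s. (t - s) powr (p - 1) * wt \<alpha> \<tau> s) integrable_on {0..t} \<and>
           integral {0..t} (\<lambda>s. (t - s) powr (p - 1) * wt \<alpha> \<tau> s) \<le> C * wt \<alpha> \<tau> t" if t: "t \<in> {0<..T}" for t
  proof -
    note i1 = has_integral_powr_right[OF p(1), of 0 t]
    have i2: "((\<lambda>s. (t - s) powr (p - 1) * (s - 0) powr (\<alpha> - 1)) has_integral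
        (integral {0..t} (\<lambda>s. (t - s) powr (p - 1) * (s - 0) powr (\<alpha> - 1)))) {0..t}"
      using t p \<alpha> by (intro integrable_integral integral_powr_convolution) auto
    have "\<exists>I. ((\<lambda>s. (t - s) powr (p - 1) * (max 0 (s - \<tau>)) powr (\<alpha> - 1)) has_integral I) {0..t} \<and>
         I \<le> C * (max 0 (t - \<tau>)) powr (\<alpha> - 1)"
    proof (cases "t \<le> \<tau>")
      case True
      then have "((\<lambda>s. (t - s) powr (p - 1) * (max 0 (s - \<tau>)) powr (\<alpha> - 1)) has_integral 0) {0..t}"
        by (intro has_integral_is_0) (auto simp: max_def)
      then show ?thesis using C by (intro exI[of _ 0]) auto
    next
      case False
      define I where "I = integral {\<tau>..t} (\<lambda>s. (t - s) powr (p - 1) * (s - \<tau>) powr (\<alpha> - 1))"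
      have "((\<lambda>s. (t - s) powr (p - 1) * (s - \<tau>) powr (\<alpha> - 1)) has_integral I) {\<tau>..t}"
        unfolding I_def using False p \<alpha> by (intro integrable_integral integral_powr_convolution) auto
      then have "((\<lambda>s. (t - s) powr (p - 1) * (max 0 (s - \<tau>)) powr (\<alpha> - 1)) has_integral I) {\<tau>..t}"
        by (rule has_integral_eq[rotated]) auto
      moreover have "((\<lambda>s. (t - s) powr (p - 1) * (max 0 (s - \<tau>)) powr (\<alpha> - 1)) has_integral 0) {0..\<tau>}"
        by (intro has_integral_is_0) (auto simp: max_def)
      ultimately have "((\<lambda>s. (t - s) powr (p - 1) * (max 0 (s - \<tau>)) powr (\<alpha> - 1)) has_integral (0 + I)) {0..t}"
        using \<tau> False by (intro has_integral_combine[of 0 \<tau> t]) auto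
      then have "((\<lambda>s. (t - s) powr (p - 1) * (max 0 (s - \<tau>)) powr (\<alpha> - 1)) has_integral I) {0..t}"
        by simp
      moreover have "I \<le> Q * (t - \<tau>) powr (p + \<alpha> - 1)"
        unfolding I_def Q_def using False p \<alpha> by (intro integral_powr_convolution) auto
      moreover have "Q * (t - \<tau>) powr (p + \<alpha> - 1) \<le> C * (t - \<tau>) powr (\<alpha> - 1)"
        using False t \<tau> by (intro pow) auto
      ultimately show ?thesis using False by (intro exI[of _ I]) auto
    qed
    then obtain I where i3: "((\<lambda>s. (t - s) powr (p - 1) * (max 0 (s - \<tau>)) powr (\<alpha> - 1)) has_integral I) {0..t}"
      and I: "I \<le> C * (max 0 (t - \<tau>)) powr (\<alpha> - 1)" by blast
    have i: "((\<lambda>s. (t - s) powr (p - 1) * wt \<alpha> \<tau> s) has_integral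
       ((t - 0) powr p / p + integral {0..t} (\<lambda>s. (t - s) powr (p - 1) * (s - 0) powr (\<alpha> - 1)) + I)) {0..t}"
      using has_integral_add[OF has_integral_add[OF i1 i2] i3] t
      by (simp add: wt_def algebra_simps)
    have "(t - 0) powr p / p \<le> C * 1"
      using t p Cge by (auto intro!: order.trans[OF _ Cge(1)] divide_right_mono powr_mono2)
    moreover have "integral {0..t} (\<lambda>s. (t - s) powr (p - 1) * (s - 0) powr (\<alpha> - 1)) \<le> C * t powr (\<alpha> - 1)"
      using integral_powr_convolution(2)[OF p, of \<alpha> 0 t] \<alpha> t pow[of t] unfolding Q_def by auto
    ultimately have "(t - 0) powr p / p + integral {0..t} (\<lambda>s. (t - s) powr (p - 1) * (s - 0) powr (\<alpha> - 1)) + I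
       \<le> C * wt \<alpha> \<tau> t" using I by (simp add: wt_def algebra_simps)
    then show ?thesis using i by (auto simp: has_integral_integrable integral_unique)
  qed
  then show ?thesis using C by blast
qed

lemma wt_integrable:
  assumes "0 < \<alpha>" "\<alpha> < 1" "\<tau> > 0" "t \<ge> 0"
  shows "wt \<alpha> \<tau> integrable_on {0..t}"
proof (cases "t = 0")
  case False
  then obtain C where "(\<lambda>s. (t - s) powr (1 - 1) * wt \<alpha> \<tau> s) integrable_on {0..t}"
    using wt_convolution[of 1 \<alpha> \<tau> t] assms by auto
  \<comment> \<open>For p = 1 the kernel is 1 except at s = t, where
    \<open>0 powr 0 = 0\<close>.\<close>
  then show ?thesis
    by (rule integrable_spike[of _ _ "{t}"]) auto
qed (use integrable_on_refl[of "wt \<alpha> \<tau>" 0] in simp)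

section \<open>Differentiating convolutions with a singular kernel\<close>

lemma has_field_derivative_uniform_limit:
  fixes f :: "nat \<Rightarrow> real \<Rightarrow> real"
  assumes S: "convex S"
    and d: "\<And>n x. x \<in> S \<Longrightarrow> (f n has_real_derivative f' n x) (at x within S)"
    and u: "uniform_limit S f' g' sequentially"
    and l: "\<And>x. x \<in> S \<Longrightarrow> (\<lambda>n. f n x) \<longlonglongrightarrow> g x"
    and x: "x \<in> S"
  shows "(g has_real_derivative g' x) (at x within S)"
proof -
  have "\<exists>h. \<forall>x\<in>S. (\<lambda>n. f n x) \<longlonglongrightarrow> h x \<and> (h has_derivative ((*) (g' x))) (at x within S)"
  proof (rule has_derivative_sequence[where f' = "\<lambda>n x. (*) (f' n x)"])
    show "\<And>n x. x \<in> S \<Longrightarrow> (f n has_derivative ((*) (f' n x))) (at x within S)"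
      using d by (simp add: has_field_derivative_def)
    show "convex S" "x \<in> S" "(\<lambda>n. f n x) \<longlonglongrightarrow> g x" using S x l by auto
    fix e :: real assume "e > 0"
    with u have "\<forall>\<^sub>F n in sequentially. \<forall>x\<in>S. dist (f' n x) (g' x) < e"
      by (auto simp: uniform_limit_iff)
    then show "\<forall>\<^sub>F n in sequentially. \<forall>x\<in>S. \<forall>h. norm (f' n x * h - g' x * h) \<le> e * norm h"
    proof eventually_elim
      case (elim n)
      then show ?case
        by (metis abs_mult dist_real_def left_diff_distrib less_imp_le mult_right_mono norm_ge_zero real_norm_def)
    qed
  qed
  then obtain h where h: "\<forall>x\<in>S. (\<lambda>n. f n x) \<longlonglongrightarrow> h x \<and> (h has_derivative ((*) (g' x))) (at x within S)" by blast
  then have "h y = g y" if "y \<in> S" for y using l[OF that] that LIMSEQ_unique by blast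
  with h x show ?thesis
    unfolding has_field_derivative_def by (metis has_derivative_transform)
qed

lemma convolution_integrable:
  fixes K F :: "real \<Rightarrow> real"
  assumes "continuous_on {0..} K" "continuous_on {0..T} F" "t \<in> {0..T}"
  shows "(\<lambda>s. K (t - s) * F s) integrable_on {0..t}"
  using assms
  by (intro integrable_continuous_real continuous_intros continuous_on_compose2[OF assms(1)]
      continuous_on_subset[OF assms(2)]) auto

text \<open>Subtracting the linear Taylor polynomial of \<open>K\<close> leaves a kernel whose extension by zero to
  negative arguments is still continuously differentiable, so that the integral may be extended to
  the fixed interval \<open>{0..T}\<close>.\<close>

lemma convolution_deriv_smooth:
  fixes K K1 F :: "real \<Rightarrow> real"
  assumes \<delta>: "\<delta> > 0" and K: "\<And>r. r > - \<delta> \<Longrightarrow> (K has_real_derivative K1 r) (at r)"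
    and K1: "continuous_on {- \<delta><..} K1"
    and F: "continuous_on {0..T} F" and t: "t \<in> {0..T}"
  shows "((\<lambda>t. integral {0..t} (\<lambda>s. K (t - s) * F s)) has_real_derivative
            K 0 * F t + integral {0..t} (\<lambda>s. K1 (t - s) * F s)) (at t within {0..T})"
proof -
  define k where "k r = K r - K 0 - K1 0 * r" for r
  define k1 where "k1 r = K1 r - K1 0" for r
  define g where "g r = k (max 0 r)" for r
  define g1 where "g1 r = k1 (max 0 r)" for r
  have k': "(k has_real_derivative k1 r) (at r)" if "r > - \<delta>" for r
    unfolding k_def k1_def using K[OF that] by (auto intro!: derivative_eq_intros)
  have g': "(g has_real_derivative g1 r) (at r)" for r
  proof -
    consider "r > 0" | "r < 0" | "r = 0" by linarith
    then show ?thesis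
    proof cases
      case 1
      have "(g has_real_derivative k1 r) (at r within {0<..})"
        using 1 \<delta> by (intro has_field_derivative_transform_within[OF has_field_derivative_at_within[OF k'], of _ 1])
          (auto simp: g_def)
      then show ?thesis using 1 by (simp add: g1_def at_within_open[of r "{0<..}"])
    next
      case 2
      have "(g has_real_derivative 0) (at r within {..<0})"
        using 2 by (intro has_field_derivative_transform_within[OF DERIV_const[of "k 0"], of 1])
          (auto simp: g_def)
      then show ?thesis using 2 by (simp add: g1_def k1_def at_within_open[of r "{..<0}"])
    next
      case 3
      have "((\<lambda>h. k h / h) \<longlongrightarrow> 0) (at 0)"
        using k'[of 0] \<delta> unfolding has_field_derivative_iff by (simp add: k_def k1_def)
      then have "((\<lambda>h. \<bar>k h / h\<bar>) \<longlongrightarrow> 0) (at 0)" by (rule tendsto_rabs_zero)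
      then have "((\<lambda>h. g h / h) \<longlongrightarrow> 0) (at 0)"
        by (rule Lim_null_comparison[rotated]) (auto simp: g_def max_def k_def divide_le_0_iff intro!: always_eventually)
      then show ?thesis using 3 unfolding has_field_derivative_iff by (simp add: g_def g1_def k_def k1_def)
    qed
  qed
  have g1c: "continuous_on UNIV g1"
    unfolding g1_def k1_def using \<delta>
    by (intro continuous_intros continuous_on_compose2[OF K1]) (auto simp: less_max_iff_disj)
  have gc: "continuous_on UNIV g" using g' by (meson DERIV_isCont continuous_at_imp_continuous_on)
  have D1: "((\<lambda>t. integral (cbox 0 T) (\<lambda>s. g (t - s) * F s)) has_real_derivative
      integral (cbox 0 T) (\<lambda>s. g1 (t - s) * F s)) (at t within {0..T})"
  proof (rule leibniz_rule_field_derivative[where U = "{0..T}" and fx = "\<lambda>t s. g1 (t - s) * F s"])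
    show "((\<lambda>x. g (x - s) * F s) has_real_derivative g1 (x - s) * F s) (at x within {0..T})" for x s
    proof -
      have "((\<lambda>x. x - s) has_real_derivative 1) (at x within {0..T})" by (auto intro!: derivative_eq_intros)
      from DERIV_cmult_right[OF DERIV_chain2[where f = g, OF g' this], of "F s"] show ?thesis by simp
    qed
    show "(\<lambda>s. g (x - s) * F s) integrable_on cbox 0 T" for x
      unfolding cbox_interval
      by (intro integrable_continuous_real continuous_intros continuous_on_compose2[OF gc] F) auto
    show "continuous_on ({0..T} \<times> cbox 0 T) (\<lambda>(x, s). g1 (x - s) * F s)"
      unfolding split_beta
      by (intro continuous_intros continuous_on_compose2[OF g1c] continuous_on_compose2[OF F]) auto
  qed (use t in auto)
  have cut: "integral {0..T} (\<lambda>s. h (t - s) * F s) = integral {0..t} (\<lambda>s. h (t - s) * F s)"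
    if h: "\<And>r. r \<le> 0 \<Longrightarrow> h r = 0" and t: "t \<in> {0..T}" for h t
  proof -
    have "integral {0..t} (\<lambda>s. h (t - s) * F s) = integral ({0..T} \<inter> {0..t}) (\<lambda>s. h (t - s) * F s)"
      using t by (intro arg_cong2[where f = integral]) auto
    also have "\<dots> = integral {0..T} (\<lambda>s. if s \<in> {0..t} then h (t - s) * F s else 0)"
      by (metis (no_types) integral_restrict_Int Int_commute)
    also have "\<dots> = integral {0..T} (\<lambda>s. h (t - s) * F s)"
      using h by (intro integral_cong) (auto simp: not_le)
    finally show ?thesis by simp
  qed
  have z: "g r = 0" "g1 r = 0" if "r \<le> 0" for r using that by (simp_all add: g_def g1_def k_def k1_def)
  have Fi: "F integrable_on {0..t}" "(\<lambda>s. s * F s) integrable_on {0..t}" if "t \<in> {0..T}" for t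
    using that by (auto intro!: integrable_continuous_real continuous_intros continuous_on_subset[OF F])
  have gi: "(\<lambda>s. g (t - s) * F s) integrable_on {0..t}" "(\<lambda>s. g1 (t - s) * F s) integrable_on {0..t}"
    if "t \<in> {0..T}" for t
    using that by (intro convolution_integrable[OF _ F] continuous_on_subset[OF gc] continuous_on_subset[OF g1c], auto)+
  \<comment> \<open>The subtracted polynomial contributes the integrals of F(s) and of (t - s) F(s),
    both differentiable by the fundamental theorem once t is taken out.\<close>
  have W: "integral {0..t} (\<lambda>s. K (t - s) * F s) = integral (cbox 0 T) (\<lambda>s. g (t - s) * F s)
      + K 0 * integral {0..t} F + K1 0 * (t * integral {0..t} F - integral {0..t} (\<lambda>s. s * F s))"
    if t: "t \<in> {0..T}" for t
  proof -
    have "integral {0..t} (\<lambda>s. K (t - s) * F s) =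
       integral {0..t} (\<lambda>s. g (t - s) * F s + K 0 * F s + K1 0 * (t * F s - s * F s))"
      by (intro integral_cong) (simp add: g_def k_def algebra_simps)
    also have "\<dots> = integral {0..t} (\<lambda>s. g (t - s) * F s) + K 0 * integral {0..t} F
        + K1 0 * (t * integral {0..t} F - integral {0..t} (\<lambda>s. s * F s))"
      by (rule integral_unique)
        (intro has_integral_add has_integral_mult_right has_integral_diff integrable_integral Fi[OF t] gi[OF t])
    finally show ?thesis using cut[of g t] z t by simp
  qed
  have D2: "((\<lambda>t. integral {0..t} F) has_real_derivative F t) (at t within {0..T})"
    by (rule integral_has_real_derivative[OF F t])
  have D3: "((\<lambda>t. integral {0..t} (\<lambda>s. s * F s)) has_real_derivative t * F t) (at t within {0..T})"
    by (rule integral_has_real_derivative[OF _ t]) (intro continuous_intros F)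
  have "((\<lambda>t. integral (cbox 0 T) (\<lambda>s. g (t - s) * F s) + K 0 * integral {0..t} F
       + K1 0 * (t * integral {0..t} F - integral {0..t} (\<lambda>s. s * F s))) has_real_derivative
     integral (cbox 0 T) (\<lambda>s. g1 (t - s) * F s) + K 0 * F t + K1 0 * integral {0..t} F) (at t within {0..T})"
    by (rule derivative_eq_intros D1 D2 D3 refl | simp add: algebra_simps)+
  then have "((\<lambda>t. integral {0..t} (\<lambda>s. K (t - s) * F s)) has_real_derivative
     integral (cbox 0 T) (\<lambda>s. g1 (t - s) * F s) + K 0 * F t + K1 0 * integral {0..t} F) (at t within {0..T})"
    by (rule has_field_derivative_transform_within[of _ _ _ _ 1]) (use t W in auto)
  moreover have "integral {0..t} (\<lambda>s. K1 (t - s) * F s) = integral (cbox 0 T) (\<lambda>s. g1 (t - s) * F s) + K1 0 * integral {0..t} F"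
  proof -
    have "integral {0..t} (\<lambda>s. K1 (t - s) * F s) = integral {0..t} (\<lambda>s. g1 (t - s) * F s + K1 0 * F s)"
      by (intro integral_cong) (simp add: g1_def k1_def algebra_simps)
    also have "\<dots> = integral {0..t} (\<lambda>s. g1 (t - s) * F s) + K1 0 * integral {0..t} F"
      by (rule integral_unique)
        (intro has_integral_add has_integral_mult_right integrable_integral Fi[OF t] gi[OF t])
    finally show ?thesis using cut[of g1 t] z t by simp
  qed
  ultimately show ?thesis by (simp add: algebra_simps)
qed

text \<open>Half-open pieces with derivatives relative to the piece: at a break point only the
  derivative from the left is prescribed, since the one from the right may be infinite.\<close>

definition piecewise_deriv :: "real \<Rightarrow> nat \<Rightarrow> (real \<Rightarrow> real) \<Rightarrow> (real \<Rightarrow> real) \<Rightarrow> bool" where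
  "piecewise_deriv \<tau> n F F' \<longleftrightarrow> (\<forall>j<n. \<forall>t\<in>{real j * \<tau><..real (Suc j) * \<tau>}.
     (F has_real_derivative F' t) (at t within {real j * \<tau><..real (Suc j) * \<tau>}))"

lemma piece_cover:
  assumes "\<tau> > 0" "t \<in> {0<..real n * \<tau>}"
  shows "\<exists>j<n. t \<in> {real j * \<tau><..real (Suc j) * \<tau>}"
  using assms(2)
proof (induction n)
  case (Suc n)
  show ?case
  proof (cases "t \<le> real n * \<tau>")
    case True
    then show ?thesis using Suc by (auto simp: less_Suc_eq)
  next
    case False
    then show ?thesis using Suc by (intro exI[of _ n]) auto
  qed
qed (use assms in simp)

lemma piecewise_deriv_interior:
  assumes \<tau>: "\<tau> > 0" and F: "piecewise_deriv \<tau> n F F'"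
    and t: "t \<in> {0<..<real n * \<tau>} - (\<lambda>j. real j * \<tau>) ` {0..n}"
  shows "(F has_real_derivative F' t) (at t)"
proof -
  obtain j where j: "j < n" "t \<in> {real j * \<tau><..real (Suc j) * \<tau>}"
    using piece_cover[OF \<tau>, of t n] t by auto
  then have "t \<noteq> real (Suc j) * \<tau>" using t by (metis DiffE atLeastAtMost_iff imageI le0 less_eq_Suc_le)
  then have t': "t \<in> {real j * \<tau><..<real (Suc j) * \<tau>}" using j by auto
  have "(F has_real_derivative F' t) (at t within {real j * \<tau><..real (Suc j) * \<tau>})"
    using F j unfolding piecewise_deriv_def by blast
  then have "(F has_real_derivative F' t) (at t within {real j * \<tau><..<real (Suc j) * \<tau>})"
    by (rule has_field_derivative_subset) auto
  then show ?thesis using t' by (simp add: at_within_open[of t "{real j * \<tau><..<real (Suc j) * \<tau>}"] del: of_nat_Suc)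
qed

text \<open>The fundamental theorem with finitely many exceptional points, here the break points,
  yields the integrability of the term with \<open>F'\<close> as part of the conclusion.\<close>

lemma convolution_by_parts:
  fixes K K1 F F' :: "real \<Rightarrow> real"
  assumes \<tau>: "\<tau> > 0" and \<delta>: "\<delta> > 0" and K: "\<And>r. r > - \<delta> \<Longrightarrow> (K has_real_derivative K1 r) (at r)"
    and K1: "continuous_on {- \<delta><..} K1"
    and F: "continuous_on {0..real n * \<tau>} F" and F': "piecewise_deriv \<tau> n F F'"
    and t: "t \<in> {0..real n * \<tau>}"
  shows "((\<lambda>s. K (t - s) * F' s) has_integral
     (K 0 * F t - K t * F 0 + integral {0..t} (\<lambda>s. K1 (t - s) * F s))) {0..t}"
proof -
  have Kc: "continuous_on {0..} K"
    using K \<delta> by (intro continuous_at_imp_continuous_on ballI) (meson DERIV_isCont atLeast_iff less_le_trans neg_less_0_iff_less)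
  have "((\<lambda>s. - (K1 (t - s) * F s) + K (t - s) * F' s) has_integral (K (t - t) * F t - K (t - 0) * F 0)) {0..t}"
  proof (rule fundamental_theorem_of_calculus_interior_strong)
    show "finite ((\<lambda>j. real j * \<tau>) ` {0..n})" by simp
    show "continuous_on {0..t} (\<lambda>s. K (t - s) * F s)"
      using t by (intro continuous_intros continuous_on_compose2[OF Kc] continuous_on_subset[OF F]) auto
    fix s assume s: "s \<in> {0<..<t} - (\<lambda>j. real j * \<tau>) ` {0..n}"
    then have d: "(F has_real_derivative F' s) (at s)"
      using t by (intro piecewise_deriv_interior[OF \<tau> F']) auto
    have k: "((\<lambda>s. K (t - s)) has_real_derivative K1 (t - s) * (- 1)) (at s)"
      using s \<delta> by (intro DERIV_chain2[where f = K and g = "\<lambda>s. t - s"] K) (auto intro!: derivative_eq_intros)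
    show "((\<lambda>s. K (t - s) * F s) has_vector_derivative - (K1 (t - s) * F s) + K (t - s) * F' s) (at s)"
      unfolding has_real_derivative_iff_has_vector_derivative[symmetric]
      by (rule derivative_eq_intros d k refl | simp)+
  qed (use t in auto)
  moreover have "((\<lambda>s. K1 (t - s) * F s) has_integral (integral {0..t} (\<lambda>s. K1 (t - s) * F s))) {0..t}"
    using \<delta> by (intro integrable_integral convolution_integrable[OF _ F t] continuous_on_subset[OF K1]) auto
  ultimately have "((\<lambda>s. (- (K1 (t - s) * F s) + K (t - s) * F' s) + K1 (t - s) * F s) has_integral
     (K (t - t) * F t - K (t - 0) * F 0 + integral {0..t} (\<lambda>s. K1 (t - s) * F s))) {0..t}"
    by (rule has_integral_add)
  then show ?thesis by simp
qed

text \<open>The properties of \<open>relax \<alpha> l\<close> for a single l. The constant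
  \<open>A\<close> will be a multiple of l, so this locale serves differentiability only; estimates
  uniform in the index are made in \<open>mild_coefficients\<close>.\<close>

locale relaxation_kernel =
  fixes \<alpha> A :: real and E E1 E2 :: "real \<Rightarrow> real"
  assumes \<alpha>: "0 < \<alpha>" "\<alpha> < 1" and A: "A > 0"
    and E_cont: "continuous_on {0..} E" and E_0: "E 0 = 1"
    and E_deriv: "\<And>t. t > 0 \<Longrightarrow> (E has_real_derivative E1 t) (at t)"
    and E1_deriv: "\<And>t. t > 0 \<Longrightarrow> (E1 has_real_derivative E2 t) (at t)"
    and E2_cont: "continuous_on {0<..} E2"
    and E1_bound: "\<And>t. t > 0 \<Longrightarrow> \<bar>E1 t\<bar> \<le> A * t powr (\<alpha> - 1)"
    and E2_bound: "\<And>t. t > 0 \<Longrightarrow> \<bar>E2 t\<bar> \<le> A * t powr (\<alpha> - 2)"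
    and E1_measurable: "E1 \<in> borel_measurable borel"
begin

text \<open>Interpolation between the mean value bound for \<delta> \<le> r and the trivial bound
  otherwise. Half of the exponent \<alpha> pays for the decay in \<delta>; the other half keeps the
  singularity in r integrable.\<close>

lemma E1_shift_diff:
  assumes "r > 0" "\<delta> > 0"
  shows "\<bar>E1 (r + \<delta>) - E1 r\<bar> \<le> 2 * A * \<delta> powr (\<alpha> / 2) * r powr (\<alpha> / 2 - 1)"
proof -
  have rr: "r powr (\<alpha> - 1) * (\<delta> / r) powr (\<alpha> / 2) = \<delta> powr (\<alpha> / 2) * r powr (\<alpha> / 2 - 1)"
  proof -
    have "r powr (\<alpha> / 2 - 1) = r powr (\<alpha> - 1) / r powr (\<alpha> / 2)"
      using assms by (simp add: powr_diff[symmetric] field_simps)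
    then show ?thesis using assms by (simp add: powr_divide)
  qed
  show ?thesis
  proof (cases "\<delta> \<le> r")
    case True
    obtain z where z: "z > r" "z < r + \<delta>" "E1 (r + \<delta>) - E1 r = (r + \<delta> - r) * E2 z"
      using MVT2[of r "r + \<delta>" E1 E2] E1_deriv assms by auto
    have "\<bar>E1 (r + \<delta>) - E1 r\<bar> = \<delta> * \<bar>E2 z\<bar>" using z assms by (simp add: abs_mult)
    also have "\<dots> \<le> \<delta> * (A * z powr (\<alpha> - 2))" using E2_bound[of z] z assms by (intro mult_left_mono) auto
    also have "\<dots> \<le> \<delta> * (A * r powr (\<alpha> - 2))" using z assms A \<alpha> by (intro mult_left_mono powr_mono2') auto
    also have "\<dots> = A * (r powr (\<alpha> - 1) * (\<delta> / r) powr 1)"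
      using assms by (simp add: powr_diff field_simps power2_eq_square)
    also have "\<dots> \<le> A * (r powr (\<alpha> - 1) * (\<delta> / r) powr (\<alpha> / 2))"
      using A assms True \<alpha> by (intro mult_left_mono powr_mono') auto
    also have "\<dots> \<le> 2 * A * \<delta> powr (\<alpha> / 2) * r powr (\<alpha> / 2 - 1)"
      unfolding rr using A by simp
    finally show ?thesis .
  next
    case False
    have "\<bar>E1 (r + \<delta>) - E1 r\<bar> \<le> A * (r + \<delta>) powr (\<alpha> - 1) + A * r powr (\<alpha> - 1)"
      using E1_bound[of r] E1_bound[of "r + \<delta>"] assms by auto
    also have "(r + \<delta>) powr (\<alpha> - 1) \<le> r powr (\<alpha> - 1)" using assms \<alpha> by (intro powr_mono2') auto
    then have "A * (r + \<delta>) powr (\<alpha> - 1) + A * r powr (\<alpha> - 1) \<le> 2 * A * (r powr (\<alpha> - 1) * 1)"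
      using A by simp
    also have "1 \<le> (\<delta> / r) powr (\<alpha> / 2)" using False assms \<alpha> by (intro ge_one_powr_ge_zero) auto
    then have "2 * A * (r powr (\<alpha> - 1) * 1) \<le> 2 * A * (r powr (\<alpha> - 1) * (\<delta> / r) powr (\<alpha> / 2))"
      using A by (intro mult_left_mono) auto
    finally show ?thesis unfolding rr by (simp add: mult.assoc)
  qed
qed

end

locale relaxation_source = relaxation_kernel +
  fixes \<tau> M T :: real and n :: nat and F F' :: "real \<Rightarrow> real"
  assumes \<tau>: "\<tau> > 0" and T: "T = real n * \<tau>" and n: "n > 0" and M: "M \<ge> 0"
    and F_cont: "continuous_on {0..T} F"
    and F_deriv: "piecewise_deriv \<tau> n F F'"
    and F'_bound: "\<And>t. t \<in> {0<..T} \<Longrightarrow> \<bar>F' t\<bar> \<le> M * wt \<alpha> \<tau> t"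
begin

lemma T_pos: "T > 0" using T n \<tau> by simp

definition J :: "real \<Rightarrow> real" where
  "J t = integral {0..t} (\<lambda>s. E (t - s) * F' s)"

definition Q :: "real \<Rightarrow> real" where
  "Q t = integral {0..t} (\<lambda>s. E1 (t - s) * F' s)"

lemma F'_abs_integrable:
  assumes "t \<in> {0..T}"
  shows "F' absolutely_integrable_on {0..t}"
proof -
  have "(F' has_integral (F t - F 0)) {0..t}"
  proof (rule fundamental_theorem_of_calculus_interior_strong)
    show "finite ((\<lambda>j. real j * \<tau>) ` {0..n})" by simp
    show "continuous_on {0..t} F" using assms by (intro continuous_on_subset[OF F_cont]) auto
    fix s assume "s \<in> {0<..<t} - (\<lambda>j. real j * \<tau>) ` {0..n}"
    then show "(F has_vector_derivative F' s) (at s)"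
      unfolding has_real_derivative_iff_has_vector_derivative[symmetric]
      using assms T by (intro piecewise_deriv_interior[OF \<tau> F_deriv]) auto
  qed (use assms in auto)
  then have "F' integrable_on {0..t}" by (rule has_integral_integrable)
  \<comment> \<open>The added constant covers s = 0, where nothing is assumed about
    \<open>F'\<close>.\<close>
  moreover have "(\<lambda>s. \<bar>F' 0\<bar> + M * wt \<alpha> \<tau> s) integrable_on {0..t}"
    using assms \<tau> \<alpha> by (intro integrable_add integrable_on_mult_right wt_integrable) auto
  moreover have "norm (F' s) \<le> \<bar>F' 0\<bar> + M * wt \<alpha> \<tau> s" if "s \<in> {0..t}" for s
    using F'_bound[of s] that assms M wt_ge_1[of \<alpha> \<tau> s] by (cases "s = 0") auto
  ultimately show ?thesis by (intro absolutely_integrable_integrable_bound)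
qed

lemma F'_measurable: "t \<in> {0..T} \<Longrightarrow> F' \<in> borel_measurable (lebesgue_on {0..t})"
  using F'_abs_integrable by (simp add: absolutely_integrable_measurable_real)

lemma kernel_F'_abs_integrable:
  assumes t: "t \<in> {0..T}" and k: "k \<in> borel_measurable borel" and p: "0 < p" "p \<le> 1" and B: "B \<ge> 0"
    and kb: "\<And>r. r \<in> {0<..T} \<Longrightarrow> \<bar>k r\<bar> \<le> B * r powr (p - 1)"
  shows "(\<lambda>s. k (t - s) * F' s) absolutely_integrable_on {0..t}"
proof (cases "t = 0")
  case True
  have "f integrable_on {0}" for f :: "real \<Rightarrow> real" using integrable_on_refl[of f 0] by simp
  then show ?thesis unfolding absolutely_integrable_on_def using True by simp
next
  case False
  then have t': "t \<in> {0<..T}" using t by simp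
  \<comment> \<open>The bounds say nothing about \<open>F'\<close> at s = 0 or about
    \<open>k\<close> at 0, that is, at s = t; the majorant is corrected at these two points.\<close>
  define g where "g s = B * M * ((t - s) powr (p - 1) * wt \<alpha> \<tau> s) +
     (if s \<in> {0, t} then \<bar>k (t - s) * F' s\<bar> else 0)" for s
  obtain C where "\<forall>t\<in>{0<..T}. (\<lambda>s. (t - s) powr (p - 1) * wt \<alpha> \<tau> s) integrable_on {0..t} \<and>
           integral {0..t} (\<lambda>s. (t - s) powr (p - 1) * wt \<alpha> \<tau> s) \<le> C * wt \<alpha> \<tau> t"
    using wt_convolution[OF p \<alpha> \<tau> T_pos] by blast
  then have "(\<lambda>s. B * M * ((t - s) powr (p - 1) * wt \<alpha> \<tau> s)) integrable_on {0..t}"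
    using t' by (intro integrable_on_mult_right) auto
  then have "g integrable_on {0..t}"
    by (rule integrable_spike[where S = "{0, t}"]) (auto simp: g_def)
  moreover have "(\<lambda>s. k (t - s) * F' s) \<in> borel_measurable (lebesgue_on {0..t})"
  proof (intro borel_measurable_times F'_measurable t borel_measurable_imp_lebesgue_on)
    show "(\<lambda>s. k (t - s)) \<in> borel_measurable borel" using k by measurable
  qed
  moreover have "norm (k (t - s) * F' s) \<le> g s" if s: "s \<in> {0..t}" for s
  proof (cases "s \<in> {0, t}")
    case True
    then show ?thesis using B M wt_ge_1[of \<alpha> \<tau> s] by (auto simp: g_def)
  next
    case False
    then have "\<bar>k (t - s)\<bar> * \<bar>F' s\<bar> \<le> (B * (t - s) powr (p - 1)) * (M * wt \<alpha> \<tau> s)"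
      using s t' F'_bound[of s] kb[of "t - s"] B by (intro mult_mono) auto
    then show ?thesis using False by (simp add: g_def abs_mult mult_ac)
  qed
  ultimately show ?thesis by (intro measurable_bounded_by_integrable_imp_absolutely_integrable) auto
qed

lemma E1_F'_abs_integrable:
  assumes "t \<in> {0..T}"
  shows "(\<lambda>s. E1 (t - s) * F' s) absolutely_integrable_on {0..t}"
  using assms \<alpha> A E1_bound E1_measurable by (intro kernel_F'_abs_integrable[where p = \<alpha> and B = A]) auto

lemma E_F'_abs_integrable:
  assumes "t \<in> {0..T}"
  shows "(\<lambda>s. E (t - s) * F' s) absolutely_integrable_on {0..t}"
proof -
  \<comment> \<open>\<open>E\<close> is continuous on [0, \<infinity>) only; its constant extension
    is Borel measurable on the line.\<close>
  define k where "k r = E (max 0 r)" for r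
  have kc: "continuous_on UNIV k" unfolding k_def
    by (intro continuous_on_compose2[OF E_cont] continuous_intros) auto
  have "compact (k ` {0..T})" by (intro compact_continuous_image continuous_on_subset[OF kc]) auto
  then obtain B where B: "\<forall>r\<in>{0..T}. \<bar>k r\<bar> \<le> B" by (auto dest!: compact_imp_bounded simp: bounded_iff)
  have B0: "B \<ge> 0" using B T_pos by (meson abs_ge_zero atLeastAtMost_iff less_imp_le order.trans order_refl)
  have "(\<lambda>s. k (t - s) * F' s) absolutely_integrable_on {0..t}"
    using assms B B0 by (intro kernel_F'_abs_integrable[where p = 1 and B = B] borel_measurable_continuous_onI kc) auto
  then show ?thesis
    by (rule set_integrable_cong[THEN iffD1, rotated -1]) (auto simp: k_def)
qed

text \<open>Shifting the argument of \<open>E\<close> by \<open>\<delta> m\<close> moves the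
  singularity of \<open>E1\<close> to -\<delta> and opens a neighbourhood of 0 to the results for
  smooth kernels.\<close>

definition \<delta> :: "nat \<Rightarrow> real" where "\<delta> m = 1 / real (Suc m)"

lemma \<delta>_pos: "\<delta> m > 0" by (simp add: \<delta>_def)

lemma \<delta>_lim: "\<delta> \<longlonglongrightarrow> 0"
  unfolding \<delta>_def using LIMSEQ_inverse_real_of_nat by (simp add: inverse_eq_divide)

lemma E_shift_uniform: "uniform_limit {0..T} (\<lambda>m r. E (r + \<delta> m)) E sequentially"
proof (rule uniform_limitI)
  fix e :: real assume e: "e > 0"
  have "uniformly_continuous_on {0..T+1} E"
    by (intro compact_uniformly_continuous continuous_on_subset[OF E_cont]) auto
  then obtain d where d: "d > 0" "\<And>x x'. \<lbrakk>x\<in>{0..T+1}; x'\<in>{0..T+1}; dist x' x < d\<rbrakk> \<Longrightarrow> dist (E x') (E x) < e"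
    using e by (rule uniformly_continuous_onE) blast
  have "\<forall>\<^sub>F m in sequentially. \<delta> m < min d 1"
    using \<delta>_lim d by (intro order_tendstoD) auto
  then show "\<forall>\<^sub>F m in sequentially. \<forall>x\<in>{0..T}. dist (E (x + \<delta> m)) (E x) < e"
  proof eventually_elim
    case (elim m)
    show ?case
    proof
      fix x assume "x \<in> {0..T}"
      then show "dist (E (x + \<delta> m)) (E x) < e"
        using elim less_imp_le[OF \<delta>_pos[of m]] by (intro d(2)) (auto simp: dist_real_def)
    qed
  qed
qed

lemma E_shift_deriv: "r > - \<delta> m \<Longrightarrow> ((\<lambda>r. E (r + \<delta> m)) has_real_derivative E1 (r + \<delta> m)) (at r)"
  using E_deriv[of "r + \<delta> m"] by (simp add: DERIV_shift)

lemma E1_shift_deriv: "r > - \<delta> m \<Longrightarrow> ((\<lambda>r. E1 (r + \<delta> m)) has_real_derivative E2 (r + \<delta> m)) (at r)"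
  using E1_deriv[of "r + \<delta> m"] by (simp add: DERIV_shift)

lemma E1_shift_cont: "continuous_on {- \<delta> m<..} (\<lambda>r. E1 (r + \<delta> m))"
  using E1_shift_deriv by (meson DERIV_isCont continuous_at_imp_continuous_on greaterThan_iff)

lemma E2_shift_cont: "continuous_on {- \<delta> m<..} (\<lambda>r. E2 (r + \<delta> m))"
  by (intro continuous_on_compose2[OF E2_cont] continuous_intros) auto

text \<open>Applied with the source and with its derivative as \<open>h\<close>; uniform convergence
  of the kernels and integrability of \<open>h\<close> are enough.\<close>

lemma shift_convolution_uniform:
  assumes h: "\<And>t. t \<in> {0..T} \<Longrightarrow> h absolutely_integrable_on {0..t}"
    and i1: "\<And>t m. t \<in> {0..T} \<Longrightarrow> (\<lambda>s. E (t - s + \<delta> m) * h s) integrable_on {0..t}"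
    and i2: "\<And>t. t \<in> {0..T} \<Longrightarrow> (\<lambda>s. E (t - s) * h s) integrable_on {0..t}"
  shows "uniform_limit {0..T} (\<lambda>m t. integral {0..t} (\<lambda>s. E (t - s + \<delta> m) * h s))
           (\<lambda>t. integral {0..t} (\<lambda>s. E (t - s) * h s)) sequentially"
proof (rule uniform_limitI)
  fix e :: real assume e: "e > 0"
  define H where "H = integral {0..T} (\<lambda>s. \<bar>h s\<bar>)"
  have hi: "(\<lambda>s. \<bar>h s\<bar>) integrable_on {0..t}" if "t \<in> {0..T}" for t
    using h[OF that] by (simp add: absolutely_integrable_on_def)
  have H: "integral {0..t} (\<lambda>s. \<bar>h s\<bar>) \<le> H" if "t \<in> {0..T}" for t
    unfolding H_def using that T_pos by (intro integral_subset_le hi) auto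
  have H0: "H \<ge> 0" using H[of 0] T_pos by simp
  define e' where "e' = e / (2 * (H + 1))"
  have e': "e' > 0" using e H0 by (simp add: e'_def)
  have "\<forall>\<^sub>F m in sequentially. \<forall>r\<in>{0..T}. dist (E (r + \<delta> m)) (E r) < e'"
    using E_shift_uniform e' by (auto simp: uniform_limit_iff)
  then show "\<forall>\<^sub>F m in sequentially. \<forall>t\<in>{0..T}. dist (integral {0..t} (\<lambda>s. E (t - s + \<delta> m) * h s))
           (integral {0..t} (\<lambda>s. E (t - s) * h s)) < e"
  proof eventually_elim
    case (elim m)
    show ?case
    proof
      fix t assume t: "t \<in> {0..T}"
      have "norm (integral {0..t} (\<lambda>s. E (t - s + \<delta> m) * h s - E (t - s) * h s)) \<le> integral {0..t} (\<lambda>s. e' * \<bar>h s\<bar>)"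
      proof (rule Henstock_Kurzweil_Integration.integral_norm_bound_integral)
        show "(\<lambda>s. E (t - s + \<delta> m) * h s - E (t - s) * h s) integrable_on {0..t}"
          using i1 i2 t by (intro integrable_diff) auto
        show "(\<lambda>s. e' * \<bar>h s\<bar>) integrable_on {0..t}" using hi[OF t] by (intro integrable_on_mult_right)
        fix s assume "s \<in> {0..t}"
        then have "\<bar>E (t - s + \<delta> m) - E (t - s)\<bar> \<le> e'" using bspec[OF elim, of "t - s"] t by (auto simp: dist_real_def)
        then show "norm (E (t - s + \<delta> m) * h s - E (t - s) * h s) \<le> e' * \<bar>h s\<bar>"
          by (simp add: left_diff_distrib[symmetric] abs_mult mult_right_mono)
      qed
      also have "\<dots> \<le> e' * H" using H[OF t] e' by (simp add: mult_left_mono)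
      also have "\<dots> < e" using e H0 mult_nonneg_nonneg[of H e] by (simp add: e'_def field_simps add_nonneg_pos)
      finally show "dist (integral {0..t} (\<lambda>s. E (t - s + \<delta> m) * h s)) (integral {0..t} (\<lambda>s. E (t - s) * h s)) < e"
        using i1[OF t] i2[OF t] by (simp add: dist_real_def integral_diff)
    qed
  qed
qed

lemma shift_by_parts:
  assumes t: "t \<in> {0..T}"
  shows "((\<lambda>s. E (t - s + \<delta> m) * F' s) has_integral
     (E (\<delta> m) * F t - E (t + \<delta> m) * F 0 + integral {0..t} (\<lambda>s. E1 (t - s + \<delta> m) * F s))) {0..t}"
  using convolution_by_parts[OF \<tau> \<delta>_pos, where K = "\<lambda>r. E (r + \<delta> m)" and ?K1.0 = "\<lambda>r. E1 (r + \<delta> m)", OF E_shift_deriv E1_shift_cont _ F_deriv, of t]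
    F_cont t T by simp

lemma shift_by_parts1:
  assumes t: "t \<in> {0..T}"
  shows "((\<lambda>s. E1 (t - s + \<delta> m) * F' s) has_integral
     (E1 (\<delta> m) * F t - E1 (t + \<delta> m) * F 0 + integral {0..t} (\<lambda>s. E2 (t - s + \<delta> m) * F s))) {0..t}"
  using convolution_by_parts[OF \<tau> \<delta>_pos, where K = "\<lambda>r. E1 (r + \<delta> m)" and ?K1.0 = "\<lambda>r. E2 (r + \<delta> m)", OF E1_shift_deriv E2_shift_cont _ F_deriv, of t]
    F_cont t T by simp

text \<open>For the shifted kernel the derivative contains the convolution of \<open>E1\<close> with
  \<open>F\<close>, singular in the limit. Integration by parts cancels it against the boundary term
  at t and leaves only \<open>E\<close>, for which the limit is uniform.\<close>

lemma convolution_deriv: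
  assumes t: "t \<in> {0..T}"
  shows "((\<lambda>t. integral {0..t} (\<lambda>s. E (t - s) * F s)) has_real_derivative E t * F 0 + J t) (at t within {0..T})"
proof (rule has_field_derivative_uniform_limit[where f = "\<lambda>m t. integral {0..t} (\<lambda>s. E (t - s + \<delta> m) * F s)"
      and f' = "\<lambda>m t. E (t + \<delta> m) * F 0 + integral {0..t} (\<lambda>s. E (t - s + \<delta> m) * F' s)"])
  have Esc: "continuous_on {0..} (\<lambda>r. E (r + \<delta> m))" for m
    using \<delta>_pos[of m] by (intro continuous_on_compose2[OF E_cont] continuous_intros) auto
  show "((\<lambda>t. integral {0..t} (\<lambda>s. E (t - s + \<delta> m) * F s)) has_real_derivative
      E (t + \<delta> m) * F 0 + integral {0..t} (\<lambda>s. E (t - s + \<delta> m) * F' s)) (at t within {0..T})" if t: "t \<in> {0..T}" for m t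
    using convolution_deriv_smooth[OF \<delta>_pos, where K = "\<lambda>r. E (r + \<delta> m)" and ?K1.0 = "\<lambda>r. E1 (r + \<delta> m)", OF E_shift_deriv E1_shift_cont F_cont t]
      integral_unique[OF shift_by_parts[OF t, of m]] by (simp add: algebra_simps)
  have "uniform_limit {0..T} (\<lambda>m t. E (t + \<delta> m) * F 0) (\<lambda>t. E t * F 0) sequentially"
    by (intro uniform_limit_intros E_shift_uniform)
  moreover have "uniform_limit {0..T} (\<lambda>m t. integral {0..t} (\<lambda>s. E (t - s + \<delta> m) * F' s)) J sequentially"
    unfolding J_def using E_F'_abs_integrable
    by (intro shift_convolution_uniform F'_abs_integrable has_integral_integrable[OF shift_by_parts])
      (auto simp: absolutely_integrable_on_def)
  ultimately show "uniform_limit {0..T} (\<lambda>m t. E (t + \<delta> m) * F 0 + integral {0..t} (\<lambda>s. E (t - s + \<delta> m) * F' s))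
     (\<lambda>t. E t * F 0 + J t) sequentially"
    by (rule uniform_limit_add)
  have "uniform_limit {0..T} (\<lambda>m t. integral {0..t} (\<lambda>s. E (t - s + \<delta> m) * F s))
      (\<lambda>t. integral {0..t} (\<lambda>s. E (t - s) * F s)) sequentially"
    using F_cont by (intro shift_convolution_uniform convolution_integrable[OF Esc F_cont] convolution_integrable[OF E_cont F_cont]
        absolutely_integrable_continuous_real continuous_on_subset[OF F_cont]) auto
  then show "(\<lambda>m. integral {0..t} (\<lambda>s. E (t - s + \<delta> m) * F s)) \<longlonglongrightarrow> integral {0..t} (\<lambda>s. E (t - s) * F s)"
    if "t \<in> {0..T}" for t using that by (rule tendsto_uniform_limitI)
qed (use t in auto)

text \<open>Combines \<open>E1_shift_diff\<close> with \<open>wt_convolution\<close> for the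
  exponent \<alpha>/2: a rate of convergence that is uniform wherever the weight is bounded.\<close>

lemma Q_shift_bound:
  "\<exists>C>0. \<forall>t\<in>{0<..T}. \<forall>m. \<bar>integral {0..t} (\<lambda>s. E1 (t - s + \<delta> m) * F' s) - Q t\<bar> \<le> C * \<delta> m powr (\<alpha> / 2) * wt \<alpha> \<tau> t"
proof -
  obtain C where C: "C > 0" "\<forall>t\<in>{0<..T}. (\<lambda>s. (t - s) powr (\<alpha> / 2 - 1) * wt \<alpha> \<tau> s) integrable_on {0..t} \<and>
           integral {0..t} (\<lambda>s. (t - s) powr (\<alpha> / 2 - 1) * wt \<alpha> \<tau> s) \<le> C * wt \<alpha> \<tau> t"
    using wt_convolution[of "\<alpha> / 2" \<alpha> \<tau> T] \<alpha> \<tau> T_pos by auto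
  have "\<bar>integral {0..t} (\<lambda>s. E1 (t - s + \<delta> m) * F' s) - Q t\<bar> \<le> (2 * A * M + 1) * C * \<delta> m powr (\<alpha> / 2) * wt \<alpha> \<tau> t"
    if t: "t \<in> {0<..T}" for t m
  proof -
    have i1: "(\<lambda>s. E1 (t - s + \<delta> m) * F' s) integrable_on {0..t}"
      using t by (intro has_integral_integrable[OF shift_by_parts1]) auto
    have i2: "(\<lambda>s. E1 (t - s) * F' s) integrable_on {0..t}"
      using E1_F'_abs_integrable[of t] t by (auto simp: absolutely_integrable_on_def)
    define c where "c = 2 * A * M * \<delta> m powr (\<alpha> / 2)"
    define d where "d s = (if s \<in> {0, t} then 0 else E1 (t - s + \<delta> m) * F' s - E1 (t - s) * F' s)" for s
    have "(\<lambda>s. E1 (t - s + \<delta> m) * F' s - E1 (t - s) * F' s) integrable_on {0..t}" using i1 i2 by (rule integrable_diff)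
    then have di: "d integrable_on {0..t}" by (rule integrable_spike[where S = "{0, t}"]) (auto simp: d_def)
    have ds: "integral {0..t} (\<lambda>s. E1 (t - s + \<delta> m) * F' s - E1 (t - s) * F' s) = integral {0..t} d"
      by (rule integral_spike[where S = "{0, t}"]) (auto simp: d_def)
    have "norm (integral {0..t} d) \<le> integral {0..t} (\<lambda>s. c * ((t - s) powr (\<alpha> / 2 - 1) * wt \<alpha> \<tau> s))"
    proof (rule Henstock_Kurzweil_Integration.integral_norm_bound_integral[OF di])
      show "(\<lambda>s. c * ((t - s) powr (\<alpha> / 2 - 1) * wt \<alpha> \<tau> s)) integrable_on {0..t}"
        using C t by (intro integrable_on_mult_right) auto
      fix s assume s: "s \<in> {0..t}"
      show "norm (d s) \<le> c * ((t - s) powr (\<alpha> / 2 - 1) * wt \<alpha> \<tau> s)"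
      proof (cases "s \<in> {0, t}")
        case True
        then show ?thesis using A M wt_ge_1[of \<alpha> \<tau> s] by (auto simp: d_def c_def intro!: mult_nonneg_nonneg)
      next
        case False
        then have "\<bar>E1 (t - s + \<delta> m) - E1 (t - s)\<bar> * \<bar>F' s\<bar> \<le>
            (2 * A * \<delta> m powr (\<alpha> / 2) * (t - s) powr (\<alpha> / 2 - 1)) * (M * wt \<alpha> \<tau> s)"
          using s t \<delta>_pos[of m] A by (intro mult_mono E1_shift_diff F'_bound) auto
        moreover have "d s = (E1 (t - s + \<delta> m) - E1 (t - s)) * F' s"
          using False by (simp add: d_def algebra_simps)
        ultimately show ?thesis by (simp add: c_def abs_mult mult_ac)
      qed
    qed
    also have "\<dots> = c * integral {0..t} (\<lambda>s. (t - s) powr (\<alpha> / 2 - 1) * wt \<alpha> \<tau> s)" by simp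
    also have "\<dots> \<le> c * (C * wt \<alpha> \<tau> t)"
      using C t A M by (intro mult_left_mono) (auto simp: c_def)
    also have "\<dots> \<le> (2 * A * M + 1) * C * \<delta> m powr (\<alpha> / 2) * wt \<alpha> \<tau> t"
      using C(1) wt_ge_1[of \<alpha> \<tau> t] by (simp add: c_def algebra_simps)
    finally show ?thesis using ds i1 i2 by (simp add: integral_diff Q_def)
  qed
  moreover have "(2 * A * M + 1) * C > 0" using A M C(1) by (simp add: add_nonneg_pos)
  ultimately show ?thesis by blast
qed

text \<open>The shifted convolution with \<open>F'\<close> is first rewritten by parts, since
  \<open>F'\<close> need not be differentiable. After differentiation a second integration by parts
  returns from \<open>E2\<close> and \<open>F\<close> to \<open>E1\<close> and \<open>F'\<close>;
  the limit of \<open>E (\<delta> m)\<close> is 1, which produces the term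
  \<open>F' t\<close>.\<close>

lemma J_deriv:
  assumes j: "j < n" and t: "t \<in> {real j * \<tau><..real (Suc j) * \<tau>}"
  shows "(J has_real_derivative F' t + Q t) (at t within {real j * \<tau><..real (Suc j) * \<tau>})"
proof -
  define S where "S = {real j * \<tau><..real (Suc j) * \<tau>}"
  \<comment> \<open>The weight may blow up at the left end of the piece, so convergence is claimed
    only on [c, (j + 1)\<tau>]; near t this interval coincides with the piece.\<close>
  define c where "c = (real j * \<tau> + t) / 2"
  have c: "real j * \<tau> < c" "c < t"
  proof -
    have "x < (x + t) / 2 \<and> (x + t) / 2 < t" if "x < t" for x :: real using that by (simp add: field_simps)
    from this[of "real j * \<tau>"] t[unfolded greaterThanAtMost_iff] have "real j * \<tau> < c \<and> c < t" unfolding c_def by blast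
    then show "real j * \<tau> < c" "c < t" by blast+
  qed
  define S' where "S' = {c..real (Suc j) * \<tau>}"
  have jn: "real (Suc j) * \<tau> \<le> T" unfolding T using j \<tau> by (intro mult_right_mono) (auto simp del: of_nat_Suc)
  have c0: "c > 0" using c \<tau> by (smt (verit) mult_nonneg_nonneg of_nat_0_le_iff)
  have S'sub: "S' \<subseteq> {0<..T}" "S' \<subseteq> S" using c0 jn c by (auto simp: S'_def S_def)
  have wb: "\<exists>B. \<forall>s\<in>S'. wt \<alpha> \<tau> s \<le> B"
  proof -
    have "s powr (\<alpha> - 1) \<le> c powr (\<alpha> - 1)" if "s \<in> S'" for s
      using that c0 \<alpha> by (intro powr_mono2') (auto simp: S'_def)
    moreover have "\<exists>B. \<forall>s\<in>S'. (max 0 (s - \<tau>)) powr (\<alpha> - 1) \<le> B"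
    proof (cases "j = 0")
      case True
      then have "(max 0 (s - \<tau>)) powr (\<alpha> - 1) \<le> 0" if "s \<in> S'" for s using that by (auto simp: S'_def max_def)
      then show ?thesis by blast
    next
      case False
      then have "1 * \<tau> \<le> real j * \<tau>" using \<tau> by (intro mult_right_mono) auto
      then have "c - \<tau> > 0" using c by simp
      then have "(max 0 (s - \<tau>)) powr (\<alpha> - 1) \<le> (c - \<tau>) powr (\<alpha> - 1)" if "s \<in> S'" for s
        using that \<alpha> by (intro powr_mono2') (auto simp: S'_def)
      then show ?thesis by blast
    qed
    ultimately show ?thesis unfolding wt_def by (meson add_mono order_refl)
  qed
  then obtain B where B: "\<And>s. s \<in> S' \<Longrightarrow> wt \<alpha> \<tau> s \<le> B" by blast
  have B1: "B \<ge> 1" using B[of t] wt_ge_1[of \<alpha> \<tau> t] t c by (auto simp: S'_def)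
  have "(J has_real_derivative F' t + Q t) (at t within S')"
  proof (rule has_field_derivative_uniform_limit[where f = "\<lambda>m t. integral {0..t} (\<lambda>s. E (t - s + \<delta> m) * F' s)"
        and f' = "\<lambda>m t. E (\<delta> m) * F' t + integral {0..t} (\<lambda>s. E1 (t - s + \<delta> m) * F' s)"])
    show "convex S'" by (simp add: S'_def)
    show "t \<in> S'" using t c by (simp add: S'_def)
    fix s assume s: "s \<in> S'"
    then have sT: "s \<in> {0..T}" and sS: "s \<in> S" using S'sub by auto
    have d1: "((\<lambda>t. integral {0..t} (\<lambda>s. E1 (t - s + \<delta> m) * F s)) has_real_derivative
      E1 (\<delta> m) * F s + integral {0..s} (\<lambda>r. E2 (s - r + \<delta> m) * F r)) (at s within S')" for m
    proof (rule has_field_derivative_subset)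
      show "((\<lambda>t. integral {0..t} (\<lambda>s. E1 (t - s + \<delta> m) * F s)) has_real_derivative
        E1 (\<delta> m) * F s + integral {0..s} (\<lambda>r. E2 (s - r + \<delta> m) * F r)) (at s within {0..T})"
        using convolution_deriv_smooth[OF \<delta>_pos, where K = "\<lambda>r. E1 (r + \<delta> m)" and ?K1.0 = "\<lambda>r. E2 (r + \<delta> m)", OF E1_shift_deriv E2_shift_cont F_cont sT]
        by simp
    qed (use S'sub in auto)
    have d2: "(F has_real_derivative F' s) (at s within S')"
      using F_deriv j sS S'sub(2) unfolding piecewise_deriv_def S_def by (blast intro: has_field_derivative_subset)
    have d3: "((\<lambda>t. E (t + \<delta> m)) has_real_derivative E1 (s + \<delta> m)) (at s within S')" for m
      using E_shift_deriv[of m s] sT \<delta>_pos[of m] by (auto intro: has_field_derivative_at_within)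
    have d: "((\<lambda>t. E (\<delta> m) * F t - E (t + \<delta> m) * F 0 + integral {0..t} (\<lambda>s. E1 (t - s + \<delta> m) * F s))
       has_real_derivative E (\<delta> m) * F' s + integral {0..s} (\<lambda>r. E1 (s - r + \<delta> m) * F' r)) (at s within S')" for m
      unfolding integral_unique[OF shift_by_parts1[OF sT, of m]]
      by (rule derivative_eq_intros d1 d2 d3 refl | simp add: algebra_simps)+
    show "((\<lambda>t. integral {0..t} (\<lambda>s. E (t - s + \<delta> m) * F' s)) has_real_derivative
        E (\<delta> m) * F' s + integral {0..s} (\<lambda>r. E1 (s - r + \<delta> m) * F' r)) (at s within S')" for m
      using d[of m] zero_less_one s
    proof (rule has_field_derivative_transform_within)
      fix x assume "x \<in> S'"
      then have "x \<in> {0..T}" using S'sub by auto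
      from integral_unique[OF shift_by_parts[OF this, of m]]
      show "E (\<delta> m) * F x - E (x + \<delta> m) * F 0 + integral {0..x} (\<lambda>s. E1 (x - s + \<delta> m) * F s) =
        integral {0..x} (\<lambda>s. E (x - s + \<delta> m) * F' s)" by simp
    qed
    have "uniform_limit {0..T} (\<lambda>m t. integral {0..t} (\<lambda>s. E (t - s + \<delta> m) * F' s)) J sequentially"
      unfolding J_def using E_F'_abs_integrable
      by (intro shift_convolution_uniform F'_abs_integrable has_integral_integrable[OF shift_by_parts])
        (auto simp: absolutely_integrable_on_def)
    then show "(\<lambda>m. integral {0..s} (\<lambda>r. E (s - r + \<delta> m) * F' r)) \<longlonglongrightarrow> J s" using sT by (rule tendsto_uniform_limitI)
  next
    obtain C where C: "C > 0" "\<forall>t\<in>{0<..T}. \<forall>m. \<bar>integral {0..t} (\<lambda>s. E1 (t - s + \<delta> m) * F' s) - Q t\<bar> \<le> C * \<delta> m powr (\<alpha> / 2) * wt \<alpha> \<tau> t"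
      using Q_shift_bound by blast
    show "uniform_limit S' (\<lambda>m t. E (\<delta> m) * F' t + integral {0..t} (\<lambda>s. E1 (t - s + \<delta> m) * F' s)) (\<lambda>t. F' t + Q t) sequentially"
    proof (rule uniform_limitI)
      fix e :: real assume e: "e > 0"
      define g where "g m = \<bar>E (\<delta> m) - 1\<bar> * (M * B) + C * \<delta> m powr (\<alpha> / 2) * B" for m
      have "(\<lambda>m. E (0 + \<delta> m)) \<longlonglongrightarrow> E 0"
        by (rule tendsto_uniform_limitI[OF E_shift_uniform]) (use T_pos in auto)
      then have "(\<lambda>m. E (\<delta> m)) \<longlonglongrightarrow> 1" by (simp add: E_0)
      moreover have "(\<lambda>m. \<delta> m powr (\<alpha> / 2)) \<longlonglongrightarrow> 0 powr (\<alpha> / 2)"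
        using \<delta>_lim \<alpha> \<delta>_pos by (intro tendsto_powr') (auto intro!: always_eventually less_imp_le)
      ultimately have "g \<longlonglongrightarrow> \<bar>1 - 1\<bar> * (M * B) + C * 0 powr (\<alpha> / 2) * B"
        unfolding g_def by (intro tendsto_add tendsto_mult tendsto_const tendsto_rabs tendsto_diff)
      then have "g \<longlonglongrightarrow> 0" by simp
      then have "\<forall>\<^sub>F m in sequentially. g m < e" using e by (rule order_tendstoD)
      then show "\<forall>\<^sub>F m in sequentially. \<forall>t\<in>S'. dist (E (\<delta> m) * F' t + integral {0..t} (\<lambda>s. E1 (t - s + \<delta> m) * F' s)) (F' t + Q t) < e"
      proof eventually_elim
        case (elim m)
        show ?case
        proof
          fix t assume t: "t \<in> S'"
          have "\<bar>F' t\<bar> \<le> M * wt \<alpha> \<tau> t" using F'_bound[of t] t S'sub by auto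
          also have "\<dots> \<le> M * B" using M B[OF t] by (rule mult_left_mono[rotated])
          finally have a: "\<bar>E (\<delta> m) - 1\<bar> * \<bar>F' t\<bar> \<le> \<bar>E (\<delta> m) - 1\<bar> * (M * B)" by (rule mult_left_mono) auto
          have "\<bar>integral {0..t} (\<lambda>s. E1 (t - s + \<delta> m) * F' s) - Q t\<bar> \<le> C * \<delta> m powr (\<alpha> / 2) * wt \<alpha> \<tau> t"
            using C t S'sub by auto
          also have "\<dots> \<le> C * \<delta> m powr (\<alpha> / 2) * B" using C B[OF t] by (intro mult_left_mono) auto
          finally have b: "\<bar>integral {0..t} (\<lambda>s. E1 (t - s + \<delta> m) * F' s) - Q t\<bar> \<le> C * \<delta> m powr (\<alpha> / 2) * B" .
          have "dist (E (\<delta> m) * F' t + integral {0..t} (\<lambda>s. E1 (t - s + \<delta> m) * F' s)) (F' t + Q t)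
             = \<bar>(E (\<delta> m) - 1) * F' t + (integral {0..t} (\<lambda>s. E1 (t - s + \<delta> m) * F' s) - Q t)\<bar>"
            by (simp add: dist_real_def algebra_simps)
          also have "\<dots> \<le> \<bar>E (\<delta> m) - 1\<bar> * \<bar>F' t\<bar> + \<bar>integral {0..t} (\<lambda>s. E1 (t - s + \<delta> m) * F' s) - Q t\<bar>"
            by (rule order.trans[OF abs_triangle_ineq]) (simp add: abs_mult)
          also have "\<dots> \<le> g m" unfolding g_def using a b by simp
          finally show "dist (E (\<delta> m) * F' t + integral {0..t} (\<lambda>s. E1 (t - s + \<delta> m) * F' s)) (F' t + Q t) < e"
            using elim by simp
        qed
      qed
    qed
  qed
  moreover have "at t within S' = at t within S"
    by (rule at_within_nhd[of t "{c<..}"]) (use c in \<open>auto simp: S'_def S_def\<close>)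
  ultimately show ?thesis by (simp add: S_def)
qed

end

section \<open>Time derivatives of Fourier coefficients\<close>

lemma AE_lborel_iff_negligible: "(AE x in lborel. P x) \<longleftrightarrow> negligible {x. \<not> P (x :: real)}"
  by (subst AE_completion_iff[symmetric]) (simp add: completion.AE_iff_null_sets negligible_iff_null_sets)

lemma continuous_on_section:
  fixes g :: "real \<Rightarrow> real \<Rightarrow> real"
  assumes g: "continuous_on (A \<times> B) (\<lambda>(x, t). g x t)"
  shows "x \<in> A \<Longrightarrow> continuous_on B (\<lambda>t. g x t)" and "t \<in> B \<Longrightarrow> continuous_on A (\<lambda>x. g x t)"
proof -
  assume x: "x \<in> A"
  have "continuous_on B (\<lambda>t. (x, t))" by (rule continuous_on_Pair[OF continuous_on_const continuous_on_id])
  from continuous_on_compose2[OF g this] x show "continuous_on B (\<lambda>t. g x t)" by auto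
next
  assume t: "t \<in> B"
  have "continuous_on A (\<lambda>x. (x, t))" by (rule continuous_on_Pair[OF continuous_on_id continuous_on_const])
  from continuous_on_compose2[OF g this] t show "continuous_on A (\<lambda>x. g x t)" by auto
qed

text \<open>The derivative in \<open>t\<close> is a pointwise limit of difference quotients of a continuous function, hence
  jointly measurable, and Fubini turns the bound for every \<open>t\<close> and almost every \<open>x\<close> into one for almost
  every \<open>x\<close> and almost every \<open>t\<close>. For such \<open>x\<close> the function is Lipschitz in \<open>t\<close>, and the Lipschitz bound
  is a closed condition on \<open>x\<close>.\<close>

lemma AE_derivative_bound_imp_Lipschitz:
  fixes g g' :: "real \<Rightarrow> real \<Rightarrow> real"
  assumes L: "L > 0" and cd: "c < d"
    and g: "continuous_on ({0..L} \<times> {c..d}) (\<lambda>(x, t). g x t)"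
    and g': "\<And>x t. x \<in> {0..L} \<Longrightarrow> t \<in> {c<..d} \<Longrightarrow> (g x has_real_derivative g' x t) (at t within {c<..d})"
    and ae: "\<And>t. t \<in> {c<..d} \<Longrightarrow> negligible {x \<in> {0..L}. \<bar>g' x t\<bar> > W t}"
    and W: "\<And>s t. c < s \<Longrightarrow> s \<le> t \<Longrightarrow> t \<le> d \<Longrightarrow> W t \<le> W s"
    and st: "c < c'" "c' \<le> s" "s \<le> t" "t \<le> d" and x: "x \<in> {0..L}"
  shows "\<bar>g x t - g x s\<bar> \<le> W c' * (t - s)"
proof -
  \<comment> \<open>Clamping both arguments to the rectangle gives a continuous function on the
    whole plane, so difference quotients are defined everywhere.\<close>
  define G where "G z = g (min L (max 0 (fst z))) (min d (max c (snd z)))" for z :: "real \<times> real"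
  have Gc: "continuous_on UNIV G"
  proof -
    have "continuous_on UNIV (\<lambda>z :: real \<times> real. (min L (max 0 (fst z)), min d (max c (snd z))))"
      by (intro continuous_intros)
    from continuous_on_compose2[OF g this]
    have "continuous_on UNIV (\<lambda>z. case (min L (max 0 (fst z)), min d (max c (snd z))) of (x, t) \<Rightarrow> g x t)"
      by (rule meta_mp) (intro image_subsetI, use L cd in auto)
    then show ?thesis by (simp add: G_def[abs_def])
  qed
  \<comment> \<open>Backward quotients, because at t = d the derivative is one-sided and only points
    to the left are available.\<close>
  define q where "q n z = (G z - G (fst z, snd z - 1 / real (Suc n))) * real (Suc n)" for n and z :: "real \<times> real"
  have qc: "continuous_on UNIV (q n)" for n
    unfolding q_def by (intro continuous_intros continuous_on_compose2[OF Gc]) auto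
  have qm: "q n \<in> borel_measurable (lborel \<Otimes>\<^sub>M lborel)" for n
    using borel_measurable_continuous_onI[OF qc] by (simp add: lborel_prod)
  define D where "D z = lim (\<lambda>n. q n z)" for z
  have Dm: "D \<in> borel_measurable (lborel \<Otimes>\<^sub>M lborel)"
    unfolding D_def by (rule borel_measurable_lim_metric[OF qm])
  have Dg: "D (x, t) = g' x t" if x: "x \<in> {0..L}" and t: "t \<in> {c<..d}" for x t
  proof -
    have lim0: "(\<lambda>n. t - 1 / real (Suc n)) \<longlonglongrightarrow> t - 0"
      using LIMSEQ_inverse_real_of_nat by (intro tendsto_intros) (simp add: inverse_eq_divide)
    have ev: "\<forall>\<^sub>F n in sequentially. t - 1 / real (Suc n) > c"
      using lim0 t by (intro order_tendstoD) auto
    have le: "t - 1 / real (Suc n) < t" for n by simp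
    have mem: "t - 1 / real (Suc n) \<in> {c<..d} \<and> t - 1 / real (Suc n) \<noteq> t" if "t - 1 / real (Suc n) > c" for n
      using le[of n] t that by (metis greaterThanAtMost_iff less_eq_real_def less_irrefl order.strict_trans1)
    have "filterlim (\<lambda>n. t - 1 / real (Suc n)) (at t within {c<..d}) sequentially"
      unfolding filterlim_at using lim0 eventually_mono[OF ev mem] by simp
    from filterlim_compose[OF g'[OF x t, unfolded has_field_derivative_iff] this]
    have "(\<lambda>n. (g x (t - 1 / real (Suc n)) - g x t) / (t - 1 / real (Suc n) - t)) \<longlonglongrightarrow> g' x t" .
    moreover have "\<forall>\<^sub>F n in sequentially. (g x (t - 1 / real (Suc n)) - g x t) / (t - 1 / real (Suc n) - t) = q n (x, t)"
      using ev
    proof eventually_elim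
      case (elim n)
      define r where "r = t - 1 / real (Suc n)"
      have r: "c < r" "r \<le> d" using elim mem[of n] by (auto simp: r_def)
      have rt: "r - t = - (1 / real (Suc n))" by (simp add: r_def)
      have "G (x, t) = g x t" "G (x, r) = g x r" using x t r by (auto simp: G_def)
      moreover have "q n (x, t) = (G (x, t) - G (x, r)) * real (Suc n)"
        by (simp only: q_def r_def fst_conv snd_conv)
      ultimately have "q n (x, t) = (g x r - g x t) / (r - t)"
        unfolding rt by (simp add: algebra_simps)
      then show ?case by (simp only: r_def)
    qed
    ultimately have "(\<lambda>n. q n (x, t)) \<longlonglongrightarrow> g' x t" by (rule Lim_transform_eventually)
    then show ?thesis unfolding D_def by (rule limI)
  qed
  \<comment> \<open>By monotonicity the constant \<open>W c'\<close> replaces \<open>W\<close> on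
    [c', d], so only \<open>D\<close> enters the question of joint measurability.\<close>
  define P where "P x t \<longleftrightarrow> x \<in> {0..L} \<and> t \<in> {c'..d} \<longrightarrow> \<bar>D (x, t)\<bar> \<le> W c'" for x t
  have "{z \<in> space (lborel \<Otimes>\<^sub>M lborel). P (fst z) (snd z)} \<in> sets (lborel \<Otimes>\<^sub>M lborel)"
  proof -
    note Dm[measurable]
    show ?thesis unfolding P_def prod.collapse by measurable
  qed
  then have comm: "(AE x in lborel. AE t in lborel. P x t) \<longleftrightarrow> (AE t in lborel. AE x in lborel. P x t)"
    by (rule lborel_pair.AE_commute)
  have "AE x in lborel. P x t" for t
  proof (cases "t \<in> {c'..d}")
    case True
    then have t: "t \<in> {c<..d}" "W t \<le> W c'" using st W[of c' t] by auto
    have "negligible {x. \<not> P x t}"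
      by (rule negligible_subset[OF ae[OF t(1)]]) (use t Dg in \<open>auto simp: P_def\<close>)
    then show ?thesis by (simp add: AE_lborel_iff_negligible)
  qed (intro AE_I2, auto simp: P_def)
  then have "AE t in lborel. AE x in lborel. P x t" by (rule AE_I2)
  then have "AE x in lborel. AE t in lborel. P x t" by (rule comm[THEN iffD2])
  then have neg: "negligible {x. \<not> (AE t in lborel. P x t)}"
    using AE_lborel_iff_negligible[of "\<lambda>x. AE t in lborel. P x t"] by blast
  have good: "\<bar>g x t - g x s\<bar> \<le> W c' * (t - s)" if x: "x \<in> {0..L}" and ae: "AE t in lborel. P x t" for x
  proof -
    define N where "N = {t. \<not> P x t}"
    have N: "negligible N" using ae by (simp add: AE_lborel_iff_negligible N_def)
    have gx: "continuous_on {c..d} (g x)"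
      using continuous_on_section(1)[OF g x] .
    have "(g' x has_integral (g x t - g x s)) {s..t}"
    proof (rule fundamental_theorem_of_calculus_interior)
      show "continuous_on {s..t} (g x)" using st by (intro continuous_on_subset[OF gx]) auto
      fix r assume r: "r \<in> {s<..<t}"
      then have "(g x has_real_derivative g' x r) (at r within {c<..<d})"
        using st x by (intro has_field_derivative_subset[OF g']) auto
      moreover have "r \<in> {c<..<d}" using r st by auto
      ultimately show "(g x has_vector_derivative g' x r) (at r)"
        unfolding has_real_derivative_iff_has_vector_derivative[symmetric] by (simp add: at_within_open[of r "{c<..<d}"])
    qed (use st in auto)
    then have "((\<lambda>r. if r \<in> N then 0 else g' x r) has_integral (g x t - g x s)) {s..t}"
      by (rule has_integral_spike[OF N, rotated]) auto
    moreover have "norm (if r \<in> N then 0 else g' x r) \<le> \<bar>W c'\<bar>" if "r \<in> {s..t}" for r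
      using that st Dg[of x r] x by (auto simp: N_def P_def)
    ultimately have bound: "norm (g x t - g x s) \<le> \<bar>W c'\<bar> * (t - s)"
      using has_integral_bound_real[of "\<bar>W c'\<bar>" "{}" "\<lambda>r. if r \<in> N then 0 else g' x r" "g x t - g x s" s t] st by auto
    \<comment> \<open>\<open>W\<close> is not assumed nonnegative. If \<open>W c'\<close> were
      negative, every point of [s, t] would violate the bound and the null set \<open>N\<close>
      would contain an interval.\<close>
    have "W c' \<ge> 0 \<or> s = t"
    proof (rule ccontr)
      assume "\<not> (W c' \<ge> 0 \<or> s = t)"
      then have "{s..t} \<subseteq> N" using st x by (auto simp: N_def P_def)
      then have "negligible {s..t}" using N negligible_subset by blast
      then have "negligible {s<..<t}" by (rule negligible_subset) auto
      moreover have "{s<..<t} \<noteq> {}" using st \<open>\<not> (W c' \<ge> 0 \<or> s = t)\<close> by simp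
      ultimately show False using open_not_negligible[of "{s<..<t}"] by simp
    qed
    then show ?thesis
    proof
      assume "W c' \<ge> 0"
      then show ?thesis using bound st by simp
    qed simp
  qed
  show ?thesis
  proof (rule ccontr)
    \<comment> \<open>Both sides are continuous in x, so a violation at one point persists on an
      interval, which is not negligible.\<close>
    assume viol: "\<not> ?thesis"
    define h where "h y = \<bar>g y t - g y s\<bar> - W c' * (t - s)" for y
    have hc: "continuous_on {0..L} h"
      unfolding h_def using st by (intro continuous_intros continuous_on_section(2)[OF g]) auto
    have "h x > 0" using viol by (simp add: h_def)
    then obtain \<delta> where \<delta>: "\<delta> > 0" "\<And>y. y \<in> {0..L} \<Longrightarrow> dist y x < \<delta> \<Longrightarrow> dist (h y) (h x) < h x"
      using hc x unfolding continuous_on_iff by blast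
    define a b where "a = max 0 (x - \<delta>)" and "b = min L (x + \<delta>)"
    have ab: "a < b" using x L \<delta> by (auto simp: a_def b_def)
    have "{a<..<b} \<subseteq> {x. \<not> (AE t in lborel. P x t)}"
    proof
      fix y assume y: "y \<in> {a<..<b}"
      then have "y \<in> {0..L}" "dist y x < \<delta>" by (auto simp: a_def b_def dist_real_def)
      then have "h y > 0" using \<delta>(2)[of y] by (simp add: dist_real_def)
      then show "y \<in> {x. \<not> (AE t in lborel. P x t)}" using good[of y] \<open>y \<in> {0..L}\<close> by (auto simp: h_def)
    qed
    then have "negligible {a<..<b}" using neg negligible_subset by blast
    then show False using ab open_not_negligible[of "{a<..<b}"] by auto
  qed
qed

text \<open>Differentiation under the integral along sequences: the Lipschitz bound dominates the
  difference quotients. The constant is taken at the midpoint c' of c and t, as \<open>W\<close> may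
  be unbounded near c.\<close>

lemma has_derivative_coefficient:
  fixes g g' :: "real \<Rightarrow> real \<Rightarrow> real" and e :: "real \<Rightarrow> real"
  assumes L: "L > 0" and cd: "c < d"
    and g: "continuous_on ({0..L} \<times> {c..d}) (\<lambda>(x, t). g x t)"
    and g': "\<And>x t. x \<in> {0..L} \<Longrightarrow> t \<in> {c<..d} \<Longrightarrow> (g x has_real_derivative g' x t) (at t within {c<..d})"
    and ae: "\<And>t. t \<in> {c<..d} \<Longrightarrow> negligible {x \<in> {0..L}. \<bar>g' x t\<bar> > W t}"
    and W: "\<And>s t. c < s \<Longrightarrow> s \<le> t \<Longrightarrow> t \<le> d \<Longrightarrow> W t \<le> W s"
    and e: "continuous_on {0..L} e" and t: "t \<in> {c<..d}"
  shows "((\<lambda>t. integral {0..L} (\<lambda>x. g x t * e x)) has_real_derivative integral {0..L} (\<lambda>x. g' x t * e x)) (at t within {c<..d})"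
  unfolding has_field_derivative_iff tendsto_at_iff_sequentially
proof (intro allI impI)
  fix X assume X: "\<forall>i. X i \<in> {c<..d} - {t}" "X \<longlonglongrightarrow> t"
  define c' where "c' = (c + t) / 2"
  have c': "c < c'" "c' < t" using t by (auto simp: c'_def)
  have "\<forall>\<^sub>F i in sequentially. X i > c'" using X(2) c'(2) by (rule order_tendstoD(1))
  then obtain N where N: "\<And>i. i \<ge> N \<Longrightarrow> X i > c'" by (auto simp: eventually_sequentially)
  define Z where "Z i = X (i + N)" for i
  have Z: "Z i \<in> {c<..d}" "Z i \<noteq> t" "Z i > c'" for i using X(1) N[of "i + N"] by (auto simp: Z_def)
  have Zl: "Z \<longlonglongrightarrow> t" unfolding Z_def using X(2) by (rule LIMSEQ_ignore_initial_segment)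
  have gi: "(\<lambda>x. g x r * e x) integrable_on {0..L}" if "r \<in> {c..d}" for r
    using that e by (intro integrable_continuous_real continuous_intros continuous_on_section(2)[OF g])
  have lim: "(\<lambda>i. integral {0..L} (\<lambda>x. (g x (Z i) - g x t) / (Z i - t) * e x)) \<longlonglongrightarrow> integral {0..L} (\<lambda>x. g' x t * e x)"
  proof (rule dominated_convergence(2))
    show "(\<lambda>x. (g x (Z i) - g x t) / (Z i - t) * e x) integrable_on {0..L}" for i
    proof -
      have "(\<lambda>x. 1 / (Z i - t) * (g x (Z i) * e x - g x t * e x)) integrable_on {0..L}"
        using Z[of i] t by (intro integrable_on_mult_right integrable_diff gi) auto
      then show ?thesis by (rule integrable_eq) (simp add: algebra_simps diff_divide_distrib)
    qed
    show "(\<lambda>x. W c' * \<bar>e x\<bar>) integrable_on {0..L}"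
      using e by (intro integrable_continuous_real continuous_intros)
    fix x assume x: "x \<in> {0..L}"
    show "norm ((g x (Z i) - g x t) / (Z i - t) * e x) \<le> W c' * \<bar>e x\<bar>" for i
    proof -
      have Lip: "\<bar>g x r2 - g x r1\<bar> \<le> W c' * (r2 - r1)" if r: "c' \<le> r1" "r1 \<le> r2" "r2 \<le> d" for r1 r2
        by (rule AE_derivative_bound_imp_Lipschitz[OF L cd g g' ae W c'(1) r x])
      have "\<bar>g x (Z i) - g x t\<bar> \<le> W c' * \<bar>Z i - t\<bar>"
      proof (cases "Z i \<le> t")
        case True
        then show ?thesis using Lip[of "Z i" t] Z(3)[of i] t by (simp add: abs_minus_commute)
      next
        case False
        then show ?thesis using Lip[of t "Z i"] c'(2) Z(1)[of i] by simp
      qed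
      then have "\<bar>g x (Z i) - g x t\<bar> / \<bar>Z i - t\<bar> \<le> W c'" using Z(2)[of i] by (simp add: pos_divide_le_eq)
      then have "\<bar>g x (Z i) - g x t\<bar> / \<bar>Z i - t\<bar> * \<bar>e x\<bar> \<le> W c' * \<bar>e x\<bar>" by (rule mult_right_mono) simp
      then show ?thesis by (simp add: abs_mult)
    qed
    have "filterlim Z (at t within {c<..d}) sequentially"
      unfolding filterlim_at using Zl Z by auto
    from filterlim_compose[OF g'[OF x t, unfolded has_field_derivative_iff] this]
    show "(\<lambda>i. (g x (Z i) - g x t) / (Z i - t) * e x) \<longlonglongrightarrow> g' x t * e x" by (intro tendsto_mult tendsto_const)
  qed
  have eq: "integral {0..L} (\<lambda>x. (g x (Z i) - g x t) / (Z i - t) * e x) =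
     (integral {0..L} (\<lambda>x. g x (Z i) * e x) - integral {0..L} (\<lambda>x. g x t * e x)) / (Z i - t)" for i
  proof -
    have "integral {0..L} (\<lambda>x. (g x (Z i) - g x t) / (Z i - t) * e x) = integral {0..L} (\<lambda>x. 1 / (Z i - t) * (g x (Z i) * e x - g x t * e x))"
      by (intro integral_cong) (simp add: algebra_simps diff_divide_distrib)
    also have "\<dots> = 1 / (Z i - t) * (integral {0..L} (\<lambda>x. g x (Z i) * e x) - integral {0..L} (\<lambda>x. g x t * e x))"
      using Z(1)[of i] t
      by (intro integral_unique has_integral_mult_right has_integral_diff integrable_integral gi) auto
    finally show ?thesis by simp
  qed
  have "(\<lambda>i. (integral {0..L} (\<lambda>x. g x (X (i + N)) * e x) - integral {0..L} (\<lambda>x. g x t * e x)) / (X (i + N) - t)) \<longlonglongrightarrow> integral {0..L} (\<lambda>x. g' x t * e x)"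
    using lim unfolding eq unfolding Z_def .
  then show "((\<lambda>y. (integral {0..L} (\<lambda>x. g x y * e x) - integral {0..L} (\<lambda>x. g x t * e x)) / (y - t)) \<circ> X) \<longlonglongrightarrow> integral {0..L} (\<lambda>x. g' x t * e x)"
    unfolding o_def by (rule LIMSEQ_offset)
qed

section \<open>Coefficient families\<close>

text \<open>Families of coefficients, in place of the norms: an $\ell^1$ bound with a rate of decay of the
  tails that is uniform in \<open>t\<close> up to the weight \<open>W\<close>. This property survives time integration.\<close>

definition ltail :: "(nat \<Rightarrow> real \<Rightarrow> real) \<Rightarrow> real set \<Rightarrow> (real \<Rightarrow> real) \<Rightarrow> bool" where
  "ltail c S W \<longleftrightarrow> (\<exists>\<epsilon>. \<epsilon> \<longlonglongrightarrow> 0 \<and> (\<forall>n. \<epsilon> n \<ge> 0) \<and>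
     (\<forall>N M. \<forall>t\<in>S. (\<Sum>i\<in>{N..<M}. \<bar>c i t\<bar>) \<le> \<epsilon> N * W t))"

lemma ltailE:
  assumes "ltail c S W"
  obtains \<epsilon> where "\<epsilon> \<longlonglongrightarrow> 0" "\<And>n. \<epsilon> n \<ge> 0" "\<And>N M t. t \<in> S \<Longrightarrow> (\<Sum>i\<in>{N..<M}. \<bar>c i t\<bar>) \<le> \<epsilon> N * W t"
  using assms unfolding ltail_def by blast

text \<open>Covers restriction of the time set, a pointwise factor \<open>V\<close>, a change of
  weight and a time change \<open>h\<close>; the delay enters through \<open>h\<close>.\<close>

lemma ltail_le:
  assumes c: "ltail c S W" and K: "K \<ge> 0"
    and d: "\<And>i t. t \<in> S' \<Longrightarrow> \<bar>d i t\<bar> \<le> V t * \<bar>c i (h t)\<bar>"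
    and h: "\<And>t. t \<in> S' \<Longrightarrow> h t \<in> S" and V: "\<And>t. t \<in> S' \<Longrightarrow> V t \<ge> 0"
    and W: "\<And>t. t \<in> S' \<Longrightarrow> V t * W (h t) \<le> K * W' t"
  shows "ltail d S' W'"
proof -
  obtain \<epsilon> where e: "\<epsilon> \<longlonglongrightarrow> 0" "\<And>n. \<epsilon> n \<ge> 0" "\<And>N M t. t \<in> S \<Longrightarrow> (\<Sum>i\<in>{N..<M}. \<bar>c i t\<bar>) \<le> \<epsilon> N * W t"
    using c by (rule ltailE) blast
  have "(\<Sum>i\<in>{N..<M}. \<bar>d i t\<bar>) \<le> (\<epsilon> N * K) * W' t" if t: "t \<in> S'" for N M t
  proof -
    have "(\<Sum>i\<in>{N..<M}. \<bar>d i t\<bar>) \<le> V t * (\<Sum>i\<in>{N..<M}. \<bar>c i (h t)\<bar>)"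
      unfolding sum_distrib_left using d[OF t] by (rule sum_mono)
    also have "\<dots> \<le> V t * (\<epsilon> N * W (h t))" using e(3)[OF h[OF t]] V[OF t] by (rule mult_left_mono)
    also have "\<dots> = \<epsilon> N * (V t * W (h t))" by simp
    also have "\<dots> \<le> \<epsilon> N * (K * W' t)" using W[OF t] e(2) by (rule mult_left_mono)
    finally show ?thesis by simp
  qed
  moreover have "(\<lambda>n. \<epsilon> n * K) \<longlonglongrightarrow> 0 * K" using e(1) by (intro tendsto_intros)
  ultimately show ?thesis unfolding ltail_def using e(2) K by (intro exI[of _ "\<lambda>n. \<epsilon> n * K"]) auto
qed

lemma ltail_add:
  assumes "ltail c S W" "ltail d S W"
  shows "ltail (\<lambda>i t. c i t + d i t) S W"
proof -
  obtain \<epsilon> where e: "\<epsilon> \<longlonglongrightarrow> 0" "\<And>n. \<epsilon> n \<ge> 0" "\<And>N M t. t \<in> S \<Longrightarrow> (\<Sum>i\<in>{N..<M}. \<bar>c i t\<bar>) \<le> \<epsilon> N * W t"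
    using assms(1) by (rule ltailE) blast
  obtain \<eta> where h: "\<eta> \<longlonglongrightarrow> 0" "\<And>n. \<eta> n \<ge> 0" "\<And>N M t. t \<in> S \<Longrightarrow> (\<Sum>i\<in>{N..<M}. \<bar>d i t\<bar>) \<le> \<eta> N * W t"
    using assms(2) by (rule ltailE) blast
  have "(\<Sum>i\<in>{N..<M}. \<bar>c i t + d i t\<bar>) \<le> (\<epsilon> N + \<eta> N) * W t" if "t \<in> S" for N M t
  proof -
    have "(\<Sum>i\<in>{N..<M}. \<bar>c i t + d i t\<bar>) \<le> (\<Sum>i\<in>{N..<M}. \<bar>c i t\<bar>) + (\<Sum>i\<in>{N..<M}. \<bar>d i t\<bar>)"
      unfolding sum.distrib[symmetric] by (intro sum_mono abs_triangle_ineq)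
    then show ?thesis using e(3)[OF that] h(3)[OF that] by (smt (verit) distrib_right)
  qed
  moreover have "(\<lambda>n. \<epsilon> n + \<eta> n) \<longlonglongrightarrow> 0 + 0" using e(1) h(1) by (intro tendsto_intros)
  ultimately show ?thesis unfolding ltail_def using e(2) h(2)
    by (intro exI[of _ "\<lambda>n. \<epsilon> n + \<eta> n"]) auto
qed

lemma ltail_bound:
  assumes "ltail c S W" and W: "\<And>t. t \<in> S \<Longrightarrow> W t \<ge> 0"
  shows "\<exists>K\<ge>0. \<forall>t\<in>S. summable (\<lambda>i. \<bar>c i t\<bar>) \<and> (\<Sum>i. \<bar>c i t\<bar>) \<le> K * W t"
proof -
  obtain \<epsilon> where e: "\<epsilon> \<longlonglongrightarrow> 0" "\<And>n. \<epsilon> n \<ge> 0" "\<And>N M t. t \<in> S \<Longrightarrow> (\<Sum>i\<in>{N..<M}. \<bar>c i t\<bar>) \<le> \<epsilon> N * W t"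
    using assms(1) by (rule ltailE) blast
  have b: "(\<Sum>i<M. \<bar>c i t\<bar>) \<le> \<epsilon> 0 * W t" if "t \<in> S" for t M
    using e(3)[OF that, of 0 M] by (simp add: atLeast0LessThan)
  have s: "summable (\<lambda>i. \<bar>c i t\<bar>)" if "t \<in> S" for t
    by (rule bounded_imp_summable[of _ "\<epsilon> 0 * W t"])
      (use b[OF that] in \<open>auto simp: lessThan_Suc_atMost[symmetric] simp del: sum.lessThan_Suc\<close>)
  have "(\<Sum>i. \<bar>c i t\<bar>) \<le> \<epsilon> 0 * W t" if "t \<in> S" for t
    by (rule suminf_le_const[OF s[OF that] b[OF that]])
  then show ?thesis using s e(2) by blast
qed

text \<open>The suprema over t of the single terms need not be summable, so the Weierstrass test is
  out of reach; the common rate of the tails replaces it.\<close>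

lemma ltail_uniform:
  assumes "ltail c S W" and W: "\<And>t. t \<in> S \<Longrightarrow> W t \<le> K" and x: "\<And>i. \<bar>x i\<bar> \<le> (B :: real)"
  shows "uniform_limit S (\<lambda>n t. \<Sum>i<n. c i t * x i) (\<lambda>t. \<Sum>i. c i t * x i) sequentially"
proof (rule uniform_limitI)
  fix \<delta> :: real assume \<delta>: "\<delta> > 0"
  obtain \<epsilon> where e: "\<epsilon> \<longlonglongrightarrow> 0" "\<And>n. \<epsilon> n \<ge> 0" "\<And>N M t. t \<in> S \<Longrightarrow> (\<Sum>i\<in>{N..<M}. \<bar>c i t\<bar>) \<le> \<epsilon> N * W t"
    using assms(1) by (rule ltailE) blast
  have B: "B \<ge> 0" using x[of 0] by linarith
  have b: "(\<Sum>i\<in>{N..<M}. \<bar>c i t * x i\<bar>) \<le> \<epsilon> N * \<bar>K\<bar> * B" if t: "t \<in> S" for N M t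
  proof -
    have "(\<Sum>i\<in>{N..<M}. \<bar>c i t * x i\<bar>) \<le> (\<Sum>i\<in>{N..<M}. \<bar>c i t\<bar> * B)"
      unfolding abs_mult by (intro sum_mono mult_left_mono x) auto
    also have "\<dots> = (\<Sum>i\<in>{N..<M}. \<bar>c i t\<bar>) * B" by (simp add: sum_distrib_right)
    also have "\<dots> \<le> (\<epsilon> N * W t) * B" using e(3)[OF t] B by (rule mult_right_mono)
    also have "\<dots> \<le> (\<epsilon> N * \<bar>K\<bar>) * B" using W[OF t] e(2) B by (intro mult_right_mono mult_left_mono) auto
    finally show ?thesis .
  qed
  have s: "summable (\<lambda>i. \<bar>c i t * x i\<bar>)" if "t \<in> S" for t
    by (rule bounded_imp_summable[of _ "\<epsilon> 0 * \<bar>K\<bar> * B"])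
      (use b[OF that, of 0] in \<open>auto simp: lessThan_Suc_atMost[symmetric] atLeast0LessThan simp del: sum.lessThan_Suc\<close>)
  have "(\<lambda>n. \<epsilon> n * \<bar>K\<bar> * B) \<longlonglongrightarrow> 0 * \<bar>K\<bar> * B" using e(1) by (intro tendsto_intros)
  then have "\<forall>\<^sub>F n in sequentially. \<epsilon> n * \<bar>K\<bar> * B < \<delta>" using \<delta> by (intro order_tendstoD) auto
  then show "\<forall>\<^sub>F n in sequentially. \<forall>t\<in>S. dist (\<Sum>i<n. c i t * x i) (\<Sum>i. c i t * x i) < \<delta>"
  proof eventually_elim
    case (elim n)
    show ?case
    proof
      fix t assume t: "t \<in> S"
      have s': "summable (\<lambda>i. c i t * x i)" using s[OF t] by (rule summable_rabs_cancel)
      have sn: "summable (\<lambda>i. \<bar>c (i + n) t * x (i + n)\<bar>)" using s[OF t] by (subst summable_iff_shift)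
      have "dist (\<Sum>i<n. c i t * x i) (\<Sum>i. c i t * x i) = \<bar>\<Sum>i. c (i + n) t * x (i + n)\<bar>"
        using suminf_minus_initial_segment[OF s', of n] by (simp add: dist_real_def abs_minus_commute)
      also have "\<dots> \<le> (\<Sum>i. \<bar>c (i + n) t * x (i + n)\<bar>)" by (rule summable_rabs[OF sn])
      also have "\<dots> \<le> \<epsilon> n * \<bar>K\<bar> * B"
      proof (rule suminf_le_const[OF sn])
        fix M
        have "(\<Sum>i<M. \<bar>c (i + n) t * x (i + n)\<bar>) = (\<Sum>i\<in>{n..<M + n}. \<bar>c i t * x i\<bar>)"
          using sum.shift_bounds_nat_ivl[of "\<lambda>i. \<bar>c i t * x i\<bar>" 0 n M] by (simp add: atLeast0LessThan)
        then show "(\<Sum>i<M. \<bar>c (i + n) t * x (i + n)\<bar>) \<le> \<epsilon> n * \<bar>K\<bar> * B" using b[OF t, of n "M + n"] by simp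
      qed
      finally show "dist (\<Sum>i<n. c i t * x i) (\<Sum>i. c i t * x i) < \<delta>" using elim by simp
    qed
  qed
qed

lemma ltail_series_deriv:
  assumes c': "ltail c' S W" and S: "convex S" and W: "\<And>t. t \<in> S \<Longrightarrow> W t \<le> K"
    and x: "\<And>i. \<bar>x i\<bar> \<le> (B :: real)"
    and d: "\<And>i t. t \<in> S \<Longrightarrow> (c i has_real_derivative c' i t) (at t within S)"
    and s: "\<And>t. t \<in> S \<Longrightarrow> summable (\<lambda>i. c i t * x i)" and t: "t \<in> S"
  shows "((\<lambda>t. \<Sum>i. c i t * x i) has_real_derivative (\<Sum>i. c' i t * x i)) (at t within S)"
proof -
  have "\<exists>g. \<forall>t\<in>S. (\<lambda>i. c i t * x i) sums g t \<and> (g has_real_derivative (\<Sum>i. c' i t * x i)) (at t within S)"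
  proof (rule has_field_derivative_series[where f' = "\<lambda>i t. c' i t * x i"])
    show "convex S" "t \<in> S" "summable (\<lambda>i. c i t * x i)" using S t s[OF t] by auto
    show "uniform_limit S (\<lambda>n t. \<Sum>i<n. c' i t * x i) (\<lambda>t. \<Sum>i. c' i t * x i) sequentially"
      using c' W x by (rule ltail_uniform)
    show "((\<lambda>t. c n t * x n) has_real_derivative c' n t * x n) (at t within S)" if "t \<in> S" for n t
      using d[OF that] by (rule DERIV_cmult_right)
  qed
  then obtain g where g: "\<And>t. t \<in> S \<Longrightarrow> (\<lambda>i. c i t * x i) sums g t"
    "\<And>t. t \<in> S \<Longrightarrow> (g has_real_derivative (\<Sum>i. c' i t * x i)) (at t within S)" by blast
  show ?thesis
    by (rule has_field_derivative_transform_within[OF g(2)[OF t], of 1]) (use t g(1) sums_unique in auto)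
qed

text \<open>The Cauchy-Schwarz inequality with the summable weight $\lambda_i^{-3/4}$.\<close>

lemma ltail_of_square_sum:
  fixes l :: "nat \<Rightarrow> real"
  assumes l: "\<And>i. l i > 0" and ls: "summable (\<lambda>i. l i powr (- (3 / 4)))" and K: "K \<ge> 0"
    and W: "\<And>t. t \<in> S \<Longrightarrow> W t \<ge> 0"
    and c: "\<And>t. t \<in> S \<Longrightarrow> summable (\<lambda>i. l i powr (2 * \<gamma>) * (c i t)\<^sup>2)"
    and cb: "\<And>t. t \<in> S \<Longrightarrow> sqrt (\<Sum>i. l i powr (2 * \<gamma>) * (c i t)\<^sup>2) \<le> K * W t"
  shows "ltail (\<lambda>i t. l i powr (\<gamma> - 3 / 8) * c i t) S W"
proof -
  define r where "r N = (\<Sum>i. l (i + N) powr (- (3 / 4)))" for N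
  have r0: "r N \<ge> 0" for N unfolding r_def
    by (intro suminf_nonneg) (use ls in \<open>auto simp: summable_iff_shift[of "\<lambda>i. l i powr (- (3 / 4))"]\<close>)
  have rl: "r \<longlonglongrightarrow> 0" unfolding r_def by (rule suminf_exist_split2[OF ls])
  have rs: "(\<Sum>i\<in>{N..<M}. l i powr (- (3 / 4))) \<le> r N" for N M
  proof -
    have "(\<Sum>i\<in>{N..<M}. l i powr (- (3 / 4))) = (\<Sum>i<M - N. l (i + N) powr (- (3 / 4)))"
      using sum.shift_bounds_nat_ivl[of "\<lambda>i. l i powr (- (3 / 4))" 0 N "M - N"]
      by (cases "N \<le> M") (auto simp: atLeast0LessThan)
    also have "\<dots> \<le> r N" unfolding r_def
      by (intro sum_le_suminf) (use ls in \<open>auto simp: summable_iff_shift[of "\<lambda>i. l i powr (- (3 / 4))"]\<close>)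
    finally show ?thesis .
  qed
  have "(\<Sum>i\<in>{N..<M}. \<bar>l i powr (\<gamma> - 3 / 8) * c i t\<bar>) \<le> (sqrt (r N) * K) * W t" if t: "t \<in> S" for N M t
  proof -
    let ?a = "\<lambda>i. l i powr (- (3 / 8))" and ?b = "\<lambda>i. l i powr \<gamma> * \<bar>c i t\<bar>"
    have "\<bar>l i powr (\<gamma> - 3 / 8) * c i t\<bar> = ?a i * ?b i" for i
      using l[of i] by (simp add: abs_mult powr_add[symmetric])
    then have "(\<Sum>i\<in>{N..<M}. \<bar>l i powr (\<gamma> - 3 / 8) * c i t\<bar>) = (\<Sum>i\<in>{N..<M}. ?a i * ?b i)" by simp
    also have "\<dots> \<le> sqrt ((\<Sum>i\<in>{N..<M}. (?a i)\<^sup>2) * (\<Sum>i\<in>{N..<M}. (?b i)\<^sup>2))"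
      by (intro real_le_rsqrt Cauchy_Schwarz_ineq_sum)
    also have "\<dots> = sqrt (\<Sum>i\<in>{N..<M}. l i powr (- (3 / 4))) * sqrt (\<Sum>i\<in>{N..<M}. l i powr (2 * \<gamma>) * (c i t)\<^sup>2)"
    proof -
      have p: "(l i powr y)\<^sup>2 = l i powr (2 * y)" for i y
        using l[of i] by (simp add: power2_eq_square powr_add[symmetric])
      show ?thesis unfolding power_mult_distrib p by (simp add: real_sqrt_mult)
    qed
    also have "\<dots> \<le> sqrt (r N) * (K * W t)"
    proof (intro mult_mono real_sqrt_le_mono rs order.trans[OF _ cb[OF t]])
      show "(\<Sum>i\<in>{N..<M}. l i powr (2 * \<gamma>) * (c i t)\<^sup>2) \<le> (\<Sum>i. l i powr (2 * \<gamma>) * (c i t)\<^sup>2)"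
        by (intro sum_le_suminf c t) auto
    qed (use r0 in \<open>auto intro!: sum_nonneg\<close>)
    finally show ?thesis by simp
  qed
  moreover have "(\<lambda>n. sqrt (r n) * K) \<longlonglongrightarrow> sqrt 0 * K" using rl by (intro tendsto_intros)
  ultimately show ?thesis unfolding ltail_def using r0 K
    by (intro exI[of _ "\<lambda>n. sqrt (r n) * K"]) auto
qed

text \<open>The crude factor l i in the bound for e1, instead of its square root, is affordable: the
  coefficients are controlled with the power 9/8 of l i, and the second derivative needs a full
  power anyway.\<close>

locale dirichlet_basis =
  fixes L B :: real and l :: "nat \<Rightarrow> real" and e e1 e2 :: "nat \<Rightarrow> real \<Rightarrow> real"
  assumes L: "L > 0" and B: "B > 0" and l_pos: "\<And>i. l i > 0"
    and e_deriv: "\<And>i x. x \<in> {0..L} \<Longrightarrow> (e i has_real_derivative e1 i x) (at x within {0..L})"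
    and e1_deriv: "\<And>i x. x \<in> {0..L} \<Longrightarrow> (e1 i has_real_derivative e2 i x) (at x within {0..L})"
    and e_bound: "\<And>i x. x \<in> {0..L} \<Longrightarrow> \<bar>e i x\<bar> \<le> B"
    and e1_bound: "\<And>i x. x \<in> {0..L} \<Longrightarrow> \<bar>e1 i x\<bar> \<le> B * l i"
    and e2_bound: "\<And>i x. x \<in> {0..L} \<Longrightarrow> \<bar>e2 i x\<bar> \<le> B * l i"
    and orthonormal: "\<And>i j. ((\<lambda>x. e i x * e j x) has_integral (if i = j then 1 else 0)) {0..L}"
    and l_summable: "summable (\<lambda>i. l i powr (- (3 / 4)))"
    and complete: "\<And>\<eta>. \<eta> absolutely_integrable_on {0..L} \<Longrightarrow> (\<And>i. integral {0..L} (\<lambda>x. e i x * \<eta> x) = 0) \<Longrightarrow>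
       negligible {x \<in> {0..L}. \<eta> x \<noteq> 0}"
    and l_bounded_below: "\<exists>l0>0. \<forall>i. l i \<ge> l0"
begin

lemma e_cont: "continuous_on {0..L} (e i)"
  using e_deriv unfolding continuous_on_eq_continuous_within by (meson DERIV_continuous)

lemma series_summable:
  assumes "summable (\<lambda>i. \<bar>c i\<bar>)" "x \<in> {0..L}"
  shows "summable (\<lambda>i. c i * e i x)"
proof (rule summable_comparison_test'[where g = "\<lambda>i. \<bar>c i\<bar> * B"])
  show "summable (\<lambda>i. \<bar>c i\<bar> * B)" using assms(1) by (rule summable_mult2)
  show "norm (c i * e i x) \<le> \<bar>c i\<bar> * B" for i
    using e_bound[OF assms(2)] by (simp add: abs_mult mult_left_mono)
qed

lemma series_abs_le:
  fixes B' :: real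
  assumes "summable (\<lambda>i. \<bar>c i\<bar>)" and y: "\<And>i. \<bar>y i\<bar> \<le> B'"
  shows "\<bar>\<Sum>i. c i * y i\<bar> \<le> B' * (\<Sum>i. \<bar>c i\<bar>)"
proof -
  have s: "summable (\<lambda>i. B' * \<bar>c i\<bar>)" using assms(1) by (rule summable_mult)
  have le: "norm (c i * y i) \<le> B' * \<bar>c i\<bar>" for i
    using y[of i] by (simp add: abs_mult mult.commute[of B'] mult_left_mono)
  have s': "summable (\<lambda>i. \<bar>c i * y i\<bar>)"
    by (rule summable_comparison_test'[OF s, of 0]) (use le in auto)
  have "\<bar>\<Sum>i. c i * y i\<bar> \<le> (\<Sum>i. \<bar>c i * y i\<bar>)" by (rule summable_rabs[OF s'])
  also have "\<dots> \<le> (\<Sum>i. B' * \<bar>c i\<bar>)" using le by (intro suminf_le s s') auto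
  also have "\<dots> = B' * (\<Sum>i. \<bar>c i\<bar>)" by (rule suminf_mult[OF assms(1)])
  finally show ?thesis .
qed

lemma series_continuous:
  assumes "summable (\<lambda>i. \<bar>c i\<bar>)"
  shows "continuous_on {0..L} (\<lambda>x. \<Sum>i. c i * e i x)"
proof (rule uniform_limit_theorem)
  show "uniform_limit {0..L} (\<lambda>n x. \<Sum>i<n. c i * e i x) (\<lambda>x. \<Sum>i. c i * e i x) sequentially"
  proof (rule Weierstrass_m_test[where M = "\<lambda>i. \<bar>c i\<bar> * B"])
    show "norm (c i * e i x) \<le> \<bar>c i\<bar> * B" if "x \<in> {0..L}" for i x
      using e_bound[OF that] by (simp add: abs_mult mult_left_mono)
    show "summable (\<lambda>i. \<bar>c i\<bar> * B)" using assms by (rule summable_mult2)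
  qed
  show "\<forall>\<^sub>F n in sequentially. continuous_on {0..L} (\<lambda>x. \<Sum>i<n. c i * e i x)"
    by (intro always_eventually allI continuous_intros e_cont)
qed simp

lemma series_coefficient:
  assumes "summable (\<lambda>i. \<bar>c i\<bar>)"
  shows "integral {0..L} (\<lambda>x. e j x * (\<Sum>i. c i * e i x)) = c j"
proof -
  have h: "((\<lambda>x. \<Sum>i<n. c i * (e j x * e i x)) has_integral (\<Sum>i<n. c i * (if j = i then 1 else 0))) {0..L}" for n
    by (intro has_integral_sum has_integral_mult_right orthonormal) auto
  have "(\<lambda>n. integral {0..L} (\<lambda>x. \<Sum>i<n. c i * (e j x * e i x))) \<longlonglongrightarrow> integral {0..L} (\<lambda>x. e j x * (\<Sum>i. c i * e i x))"
  proof (rule dominated_convergence(2))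
    show "(\<lambda>x. \<Sum>i<n. c i * (e j x * e i x)) integrable_on {0..L}" for n using h by (rule has_integral_integrable)
    show "(\<lambda>x. B * B * (\<Sum>i. \<bar>c i\<bar>)) integrable_on {0..L}" by (rule integrable_const_ivl)
    fix x assume x: "x \<in> {0..L}"
    have bb: "\<bar>e j x * e i x\<bar> \<le> B * B" for i
      unfolding abs_mult using e_bound[OF x] B by (intro mult_mono) auto
    show "norm (\<Sum>i<n. c i * (e j x * e i x)) \<le> B * B * (\<Sum>i. \<bar>c i\<bar>)" for n
    proof -
      have "norm (\<Sum>i<n. c i * (e j x * e i x)) \<le> (\<Sum>i<n. \<bar>c i\<bar> * (B * B))"
        using bb by (intro sum_norm_le) (simp add: abs_mult mult_left_mono)
      also have "\<dots> = B * B * (\<Sum>i<n. \<bar>c i\<bar>)" by (simp add: sum_distrib_left mult.commute)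
      also have "\<dots> \<le> B * B * (\<Sum>i. \<bar>c i\<bar>)" using assms B by (intro mult_left_mono sum_le_suminf) auto
      finally show ?thesis .
    qed
    have "(\<lambda>i. e j x * (c i * e i x)) sums (e j x * (\<Sum>i. c i * e i x))"
      by (intro sums_mult summable_sums series_summable assms x)
    then show "(\<lambda>n. \<Sum>i<n. c i * (e j x * e i x)) \<longlonglongrightarrow> e j x * (\<Sum>i. c i * e i x)"
      unfolding sums_def by (simp add: mult.left_commute)
  qed
  moreover have "(\<lambda>n. integral {0..L} (\<lambda>x. \<Sum>i<n. c i * (e j x * e i x))) \<longlonglongrightarrow> c j"
  proof (rule tendsto_eventually, rule eventually_mono[OF eventually_gt_at_top[of j]])
    fix n assume "j < n"
    then have "(\<Sum>i<n. c i * (if j = i then 1 else 0)) = c j" by (simp add: if_distrib cong: if_cong)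
    then show "integral {0..L} (\<lambda>x. \<Sum>i<n. c i * (e j x * e i x)) = c j" using integral_unique[OF h[of n]] by simp
  qed
  ultimately show ?thesis by (rule LIMSEQ_unique)
qed

text \<open>The absolutely convergent series is a continuous function with the same coefficients, so
  completeness applies to the difference.\<close>

lemma coefficients_determine:
  assumes \<eta>: "\<eta> absolutely_integrable_on {0..L}"
    and s: "summable (\<lambda>i. \<bar>integral {0..L} (\<lambda>x. e i x * \<eta> x)\<bar>)"
  shows "negligible {x \<in> {0..L}. \<eta> x \<noteq> (\<Sum>i. integral {0..L} (\<lambda>x. e i x * \<eta> x) * e i x)}"
proof -
  define S where "S x = (\<Sum>i. integral {0..L} (\<lambda>x. e i x * \<eta> x) * e i x)" for x
  have Sc: "continuous_on {0..L} S" unfolding S_def by (rule series_continuous[OF s])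
  then have Sa: "S absolutely_integrable_on {0..L}" by (rule absolutely_integrable_continuous_real)
  have "integral {0..L} (\<lambda>x. e i x * (\<eta> x - S x)) = 0" for i
  proof -
    have "(\<lambda>x. e i x * \<eta> x) integrable_on {0..L}"
      using absolutely_integrable_mult_continuous[OF \<eta> e_cont] by (simp add: absolutely_integrable_on_def)
    moreover have "(\<lambda>x. e i x * S x) integrable_on {0..L}"
      by (intro integrable_continuous_real continuous_intros Sc e_cont)
    ultimately have "integral {0..L} (\<lambda>x. e i x * (\<eta> x - S x)) = integral {0..L} (\<lambda>x. e i x * \<eta> x) - integral {0..L} (\<lambda>x. e i x * S x)"
      by (simp add: right_diff_distrib integral_diff)
    then show ?thesis unfolding S_def series_coefficient[OF s] by simp
  qed
  then have "negligible {x \<in> {0..L}. \<eta> x - S x \<noteq> 0}"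
    using \<eta> Sa by (intro complete set_integral_diff) auto
  then show ?thesis by (simp add: S_def)
qed

text \<open>For a continuous function the exceptional set is relatively open; if nonempty it would
  contain an interval.\<close>

lemma coefficients_determine_continuous:
  assumes \<eta>: "continuous_on {0..L} \<eta>"
    and s: "summable (\<lambda>i. \<bar>integral {0..L} (\<lambda>x. e i x * \<eta> x)\<bar>)" and x: "x \<in> {0..L}"
  shows "\<eta> x = (\<Sum>i. integral {0..L} (\<lambda>x. e i x * \<eta> x) * e i x)"
proof (rule ccontr)
  assume ne: "\<not> ?thesis"
  define h where "h x = \<bar>\<eta> x - (\<Sum>i. integral {0..L} (\<lambda>x. e i x * \<eta> x) * e i x)\<bar>" for x
  have hc: "continuous_on {0..L} h" unfolding h_def by (intro continuous_intros \<eta> series_continuous s)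
  have neg: "negligible {x \<in> {0..L}. h x \<noteq> 0}"
    using coefficients_determine[OF absolutely_integrable_continuous_real[OF \<eta>] s] by (simp add: h_def)
  have "h x > 0" using ne by (simp add: h_def)
  then obtain \<delta> where \<delta>: "\<delta> > 0" "\<And>y. y \<in> {0..L} \<Longrightarrow> dist y x < \<delta> \<Longrightarrow> dist (h y) (h x) < h x"
    using hc x unfolding continuous_on_iff by blast
  define a b where "a = max 0 (x - \<delta>)" and "b = min L (x + \<delta>)"
  have ab: "a < b" using x L \<delta> by (auto simp: a_def b_def)
  have "{a<..<b} \<subseteq> {x \<in> {0..L}. h x \<noteq> 0}"
  proof
    fix y assume y: "y \<in> {a<..<b}"
    then have "y \<in> {0..L}" "dist y x < \<delta>" by (auto simp: a_def b_def dist_real_def)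
    then show "y \<in> {x \<in> {0..L}. h x \<noteq> 0}" using \<delta>(2)[of y] by (auto simp: dist_real_def)
  qed
  then have "negligible {a<..<b}" using neg negligible_subset by blast
  then show False using ab open_not_negligible[of "{a<..<b}"] by auto
qed

end

lemma eigensystem_basis:
  assumes L: "L > 0" and p: "p > 0" and a: "a \<le> 0" and es: "dirichlet_eigensystem p a L lam X"
  shows "\<exists>B e1 e2. dirichlet_basis L B (\<lambda>i. lam (Suc i)) (\<lambda>i. X (Suc i)) e1 e2"
proof -
  obtain \<sigma> s where \<sigma>: "bij_betw \<sigma> {1..} {1::nat..}"
    and lam: "\<And>i. i \<ge> 1 \<Longrightarrow> lam i = p * (real (\<sigma> i) * pi / L)\<^sup>2 - a"
    and s: "\<And>i. i \<ge> 1 \<Longrightarrow> s i = 1 \<or> s i = (-1 :: real)"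
    and X: "\<And>i x. i \<ge> 1 \<Longrightarrow> x \<in> {0..L} \<Longrightarrow> X i x = s i * sqrt (2 / L) * sin (real (\<sigma> i) * pi / L * x)"
    using eigensystem_form[OF L p es] by metis
  have \<sigma>1: "\<sigma> (Suc i) \<ge> 1" for i using \<sigma> by (auto simp: bij_betw_def)
  define \<omega> where "\<omega> i = real (\<sigma> (Suc i)) * pi / L" for i
  define q where "q i = s (Suc i) * sqrt (2 / L)" for i
  define c where "c = sqrt (2 / L)"
  define l where "l i = lam (Suc i)" for i
  have c: "c > 0" using L by (simp add: c_def)
  have q: "\<bar>q i\<bar> = c" for i using s[of "Suc i"] L by (auto simp: q_def c_def)
  have \<omega>: "\<omega> i \<ge> pi / L" for i
    unfolding \<omega>_def using \<sigma>1[of i] L by (intro divide_right_mono) auto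
  have \<omega>0: "\<omega> i > 0" for i using \<omega>[of i] L by (smt (verit) divide_pos_pos pi_gt_zero)
  have l: "p * (\<omega> i)\<^sup>2 \<le> l i" for i using lam[of "Suc i"] a by (simp add: l_def \<omega>_def)
  have Xe: "X (Suc i) x = q i * sin (\<omega> i * x)" if "x \<in> {0..L}" for i x
    using X[of "Suc i" x] that by (simp add: q_def \<omega>_def)
  \<comment> \<open>The three summands serve the eigenfunctions, their second and their first
    derivatives, in this order; the last uses \<omega> \<ge> \<pi>/L to bound \<omega> by a multiple
    of \<omega>^2.\<close>
  define B where "B = c * (1 + 1 / p + L / (pi * p))"
  have B: "B > 0" "c \<le> B" "c * (1 / p) \<le> B" "c * (L / (pi * p)) \<le> B"
    using c p L by (auto simp: B_def add_pos_pos field_simps)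
  have lpos: "l i > 0" for i using l[of i] \<omega>0[of i] p by (smt (verit) mult_pos_pos zero_less_power)
  have w2: "c * (\<omega> i)\<^sup>2 \<le> B * l i" for i
  proof -
    have "c * (\<omega> i)\<^sup>2 \<le> c * (l i / p)" using l[of i] p c by (intro mult_left_mono) (auto simp: pos_le_divide_eq mult.commute)
    also have "\<dots> = c * (1 / p) * l i" by simp
    also have "\<dots> \<le> B * l i" using B lpos[of i] by (intro mult_right_mono) auto
    finally show ?thesis .
  qed
  have w1: "c * \<omega> i \<le> B * l i" for i
  proof -
    have "1 \<le> \<omega> i * (L / pi)" using \<omega>[of i] L by (simp add: field_simps)
    then have "\<omega> i * 1 \<le> \<omega> i * (\<omega> i * (L / pi))" using \<omega>0[of i] by (intro mult_left_mono) auto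
    also have "\<dots> = (\<omega> i)\<^sup>2 * (L / pi)" by (simp add: power2_eq_square)
    also have "\<dots> \<le> (l i / p) * (L / pi)" using l[of i] p L by (intro mult_right_mono) (auto simp: pos_le_divide_eq mult.commute)
    finally have "\<omega> i \<le> (l i / p) * (L / pi)" by simp
    then have "c * \<omega> i \<le> c * ((l i / p) * (L / pi))" using c by (intro mult_left_mono) auto
    also have "\<dots> = c * (L / (pi * p)) * l i" by (simp add: mult_ac)
    also have "\<dots> \<le> B * l i" using B lpos[of i] by (intro mult_right_mono) auto
    finally show ?thesis .
  qed
  define e1 where "e1 i x = q i * \<omega> i * cos (\<omega> i * x)" for i x
  define e2 where "e2 i x = - (q i * (\<omega> i)\<^sup>2 * sin (\<omega> i * x))" for i x
  have inj: "inj (\<lambda>i. \<sigma> (Suc i))" using \<sigma> by (auto simp: bij_betw_def inj_on_def inj_def)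
  have "dirichlet_basis L B l (\<lambda>i. X (Suc i)) e1 e2"
  proof
    show "L > 0" "B > 0" "l i > 0" for i using L B lpos by auto
    fix i x assume x: "x \<in> {0..L}"
    have "((\<lambda>x. q i * sin (\<omega> i * x)) has_real_derivative e1 i x) (at x within {0..L})"
      unfolding e1_def by (auto intro!: derivative_eq_intros)
    then show "(X (Suc i) has_real_derivative e1 i x) (at x within {0..L})"
      by (rule has_field_derivative_transform_within[of _ _ _ _ 1]) (use x Xe in auto)
    show "(e1 i has_real_derivative e2 i x) (at x within {0..L})"
      unfolding e1_def[abs_def] e2_def by (auto intro!: derivative_eq_intros simp: power2_eq_square)
    have "c * \<bar>sin (\<omega> i * x)\<bar> \<le> c * 1" using c by (intro mult_left_mono) auto
    then show "\<bar>X (Suc i) x\<bar> \<le> B" using Xe[OF x, of i] q[of i] B by (simp add: abs_mult)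
    have "c * \<omega> i * \<bar>cos (\<omega> i * x)\<bar> \<le> c * \<omega> i * 1" using c \<omega>0[of i] by (intro mult_left_mono) auto
    then show "\<bar>e1 i x\<bar> \<le> B * l i" using w1[of i] q[of i] \<omega>0[of i] by (simp add: e1_def abs_mult)
    have "c * (\<omega> i)\<^sup>2 * \<bar>sin (\<omega> i * x)\<bar> \<le> c * (\<omega> i)\<^sup>2 * 1" using c by (intro mult_left_mono) auto
    then show "\<bar>e2 i x\<bar> \<le> B * l i" using w2[of i] q[of i] by (simp add: e2_def abs_mult)
  next
    show "((\<lambda>x. X (Suc i) x * X (Suc j) x) has_integral (if i = j then 1 else 0)) {0..L}" for i j
      using eigenfunctions_orthonormal[OF L p es, of "Suc i" "Suc j"] by simp
    show "summable (\<lambda>i. l i powr (- (3 / 4)))"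
    proof (rule summable_comparison_test')
      \<comment> \<open>The eigenvalue is at least a multiple of \<sigma>(i)^2, so the power -3/4
        becomes -3/2, and injectivity of \<sigma> transfers summability.\<close>
      have "summable (\<lambda>n. real n powr (- (3 / 2)))" by (simp add: summable_real_powr_iff)
      then have "summable ((\<lambda>n. real n powr (- (3 / 2))) \<circ> (\<lambda>i. \<sigma> (Suc i)))"
        by (rule summable_reindex[OF _ inj]) auto
      then show "summable (\<lambda>i. (p * (pi / L)\<^sup>2) powr (- (3 / 4)) * real (\<sigma> (Suc i)) powr (- (3 / 2)))"
        by (intro summable_mult) (simp add: o_def)
      fix i
      have "norm (l i powr (- (3 / 4))) \<le> (p * (\<omega> i)\<^sup>2) powr (- (3 / 4))"
        using l[of i] \<omega>0[of i] p by (auto intro!: powr_mono2')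
      also have "p * (\<omega> i)\<^sup>2 = p * (pi / L)\<^sup>2 * (real (\<sigma> (Suc i))) powr 2"
        using \<sigma>1[of i] by (simp add: \<omega>_def power_mult_distrib power_divide powr_numeral)
      also have "\<dots> powr (- (3 / 4)) = (p * (pi / L)\<^sup>2) powr (- (3 / 4)) * real (\<sigma> (Suc i)) powr (- (3 / 2))"
      proof -
        have "(p * (pi / L)\<^sup>2 * real (\<sigma> (Suc i)) powr 2) powr (- (3 / 4)) =
            (p * (pi / L)\<^sup>2) powr (- (3 / 4)) * (real (\<sigma> (Suc i)) powr 2) powr (- (3 / 4))"
          by (simp only: powr_mult)
        then show ?thesis unfolding powr_powr by simp
      qed
      finally show "norm (l i powr (- (3 / 4))) \<le> (p * (pi / L)\<^sup>2) powr (- (3 / 4)) * real (\<sigma> (Suc i)) powr (- (3 / 2))" .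
    qed
    fix \<eta> assume \<eta>: "\<eta> absolutely_integrable_on {0..L}"
      and z: "\<And>i. integral {0..L} (\<lambda>x. X (Suc i) x * \<eta> x) = 0"
    show "negligible {x \<in> {0..L}. \<eta> x \<noteq> 0}"
    proof (rule sine_coefficients_zero_imp_negligible[OF L \<eta>])
      fix n :: nat assume "n \<ge> 1"
      then have "n \<in> \<sigma> ` {1..}" using \<sigma> by (auto simp: bij_betw_def)
      then obtain i0 where i0: "i0 \<ge> 1" "n = \<sigma> i0" by auto
      then obtain i where i: "n = \<sigma> (Suc i)" by (cases i0) auto
      have "0 = integral {0..L} (\<lambda>x. X (Suc i) x * \<eta> x)" using z by simp
      also have "\<dots> = integral {0..L} (\<lambda>x. q i * (sin (\<omega> i * x) * \<eta> x))"
        using Xe by (intro integral_cong) (simp add: mult.assoc)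
      also have "\<dots> = q i * integral {0..L} (\<lambda>x. sin (\<omega> i * x) * \<eta> x)" by simp
      finally show "integral {0..L} (\<lambda>x. sin (real n * pi / L * x) * \<eta> x) = 0"
        using q[of i] c i by (auto simp: \<omega>_def)
    qed
  next
    have "p * (pi / L)\<^sup>2 \<le> l i" for i
    proof (rule order.trans[OF _ l])
      show "p * (pi / L)\<^sup>2 \<le> p * (\<omega> i)\<^sup>2" using \<omega>[of i] p L by (intro mult_left_mono power_mono) auto
    qed
    moreover have "p * (pi / L)\<^sup>2 > 0" using p L by simp
    ultimately show "\<exists>l0>0. \<forall>i. l0 \<le> l i" by blast
  qed
  then show ?thesis unfolding l_def[abs_def] by blast
qed

lemma square_integrable_imp_absolutely_integrable:
  assumes "square_integrable_on L g"
  shows "g absolutely_integrable_on {0..L}"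
proof (rule measurable_bounded_by_integrable_imp_absolutely_integrable)
  show "g \<in> borel_measurable (lebesgue_on {0..L})" using assms by (simp add: square_integrable_on_def)
  have "(\<lambda>x. (g x)\<^sup>2) integrable_on {0..L}"
    using assms by (intro integrable_on_lebesgue_on) (simp_all add: square_integrable_on_def)
  then show "(\<lambda>x. 1 + (g x)\<^sup>2) integrable_on {0..L}" by (intro integrable_add integrable_const_ivl)
  show "norm (g x) \<le> 1 + (g x)\<^sup>2" for x
  proof -
    have "0 \<le> (\<bar>g x\<bar> - 1)\<^sup>2" by simp
    then show ?thesis by (simp add: power2_diff)
  qed
qed auto

text \<open>The absolute value is there because \<open>ennreal C\<close> is 0 for negative
  \<open>C\<close>; finiteness of the bound rules out the infinite branch of the norm.\<close>

lemma G_norm_leD: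
  assumes "G_norm L lam X \<gamma> g \<le> ennreal C"
  shows "square_integrable_on L g"
    and "summable (\<lambda>i. lam (Suc i) powr (2 * \<gamma>) * (integral {0..L} (\<lambda>x. X (Suc i) x * g x))\<^sup>2)"
    and "sqrt (\<Sum>i. lam (Suc i) powr (2 * \<gamma>) * (integral {0..L} (\<lambda>x. X (Suc i) x * g x))\<^sup>2) \<le> \<bar>C\<bar>"
proof -
  let ?c = "\<lambda>i. lam (Suc i) powr (2 * \<gamma>) * (integral {0..L} (\<lambda>x. X (Suc i) x * g x))\<^sup>2"
  have c: "square_integrable_on L g \<and> summable ?c"
    using assms unfolding G_norm_def Let_def l2_inner_def by (auto split: if_splits simp: top_unique)
  then have "ennreal (sqrt (\<Sum>i. ?c i)) \<le> ennreal C"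
    using assms unfolding G_norm_def Let_def l2_inner_def by simp
  then have "sqrt (\<Sum>i. ?c i) \<le> C \<or> sqrt (\<Sum>i. ?c i) \<le> 0"
    unfolding ennreal_le_iff2 by blast
  then show "sqrt (\<Sum>i. ?c i) \<le> \<bar>C\<bar>" using abs_ge_self[of C] abs_ge_zero[of C] by linarith
  show "square_integrable_on L g" "summable ?c" using c by auto
qed

lemma (in dirichlet_basis) G_norm_ltail:
  assumes C: "\<And>t. t \<in> S \<Longrightarrow> G_norm L lam X \<gamma> (g t) \<le> ennreal (C * W t)" and W: "\<And>t. t \<in> S \<Longrightarrow> W t \<ge> 0"
    and l: "\<And>i. l i = lam (Suc i)" and e: "\<And>i. e i = X (Suc i)"
  shows "ltail (\<lambda>i t. l i powr (\<gamma> - 3 / 8) * integral {0..L} (\<lambda>x. e i x * g t x)) S W"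
proof (rule ltail_of_square_sum[OF l_pos l_summable, of "\<bar>C\<bar>"])
  fix t assume t: "t \<in> S"
  show "summable (\<lambda>i. l i powr (2 * \<gamma>) * (integral {0..L} (\<lambda>x. e i x * g t x))\<^sup>2)"
    using G_norm_leD(2)[OF C[OF t]] by (simp add: l e)
  show "sqrt (\<Sum>i. l i powr (2 * \<gamma>) * (integral {0..L} (\<lambda>x. e i x * g t x))\<^sup>2) \<le> \<bar>C\<bar> * W t"
    using G_norm_leD(3)[OF C[OF t]] W[OF t] by (simp add: l e abs_mult)
qed (use W in auto)

section \<open>The scalar equations\<close>

lemma relax_kernel:
  assumes \<alpha>: "0 < \<alpha>" "\<alpha> < 1" and l: "l > 0" and Br: "Br > 0"
    and b: "\<And>\<theta> t. \<theta> \<in> {0..1} \<Longrightarrow> t > 0 \<Longrightarrow> \<bar>relax1 \<alpha> l t\<bar> \<le> Br * (l powr \<theta> * t powr (\<theta> * \<alpha> - 1))"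
      "\<And>\<theta> t. \<theta> \<in> {0..1} \<Longrightarrow> t > 0 \<Longrightarrow> \<bar>relax2 \<alpha> l t\<bar> \<le> Br * (l powr \<theta> * t powr (\<theta> * \<alpha> - 2))"
  shows "relaxation_kernel \<alpha> (Br * l) (relax \<alpha> l) (relax1 \<alpha> l) (relax2 \<alpha> l)"
proof
  show "continuous_on {0<..} (relax2 \<alpha> l)"
    unfolding relax2_def using \<alpha> l
    by (intro continuous_intros continuous_on_compose2[OF continuous_on_mlt[OF \<alpha>, of UNIV]]) auto
  show "\<bar>relax1 \<alpha> l t\<bar> \<le> Br * l * t powr (\<alpha> - 1)" if "t > 0" for t
    using b(1)[of 1 t] that l by (simp add: mult.assoc)
  show "\<bar>relax2 \<alpha> l t\<bar> \<le> Br * l * t powr (\<alpha> - 2)" if "t > 0" for t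
    using b(2)[of 1 t] that l by (simp add: mult.assoc)
qed (use assms relax_deriv relax1_deriv continuous_on_relax relax_0 borel_measurable_relax1 in auto)

lemma integral_convolution_commute:
  fixes f g :: "real \<Rightarrow> real"
  assumes "t \<ge> 0"
  shows "integral {0..t} (\<lambda>s. f s * g (t - s)) = integral {0..t} (\<lambda>s. f (t - s) * g s)"
proof -
  have "integral {0..t} (\<lambda>s. f s * g (t - s)) = integral {- t..- 0} (\<lambda>s. f (- s) * g (t - (- s)))"
    by (rule Henstock_Kurzweil_Integration.integral_reflect_real[symmetric])
  also have "\<dots> = integral {- t..0} ((\<lambda>s. f (t - s) * g s) \<circ> (+) t)"
    by (simp add: o_def)
  also have "\<dots> = integral {- t + t..0 + t} (\<lambda>s. f (t - s) * g s)"
    by (rule integral_shift_Icc_real)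
  finally show ?thesis by simp
qed

lemma ltail_integral:
  assumes c: "ltail c {0<..T} W"
    and k: "\<And>r. k r \<ge> 0" and kW: "\<And>t. t \<in> S \<Longrightarrow> (\<lambda>s. k (t - s) * W s) integrable_on {0..t}"
    and K: "K \<ge> 0" "\<And>t. t \<in> S \<Longrightarrow> integral {0..t} (\<lambda>s. k (t - s) * W s) \<le> K * W' t"
    and S: "S \<subseteq> {0..T}"
    and ki: "\<And>i t. t \<in> S \<Longrightarrow> (\<lambda>s. k (t - s) * \<bar>c i s\<bar>) integrable_on {0..t}"
    and d: "\<And>i t. t \<in> S \<Longrightarrow> \<bar>d i t\<bar> \<le> integral {0..t} (\<lambda>s. k (t - s) * \<bar>c i s\<bar>)"
  shows "ltail d S W'"
proof -
  obtain \<epsilon> where e: "\<epsilon> \<longlonglongrightarrow> 0" "\<And>n. \<epsilon> n \<ge> 0" "\<And>N M t. t \<in> {0<..T} \<Longrightarrow> (\<Sum>i\<in>{N..<M}. \<bar>c i t\<bar>) \<le> \<epsilon> N * W t"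
    using c by (rule ltailE) blast
  have "(\<Sum>i\<in>{N..<M}. \<bar>d i t\<bar>) \<le> (\<epsilon> N * K) * W' t" if t: "t \<in> S" for N M t
  proof -
    let ?f = "\<lambda>s. \<Sum>i\<in>{N..<M}. k (t - s) * \<bar>c i s\<bar>"
    have fi: "?f integrable_on {0..t}" using ki[OF t] by (intro integrable_sum) auto
    define f where "f s = (if s = 0 then 0 else ?f s)" for s
    define g where "g s = (if s = 0 then 0 else \<epsilon> N * (k (t - s) * W s))" for s
    have gi: "(\<lambda>s. \<epsilon> N * (k (t - s) * W s)) integrable_on {0..t}" using kW[OF t] by (rule integrable_on_mult_right)
    have "(\<Sum>i\<in>{N..<M}. \<bar>d i t\<bar>) \<le> (\<Sum>i\<in>{N..<M}. integral {0..t} (\<lambda>s. k (t - s) * \<bar>c i s\<bar>))"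
      by (intro sum_mono d t)
    also have "\<dots> = integral {0..t} ?f" using ki[OF t] by (intro integral_sum[symmetric]) auto
    also have "\<dots> = integral {0..t} f" by (rule integral_spike[of "{0}"]) (auto simp: f_def)
    also have "\<dots> \<le> integral {0..t} g"
    proof (rule integral_le)
      show "f integrable_on {0..t}" using fi by (rule integrable_spike[of _ _ "{0}"]) (auto simp: f_def)
      show "g integrable_on {0..t}" using gi by (rule integrable_spike[of _ _ "{0}"]) (auto simp: g_def)
      fix s assume s: "s \<in> {0..t}"
      show "f s \<le> g s"
      proof (cases "s = 0")
        case False
        then have "s \<in> {0<..T}" using s S t by auto
        then have "k (t - s) * (\<Sum>i\<in>{N..<M}. \<bar>c i s\<bar>) \<le> k (t - s) * (\<epsilon> N * W s)"
          by (intro mult_left_mono e k)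
        then show ?thesis using False by (simp add: f_def g_def sum_distrib_left mult_ac)
      qed (simp add: f_def g_def)
    qed
    also have "\<dots> = integral {0..t} (\<lambda>s. \<epsilon> N * (k (t - s) * W s))"
      by (rule integral_spike[of "{0}"]) (auto simp: g_def)
    also have "\<dots> = \<epsilon> N * integral {0..t} (\<lambda>s. k (t - s) * W s)" by simp
    also have "\<dots> \<le> \<epsilon> N * (K * W' t)" using K(2)[OF t] e(2) by (rule mult_left_mono)
    finally show ?thesis by simp
  qed
  moreover have "(\<lambda>n. \<epsilon> n * K) \<longlonglongrightarrow> 0 * K" using e(1) by (intro tendsto_intros)
  ultimately show ?thesis unfolding ltail_def using e(2) K(1) by (intro exI[of _ "\<lambda>n. \<epsilon> n * K"]) auto
qed

text \<open>All indices at once: the tail conditions are the estimates uniform in i. The initial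
  coefficients, which do not depend on time, are encoded as a family over the single time 0.\<close>

locale mild_coefficients =
  fixes \<alpha> \<tau> l0 T :: real and n :: nat and l v0 :: "nat \<Rightarrow> real" and F F' :: "nat \<Rightarrow> real \<Rightarrow> real"
  assumes \<alpha>: "0 < \<alpha>" "\<alpha> < 1" and \<tau>: "\<tau> > 0" and n: "n > 0" and T: "T = real n * \<tau>"
    and l0: "l0 > 0" "\<And>i. l i \<ge> l0"
    and F_cont: "\<And>i. continuous_on {0..T} (F i)"
    and F_deriv: "\<And>i. piecewise_deriv \<tau> n (F i) (F' i)"
    and F_tail: "ltail (\<lambda>i t. l i powr (9 / 8) * F i t) {0..T} (\<lambda>_. 1)"
    and F'_tail: "ltail (\<lambda>i t. l i powr (1 / 8) * F' i t) {0<..T} (wt \<alpha> \<tau>)"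
    and v0_tail: "ltail (\<lambda>i t. l i powr (9 / 8) * v0 i) {0} (\<lambda>_. 1)"
begin

lemma l_pos: "l i > 0" using l0 by (meson less_le_trans)

lemma T_pos: "T > 0" using T n \<tau> by simp

lemma powr_le_powr:
  assumes "x \<le> y"
  shows "l i powr x \<le> l0 powr (x - y) * l i powr y"
proof -
  have "l i powr x = l i powr (x - y) * l i powr y" using l_pos[of i] by (simp add: powr_add[symmetric])
  also have "\<dots> \<le> l0 powr (x - y) * l i powr y"
    using assms l0 by (intro mult_right_mono powr_mono2') auto
  finally show ?thesis .
qed

definition Br :: real where
  "Br = (SOME B. B > 0 \<and> (\<forall>l>0. \<forall>t\<ge>0. \<bar>relax \<alpha> l t\<bar> \<le> B) \<and>
     (\<forall>\<theta>\<in>{0..1}. \<forall>l>0. \<forall>t>0. \<bar>relax1 \<alpha> l t\<bar> \<le> B * (l powr \<theta> * t powr (\<theta> * \<alpha> - 1))) \<and>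
     (\<forall>\<theta>\<in>{0..1}. \<forall>l>0. \<forall>t>0. \<bar>relax2 \<alpha> l t\<bar> \<le> B * (l powr \<theta> * t powr (\<theta> * \<alpha> - 2))))"

lemma Br: "Br > 0" "t \<ge> 0 \<Longrightarrow> \<bar>relax \<alpha> (l i) t\<bar> \<le> Br"
  "\<theta> \<in> {0..1} \<Longrightarrow> t > 0 \<Longrightarrow> \<bar>relax1 \<alpha> (l i) t\<bar> \<le> Br * (l i powr \<theta> * t powr (\<theta> * \<alpha> - 1))"
  "\<theta> \<in> {0..1} \<Longrightarrow> t > 0 \<Longrightarrow> \<bar>relax2 \<alpha> (l i) t\<bar> \<le> Br * (l i powr \<theta> * t powr (\<theta> * \<alpha> - 2))"
proof -
  note P = someI_ex[OF relax_bounds[OF \<alpha>], folded Br_def]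
  from P show "Br > 0" by (rule conjunct1)
  note P0 = P[THEN conjunct2, THEN conjunct1] and P1 = P[THEN conjunct2, THEN conjunct2, THEN conjunct1]
    and P2 = P[THEN conjunct2, THEN conjunct2, THEN conjunct2]
  show "\<bar>relax \<alpha> (l i) t\<bar> \<le> Br" if "t \<ge> 0"
    using P0[rule_format, OF l_pos that] .
  show "\<bar>relax1 \<alpha> (l i) t\<bar> \<le> Br * (l i powr \<theta> * t powr (\<theta> * \<alpha> - 1))" if "\<theta> \<in> {0..1}" "t > 0"
    using P1[rule_format, OF that(1) l_pos that(2)] .
  show "\<bar>relax2 \<alpha> (l i) t\<bar> \<le> Br * (l i powr \<theta> * t powr (\<theta> * \<alpha> - 2))" if "\<theta> \<in> {0..1}" "t > 0"
    using P2[rule_format, OF that(1) l_pos that(2)] .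
qed

text \<open>A bound for one index, read off from a tail sum with a single term; it only serves to
  instantiate \<open>relaxation_source\<close>.\<close>

definition M :: "nat \<Rightarrow> real" where
  "M i = (SOME m. m \<ge> 0 \<and> (\<forall>t\<in>{0<..T}. \<bar>F' i t\<bar> \<le> m * wt \<alpha> \<tau> t))"

lemma M: "M i \<ge> 0" "t \<in> {0<..T} \<Longrightarrow> \<bar>F' i t\<bar> \<le> M i * wt \<alpha> \<tau> t"
proof -
  obtain \<epsilon> where e: "\<epsilon> \<longlonglongrightarrow> 0" "\<And>n. \<epsilon> n \<ge> 0" "\<And>N M t. t \<in> {0<..T} \<Longrightarrow> (\<Sum>i\<in>{N..<M}. \<bar>l i powr (1 / 8) * F' i t\<bar>) \<le> \<epsilon> N * wt \<alpha> \<tau> t"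
    using F'_tail by (rule ltailE) blast
  have "\<bar>F' i t\<bar> \<le> (\<epsilon> i / l i powr (1 / 8)) * wt \<alpha> \<tau> t" if "t \<in> {0<..T}" for t
    using e(3)[OF that, of i "Suc i"] l_pos[of i] by (simp add: abs_mult field_simps)
  moreover have "\<epsilon> i / l i powr (1 / 8) \<ge> 0" using e(2) by simp
  ultimately have "\<exists>m. m \<ge> 0 \<and> (\<forall>t\<in>{0<..T}. \<bar>F' i t\<bar> \<le> m * wt \<alpha> \<tau> t)" by blast
  then have "M i \<ge> 0 \<and> (\<forall>t\<in>{0<..T}. \<bar>F' i t\<bar> \<le> M i * wt \<alpha> \<tau> t)" unfolding M_def by (rule someI_ex)
  then show "M i \<ge> 0" "t \<in> {0<..T} \<Longrightarrow> \<bar>F' i t\<bar> \<le> M i * wt \<alpha> \<tau> t" by auto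
qed

lemma source: "relaxation_source \<alpha> (Br * l i) (relax \<alpha> (l i)) (relax1 \<alpha> (l i)) (relax2 \<alpha> (l i)) \<tau> (M i) T n (F i) (F' i)"
  unfolding relaxation_source_def relaxation_source_axioms_def
  by (intro conjI relax_kernel \<alpha> l_pos Br \<tau> T n M F_cont F_deriv allI impI) auto

definition w :: "nat \<Rightarrow> real \<Rightarrow> real" where
  "w i t = integral {0..t} (\<lambda>s. relax \<alpha> (l i) s * F i (t - s))"

definition J :: "nat \<Rightarrow> real \<Rightarrow> real" where
  "J i t = integral {0..t} (\<lambda>s. relax \<alpha> (l i) (t - s) * F' i s)"

definition Q :: "nat \<Rightarrow> real \<Rightarrow> real" where
  "Q i t = integral {0..t} (\<lambda>s. relax1 \<alpha> (l i) (t - s) * F' i s)"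

definition w1 :: "nat \<Rightarrow> real \<Rightarrow> real" where
  "w1 i t = relax \<alpha> (l i) t * F i 0 + J i t"

definition w2 :: "nat \<Rightarrow> real \<Rightarrow> real" where
  "w2 i t = relax1 \<alpha> (l i) t * F i 0 + (F' i t + Q i t)"

lemma w_deriv:
  assumes t: "t \<in> {0..T}"
  shows "(w i has_real_derivative w1 i t) (at t within {0..T})"
proof -
  have "((\<lambda>t. integral {0..t} (\<lambda>s. relax \<alpha> (l i) (t - s) * F i s)) has_real_derivative w1 i t) (at t within {0..T})"
    using relaxation_source.convolution_deriv[OF source t]
    unfolding w1_def J_def relaxation_source.J_def[OF source] .
  then show ?thesis
    by (rule has_field_derivative_transform_within[of _ _ _ _ 1])
      (use t in \<open>auto simp: w_def integral_convolution_commute[of _ "relax \<alpha> (l i)"]\<close>)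
qed

lemma w1_deriv:
  assumes j: "j < n" and t: "t \<in> {real j * \<tau><..real (Suc j) * \<tau>}"
  shows "(w1 i has_real_derivative w2 i t) (at t within {real j * \<tau><..real (Suc j) * \<tau>})"
proof -
  have t0: "t > 0" using t \<tau> by (smt (verit) greaterThanAtMost_iff mult_nonneg_nonneg of_nat_0_le_iff)
  have "(relax \<alpha> (l i) has_real_derivative relax1 \<alpha> (l i) t) (at t within {real j * \<tau><..real (Suc j) * \<tau>})"
    using relax_deriv[OF \<alpha> l_pos t0] by (rule has_field_derivative_at_within)
  moreover have "(J i has_real_derivative F' i t + Q i t) (at t within {real j * \<tau><..real (Suc j) * \<tau>})"
    using relaxation_source.J_deriv[OF source j t]
    unfolding J_def[abs_def] Q_def relaxation_source.J_def[OF source, abs_def] relaxation_source.Q_def[OF source] .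
  ultimately show ?thesis
    unfolding w1_def[abs_def] w2_def by (intro DERIV_add DERIV_cmult_right)
qed

lemma wt_integral_bound: "t \<in> {0..T} \<Longrightarrow> integral {0..t} (wt \<alpha> \<tau>) \<le> integral {0..T} (wt \<alpha> \<tau>)"
  using wt_ge_1[of \<alpha> \<tau>] wt_integrable[OF \<alpha> \<tau>] T_pos
  by (intro integral_subset_le) (auto intro: order.trans[OF zero_le_one])

lemma w_tail: "ltail (\<lambda>i t. l i powr (9 / 8) * w i t) {0..T} (\<lambda>_. 1)"
proof (rule ltail_integral[where c = "\<lambda>i t. l i powr (9 / 8) * F i t" and k = "\<lambda>_. Br" and T = T and K = "Br * T" and W = "\<lambda>_. 1"])
  show "ltail (\<lambda>i t. l i powr (9 / 8) * F i t) {0<..T} (\<lambda>_. 1)"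
    using F_tail by (rule ltail_le[where K = 1 and V = "\<lambda>_. 1" and h = "\<lambda>t. t"]) auto
  show "integral {0..t} (\<lambda>s. Br * 1) \<le> Br * T * 1" if "t \<in> {0..T}" for t
    using that Br(1) by (simp add: mult.commute mult_left_mono)
  have Fi: "continuous_on {0..t} (F i)" if "t \<in> {0..T}" for i t
    using that by (intro continuous_on_subset[OF F_cont]) auto
  show int: "(\<lambda>s. Br * \<bar>l i powr (9 / 8) * F i s\<bar>) integrable_on {0..t}" if "t \<in> {0..T}" for i t
    using that by (intro integrable_continuous_real continuous_intros Fi)
  show "\<bar>l i powr (9 / 8) * w i t\<bar> \<le> integral {0..t} (\<lambda>s. Br * \<bar>l i powr (9 / 8) * F i s\<bar>)" if t: "t \<in> {0..T}" for i t
  proof -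
    have w: "w i t = integral {0..t} (\<lambda>s. relax \<alpha> (l i) (t - s) * F i s)"
      using t by (simp add: w_def integral_convolution_commute)
    have "norm (integral {0..t} (\<lambda>s. l i powr (9 / 8) * (relax \<alpha> (l i) (t - s) * F i s))) \<le> integral {0..t} (\<lambda>s. Br * \<bar>l i powr (9 / 8) * F i s\<bar>)"
    proof (rule Henstock_Kurzweil_Integration.integral_norm_bound_integral)
      show "(\<lambda>s. l i powr (9 / 8) * (relax \<alpha> (l i) (t - s) * F i s)) integrable_on {0..t}"
        by (intro integrable_on_mult_right convolution_integrable[OF continuous_on_relax[OF \<alpha>] F_cont t])
      fix s assume "s \<in> {0..t}"
      then have "l i powr (9 / 8) * \<bar>F i s\<bar> * \<bar>relax \<alpha> (l i) (t - s)\<bar> \<le> l i powr (9 / 8) * \<bar>F i s\<bar> * Br"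
        by (intro mult_left_mono Br) auto
      then show "norm (l i powr (9 / 8) * (relax \<alpha> (l i) (t - s) * F i s)) \<le> Br * \<bar>l i powr (9 / 8) * F i s\<bar>"
        by (simp add: abs_mult mult_ac)
    qed (rule int[OF t])
    then show ?thesis unfolding w by simp
  qed
qed (use Br T_pos in auto)

lemma F'_abs_integrable: "t \<in> {0..T} \<Longrightarrow> (\<lambda>s. \<bar>l i powr (1 / 8) * F' i s\<bar>) integrable_on {0..t}"
proof -
  assume "t \<in> {0..T}"
  then have "F' i absolutely_integrable_on {0..t}" by (rule relaxation_source.F'_abs_integrable[OF source])
  then have "(\<lambda>s. l i powr (1 / 8) * \<bar>F' i s\<bar>) integrable_on {0..t}"
    by (intro integrable_on_mult_right) (simp add: absolutely_integrable_on_def)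
  then show ?thesis by (simp add: abs_mult)
qed

lemma J_tail: "ltail (\<lambda>i t. l i powr (1 / 8) * J i t) {0..T} (\<lambda>_. 1)"
proof (rule ltail_integral[where c = "\<lambda>i t. l i powr (1 / 8) * F' i t" and k = "\<lambda>_. Br" and T = T and K = "Br * integral {0..T} (wt \<alpha> \<tau>)", OF F'_tail])
  show "(\<lambda>s. Br * wt \<alpha> \<tau> s) integrable_on {0..t}" if "t \<in> {0..T}" for t
    using that by (intro integrable_on_mult_right wt_integrable \<alpha> \<tau>) auto
  show "integral {0..t} (\<lambda>s. Br * wt \<alpha> \<tau> s) \<le> Br * integral {0..T} (wt \<alpha> \<tau>) * 1" if "t \<in> {0..T}" for t
    using that Br(1) wt_integral_bound by simp
  show "0 \<le> Br * integral {0..T} (wt \<alpha> \<tau>)"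
    using Br(1) wt_integral_bound[of 0] T_pos by simp
  show int: "(\<lambda>s. Br * \<bar>l i powr (1 / 8) * F' i s\<bar>) integrable_on {0..t}" if "t \<in> {0..T}" for i t
    using that by (intro integrable_on_mult_right F'_abs_integrable)
  show "\<bar>l i powr (1 / 8) * J i t\<bar> \<le> integral {0..t} (\<lambda>s. Br * \<bar>l i powr (1 / 8) * F' i s\<bar>)" if t: "t \<in> {0..T}" for i t
  proof -
    have "norm (integral {0..t} (\<lambda>s. l i powr (1 / 8) * (relax \<alpha> (l i) (t - s) * F' i s))) \<le> integral {0..t} (\<lambda>s. Br * \<bar>l i powr (1 / 8) * F' i s\<bar>)"
    proof (rule Henstock_Kurzweil_Integration.integral_norm_bound_integral)
      show "(\<lambda>s. l i powr (1 / 8) * (relax \<alpha> (l i) (t - s) * F' i s)) integrable_on {0..t}"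
        using relaxation_source.E_F'_abs_integrable[OF source t] by (intro integrable_on_mult_right) (simp add: absolutely_integrable_on_def)
      fix s assume "s \<in> {0..t}"
      then have "l i powr (1 / 8) * \<bar>F' i s\<bar> * \<bar>relax \<alpha> (l i) (t - s)\<bar> \<le> l i powr (1 / 8) * \<bar>F' i s\<bar> * Br"
        by (intro mult_left_mono Br) auto
      then show "norm (l i powr (1 / 8) * (relax \<alpha> (l i) (t - s) * F' i s)) \<le> Br * \<bar>l i powr (1 / 8) * F' i s\<bar>"
        by (simp add: abs_mult mult_ac)
    qed (rule int[OF t])
    then show ?thesis unfolding J_def by simp
  qed
qed (use Br in auto)

text \<open>The case \<theta> = 1/8 of the kernel bound: l^(1/8) t^(\<alpha>/8-1). The power of l is
  exactly what the tail condition on \<open>F'\<close> supplies, and the remaining singularity is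
  integrable uniformly in the index.\<close>

lemma Q_tail: "ltail Q {0<..T} (wt \<alpha> \<tau>)"
proof -
  have p: "0 < \<alpha> / 8" "\<alpha> / 8 \<le> 1" using \<alpha> by auto
  obtain C where C: "C > 0" "\<And>t. t \<in> {0<..T} \<Longrightarrow> (\<lambda>s. (t - s) powr (\<alpha> / 8 - 1) * wt \<alpha> \<tau> s) integrable_on {0..t}"
    "\<And>t. t \<in> {0<..T} \<Longrightarrow> integral {0..t} (\<lambda>s. (t - s) powr (\<alpha> / 8 - 1) * wt \<alpha> \<tau> s) \<le> C * wt \<alpha> \<tau> t"
    using wt_convolution[OF p \<alpha> \<tau> T_pos] by blast
  show ?thesis
  proof (rule ltail_integral[where c = "\<lambda>i t. l i powr (1 / 8) * F' i t" and k = "\<lambda>r. Br * r powr (\<alpha> / 8 - 1)" and T = T and K = "Br * C", OF F'_tail])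
    show "(\<lambda>s. Br * (t - s) powr (\<alpha> / 8 - 1) * wt \<alpha> \<tau> s) integrable_on {0..t}" if "t \<in> {0<..T}" for t
      using integrable_on_mult_right[OF C(2)[OF that], of Br] by (simp add: mult.assoc)
    show "integral {0..t} (\<lambda>s. Br * (t - s) powr (\<alpha> / 8 - 1) * wt \<alpha> \<tau> s) \<le> Br * C * wt \<alpha> \<tau> t" if "t \<in> {0<..T}" for t
      using mult_left_mono[OF C(3)[OF that], of Br] Br(1) by (simp add: mult.assoc)
    have pi: "(\<lambda>s. (Br * (t - s) powr (\<alpha> / 8 - 1)) * (l i powr (1 / 8) * F' i s)) absolutely_integrable_on {0..t}" if t: "t \<in> {0<..T}" for i t
    proof -
      have "(\<lambda>s. (Br * l i powr (1 / 8) * (t - s) powr (\<alpha> / 8 - 1)) * F' i s) absolutely_integrable_on {0..t}"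
        using t p Br(1) by (intro relaxation_source.kernel_F'_abs_integrable[OF source, where k = "\<lambda>r. Br * l i powr (1 / 8) * r powr (\<alpha> / 8 - 1)" and B = "Br * l i powr (1 / 8)" and p = "\<alpha> / 8"])
          (auto simp: abs_mult)
      then show ?thesis by (simp add: mult_ac)
    qed
    show int: "(\<lambda>s. Br * (t - s) powr (\<alpha> / 8 - 1) * \<bar>l i powr (1 / 8) * F' i s\<bar>) integrable_on {0..t}" if t: "t \<in> {0<..T}" for i t
      using pi[OF t, of i] Br(1) by (simp add: absolutely_integrable_on_def abs_mult)
    show "\<bar>Q i t\<bar> \<le> integral {0..t} (\<lambda>s. Br * (t - s) powr (\<alpha> / 8 - 1) * \<bar>l i powr (1 / 8) * F' i s\<bar>)" if t: "t \<in> {0<..T}" for i t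
    proof -
      define h where "h s = (if s = t then 0 else relax1 \<alpha> (l i) (t - s) * F' i s)" for s
      have "Q i t = integral {0..t} h" unfolding Q_def by (rule integral_spike[of "{t}"]) (auto simp: h_def)
      moreover have "norm (integral {0..t} h) \<le> integral {0..t} (\<lambda>s. Br * (t - s) powr (\<alpha> / 8 - 1) * \<bar>l i powr (1 / 8) * F' i s\<bar>)"
      proof (rule Henstock_Kurzweil_Integration.integral_norm_bound_integral)
        have "(\<lambda>s. relax1 \<alpha> (l i) (t - s) * F' i s) integrable_on {0..t}"
          using relaxation_source.E1_F'_abs_integrable[OF source, of t] t by (simp add: absolutely_integrable_on_def)
        then show "h integrable_on {0..t}" by (rule integrable_spike[of _ _ "{t}"]) (auto simp: h_def)
        fix s assume s: "s \<in> {0..t}"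
        show "norm (h s) \<le> Br * (t - s) powr (\<alpha> / 8 - 1) * \<bar>l i powr (1 / 8) * F' i s\<bar>"
        proof (cases "s = t")
          case False
          then have "\<bar>relax1 \<alpha> (l i) (t - s)\<bar> * \<bar>F' i s\<bar> \<le> (Br * (l i powr (1 / 8) * (t - s) powr (1 / 8 * \<alpha> - 1))) * \<bar>F' i s\<bar>"
            using s by (intro mult_right_mono Br) auto
          then show ?thesis using False by (simp add: h_def abs_mult mult_ac)
        qed (use Br in \<open>simp add: h_def\<close>)
      qed (rule int[OF t])
      ultimately show ?thesis by simp
    qed
  qed (use Br C in auto)
qed

definition u :: "nat \<Rightarrow> real \<Rightarrow> real" where
  "u i t = v0 i * relax \<alpha> (l i) t + w i t"

definition u1 :: "nat \<Rightarrow> real \<Rightarrow> real" where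
  "u1 i t = v0 i * relax1 \<alpha> (l i) t + w1 i t"

definition u2 :: "nat \<Rightarrow> real \<Rightarrow> real" where
  "u2 i t = v0 i * relax2 \<alpha> (l i) t + w2 i t"

lemma w_0: "w i 0 = 0" by (simp add: w_def)

lemma u_0: "u i 0 = v0 i" by (simp add: u_def w_0 relax_0)

lemma u_cont: "continuous_on {0..T} (u i)"
proof -
  have "continuous_on {0..T} (w i)"
    using w_deriv unfolding continuous_on_eq_continuous_within by (meson DERIV_continuous)
  then show ?thesis unfolding u_def[abs_def]
    by (intro continuous_intros continuous_on_subset[OF continuous_on_relax[OF \<alpha>]]) auto
qed

lemma u_deriv:
  assumes t: "t \<in> {0<..T}"
  shows "(u i has_real_derivative u1 i t) (at t within {0..T})"
  unfolding u_def[abs_def] u1_def using t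
  by (intro DERIV_add DERIV_cmult w_deriv has_field_derivative_at_within[OF relax_deriv[OF \<alpha> l_pos]]) auto

lemma u1_deriv:
  assumes j: "j < n" and t: "t \<in> {real j * \<tau><..real (Suc j) * \<tau>}"
  shows "(u1 i has_real_derivative u2 i t) (at t within {real j * \<tau><..real (Suc j) * \<tau>})"
proof -
  have t0: "t > 0" using t \<tau> by (smt (verit) greaterThanAtMost_iff mult_nonneg_nonneg of_nat_0_le_iff)
  show ?thesis unfolding u1_def[abs_def] u2_def
    by (intro DERIV_add DERIV_cmult w1_deriv[OF j t] has_field_derivative_at_within[OF relax1_deriv[OF \<alpha> l_pos t0]])
qed

lemma tail_at_0: "ltail (\<lambda>i t. l i powr (9 / 8) * F i 0) {0} (\<lambda>_. 1)"
  using F_tail by (rule ltail_le[where K = 1 and V = "\<lambda>_. 1" and h = "\<lambda>t. t"]) (use T_pos in auto)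

text \<open>For products of fixed coefficients with a kernel factor; the lower bound
  \<open>l0\<close> pays for the passage from the power x to 9/8.\<close>

lemma constant_tail:
  fixes W :: "real \<Rightarrow> real"
  assumes c: "ltail (\<lambda>i t. l i powr (9 / 8) * c i) {0} (\<lambda>_. 1)" and x: "x \<le> 9 / 8" and D: "D \<ge> 0"
    and W: "\<And>t. t \<in> S \<Longrightarrow> W t \<ge> 0"
    and d: "\<And>i t. t \<in> S \<Longrightarrow> \<bar>d i t\<bar> \<le> D * W t * (l i powr x * \<bar>c i\<bar>)"
  shows "ltail d S W"
proof (rule ltail_le[OF c, where K = "D * l0 powr (x - 9 / 8)" and V = "\<lambda>t. D * W t * l0 powr (x - 9 / 8)" and h = "\<lambda>_. 0"])
  fix i t assume t: "t \<in> S"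
  have "D * W t * (l i powr x * \<bar>c i\<bar>) \<le> D * W t * ((l0 powr (x - 9 / 8) * l i powr (9 / 8)) * \<bar>c i\<bar>)"
    using D W[OF t] x by (intro mult_left_mono mult_right_mono powr_le_powr) auto
  then show "\<bar>d i t\<bar> \<le> D * W t * l0 powr (x - 9 / 8) * \<bar>l i powr (9 / 8) * c i\<bar>"
    using d[OF t, of i] by (simp add: abs_mult mult_ac)
qed (use D W in auto)

lemma u_tail: "ltail (\<lambda>i t. l i powr (9 / 8) * u i t) {0..T} (\<lambda>_. 1)"
proof -
  have "ltail (\<lambda>i t. l i powr (9 / 8) * v0 i * relax \<alpha> (l i) t) {0..T} (\<lambda>_. 1)"
  proof (rule constant_tail[OF v0_tail, where x = "9 / 8" and D = Br])
    fix i t assume "t \<in> {0..T}"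
    then have "l i powr (9 / 8) * \<bar>v0 i\<bar> * \<bar>relax \<alpha> (l i) t\<bar> \<le> l i powr (9 / 8) * \<bar>v0 i\<bar> * Br"
      by (intro mult_left_mono Br) auto
    then show "\<bar>l i powr (9 / 8) * v0 i * relax \<alpha> (l i) t\<bar> \<le> Br * 1 * (l i powr (9 / 8) * \<bar>v0 i\<bar>)"
      by (simp add: abs_mult mult_ac)
  qed (use Br in auto)
  from ltail_add[OF this w_tail] show ?thesis by (simp add: u_def algebra_simps)
qed

lemma EF0_tail: "ltail (\<lambda>i t. l i powr (1 / 8) * (relax \<alpha> (l i) t * F i 0)) {0..T} (\<lambda>_. 1)"
proof (rule constant_tail[OF tail_at_0, where x = "1 / 8" and D = Br])
  fix i t assume "t \<in> {0..T}"
  then have "l i powr (1 / 8) * \<bar>F i 0\<bar> * \<bar>relax \<alpha> (l i) t\<bar> \<le> l i powr (1 / 8) * \<bar>F i 0\<bar> * Br"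
    by (intro mult_left_mono Br) auto
  then show "\<bar>l i powr (1 / 8) * (relax \<alpha> (l i) t * F i 0)\<bar> \<le> Br * 1 * (l i powr (1 / 8) * \<bar>F i 0\<bar>)"
    by (simp add: abs_mult mult_ac)
qed (use Br in auto)

lemma w1_tail: "ltail (\<lambda>i t. l i powr (1 / 8) * w1 i t) {0..T} (\<lambda>_. 1)"
  using ltail_add[OF EF0_tail J_tail] by (simp add: w1_def algebra_simps)

text \<open>With \<theta> = 1 the initial term costs one power of l besides the weight 1/8, which
  uses up the full order 9/8 of the initial coefficients.\<close>

lemma u1_tail: "ltail (\<lambda>i t. l i powr (1 / 8) * u1 i t) {0<..T} (\<lambda>t. 1 + t powr (\<alpha> - 1))"
proof -
  have "ltail (\<lambda>i t. l i powr (1 / 8) * (v0 i * relax1 \<alpha> (l i) t)) {0<..T} (\<lambda>t. 1 + t powr (\<alpha> - 1))"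
  proof (rule constant_tail[OF v0_tail, where x = "9 / 8" and D = Br])
    fix i t assume "t \<in> {0<..T}"
    then have "l i powr (1 / 8) * \<bar>v0 i\<bar> * \<bar>relax1 \<alpha> (l i) t\<bar> \<le> l i powr (1 / 8) * \<bar>v0 i\<bar> * (Br * (l i powr 1 * t powr (1 * \<alpha> - 1)))"
      by (intro mult_left_mono Br) auto
    also have "\<dots> = Br * t powr (\<alpha> - 1) * (l i powr (1 / 8 + 1) * \<bar>v0 i\<bar>)"
      unfolding powr_add by simp
    also have "\<dots> \<le> Br * (1 + t powr (\<alpha> - 1)) * (l i powr (1 / 8 + 1) * \<bar>v0 i\<bar>)"
      using Br(1) by (intro mult_right_mono mult_left_mono) auto
    finally show "\<bar>l i powr (1 / 8) * (v0 i * relax1 \<alpha> (l i) t)\<bar> \<le> Br * (1 + t powr (\<alpha> - 1)) * (l i powr (9 / 8) * \<bar>v0 i\<bar>)"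
      by (simp add: abs_mult mult_ac)
  qed (use Br in \<open>auto intro: add_nonneg_nonneg\<close>)
  moreover have "ltail (\<lambda>i t. l i powr (1 / 8) * w1 i t) {0<..T} (\<lambda>t. 1 + t powr (\<alpha> - 1))"
    using w1_tail by (rule ltail_le[where K = 1 and V = "\<lambda>_. 1" and h = "\<lambda>t. t"]) auto
  ultimately have "ltail (\<lambda>i t. l i powr (1 / 8) * (v0 i * relax1 \<alpha> (l i) t) + l i powr (1 / 8) * w1 i t) {0<..T} (\<lambda>t. 1 + t powr (\<alpha> - 1))"
    by (rule ltail_add)
  then show ?thesis by (simp add: u1_def algebra_simps)
qed

lemma w2_tail: "ltail w2 {0<..T} (wt \<alpha> \<tau>)"
proof -
  have "ltail (\<lambda>i t. relax1 \<alpha> (l i) t * F i 0) {0<..T} (wt \<alpha> \<tau>)"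
  proof (rule constant_tail[OF tail_at_0, where x = 1 and D = Br])
    fix i t assume "t \<in> {0<..T}"
    then have "\<bar>F i 0\<bar> * \<bar>relax1 \<alpha> (l i) t\<bar> \<le> \<bar>F i 0\<bar> * (Br * (l i powr 1 * t powr (1 * \<alpha> - 1)))"
      by (intro mult_left_mono Br) auto
    also have "\<dots> = Br * t powr (\<alpha> - 1) * (l i powr 1 * \<bar>F i 0\<bar>)" by (simp add: mult_ac)
    also have "\<dots> \<le> Br * wt \<alpha> \<tau> t * (l i powr 1 * \<bar>F i 0\<bar>)"
      using Br(1) by (intro mult_right_mono mult_left_mono) (auto simp: wt_def)
    finally show "\<bar>relax1 \<alpha> (l i) t * F i 0\<bar> \<le> Br * wt \<alpha> \<tau> t * (l i powr 1 * \<bar>F i 0\<bar>)"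
      by (simp add: abs_mult mult_ac)
  qed (use Br wt_ge_1 in \<open>auto intro: order.trans[OF zero_le_one]\<close>)
  moreover have "ltail F' {0<..T} (wt \<alpha> \<tau>)"
  proof (rule ltail_le[OF F'_tail, where K = "l0 powr (0 - 1 / 8)" and V = "\<lambda>_. l0 powr (0 - 1 / 8)" and h = "\<lambda>t. t"])
    fix i t
    have "1 * \<bar>F' i t\<bar> \<le> l0 powr (0 - 1 / 8) * l i powr (1 / 8) * \<bar>F' i t\<bar>"
      using powr_le_powr[of 0 "1 / 8" i] l_pos[of i] by (intro mult_right_mono) auto
    then show "\<bar>F' i t\<bar> \<le> l0 powr (0 - 1 / 8) * \<bar>l i powr (1 / 8) * F' i t\<bar>" by (simp add: abs_mult mult_ac)
  qed auto
  ultimately show ?thesis using Q_tail unfolding w2_def by (intro ltail_add)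
qed

lemma u2_tail: "ltail u2 {0<..T} (\<lambda>t. t powr (\<alpha> - 2) + wt \<alpha> \<tau> t)"
proof -
  have "ltail (\<lambda>i t. v0 i * relax2 \<alpha> (l i) t) {0<..T} (\<lambda>t. t powr (\<alpha> - 2) + wt \<alpha> \<tau> t)"
  proof (rule constant_tail[OF v0_tail, where x = 1 and D = Br])
    fix i t assume "t \<in> {0<..T}"
    then have "\<bar>v0 i\<bar> * \<bar>relax2 \<alpha> (l i) t\<bar> \<le> \<bar>v0 i\<bar> * (Br * (l i powr 1 * t powr (1 * \<alpha> - 2)))"
      by (intro mult_left_mono Br) auto
    also have "\<dots> = Br * t powr (\<alpha> - 2) * (l i powr 1 * \<bar>v0 i\<bar>)" by (simp add: mult_ac)
    also have "\<dots> \<le> Br * (t powr (\<alpha> - 2) + wt \<alpha> \<tau> t) * (l i powr 1 * \<bar>v0 i\<bar>)"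
      using Br(1) wt_ge_1[of \<alpha> \<tau> t] by (intro mult_right_mono mult_left_mono) auto
    finally show "\<bar>v0 i * relax2 \<alpha> (l i) t\<bar> \<le> Br * (t powr (\<alpha> - 2) + wt \<alpha> \<tau> t) * (l i powr 1 * \<bar>v0 i\<bar>)"
      by (simp add: abs_mult mult_ac)
  next
    fix t show "0 \<le> t powr (\<alpha> - 2) + wt \<alpha> \<tau> t" using wt_ge_1[of \<alpha> \<tau> t] by (intro add_nonneg_nonneg) auto
  qed (use Br in auto)
  moreover have "ltail w2 {0<..T} (\<lambda>t. t powr (\<alpha> - 2) + wt \<alpha> \<tau> t)"
    using w2_tail by (rule ltail_le[where K = 1 and V = "\<lambda>_. 1" and h = "\<lambda>t. t"]) auto
  ultimately show ?thesis unfolding u2_def by (rule ltail_add)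
qed

end

section \<open>Fourier coefficients of functions of space and time\<close>

context dirichlet_basis
begin

definition coef :: "(real \<Rightarrow> real \<Rightarrow> real) \<Rightarrow> nat \<Rightarrow> real \<Rightarrow> real" where
  "coef g i t = integral {0..L} (\<lambda>x. e i x * g x t)"

lemma coef_cont:
  assumes "continuous_on ({0..L} \<times> {c..d}) (\<lambda>(x, t). g x t)"
  shows "continuous_on {c..d} (coef g i)"
proof -
  have "continuous_on ({c..d} \<times> cbox 0 L) (\<lambda>(t, x). e i x * g x t)"
  proof -
    have p: "continuous_on ({c..d} \<times> {0..L}) (\<lambda>z. (snd z, fst z))" by (intro continuous_intros)
    have "continuous_on ({c..d} \<times> {0..L}) (\<lambda>z. g (snd z) (fst z))"
    proof -
      have "(\<lambda>z. (snd z, fst z)) ` ({c..d} \<times> {0..L}) \<subseteq> {0..L} \<times> {c..d}" by auto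
      from continuous_on_compose2[OF assms p this] show ?thesis by simp
    qed
    moreover have "continuous_on ({c..d} \<times> {0..L}) (\<lambda>z. e i (snd z))"
      by (rule continuous_on_compose2[OF e_cont continuous_on_snd[OF continuous_on_id]]) auto
    ultimately show ?thesis by (simp add: split_beta continuous_on_mult)
  qed
  then have "continuous_on {c..d} (\<lambda>t. integral (cbox 0 L) (\<lambda>x. e i x * g x t))"
    by (rule integral_continuous_on_param)
  then show ?thesis unfolding coef_def[abs_def] by simp
qed

lemma ltail_weaken:
  assumes c: "ltail (\<lambda>i t. l i powr y * c i t) S W" and xy: "x \<le> y"
  shows "ltail (\<lambda>i t. l i powr x * c i t) S W"
proof -
  obtain l0 where l0: "l0 > 0" "\<And>i. l i \<ge> l0" using l_bounded_below by blast
  show ?thesis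
  proof (rule ltail_le[OF c, where K = "l0 powr (x - y)" and V = "\<lambda>_. l0 powr (x - y)" and h = "\<lambda>t. t"])
    fix i t
    have "l i powr x = l i powr (x - y) * l i powr y" using l_pos[of i] by (simp add: powr_add[symmetric])
    also have "\<dots> \<le> l0 powr (x - y) * l i powr y"
      using xy l0 by (intro mult_right_mono powr_mono2') auto
    finally have "l i powr x * \<bar>c i t\<bar> \<le> l0 powr (x - y) * l i powr y * \<bar>c i t\<bar>" by (rule mult_right_mono) auto
    then show "\<bar>l i powr x * c i t\<bar> \<le> l0 powr (x - y) * \<bar>l i powr y * c i t\<bar>" by (simp add: abs_mult mult_ac)
  qed auto
qed

lemma ltail_unweighted:
  assumes "ltail (\<lambda>i t. l i powr y * c i t) S W" and "0 \<le> y"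
  shows "ltail c S W"
proof -
  have "ltail (\<lambda>i t. l i powr 0 * c i t) S W" using assms by (rule ltail_weaken)
  moreover have "(\<lambda>i t. l i powr 0 * c i t) = c" using l_pos by (auto simp: fun_eq_iff less_imp_neq[OF l_pos, symmetric])
  ultimately show ?thesis by simp
qed

text \<open>The norm bound makes the coefficients of the derivative absolutely summable; by
  completeness the derivative then equals a bounded series almost everywhere. This is the bound that
  \<open>has_derivative_coefficient\<close> asks for.\<close>

lemma coef_derivative:
  fixes g g' :: "real \<Rightarrow> real \<Rightarrow> real"
  assumes cd: "c < d" and g: "continuous_on ({0..L} \<times> {c..d}) (\<lambda>(x, t). g x t)"
    and g': "\<And>x t. x \<in> {0..L} \<Longrightarrow> t \<in> {c<..d} \<Longrightarrow> (g x has_real_derivative g' x t) (at t within {c<..d})"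
    and N: "\<And>t. t \<in> {c<..d} \<Longrightarrow> G_norm L lam X (1 / 2) (\<lambda>x. g' x t) \<le> ennreal (C * W t)"
    and W: "\<And>t. t \<in> {c<..d} \<Longrightarrow> W t \<ge> 0" "\<And>s t. c < s \<Longrightarrow> s \<le> t \<Longrightarrow> t \<le> d \<Longrightarrow> W t \<le> W s"
    and l: "\<And>i. l i = lam (Suc i)" and e: "\<And>i. e i = X (Suc i)"
  shows "ltail (\<lambda>i t. l i powr (1 / 8) * coef g' i t) {c<..d} W"
    and "t \<in> {c<..d} \<Longrightarrow> (coef g i has_real_derivative coef g' i t) (at t within {c<..d})"
proof -
  have "ltail (\<lambda>i t. l i powr (1 / 2 - 3 / 8) * integral {0..L} (\<lambda>x. e i x * g' x t)) {c<..d} W"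
    by (rule G_norm_ltail[where g = "\<lambda>t x. g' x t", OF N W(1) l e])
  then show tail: "ltail (\<lambda>i t. l i powr (1 / 8) * coef g' i t) {c<..d} W" by (simp add: coef_def)
  have "ltail (coef g') {c<..d} W" using tail by (rule ltail_unweighted) simp
  then have "\<exists>K\<ge>0. \<forall>t\<in>{c<..d}. summable (\<lambda>i. \<bar>coef g' i t\<bar>) \<and> (\<Sum>i. \<bar>coef g' i t\<bar>) \<le> K * W t"
    using W(1) by (rule ltail_bound)
  then obtain K where KK: "K \<ge> 0 \<and> (\<forall>t\<in>{c<..d}. summable (\<lambda>i. \<bar>coef g' i t\<bar>) \<and> (\<Sum>i. \<bar>coef g' i t\<bar>) \<le> K * W t)" ..
  note K = KK[THEN conjunct1] bspec[OF KK[THEN conjunct2], THEN conjunct1] bspec[OF KK[THEN conjunct2], THEN conjunct2]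
  have ae: "negligible {x \<in> {0..L}. \<bar>g' x t\<bar> > B * K * W t}" if t: "t \<in> {c<..d}" for t
  proof (rule negligible_subset)
    show "negligible {x \<in> {0..L}. g' x t \<noteq> (\<Sum>i. integral {0..L} (\<lambda>x. e i x * g' x t) * e i x)}"
      using coefficients_determine[OF square_integrable_imp_absolutely_integrable[OF G_norm_leD(1)[OF N[OF t]]]] K(2)[OF t]
      by (simp add: coef_def)
    have "\<bar>\<Sum>i. integral {0..L} (\<lambda>x. e i x * g' x t) * e i x\<bar> \<le> B * K * W t" if x: "x \<in> {0..L}" for x
    proof -
      have "\<bar>\<Sum>i. coef g' i t * e i x\<bar> \<le> B * (\<Sum>i. \<bar>coef g' i t\<bar>)"
        by (rule series_abs_le[OF K(2)[OF t]]) (rule e_bound[OF x])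
      also have "\<dots> \<le> B * (K * W t)" using K(3)[OF t] B by (intro mult_left_mono) auto
      finally show ?thesis by (simp add: coef_def mult.assoc)
    qed
    then show "{x \<in> {0..L}. B * K * W t < \<bar>g' x t\<bar>} \<subseteq> {x \<in> {0..L}. g' x t \<noteq> (\<Sum>i. integral {0..L} (\<lambda>x. e i x * g' x t) * e i x)}"
      by fastforce
  qed
  have anti: "B * K * W t \<le> B * K * W s" if "c < s" "s \<le> t" "t \<le> d" for s t
    using W(2)[OF that] B K(1) by (intro mult_left_mono) auto
  have "((\<lambda>t. integral {0..L} (\<lambda>x. g x t * e i x)) has_real_derivative integral {0..L} (\<lambda>x. g' x t * e i x)) (at t within {c<..d})"
    if "t \<in> {c<..d}"
    by (rule has_derivative_coefficient[OF L cd g g' ae anti e_cont that])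
  then show "t \<in> {c<..d} \<Longrightarrow> (coef g i has_real_derivative coef g' i t) (at t within {c<..d})"
    unfolding coef_def[abs_def] by (simp add: mult.commute)
qed

end

section \<open>The delay problem\<close>

locale delay_problem = dirichlet_basis L B l e e1 e2
  for L B :: real and l :: "nat \<Rightarrow> real" and e e1 e2 :: "nat \<Rightarrow> real \<Rightarrow> real" +
  fixes \<alpha> b \<tau> l0 :: real and K :: nat and lam :: "nat \<Rightarrow> real" and X :: "nat \<Rightarrow> real \<Rightarrow> real"
    and \<phi> \<phi>\<^sub>t f f\<^sub>t u :: "real \<Rightarrow> real \<Rightarrow> real"
  assumes \<alpha>: "0 < \<alpha>" "\<alpha> < 1" and \<tau>: "\<tau> > 0" and K: "K \<ge> 1"
    and l0: "l0 > 0" "\<And>i. l i \<ge> l0"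
    and lam: "\<And>i. l i = lam (Suc i)" and X: "\<And>i. e i = X (Suc i)"
    and \<phi>_cont: "continuous_on ({0..L} \<times> {-\<tau>..0}) (\<lambda>(x, t). \<phi> x t)"
    and f_cont: "continuous_on ({0..L} \<times> {0..real K * \<tau>}) (\<lambda>(x, t). f x t)"
    and \<phi>_norm: "\<exists>C. \<forall>t\<in>{0..\<tau>}. G_norm L lam X (3/2) (\<lambda>x. \<phi> x (t - \<tau>)) \<le> ennreal C"
    and \<phi>_deriv: "\<And>x t. x \<in> {0..L} \<Longrightarrow> t \<in> {-\<tau><..0} \<Longrightarrow>
           (\<phi> x has_real_derivative \<phi>\<^sub>t x t) (at t within {-\<tau>..0})"
    and \<phi>\<^sub>t_norm: "\<exists>C. \<forall>t\<in>{0<..\<tau>}. G_norm L lam X (1/2) (\<lambda>x. \<phi>\<^sub>t x (t - \<tau>))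
                 \<le> ennreal (C * (1 + t powr (\<alpha> - 1)))"
    and f_norm: "\<exists>C. \<forall>t\<in>{0..real K * \<tau>}. G_norm L lam X (3/2) (\<lambda>x. f x t) \<le> ennreal C"
    and f_deriv1: "\<And>x t. x \<in> {0..L} \<Longrightarrow> t \<in> {0<..\<tau>} \<Longrightarrow>
           (f x has_real_derivative f\<^sub>t x t) (at t within {0<..\<tau>})"
    and f_deriv2: "\<And>x t. x \<in> {0..L} \<Longrightarrow> t \<in> {\<tau><..real K * \<tau>} \<Longrightarrow>
           (f x has_real_derivative f\<^sub>t x t) (at t within {\<tau><..real K * \<tau>})"
    and f\<^sub>t_norm1: "\<exists>C. \<forall>t\<in>{0<..\<tau>}. G_norm L lam X (1/2) (\<lambda>x. f\<^sub>t x t) \<le> ennreal C"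
    and f\<^sub>t_norm2: "\<exists>C. \<forall>t\<in>{\<tau><..real K * \<tau>}. G_norm L lam X (1/2) (\<lambda>x. f\<^sub>t x t)
                 \<le> ennreal (C * (1 + (t - \<tau>) powr (\<alpha> - 1)))"
    and u: "u = delay_sol L \<alpha> lam X b \<tau> \<phi> f K"
begin

lemma powr_weight_antimono:
  assumes "0 < s" "s \<le> t"
  shows "1 + t powr (\<alpha> - 1) \<le> 1 + s powr (\<alpha> - 1)"
  using assms \<alpha> by (auto intro!: powr_mono2')

lemma \<phi>_coef_tail: "ltail (\<lambda>i t. l i powr (9 / 8) * coef \<phi> i t) {-\<tau>..0} (\<lambda>_. 1)"
proof -
  obtain C where C: "\<forall>t\<in>{0..\<tau>}. G_norm L lam X (3/2) (\<lambda>x. \<phi> x (t - \<tau>)) \<le> ennreal C" using \<phi>_norm by blast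
  have "ltail (\<lambda>i t. l i powr (3 / 2 - 3 / 8) * integral {0..L} (\<lambda>x. e i x * \<phi> x t)) {-\<tau>..0} (\<lambda>_. 1)"
  proof (rule G_norm_ltail[where g = "\<lambda>t x. \<phi> x t" and C = C, OF _ _ lam X])
    show "G_norm L lam X (3 / 2) (\<lambda>x. \<phi> x t) \<le> ennreal (C * 1)" if "t \<in> {-\<tau>..0}" for t
      using bspec[OF C, of "t + \<tau>"] that by simp
  qed auto
  then show ?thesis by (simp add: coef_def)
qed

lemma f_coef_tail: "ltail (\<lambda>i t. l i powr (9 / 8) * coef f i t) {0..real K * \<tau>} (\<lambda>_. 1)"
proof -
  obtain C where C: "\<forall>t\<in>{0..real K * \<tau>}. G_norm L lam X (3/2) (\<lambda>x. f x t) \<le> ennreal C" using f_norm by blast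
  have "ltail (\<lambda>i t. l i powr (3 / 2 - 3 / 8) * integral {0..L} (\<lambda>x. e i x * f x t)) {0..real K * \<tau>} (\<lambda>_. 1)"
    by (rule G_norm_ltail[where g = "\<lambda>t x. f x t" and C = C, OF _ _ lam X]) (use C in auto)
  then show ?thesis by (simp add: coef_def)
qed

lemma \<phi>_coef_deriv:
  "ltail (\<lambda>i t. l i powr (1 / 8) * coef \<phi>\<^sub>t i t) {-\<tau><..0} (\<lambda>t. 1 + (t + \<tau>) powr (\<alpha> - 1))"
  "t \<in> {-\<tau><..0} \<Longrightarrow> (coef \<phi> i has_real_derivative coef \<phi>\<^sub>t i t) (at t within {-\<tau><..0})"
proof -
  obtain C where C: "\<forall>t\<in>{0<..\<tau>}. G_norm L lam X (1/2) (\<lambda>x. \<phi>\<^sub>t x (t - \<tau>)) \<le> ennreal (C * (1 + t powr (\<alpha> - 1)))"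
    using \<phi>\<^sub>t_norm by blast
  have d: "(\<phi> x has_real_derivative \<phi>\<^sub>t x t) (at t within {-\<tau><..0})" if "x \<in> {0..L}" "t \<in> {-\<tau><..0}" for x t
    using \<phi>_deriv[OF that] by (rule has_field_derivative_subset) auto
  have N: "G_norm L lam X (1 / 2) (\<lambda>x. \<phi>\<^sub>t x t) \<le> ennreal (C * (1 + (t + \<tau>) powr (\<alpha> - 1)))" if "t \<in> {-\<tau><..0}" for t
    using bspec[OF C, of "t + \<tau>"] that by simp
  have W: "0 \<le> 1 + (t + \<tau>) powr (\<alpha> - 1)" for t by (simp add: add_nonneg_nonneg)
  have W2: "1 + (t + \<tau>) powr (\<alpha> - 1) \<le> 1 + (s + \<tau>) powr (\<alpha> - 1)" if "-\<tau> < s" "s \<le> t" "t \<le> 0" for s t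
    using that by (intro powr_weight_antimono) auto
  have \<tau>0: "-\<tau> < 0" using \<tau> by simp
  show "ltail (\<lambda>i t. l i powr (1 / 8) * coef \<phi>\<^sub>t i t) {-\<tau><..0} (\<lambda>t. 1 + (t + \<tau>) powr (\<alpha> - 1))"
    by (rule coef_derivative(1)[OF \<tau>0 \<phi>_cont d N W W2 lam X])
  show "(coef \<phi> i has_real_derivative coef \<phi>\<^sub>t i t) (at t within {-\<tau><..0})" if "t \<in> {-\<tau><..0}"
    by (rule coef_derivative(2)[OF \<tau>0 \<phi>_cont d N W W2 lam X that])
qed

lemma K\<tau>: "\<tau> \<le> real K * \<tau>"
  using K \<tau> by (simp add: mult_le_cancel_right1)

lemma f_coef_deriv1:
  "ltail (\<lambda>i t. l i powr (1 / 8) * coef f\<^sub>t i t) {0<..\<tau>} (\<lambda>t. 1)"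
  "t \<in> {0<..\<tau>} \<Longrightarrow> (coef f i has_real_derivative coef f\<^sub>t i t) (at t within {0<..\<tau>})"
proof -
  obtain C where C: "\<forall>t\<in>{0<..\<tau>}. G_norm L lam X (1/2) (\<lambda>x. f\<^sub>t x t) \<le> ennreal C"
    using f\<^sub>t_norm1 by blast
  have N: "G_norm L lam X (1 / 2) (\<lambda>x. f\<^sub>t x t) \<le> ennreal (C * 1)" if "t \<in> {0<..\<tau>}" for t
    using C that by simp
  have c: "continuous_on ({0..L} \<times> {0..\<tau>}) (\<lambda>(x, t). f x t)"
    using K\<tau> by (intro continuous_on_subset[OF f_cont]) auto
  show "ltail (\<lambda>i t. l i powr (1 / 8) * coef f\<^sub>t i t) {0<..\<tau>} (\<lambda>t. 1)"
    by (rule coef_derivative(1)[OF \<tau> c f_deriv1 N _ _ lam X]) auto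
  show "(coef f i has_real_derivative coef f\<^sub>t i t) (at t within {0<..\<tau>})" if "t \<in> {0<..\<tau>}"
    by (rule coef_derivative(2)[OF \<tau> c f_deriv1 N _ _ lam X that]) auto
qed

lemma f_coef_deriv2:
  "ltail (\<lambda>i t. l i powr (1 / 8) * coef f\<^sub>t i t) {\<tau><..real K * \<tau>} (\<lambda>t. 1 + (t - \<tau>) powr (\<alpha> - 1))"
  "t \<in> {\<tau><..real K * \<tau>} \<Longrightarrow> (coef f i has_real_derivative coef f\<^sub>t i t) (at t within {\<tau><..real K * \<tau>})"
proof -
  obtain C where C: "\<forall>t\<in>{\<tau><..real K * \<tau>}. G_norm L lam X (1/2) (\<lambda>x. f\<^sub>t x t) \<le> ennreal (C * (1 + (t - \<tau>) powr (\<alpha> - 1)))"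
    using f\<^sub>t_norm2 by blast
  have N: "G_norm L lam X (1 / 2) (\<lambda>x. f\<^sub>t x t) \<le> ennreal (C * (1 + (t - \<tau>) powr (\<alpha> - 1)))" if "t \<in> {\<tau><..real K * \<tau>}" for t
    using C that by simp
  have c: "continuous_on ({0..L} \<times> {\<tau>..real K * \<tau>}) (\<lambda>(x, t). f x t)"
    using \<tau> by (intro continuous_on_subset[OF f_cont]) auto
  have W: "0 \<le> 1 + (t - \<tau>) powr (\<alpha> - 1)" for t by (simp add: add_nonneg_nonneg)
  have W2: "1 + (t - \<tau>) powr (\<alpha> - 1) \<le> 1 + (s - \<tau>) powr (\<alpha> - 1)" if "\<tau> < s" "s \<le> t" "t \<le> real K * \<tau>" for s t
    using that by (intro powr_weight_antimono) auto
  show "ltail (\<lambda>i t. l i powr (1 / 8) * coef f\<^sub>t i t) {\<tau><..real K * \<tau>} (\<lambda>t. 1 + (t - \<tau>) powr (\<alpha> - 1))"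
  proof (cases "\<tau> < real K * \<tau>")
    case True
    show ?thesis by (rule coef_derivative(1)[OF True c f_deriv2 N W W2 lam X])
  next
    case False
    then have "{\<tau><..real K * \<tau>} = {}" by simp
    then show ?thesis unfolding ltail_def by (intro exI[of _ "\<lambda>_. 0"]) auto
  qed
  show "(coef f i has_real_derivative coef f\<^sub>t i t) (at t within {\<tau><..real K * \<tau>})" if t: "t \<in> {\<tau><..real K * \<tau>}"
  proof -
    have "\<tau> < real K * \<tau>" using t by auto
    then show ?thesis by (rule coef_derivative(2)[OF _ c f_deriv2 N W W2 lam X t])
  qed
qed

lemma delay_sol_agree:
  assumes "j \<le> k" "t \<le> real j * \<tau>"
  shows "delay_sol L \<alpha> lam X b \<tau> \<phi> f k x t = delay_sol L \<alpha> lam X b \<tau> \<phi> f j x t"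
  using assms
proof (induction k)
  case (Suc k)
  show ?case
  proof (cases "j = Suc k")
    case False
    then have jk: "j \<le> k" using Suc.prems by simp
    then have "real j * \<tau> \<le> real k * \<tau>" using \<tau> by (intro mult_right_mono) auto
    then show ?thesis using Suc jk by simp
  qed simp
qed simp

lemma u_initial: "t \<le> 0 \<Longrightarrow> u x t = \<phi> x t"
  using delay_sol_agree[of 0 K t x] by (simp add: u)

text \<open>The weight of \<partial>_t u: singular to the right of -\<tau>, inherited from the
  initial function, and to the right of 0, created by the equation. Delayed by \<tau> it is
  dominated by \<open>wt\<close>.\<close>

definition U1 :: "real \<Rightarrow> real" where "U1 t = 1 + (if t \<le> 0 then (t + \<tau>) powr (\<alpha> - 1) else t powr (\<alpha> - 1))"

text \<open>The induction hypothesis of the method of steps. The piece with j = 0 is (-\<tau>, 0],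
  so the initial function is stage 0. No second time derivative appears, since the source needs only
  one.\<close>

definition regular :: "nat \<Rightarrow> (nat \<Rightarrow> real \<Rightarrow> real) \<Rightarrow> bool" where
  "regular k D \<longleftrightarrow>
     (\<forall>t\<in>{-\<tau>..real k * \<tau>}. continuous_on {0..L} (\<lambda>x. u x t)) \<and>
     (\<forall>i. continuous_on {-\<tau>..real k * \<tau>} (coef u i)) \<and>
     (\<forall>i. \<forall>j\<le>k. \<forall>t\<in>{(real j - 1) * \<tau><..real j * \<tau>}.
        (coef u i has_real_derivative D i t) (at t within {(real j - 1) * \<tau><..real j * \<tau>})) \<and>
     ltail (\<lambda>i t. l i powr (9 / 8) * coef u i t) {-\<tau>..real k * \<tau>} (\<lambda>_. 1) \<and>
     ltail (\<lambda>i t. l i powr (1 / 8) * D i t) {-\<tau><..real k * \<tau>} U1"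

text \<open>Built from the final \<open>u\<close> rather than from the stages of the recursion, so
  that one family serves the whole induction.\<close>

definition source :: "nat \<Rightarrow> real \<Rightarrow> real" where
  "source i s = b * coef u i (s - \<tau>) + coef f i s"

definition source' :: "(nat \<Rightarrow> real \<Rightarrow> real) \<Rightarrow> nat \<Rightarrow> real \<Rightarrow> real" where
  "source' D i s = b * D i (s - \<tau>) + coef f\<^sub>t i s"

lemma regular_0: "regular 0 (coef \<phi>\<^sub>t)"
proof -
  have uc: "coef u i t = coef \<phi> i t" if "t \<le> 0" for i t using u_initial[OF that] by (simp add: coef_def)
  show ?thesis unfolding regular_def
  proof (intro conjI ballI allI impI)
    fix t assume "t \<in> {-\<tau>..real 0 * \<tau>}"
    then show "continuous_on {0..L} (\<lambda>x. u x t)"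
      using continuous_on_section(2)[OF \<phi>_cont, of t] u_initial[of t] by simp
  next
    fix i show "continuous_on {-\<tau>..real 0 * \<tau>} (coef u i)"
    proof -
      have "continuous_on {-\<tau>..0} (coef u i)"
        by (rule continuous_on_eq[OF coef_cont[OF \<phi>_cont, of i]]) (auto simp: uc)
      then show ?thesis by simp
    qed
  next
    fix i j t assume "j \<le> (0 :: nat)" "t \<in> {(real j - 1) * \<tau><..real j * \<tau>}"
    then have t: "t \<in> {-\<tau><..0}" and j: "j = 0" by auto
    have "(coef u i has_real_derivative coef \<phi>\<^sub>t i t) (at t within {-\<tau><..0})"
      by (rule has_field_derivative_transform_within[OF \<phi>_coef_deriv(2)[OF t], of 1]) (use t uc in auto)
    then show "(coef u i has_real_derivative coef \<phi>\<^sub>t i t) (at t within {(real j - 1) * \<tau><..real j * \<tau>})" by (simp add: j)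
  next
    show "ltail (\<lambda>i t. l i powr (9 / 8) * coef u i t) {-\<tau>..real 0 * \<tau>} (\<lambda>_. 1)"
      using \<phi>_coef_tail by (rule ltail_le[where K = 1 and V = "\<lambda>_. 1" and h = "\<lambda>t. t"]) (auto simp: uc)
    show "ltail (\<lambda>i t. l i powr (1 / 8) * coef \<phi>\<^sub>t i t) {-\<tau><..real 0 * \<tau>} U1"
      using \<phi>_coef_deriv(1) by (rule ltail_le[where K = 1 and V = "\<lambda>_. 1" and h = "\<lambda>t. t"]) (auto simp: U1_def)
  qed
qed

text \<open>The delay moves the piece of u that ends at j\<tau> to the piece of the source that
  starts there, and it turns \<open>U1\<close> into at most \<open>wt\<close>. The break of f at
  \<tau> is among the break points.\<close>

lemma mild_step:
  assumes k: "k < K" and reg: "regular k D"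
  shows "mild_coefficients \<alpha> \<tau> l0 (real (Suc k) * \<tau>) (Suc k) l (\<lambda>i. coef \<phi> i 0) source (source' D)"
proof
  show "0 < \<alpha>" "\<alpha> < 1" "\<tau> > 0" "Suc k > 0" "l0 > 0" "l i \<ge> l0" "real (Suc k) * \<tau> = real (Suc k) * \<tau>" for i
    using \<alpha> \<tau> l0 by auto
  have kK: "real (Suc k) * \<tau> \<le> real K * \<tau>" using k \<tau> by (intro mult_right_mono) auto
  have sk: "real (Suc k) * \<tau> = real k * \<tau> + \<tau>" by (simp add: algebra_simps)
  show "continuous_on {0..real (Suc k) * \<tau>} (source i)" for i
  proof -
    have cu: "continuous_on {-\<tau>..real k * \<tau>} (coef u i)" using reg by (simp add: regular_def)
    have "continuous_on {0..real (Suc k) * \<tau>} (\<lambda>s. coef u i (s - \<tau>))"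
      by (rule continuous_on_compose2[OF cu]) (auto intro!: continuous_intros simp: sk simp del: of_nat_Suc)
    moreover have "continuous_on {0..real (Suc k) * \<tau>} (coef f i)"
      using kK by (intro continuous_on_subset[OF coef_cont[OF f_cont]]) auto
    ultimately show ?thesis unfolding source_def[abs_def] by (intro continuous_intros)
  qed
  show "piecewise_deriv \<tau> (Suc k) (source i) (source' D i)" for i
    unfolding piecewise_deriv_def
  proof (intro allI impI ballI)
    fix j t assume j: "j < Suc k" and t: "t \<in> {real j * \<tau><..real (Suc j) * \<tau>}"
    let ?S = "{real j * \<tau><..real (Suc j) * \<tau>}"
    have "(coef u i has_real_derivative D i (t - \<tau>)) (at (t - \<tau>) within {(real j - 1) * \<tau><..real j * \<tau>})"
      using reg j t unfolding regular_def by (auto simp: algebra_simps)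
    then have "(coef u i has_real_derivative D i (t - \<tau>)) (at (t - \<tau>) within (\<lambda>s. s - \<tau>) ` ?S)"
      by (rule has_field_derivative_subset) (auto simp: algebra_simps)
    moreover have "((\<lambda>s. s - \<tau>) has_real_derivative 1) (at t within ?S)" by (auto intro!: derivative_eq_intros)
    ultimately have "((coef u i \<circ> (\<lambda>s. s - \<tau>)) has_real_derivative D i (t - \<tau>) * 1) (at t within ?S)"
      by (rule DERIV_image_chain)
    then have 1: "((\<lambda>s. coef u i (s - \<tau>)) has_real_derivative D i (t - \<tau>)) (at t within ?S)" by (simp add: o_def)
    have 2: "(coef f i has_real_derivative coef f\<^sub>t i t) (at t within ?S)"
    proof (cases "j = 0")
      case True
      then show ?thesis using f_coef_deriv1(2)[of t i] t by simp
    next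
      case False
      have "real (Suc j) * \<tau> \<le> real K * \<tau>" using j k \<tau> by (intro mult_right_mono) auto
      moreover have "1 * \<tau> \<le> real j * \<tau>" using False \<tau> by (intro mult_right_mono) auto
      ultimately have sub: "?S \<subseteq> {\<tau><..real K * \<tau>}" by auto
      then have "t \<in> {\<tau><..real K * \<tau>}" using t by blast
      from has_field_derivative_subset[OF f_coef_deriv2(2)[OF this] sub] show ?thesis .
    qed
    show "(source i has_real_derivative source' D i t) (at t within ?S)"
      unfolding source_def[abs_def] source'_def by (intro DERIV_add DERIV_cmult 1 2)
  qed
  show "ltail (\<lambda>i t. l i powr (9 / 8) * source i t) {0..real (Suc k) * \<tau>} (\<lambda>_. 1)"
  proof -
    have "ltail (\<lambda>i t. l i powr (9 / 8) * (b * coef u i (t - \<tau>))) {0..real (Suc k) * \<tau>} (\<lambda>_. 1)"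
    proof (rule ltail_le[where c = "\<lambda>i t. l i powr (9 / 8) * coef u i t" and S = "{-\<tau>..real k * \<tau>}" and W = "\<lambda>_. 1"
          and K = "\<bar>b\<bar>" and V = "\<lambda>_. \<bar>b\<bar>" and h = "\<lambda>t. t - \<tau>"])
      show "ltail (\<lambda>i t. l i powr (9 / 8) * coef u i t) {-\<tau>..real k * \<tau>} (\<lambda>_. 1)" using reg by (simp add: regular_def)
    qed (auto simp: abs_mult sk simp del: of_nat_Suc)
    moreover have "ltail (\<lambda>i t. l i powr (9 / 8) * coef f i t) {0..real (Suc k) * \<tau>} (\<lambda>_. 1)"
      using f_coef_tail by (rule ltail_le[where K = 1 and V = "\<lambda>_. 1" and h = "\<lambda>t. t"]) (use kK in auto)
    ultimately have "ltail (\<lambda>i t. l i powr (9 / 8) * (b * coef u i (t - \<tau>)) + l i powr (9 / 8) * coef f i t) {0..real (Suc k) * \<tau>} (\<lambda>_. 1)"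
      by (rule ltail_add)
    then show ?thesis by (simp add: source_def distrib_left)
  qed
  show "ltail (\<lambda>i t. l i powr (1 / 8) * source' D i t) {0<..real (Suc k) * \<tau>} (wt \<alpha> \<tau>)"
  proof -
    have "ltail (\<lambda>i t. l i powr (1 / 8) * (b * D i (t - \<tau>))) {0<..real (Suc k) * \<tau>} (wt \<alpha> \<tau>)"
    proof (rule ltail_le[where c = "\<lambda>i t. l i powr (1 / 8) * D i t" and S = "{-\<tau><..real k * \<tau>}" and W = U1
          and K = "\<bar>b\<bar>" and V = "\<lambda>_. \<bar>b\<bar>" and h = "\<lambda>t. t - \<tau>"])
      show "ltail (\<lambda>i t. l i powr (1 / 8) * D i t) {-\<tau><..real k * \<tau>} U1" using reg by (simp add: regular_def)
      fix t
      have "U1 (t - \<tau>) \<le> wt \<alpha> \<tau> t" by (auto simp: U1_def wt_def)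
      then show "\<bar>b\<bar> * U1 (t - \<tau>) \<le> \<bar>b\<bar> * wt \<alpha> \<tau> t" by (rule mult_left_mono) simp
    qed (auto simp: abs_mult sk simp del: of_nat_Suc)
    moreover have "ltail (\<lambda>i t. l i powr (1 / 8) * coef f\<^sub>t i t) {0<..real (Suc k) * \<tau>} (wt \<alpha> \<tau>)"
    proof -
      obtain \<epsilon> where e: "\<epsilon> \<longlonglongrightarrow> 0" "\<And>n. \<epsilon> n \<ge> 0" "\<And>N M t. t \<in> {0<..\<tau>} \<Longrightarrow> (\<Sum>i\<in>{N..<M}. \<bar>l i powr (1 / 8) * coef f\<^sub>t i t\<bar>) \<le> \<epsilon> N * 1"
        using f_coef_deriv1(1) by (rule ltailE) blast
      obtain \<eta> where h: "\<eta> \<longlonglongrightarrow> 0" "\<And>n. \<eta> n \<ge> 0" "\<And>N M t. t \<in> {\<tau><..real K * \<tau>} \<Longrightarrow> (\<Sum>i\<in>{N..<M}. \<bar>l i powr (1 / 8) * coef f\<^sub>t i t\<bar>) \<le> \<eta> N * (1 + (t - \<tau>) powr (\<alpha> - 1))"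
        using f_coef_deriv2(1) by (rule ltailE) blast
      have "(\<Sum>i\<in>{N..<M}. \<bar>l i powr (1 / 8) * coef f\<^sub>t i t\<bar>) \<le> (\<epsilon> N + \<eta> N) * wt \<alpha> \<tau> t" if t: "t \<in> {0<..real (Suc k) * \<tau>}" for N M t
      proof (cases "t \<le> \<tau>")
        case True
        then have "(\<Sum>i\<in>{N..<M}. \<bar>l i powr (1 / 8) * coef f\<^sub>t i t\<bar>) \<le> \<epsilon> N * 1" using e(3)[of t N M] t by simp
        also have "\<dots> \<le> (\<epsilon> N + \<eta> N) * wt \<alpha> \<tau> t" using e(2)[of N] h(2)[of N] wt_ge_1[of \<alpha> \<tau> t] by (intro mult_mono) auto
        finally show ?thesis .
      next
        case False
        then have "(\<Sum>i\<in>{N..<M}. \<bar>l i powr (1 / 8) * coef f\<^sub>t i t\<bar>) \<le> \<eta> N * (1 + (t - \<tau>) powr (\<alpha> - 1))" using h(3)[of t N M] t kK by simp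
        also have "\<dots> \<le> (\<epsilon> N + \<eta> N) * wt \<alpha> \<tau> t" using False e(2)[of N] h(2)[of N] by (intro mult_mono) (auto simp: wt_def)
        finally show ?thesis .
      qed
      moreover have "(\<lambda>n. \<epsilon> n + \<eta> n) \<longlonglongrightarrow> 0 + 0" using e(1) h(1) by (intro tendsto_intros)
      ultimately show ?thesis unfolding ltail_def using e(2) h(2) by (intro exI[of _ "\<lambda>n. \<epsilon> n + \<eta> n"]) auto
    qed
    ultimately have "ltail (\<lambda>i t. l i powr (1 / 8) * (b * D i (t - \<tau>)) + l i powr (1 / 8) * coef f\<^sub>t i t) {0<..real (Suc k) * \<tau>} (wt \<alpha> \<tau>)"
      by (rule ltail_add)
    then show ?thesis by (simp add: source'_def distrib_left)
  qed
  show "ltail (\<lambda>i t. l i powr (9 / 8) * coef \<phi> i 0) {0} (\<lambda>_. 1)"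
    using \<phi>_coef_tail by (rule ltail_le[where K = 1 and V = "\<lambda>_. 1" and h = "\<lambda>t. t"]) (use \<tau> in auto)
qed

abbreviation mu where "mu \<equiv> mild_coefficients.u \<alpha> l (\<lambda>i. coef \<phi> i 0) source"
abbreviation mu1 where "mu1 D \<equiv> mild_coefficients.u1 \<alpha> l (\<lambda>i. coef \<phi> i 0) source (source' D)"

text \<open>For t between j\<tau> and (j + 1)\<tau> the recursion consults stage j, which agrees
  with u up to time j\<tau>. Hence a single series represents u on all pieces up to (k +
  1)\<tau>.\<close>

lemma solution_series:
  assumes k: "k < K" and reg: "regular k D" and t: "t \<in> {0<..real (Suc k) * \<tau>}"
  shows "u x t = (\<Sum>i. mu i t * e i x)"
proof -
  interpret mc: mild_coefficients \<alpha> \<tau> l0 "real (Suc k) * \<tau>" "Suc k" l "\<lambda>i. coef \<phi> i 0" source "source' D"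
    using k reg by (rule mild_step)
  obtain j where j: "j < Suc k" "t \<in> {real j * \<tau><..real (Suc j) * \<tau>}" using piece_cover[OF \<tau> t] by blast
  have kK: "real (Suc k) * \<tau> \<le> real K * \<tau>" using k \<tau> by (intro mult_right_mono) auto
  have jk: "real j * \<tau> \<le> real k * \<tau>" using j \<tau> by (intro mult_right_mono) auto
  have sj: "real (Suc j) * \<tau> = real j * \<tau> + \<tau>" by (simp add: algebra_simps)
  have src: "l2_inner L (\<lambda>y. b * delay_sol L \<alpha> lam X b \<tau> \<phi> f j y (r - \<tau>) + f y r) (X (Suc i)) = source i r"
    if r: "0 \<le> r" "r \<le> t" for r i
  proof -
    have rj: "r - \<tau> \<le> real j * \<tau>" using r j sj by auto
    have eq: "delay_sol L \<alpha> lam X b \<tau> \<phi> f j y (r - \<tau>) = u y (r - \<tau>)" for y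
      using delay_sol_agree[OF _ rj, of K y] j k by (simp add: u)
    have cu: "continuous_on {0..L} (\<lambda>x. u x (r - \<tau>))" using reg r rj jk by (simp add: regular_def)
    have rK: "r \<in> {0..real K * \<tau>}" using r t kK by simp
    have i1: "(\<lambda>x. e i x * u x (r - \<tau>)) integrable_on {0..L}"
      by (intro integrable_continuous_real continuous_intros e_cont cu)
    have i2: "(\<lambda>x. e i x * f x r) integrable_on {0..L}"
      by (intro integrable_continuous_real continuous_intros e_cont continuous_on_section(2)[OF f_cont rK])
    have "l2_inner L (\<lambda>y. b * delay_sol L \<alpha> lam X b \<tau> \<phi> f j y (r - \<tau>) + f y r) (X (Suc i)) =
       integral {0..L} (\<lambda>x. b * (e i x * u x (r - \<tau>)) + e i x * f x r)"
      unfolding l2_inner_def eq X[symmetric] by (intro integral_cong) (simp add: algebra_simps)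
    also have "\<dots> = b * integral {0..L} (\<lambda>x. e i x * u x (r - \<tau>)) + integral {0..L} (\<lambda>x. e i x * f x r)"
      by (rule integral_unique) (intro has_integral_add has_integral_mult_right integrable_integral i1 i2)
    finally show ?thesis by (simp add: source_def coef_def)
  qed
  have ml: "mittag_leffler \<alpha> 1 (- lam (Suc i) * s powr \<alpha>) = relax \<alpha> (l i) s" for i s
    using mittag_leffler_mlt[of \<alpha> "lam (Suc i) * s powr \<alpha>"] by (simp add: relax_def lam)
  have "u x t = delay_sol L \<alpha> lam X b \<tau> \<phi> f (Suc j) x t"
    unfolding u using j k by (intro delay_sol_agree) auto
  also have "\<dots> = mild_series L \<alpha> lam X (\<lambda>y. \<phi> y 0) (\<lambda>y s. b * delay_sol L \<alpha> lam X b \<tau> \<phi> f j y (s - \<tau>) + f y s) x t"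
    using j by simp
  also have "\<dots> = (\<Sum>i. mu i t * e i x)"
    unfolding mild_series_def Let_def ml
  proof (rule suminf_cong)
    fix i
    have "integral {0..t} (\<lambda>s. relax \<alpha> (l i) s * l2_inner L (\<lambda>y. b * delay_sol L \<alpha> lam X b \<tau> \<phi> f j y (t - s - \<tau>) + f y (t - s)) (X (Suc i)))
       = mc.w i t"
      unfolding mc.w_def by (intro integral_cong) (use src in auto)
    moreover have "l2_inner L (\<lambda>y. \<phi> y 0) (X (Suc i)) = coef \<phi> i 0"
      by (simp add: l2_inner_def coef_def X mult.commute)
    ultimately show "(l2_inner L (\<lambda>y. \<phi> y 0) (X (Suc i)) * relax \<alpha> (l i) t +
          integral {0..t} (\<lambda>s. relax \<alpha> (l i) s * l2_inner L (\<lambda>y. b * delay_sol L \<alpha> lam X b \<tau> \<phi> f j y (t - s - \<tau>) + f y (t - s)) (X (Suc i)))) *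
         X (Suc i) x = mu i t * e i x"
      by (simp add: mc.u_def X)
  qed
  finally show ?thesis .
qed

lemma coef_solution:
  assumes k: "k < K" and reg: "regular k D" and t: "t \<in> {0..real (Suc k) * \<tau>}"
  shows "coef u i t = mu i t" and "summable (\<lambda>i. \<bar>mu i t\<bar>)"
proof -
  interpret mc: mild_coefficients \<alpha> \<tau> l0 "real (Suc k) * \<tau>" "Suc k" l "\<lambda>i. coef \<phi> i 0" source "source' D"
    using k reg by (rule mild_step)
  have "ltail mu {0..real (Suc k) * \<tau>} (\<lambda>_. 1)" using mc.u_tail by (rule ltail_unweighted) simp
  from ltail_bound[OF this] t show s: "summable (\<lambda>i. \<bar>mu i t\<bar>)" by auto
  show "coef u i t = mu i t"
  proof (cases "t = 0")
    case True
    have "coef u i 0 = coef \<phi> i 0" by (simp add: coef_def u_initial)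
    then show ?thesis using mc.u_0[of i] True by simp
  next
    case False
    then have t': "t \<in> {0<..real (Suc k) * \<tau>}" using t by auto
    have "coef u i t = integral {0..L} (\<lambda>x. e i x * (\<Sum>i. mu i t * e i x))"
      by (simp only: coef_def[of u] solution_series[OF k reg t'])
    then show ?thesis using series_coefficient[OF s, of i] by simp
  qed
qed

lemma regular_Suc:
  assumes k: "k < K" and reg: "regular k D" and D: "\<And>i t. t \<in> {-\<tau><..0} \<Longrightarrow> D i t = coef \<phi>\<^sub>t i t"
  shows "\<exists>D. regular (Suc k) D \<and> (\<forall>i. \<forall>t\<in>{-\<tau><..0}. D i t = coef \<phi>\<^sub>t i t)"
proof -
  interpret mc: mild_coefficients \<alpha> \<tau> l0 "real (Suc k) * \<tau>" "Suc k" l "\<lambda>i. coef \<phi> i 0" source "source' D"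
    using k reg by (rule mild_step)
  \<comment> \<open>At t = 0 the derivative belongs to the left piece, so the initial function
    prescribes it.\<close>
  define D' where "D' i t = (if t \<le> 0 then coef \<phi>\<^sub>t i t else mc.u1 i t)" for i t
  have Tp: "real (Suc k) * \<tau> > 0" using \<tau> by simp
  have split: "{-\<tau>..real (Suc k) * \<tau>} = {-\<tau>..0} \<union> {0..real (Suc k) * \<tau>}" using \<tau> less_imp_le[OF Tp]
    by (intro ivl_disj_un_two_touch(4)[symmetric]) auto
  note r0 = regular_0[unfolded regular_def, simplified]
  have cs: "coef u i t = mc.u i t" if "t \<in> {0..real (Suc k) * \<tau>}" for i t using coef_solution[OF k reg that] by simp
  have "regular (Suc k) D'" unfolding regular_def
  proof (intro conjI ballI allI impI)
    fix t assume t: "t \<in> {-\<tau>..real (Suc k) * \<tau>}"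
    show "continuous_on {0..L} (\<lambda>x. u x t)"
    proof (cases "t \<le> 0")
      case True
      then show ?thesis using r0 t by auto
    next
      case False
      then have t': "t \<in> {0<..real (Suc k) * \<tau>}" using t by auto
      show ?thesis unfolding solution_series[OF k reg t']
        using t' by (intro series_continuous coef_solution(2)[OF k reg]) auto
    qed
  next
    fix i
    have "continuous_on {-\<tau>..0} (coef u i)" using r0 by auto
    moreover have "continuous_on {0..real (Suc k) * \<tau>} (coef u i)"
      by (rule continuous_on_eq[OF mc.u_cont[of i]]) (simp add: cs)
    ultimately show "continuous_on {-\<tau>..real (Suc k) * \<tau>} (coef u i)"
      unfolding split by (intro continuous_on_closed_Un) auto
  next
    fix i j t assume j: "j \<le> Suc k" and t: "t \<in> {(real j - 1) * \<tau><..real j * \<tau>}"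
    let ?S = "{(real j - 1) * \<tau><..real j * \<tau>}"
    show "(coef u i has_real_derivative D' i t) (at t within ?S)"
    proof (cases "j = 0")
      case True
      then show ?thesis using regular_0 t unfolding regular_def D'_def by auto
    next
      case False
      then have "0 \<le> (real j - 1) * \<tau>" using \<tau> by (intro mult_nonneg_nonneg) auto
      moreover have "real j * \<tau> \<le> real (Suc k) * \<tau>" using j \<tau> by (intro mult_right_mono) auto
      ultimately have S: "?S \<subseteq> {0..real (Suc k) * \<tau>}" and t': "t \<in> {0<..real (Suc k) * \<tau>}" using t by auto
      have "(mc.u i has_real_derivative mc.u1 i t) (at t within ?S)"
        using mc.u_deriv[OF t'] S by (rule has_field_derivative_subset)
      then have "(coef u i has_real_derivative mc.u1 i t) (at t within ?S)"
        using zero_less_one t by (rule has_field_derivative_transform_within) (use S cs in auto)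
      then show ?thesis using t' by (simp add: D'_def)
    qed
  next
    obtain \<epsilon> where e: "\<epsilon> \<longlonglongrightarrow> 0" "\<And>n. \<epsilon> n \<ge> 0" "\<And>N M t. t \<in> {-\<tau>..0} \<Longrightarrow> (\<Sum>i\<in>{N..<M}. \<bar>l i powr (9 / 8) * coef \<phi> i t\<bar>) \<le> \<epsilon> N * 1"
      using \<phi>_coef_tail by (rule ltailE) blast
    obtain \<eta> where h: "\<eta> \<longlonglongrightarrow> 0" "\<And>n. \<eta> n \<ge> 0" "\<And>N M t. t \<in> {0..real (Suc k) * \<tau>} \<Longrightarrow> (\<Sum>i\<in>{N..<M}. \<bar>l i powr (9 / 8) * mc.u i t\<bar>) \<le> \<eta> N * 1"
      using mc.u_tail by (rule ltailE) blast
    have "(\<Sum>i\<in>{N..<M}. \<bar>l i powr (9 / 8) * coef u i t\<bar>) \<le> (\<epsilon> N + \<eta> N) * 1" if t: "t \<in> {-\<tau>..real (Suc k) * \<tau>}" for N M t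
    proof (cases "t \<le> 0")
      case True
      then have "coef u i t = coef \<phi> i t" for i by (simp add: coef_def u_initial)
      then show ?thesis using e(3)[of t N M] h(2)[of N] t True by simp
    next
      case False
      then show ?thesis using h(3)[of t N M] e(2)[of N] t cs[of t] by simp
    qed
    moreover have "(\<lambda>n. \<epsilon> n + \<eta> n) \<longlonglongrightarrow> 0 + 0" using e(1) h(1) by (intro tendsto_intros)
    ultimately show "ltail (\<lambda>i t. l i powr (9 / 8) * coef u i t) {-\<tau>..real (Suc k) * \<tau>} (\<lambda>_. 1)"
      unfolding ltail_def using e(2) h(2) by (intro exI[of _ "\<lambda>n. \<epsilon> n + \<eta> n"]) auto
  next
    obtain \<epsilon> where e: "\<epsilon> \<longlonglongrightarrow> 0" "\<And>n. \<epsilon> n \<ge> 0" "\<And>N M t. t \<in> {-\<tau><..0} \<Longrightarrow> (\<Sum>i\<in>{N..<M}. \<bar>l i powr (1 / 8) * coef \<phi>\<^sub>t i t\<bar>) \<le> \<epsilon> N * (1 + (t + \<tau>) powr (\<alpha> - 1))"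
      using \<phi>_coef_deriv(1) by (rule ltailE) blast
    obtain \<eta> where h: "\<eta> \<longlonglongrightarrow> 0" "\<And>n. \<eta> n \<ge> 0" "\<And>N M t. t \<in> {0<..real (Suc k) * \<tau>} \<Longrightarrow> (\<Sum>i\<in>{N..<M}. \<bar>l i powr (1 / 8) * mc.u1 i t\<bar>) \<le> \<eta> N * (1 + t powr (\<alpha> - 1))"
      using mc.u1_tail by (rule ltailE) blast
    have U: "U1 t \<ge> 0" for t by (auto simp: U1_def add_nonneg_nonneg)
    have "(\<Sum>i\<in>{N..<M}. \<bar>l i powr (1 / 8) * D' i t\<bar>) \<le> (\<epsilon> N + \<eta> N) * U1 t" if t: "t \<in> {-\<tau><..real (Suc k) * \<tau>}" for N M t
    proof (cases "t \<le> 0")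
      case True
      then have "(\<Sum>i\<in>{N..<M}. \<bar>l i powr (1 / 8) * D' i t\<bar>) \<le> \<epsilon> N * U1 t"
        using e(3)[of t N M] t by (simp add: D'_def U1_def)
      also have "\<dots> \<le> (\<epsilon> N + \<eta> N) * U1 t" using h(2)[of N] U by (intro mult_right_mono) auto
      finally show ?thesis .
    next
      case False
      then have "(\<Sum>i\<in>{N..<M}. \<bar>l i powr (1 / 8) * D' i t\<bar>) \<le> \<eta> N * U1 t"
        using h(3)[of t N M] t by (simp add: D'_def U1_def)
      also have "\<dots> \<le> (\<epsilon> N + \<eta> N) * U1 t" using e(2)[of N] U by (intro mult_right_mono) auto
      finally show ?thesis .
    qed
    moreover have "(\<lambda>n. \<epsilon> n + \<eta> n) \<longlonglongrightarrow> 0 + 0" using e(1) h(1) by (intro tendsto_intros)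
    ultimately show "ltail (\<lambda>i t. l i powr (1 / 8) * D' i t) {-\<tau><..real (Suc k) * \<tau>} U1"
      unfolding ltail_def using e(2) h(2) by (intro exI[of _ "\<lambda>n. \<epsilon> n + \<eta> n"]) auto
  qed
  then show ?thesis by (auto simp: D'_def)
qed

lemma regular_ex: "k \<le> K \<Longrightarrow> \<exists>D. regular k D \<and> (\<forall>i. \<forall>t\<in>{-\<tau><..0}. D i t = coef \<phi>\<^sub>t i t)"
proof (induction k)
  case 0
  show ?case using regular_0 by blast
next
  case (Suc k)
  then obtain D where D: "regular k D" "\<And>i t. t \<in> {-\<tau><..0} \<Longrightarrow> D i t = coef \<phi>\<^sub>t i t" by auto
  show ?case by (rule regular_Suc[OF _ D(1) D(2)]) (use Suc.prems in auto)
qed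

text \<open>The source on [0, K\<tau>] sees u only up to (K - 1)\<tau>, so regularity at stage K - 1
  is enough.\<close>

lemma solution_mild:
  "\<exists>D. mild_coefficients \<alpha> \<tau> l0 (real K * \<tau>) K l (\<lambda>i. coef \<phi> i 0) source (source' D) \<and>
     (\<forall>x. \<forall>t\<in>{0<..real K * \<tau>}. u x t = (\<Sum>i. mu i t * e i x))"
proof -
  obtain k where k: "K = Suc k" using K by (cases K) auto
  then obtain D where "regular k D" using regular_ex[of k] by auto
  then show ?thesis using mild_step[of k D] solution_series[of k D] k by auto
qed

end

section \<open>Termwise differentiation and the pointwise bounds\<close>

lemma wt_bounded_on_piece:
  assumes \<alpha>: "0 < \<alpha>" "\<alpha> < 1" and \<tau>: "\<tau> > 0" and c: "real j * \<tau> < c"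
  shows "\<exists>B\<ge>1. \<forall>s\<in>{c..real (Suc j) * \<tau>}. wt \<alpha> \<tau> s \<le> B \<and> s powr (\<alpha> - 1) \<le> B \<and> s powr (\<alpha> - 2) \<le> B"
proof -
  have c0: "c > 0" using c \<tau> by (smt (verit) mult_nonneg_nonneg of_nat_0_le_iff)
  define B where "B = 1 + c powr (\<alpha> - 1) + c powr (\<alpha> - 2) + (c - \<tau>) powr (\<alpha> - 1)"
  have B1: "B \<ge> 1" by (simp add: B_def)
  have p: "s powr (\<alpha> - 1) \<le> c powr (\<alpha> - 1)" "s powr (\<alpha> - 2) \<le> c powr (\<alpha> - 2)" if "s \<in> {c..real (Suc j) * \<tau>}" for s
    using that c0 \<alpha> by (auto intro!: powr_mono2' simp del: of_nat_Suc)
  have m: "(max 0 (s - \<tau>)) powr (\<alpha> - 1) \<le> (c - \<tau>) powr (\<alpha> - 1)" if s: "s \<in> {c..real (Suc j) * \<tau>}" for s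
  proof (cases "j = 0")
    case True
    then show ?thesis using s by (auto simp: max_def)
  next
    case False
    then have "1 * \<tau> \<le> real j * \<tau>" using \<tau> by (intro mult_right_mono) auto
    then have "c - \<tau> > 0" using c by simp
    then show ?thesis using s \<alpha> by (intro powr_mono2') (auto simp del: of_nat_Suc)
  qed
  have "wt \<alpha> \<tau> s \<le> B \<and> s powr (\<alpha> - 1) \<le> B \<and> s powr (\<alpha> - 2) \<le> B" if "s \<in> {c..real (Suc j) * \<tau>}" for s
  proof -
    have "0 \<le> c powr (\<alpha> - 1)" "0 \<le> c powr (\<alpha> - 2)" "0 \<le> (c - \<tau>) powr (\<alpha> - 1)" by auto
    then show ?thesis using p[OF that] m[OF that] unfolding wt_def B_def by linarith
  qed
  then show ?thesis using B1 by blast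
qed

text \<open>The weights may be unbounded at the left end p. Termwise differentiation is carried out
  on [r, q], with r halfway between p and t, and this interval determines the same derivative at
  t.\<close>

lemma piece_deriv_series:
  fixes c c' :: "nat \<Rightarrow> real \<Rightarrow> real" and x :: "nat \<Rightarrow> real"
  assumes t: "t \<in> {p<..q}" and c': "ltail c' {p<..q} W" and c: "ltail c {p<..q} W0"
    and W: "\<And>r. p < r \<Longrightarrow> \<exists>K. \<forall>t\<in>{r..q}. W t \<le> K" and W0: "\<And>t. t \<in> {p<..q} \<Longrightarrow> W0 t \<ge> 0"
    and x: "\<And>i. \<bar>x i\<bar> \<le> B"
    and d: "\<And>i t. t \<in> {p<..q} \<Longrightarrow> (c i has_real_derivative c' i t) (at t within {p<..q})"
  shows "((\<lambda>t. \<Sum>i. c i t * x i) has_real_derivative (\<Sum>i. c' i t * x i)) (at t within {p<..q})"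
proof -
  define r where "r = (p + t) / 2"
  have r: "p < r" "r < t" using t by (auto simp: r_def)
  have sub: "{r..q} \<subseteq> {p<..q}" using r by auto
  obtain K where K: "\<forall>t\<in>{r..q}. W t \<le> K" using W[OF r(1)] by blast
  have s: "summable (\<lambda>i. c i t * x i)" if "t \<in> {r..q}" for t
  proof (rule summable_comparison_test'[where g = "\<lambda>i. \<bar>c i t\<bar> * B"])
    have "\<exists>K\<ge>0. \<forall>t\<in>{p<..q}. summable (\<lambda>i. \<bar>c i t\<bar>) \<and> (\<Sum>i. \<bar>c i t\<bar>) \<le> K * W0 t"
      using c W0 by (rule ltail_bound)
    then show "summable (\<lambda>i. \<bar>c i t\<bar> * B)" using that sub by (intro summable_mult2) blast
    show "norm (c i t * x i) \<le> \<bar>c i t\<bar> * B" for i using x[of i] by (simp add: abs_mult mult_left_mono)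
  qed
  have "((\<lambda>t. \<Sum>i. c i t * x i) has_real_derivative (\<Sum>i. c' i t * x i)) (at t within {r..q})"
  proof (rule ltail_series_deriv[where W = W and K = K and B = B])
    show "ltail c' {r..q} W" using c' by (rule ltail_le[where K = 1 and V = "\<lambda>_. 1" and h = "\<lambda>t. t"]) (use sub in auto)
    show "(c i has_real_derivative c' i t) (at t within {r..q})" if "t \<in> {r..q}" for i t
      using d[of t i] that sub by (blast intro: has_field_derivative_subset)
  qed (use K x s t r in auto)
  moreover have "at t within {r..q} = at t within {p<..q}"
    by (rule at_within_nhd[of t "{r<..}"]) (use r in auto)
  ultimately show ?thesis by simp
qed

context dirichlet_basis
begin

text \<open>Serves for the first and for the second derivative in x: both families of derivatives
  satisfy the same bound.\<close>

lemma series_x_deriv: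
  fixes y y1 :: "nat \<Rightarrow> real \<Rightarrow> real"
  assumes c: "summable (\<lambda>i. \<bar>c i\<bar> * l i)"
    and y: "\<And>i x. x \<in> {0..L} \<Longrightarrow> (y i has_real_derivative y1 i x) (at x within {0..L})"
    and s: "\<And>x. x \<in> {0..L} \<Longrightarrow> summable (\<lambda>i. c i * y i x)" and y1b: "\<And>i x. x \<in> {0..L} \<Longrightarrow> \<bar>y1 i x\<bar> \<le> B * l i"
    and x: "x \<in> {0..L}"
  shows "((\<lambda>x. \<Sum>i. c i * y i x) has_real_derivative (\<Sum>i. c i * y1 i x)) (at x within {0..L})"
    and "\<bar>\<Sum>i. c i * y1 i x\<bar> \<le> B * (\<Sum>i. \<bar>c i\<bar> * l i)"
proof -
  have m: "summable (\<lambda>i. B * (\<bar>c i\<bar> * l i))" using c by (rule summable_mult)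
  have b: "\<bar>c i * z\<bar> \<le> B * (\<bar>c i\<bar> * l i)" if "\<bar>z\<bar> \<le> B * l i" for i z
    using mult_left_mono[OF that, of "\<bar>c i\<bar>"] by (simp add: abs_mult mult_ac)
  have "\<exists>g. \<forall>x\<in>{0..L}. (\<lambda>i. c i * y i x) sums g x \<and> (g has_real_derivative (\<Sum>i. c i * y1 i x)) (at x within {0..L})"
  proof (rule has_field_derivative_series[where f' = "\<lambda>i x. c i * y1 i x"])
    show "uniform_limit {0..L} (\<lambda>n x. \<Sum>i<n. c i * y1 i x) (\<lambda>x. \<Sum>i. c i * y1 i x) sequentially"
      by (rule Weierstrass_m_test[OF _ m]) (use b[OF y1b] in simp)
    show "((\<lambda>x. c i * y i x) has_real_derivative c i * y1 i x) (at x within {0..L})" if "x \<in> {0..L}" for i x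
      using y[OF that] by (rule DERIV_cmult)
  qed (use s x in auto)
  then obtain g where g: "\<And>x. x \<in> {0..L} \<Longrightarrow> (\<lambda>i. c i * y i x) sums g x"
    "\<And>x. x \<in> {0..L} \<Longrightarrow> (g has_real_derivative (\<Sum>i. c i * y1 i x)) (at x within {0..L})" by blast
  show "((\<lambda>x. \<Sum>i. c i * y i x) has_real_derivative (\<Sum>i. c i * y1 i x)) (at x within {0..L})"
    by (rule has_field_derivative_transform_within[OF g(2)[OF x], of 1]) (use x g(1) sums_unique in auto)
  have s1: "summable (\<lambda>i. \<bar>c i * y1 i x\<bar>)"
    by (rule summable_comparison_test'[OF m, of 0]) (use b[OF y1b[OF x]] in simp)
  have "\<bar>\<Sum>i. c i * y1 i x\<bar> \<le> (\<Sum>i. \<bar>c i * y1 i x\<bar>)" by (rule summable_rabs[OF s1])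
  also have "\<dots> \<le> (\<Sum>i. B * (\<bar>c i\<bar> * l i))" by (intro suminf_le s1 m b y1b x)
  also have "\<dots> = B * (\<Sum>i. \<bar>c i\<bar> * l i)" by (rule suminf_mult[OF c])
  finally show "\<bar>\<Sum>i. c i * y1 i x\<bar> \<le> B * (\<Sum>i. \<bar>c i\<bar> * l i)" .
qed

lemma series_e_bound:
  assumes c: "ltail c S W" and W: "\<And>t. t \<in> S \<Longrightarrow> W t \<ge> 0"
  shows "\<exists>C\<ge>0. \<forall>x\<in>{0..L}. \<forall>t\<in>S. \<bar>\<Sum>i. c i t * e i x\<bar> \<le> C * W t"
proof -
  have "\<exists>K\<ge>0. \<forall>t\<in>S. summable (\<lambda>i. \<bar>c i t\<bar>) \<and> (\<Sum>i. \<bar>c i t\<bar>) \<le> K * W t"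
    using c W by (rule ltail_bound)
  then obtain K where K: "K \<ge> 0" "\<forall>t\<in>S. summable (\<lambda>i. \<bar>c i t\<bar>) \<and> (\<Sum>i. \<bar>c i t\<bar>) \<le> K * W t" by blast
  have "\<bar>\<Sum>i. c i t * e i x\<bar> \<le> B * K * W t" if x: "x \<in> {0..L}" and t: "t \<in> S" for x t
  proof -
    have "\<bar>\<Sum>i. c i t * e i x\<bar> \<le> B * (\<Sum>i. \<bar>c i t\<bar>)"
      using K(2) t by (intro series_abs_le e_bound x) auto
    also have "\<dots> \<le> B * (K * W t)" using K(2) t B by (intro mult_left_mono) auto
    finally show ?thesis by (simp add: mult.assoc)
  qed
  moreover have "B * K \<ge> 0" using B K by simp
  ultimately show ?thesis by blast
qed

end

context delay_problem
begin

lemma regularity: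
  "\<exists>C>0. \<forall>k\<in>{1..K}. \<exists>u\<^sub>t u\<^sub>t\<^sub>t u\<^sub>x u\<^sub>x\<^sub>x.
        \<forall>x\<in>{0..L}. \<forall>t\<in>{real (k - 1) * \<tau><..real k * \<tau>}.
          (u x has_real_derivative u\<^sub>t x t) (at t within {real (k - 1) * \<tau><..real k * \<tau>}) \<and>
          (u\<^sub>t x has_real_derivative u\<^sub>t\<^sub>t x t) (at t within {real (k - 1) * \<tau><..real k * \<tau>}) \<and>
          ((\<lambda>y. u y t) has_real_derivative u\<^sub>x x t) (at x within {0..L}) \<and>
          ((\<lambda>y. u\<^sub>x y t) has_real_derivative u\<^sub>x\<^sub>x x t) (at x within {0..L}) \<and>
          \<bar>u x t\<bar> \<le> C * (1 + t powr \<alpha>) \<and>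
          \<bar>u\<^sub>t x t\<bar> \<le> C * (1 + t powr (\<alpha> - 1)) \<and>
          (k = 1 \<longrightarrow> \<bar>u\<^sub>t\<^sub>t x t\<bar> \<le> C * (1 + t powr (\<alpha> - 2))) \<and>
          (k \<ge> 2 \<longrightarrow> \<bar>u\<^sub>t\<^sub>t x t\<bar> \<le> C * (1 + (t - \<tau>) powr (\<alpha> - 1))) \<and>
          \<bar>u x t\<bar> \<le> C \<and> \<bar>u\<^sub>x x t\<bar> \<le> C \<and> \<bar>u\<^sub>x\<^sub>x x t\<bar> \<le> C"
proof -
  obtain D where mcD: "mild_coefficients \<alpha> \<tau> l0 (real K * \<tau>) K l (\<lambda>i. coef \<phi> i 0) source (source' D)"
    and us: "\<And>x t. t \<in> {0<..real K * \<tau>} \<Longrightarrow> u x t = (\<Sum>i. mu i t * e i x)"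
    using solution_mild by blast
  interpret mc: mild_coefficients \<alpha> \<tau> l0 "real K * \<tau>" K l "\<lambda>i. coef \<phi> i 0" source "source' D"
    by (rule mcD)
  define T where "T = real K * \<tau>"
  have w0: "0 \<le> 1 + t powr (\<alpha> - 1)" "0 \<le> t powr (\<alpha> - 2) + wt \<alpha> \<tau> t" for t
    using wt_ge_1[of \<alpha> \<tau> t] by (auto intro!: add_nonneg_nonneg)
  have tu: "ltail mc.u {0..T} (\<lambda>_. 1)" unfolding T_def using mc.u_tail by (rule ltail_unweighted) simp
  have tul: "ltail (\<lambda>i t. l i powr 1 * mc.u i t) {0..T} (\<lambda>_. 1)" unfolding T_def using mc.u_tail by (rule ltail_weaken) simp
  have tu1: "ltail mc.u1 {0<..T} (\<lambda>t. 1 + t powr (\<alpha> - 1))" unfolding T_def using mc.u1_tail by (rule ltail_unweighted) simp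
  have tu2: "ltail mc.u2 {0<..T} (\<lambda>t. t powr (\<alpha> - 2) + wt \<alpha> \<tau> t)" unfolding T_def by (rule mc.u2_tail)
  have sub: "ltail c S W" if "ltail c S' W" "S \<subseteq> S'" for c S S' W
    using that(1) by (rule ltail_le[where K = 1 and V = "\<lambda>_. 1" and h = "\<lambda>t. t"]) (use that(2) in auto)
  define Ut where "Ut x t = (\<Sum>i. mc.u1 i t * e i x)" for x t
  define Utt where "Utt x t = (\<Sum>i. mc.u2 i t * e i x)" for x t
  define Ux where "Ux x t = (\<Sum>i. mc.u i t * e1 i x)" for x t
  define Uxx where "Uxx x t = (\<Sum>i. mc.u i t * e2 i x)" for x t
  obtain C0 where C0: "C0 \<ge> 0" "\<And>x t. x \<in> {0..L} \<Longrightarrow> t \<in> {0..T} \<Longrightarrow> \<bar>\<Sum>i. mc.u i t * e i x\<bar> \<le> C0 * 1"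
    using series_e_bound[OF tu] by auto
  obtain C1 where C1: "C1 \<ge> 0" "\<And>x t. x \<in> {0..L} \<Longrightarrow> t \<in> {0<..T} \<Longrightarrow> \<bar>Ut x t\<bar> \<le> C1 * (1 + t powr (\<alpha> - 1))"
    using series_e_bound[OF tu1] w0 unfolding Ut_def by auto
  obtain C2 where C2: "C2 \<ge> 0" "\<And>x t. x \<in> {0..L} \<Longrightarrow> t \<in> {0<..T} \<Longrightarrow> \<bar>Utt x t\<bar> \<le> C2 * (t powr (\<alpha> - 2) + wt \<alpha> \<tau> t)"
    using series_e_bound[OF tu2] w0 unfolding Utt_def by auto
  have "\<exists>K\<ge>0. \<forall>t\<in>{0..T}. summable (\<lambda>i. \<bar>l i powr 1 * mc.u i t\<bar>) \<and> (\<Sum>i. \<bar>l i powr 1 * mc.u i t\<bar>) \<le> K * 1"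
    using tul by (rule ltail_bound) simp
  moreover have "\<bar>l i powr 1 * mc.u i t\<bar> = \<bar>mc.u i t\<bar> * l i" for i t using l_pos[of i] by (simp add: abs_mult)
  ultimately obtain C3 where C3: "C3 \<ge> 0" "\<And>t. t \<in> {0..T} \<Longrightarrow> summable (\<lambda>i. \<bar>mc.u i t\<bar> * l i)"
    "\<And>t. t \<in> {0..T} \<Longrightarrow> (\<Sum>i. \<bar>mc.u i t\<bar> * l i) \<le> C3" by auto
  have su: "summable (\<lambda>i. \<bar>mc.u i t\<bar>)" if "t \<in> {0..T}" for t
    using ltail_bound[OF tu] that by auto
  have se1: "summable (\<lambda>i. mc.u i t * e1 i x)" if "t \<in> {0..T}" "x \<in> {0..L}" for t x
  proof (rule summable_comparison_test'[where g = "\<lambda>i. B * (\<bar>mc.u i t\<bar> * l i)"])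
    show "summable (\<lambda>i. B * (\<bar>mc.u i t\<bar> * l i))" using C3(2)[OF that(1)] by (rule summable_mult)
    show "norm (mc.u i t * e1 i x) \<le> B * (\<bar>mc.u i t\<bar> * l i)" for i
      using mult_left_mono[OF e1_bound[OF that(2), of i], of "\<bar>mc.u i t\<bar>"] by (simp add: abs_mult mult_ac)
  qed
  \<comment> \<open>Converts the weight t^(\<alpha>-2) + \<open>wt\<close> into the two required
    ones: 2 + \<tau> serves the first piece, where t^(\<alpha>-1) \<le> \<tau> t^(\<alpha>-2), and
    the powers of \<tau> serve the later pieces.\<close>
  define M where "M = 2 + \<tau> + \<tau> powr (\<alpha> - 2) + \<tau> powr (\<alpha> - 1)"
  have M: "M \<ge> 2" "2 + \<tau> \<le> M" "1 + \<tau> powr (\<alpha> - 2) + \<tau> powr (\<alpha> - 1) \<le> M" using \<tau> by (auto simp: M_def)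
  define C where "C = 1 + C0 + C1 + C2 * M + B * C3"
  have C: "C > 0" "C0 \<le> C" "C1 \<le> C" "C2 * M \<le> C" "B * C3 \<le> C"
    using C0(1) C1(1) C2(1) C3(1) M B by (auto simp: C_def intro!: add_nonneg_nonneg add_pos_nonneg)
  show ?thesis
  proof (intro exI[of _ C] conjI ballI C(1))
    fix k assume k: "k \<in> {1..K}"
    then obtain j where j: "k = Suc j" by (cases k) auto
    have jK: "j < K" using k j by simp
    let ?S = "{real (k - 1) * \<tau><..real k * \<tau>}"
    have Sj: "?S = {real j * \<tau><..real (Suc j) * \<tau>}" by (simp add: j)
    have "0 \<le> real j * \<tau>" using \<tau> by simp
    moreover have "real (Suc j) * \<tau> \<le> T" unfolding T_def using jK \<tau> by (intro mult_right_mono) auto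
    ultimately have ST: "?S \<subseteq> {0<..T}" unfolding Sj by auto
    have T0: "{0<..T} \<subseteq> {0..T}" by auto
    have Wb1: "\<exists>B. \<forall>t\<in>{r..real (Suc j) * \<tau>}. 1 + t powr (\<alpha> - 1) \<le> B" if r: "real j * \<tau> < r" for r
    proof -
      obtain B where "\<forall>s\<in>{r..real (Suc j) * \<tau>}. wt \<alpha> \<tau> s \<le> B \<and> s powr (\<alpha> - 1) \<le> B \<and> s powr (\<alpha> - 2) \<le> B"
        using wt_bounded_on_piece[OF \<alpha> \<tau> r] by blast
      then show ?thesis by (intro exI[of _ "1 + B"]) auto
    qed
    have Wb2: "\<exists>B. \<forall>t\<in>{r..real (Suc j) * \<tau>}. t powr (\<alpha> - 2) + wt \<alpha> \<tau> t \<le> B" if r: "real j * \<tau> < r" for r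
    proof -
      obtain B where "\<forall>s\<in>{r..real (Suc j) * \<tau>}. wt \<alpha> \<tau> s \<le> B \<and> s powr (\<alpha> - 1) \<le> B \<and> s powr (\<alpha> - 2) \<le> B"
        using wt_bounded_on_piece[OF \<alpha> \<tau> r] by blast
      then show ?thesis by (intro exI[of _ "B + B"]) (auto intro: add_mono)
    qed
    show "\<exists>u\<^sub>t u\<^sub>t\<^sub>t u\<^sub>x u\<^sub>x\<^sub>x. \<forall>x\<in>{0..L}. \<forall>t\<in>?S.
          (u x has_real_derivative u\<^sub>t x t) (at t within ?S) \<and>
          (u\<^sub>t x has_real_derivative u\<^sub>t\<^sub>t x t) (at t within ?S) \<and>
          ((\<lambda>y. u y t) has_real_derivative u\<^sub>x x t) (at x within {0..L}) \<and>
          ((\<lambda>y. u\<^sub>x y t) has_real_derivative u\<^sub>x\<^sub>x x t) (at x within {0..L}) \<and>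
          \<bar>u x t\<bar> \<le> C * (1 + t powr \<alpha>) \<and>
          \<bar>u\<^sub>t x t\<bar> \<le> C * (1 + t powr (\<alpha> - 1)) \<and>
          (k = 1 \<longrightarrow> \<bar>u\<^sub>t\<^sub>t x t\<bar> \<le> C * (1 + t powr (\<alpha> - 2))) \<and>
          (k \<ge> 2 \<longrightarrow> \<bar>u\<^sub>t\<^sub>t x t\<bar> \<le> C * (1 + (t - \<tau>) powr (\<alpha> - 1))) \<and>
          \<bar>u x t\<bar> \<le> C \<and> \<bar>u\<^sub>x x t\<bar> \<le> C \<and> \<bar>u\<^sub>x\<^sub>x x t\<bar> \<le> C"
    proof (rule exI[of _ Ut], rule exI[of _ Utt], rule exI[of _ Ux], rule exI[of _ Uxx], intro ballI)
      fix x t assume x: "x \<in> {0..L}" and t: "t \<in> ?S"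
      have tT: "t \<in> {0<..T}" "t \<in> {0..T}" using t ST T0 by blast+
      have usum: "u y s = (\<Sum>i. mc.u i s * e i y)" if "s \<in> ?S" for y s
        using us[of s y] that ST by (auto simp: T_def)
      have "((\<lambda>t. \<Sum>i. mc.u i t * e i x) has_real_derivative Ut x t) (at t within {real j * \<tau><..real (Suc j) * \<tau>})"
        unfolding Ut_def
      proof (rule piece_deriv_series[where W = "\<lambda>t. 1 + t powr (\<alpha> - 1)" and ?W0.0 = "\<lambda>_. 1" and B = B])
        show "ltail mc.u1 {real j * \<tau><..real (Suc j) * \<tau>} (\<lambda>t. 1 + t powr (\<alpha> - 1))"
          using sub[OF tu1] ST unfolding Sj .
        show "ltail mc.u {real j * \<tau><..real (Suc j) * \<tau>} (\<lambda>_. 1)"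
          using sub[OF tu subset_trans[OF ST T0]] unfolding Sj .
        fix i s assume s: "s \<in> {real j * \<tau><..real (Suc j) * \<tau>}"
        then have "s \<in> {0<..T}" using ST unfolding Sj by blast
        then show "(mc.u i has_real_derivative mc.u1 i s) (at s within {real j * \<tau><..real (Suc j) * \<tau>})"
          using has_field_derivative_subset[OF mc.u_deriv[of s i]] subset_trans[OF ST T0] unfolding Sj T_def by blast
      qed (use t Sj Wb1 e_bound x in auto)
      then have 1: "(u x has_real_derivative Ut x t) (at t within ?S)"
        unfolding Sj[symmetric] using zero_less_one t by (rule has_field_derivative_transform_within) (use usum in auto)
      have 2: "(Ut x has_real_derivative Utt x t) (at t within ?S)"
        unfolding Ut_def[abs_def] Utt_def Sj
      proof (rule piece_deriv_series[where W = "\<lambda>t. t powr (\<alpha> - 2) + wt \<alpha> \<tau> t" and ?W0.0 = "\<lambda>t. 1 + t powr (\<alpha> - 1)" and B = B])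
        show "ltail mc.u2 {real j * \<tau><..real (Suc j) * \<tau>} (\<lambda>t. t powr (\<alpha> - 2) + wt \<alpha> \<tau> t)"
          using sub[OF tu2] ST unfolding Sj .
        show "ltail mc.u1 {real j * \<tau><..real (Suc j) * \<tau>} (\<lambda>t. 1 + t powr (\<alpha> - 1))"
          using sub[OF tu1] ST unfolding Sj .
        show "(mc.u1 i has_real_derivative mc.u2 i s) (at s within {real j * \<tau><..real (Suc j) * \<tau>})"
          if "s \<in> {real j * \<tau><..real (Suc j) * \<tau>}" for i s
          by (rule mc.u1_deriv[OF jK that])
      qed (use t Sj Wb2 e_bound x w0 in auto)
      have 3: "((\<lambda>y. u y t) has_real_derivative Ux x t) (at x within {0..L})"
        unfolding usum[OF t] Ux_def
        by (rule series_x_deriv(1)[OF C3(2)[OF tT(2)] e_deriv series_summable[OF su[OF tT(2)]] e1_bound x])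
      have 4: "((\<lambda>y. Ux y t) has_real_derivative Uxx x t) (at x within {0..L})"
        unfolding Ux_def Uxx_def
        by (rule series_x_deriv(1)[OF C3(2)[OF tT(2)] e1_deriv se1[OF tT(2)] e2_bound x])
      have "\<bar>Ux x t\<bar> \<le> B * (\<Sum>i. \<bar>mc.u i t\<bar> * l i)" unfolding Ux_def
        by (rule series_x_deriv(2)[OF C3(2)[OF tT(2)] e_deriv series_summable[OF su[OF tT(2)]] e1_bound x])
      moreover have "\<bar>Uxx x t\<bar> \<le> B * (\<Sum>i. \<bar>mc.u i t\<bar> * l i)" unfolding Uxx_def
        by (rule series_x_deriv(2)[OF C3(2)[OF tT(2)] e1_deriv se1[OF tT(2)] e2_bound x])
      moreover have "B * (\<Sum>i. \<bar>mc.u i t\<bar> * l i) \<le> B * C3" using C3(3)[OF tT(2)] B by (intro mult_left_mono) auto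
      ultimately have 5: "\<bar>Ux x t\<bar> \<le> C" "\<bar>Uxx x t\<bar> \<le> C" using C(5) by linarith+
      have 6: "\<bar>u x t\<bar> \<le> C" using C0(2)[OF x tT(2)] C(2) unfolding usum[OF t] by simp
      have "C * 1 \<le> C * (1 + t powr \<alpha>)" using C(1) by (intro mult_left_mono) auto
      then have 7: "\<bar>u x t\<bar> \<le> C * (1 + t powr \<alpha>)" using 6 by linarith
      have 8: "\<bar>Ut x t\<bar> \<le> C * (1 + t powr (\<alpha> - 1))"
        by (rule order.trans[OF C1(2)[OF x tT(1)] mult_right_mono[OF C(3) w0(1)]])
      have bd: "\<bar>Utt x t\<bar> \<le> C * R" if R: "t powr (\<alpha> - 2) + wt \<alpha> \<tau> t \<le> M * R" "R \<ge> 0" for R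
      proof -
        have "\<bar>Utt x t\<bar> \<le> C2 * (M * R)" using C2(2)[OF x tT(1)] mult_left_mono[OF R(1) C2(1)] by linarith
        also have "\<dots> = (C2 * M) * R" by simp
        also have "\<dots> \<le> C * R" using C(4) R(2) by (rule mult_right_mono)
        finally show ?thesis .
      qed
      have 9: "\<bar>Utt x t\<bar> \<le> C * (1 + t powr (\<alpha> - 2))" if "k = 1"
      proof (rule bd)
        have t': "0 < t" "t \<le> \<tau>" using t that by auto
        have "t powr (\<alpha> - 1) = t * t powr (\<alpha> - 2)" using t' by (simp add: powr_mult_base)
        also have "\<dots> \<le> \<tau> * t powr (\<alpha> - 2)" using t' by (intro mult_right_mono) auto
        finally have "t powr (\<alpha> - 1) \<le> \<tau> * t powr (\<alpha> - 2)" .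
        moreover have "wt \<alpha> \<tau> t = 1 + t powr (\<alpha> - 1)" using t' by (simp add: wt_def max_def)
        moreover have "(2 + \<tau>) * (1 + t powr (\<alpha> - 2)) = 2 + \<tau> + 2 * t powr (\<alpha> - 2) + \<tau> * t powr (\<alpha> - 2)"
          by (simp add: algebra_simps)
        ultimately have "t powr (\<alpha> - 2) + wt \<alpha> \<tau> t \<le> (2 + \<tau>) * (1 + t powr (\<alpha> - 2))"
          using \<tau> powr_ge_zero[of t "\<alpha> - 2"] by linarith
        also have "\<dots> \<le> M * (1 + t powr (\<alpha> - 2))" using M by (intro mult_right_mono add_nonneg_nonneg) auto
        finally show "t powr (\<alpha> - 2) + wt \<alpha> \<tau> t \<le> M * (1 + t powr (\<alpha> - 2))" .
      qed (simp add: add_nonneg_nonneg)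
      have 10: "\<bar>Utt x t\<bar> \<le> C * (1 + (t - \<tau>) powr (\<alpha> - 1))" if "k \<ge> 2"
      proof (rule bd)
        have "1 * \<tau> \<le> real (k - 1) * \<tau>" using that \<tau> by (intro mult_right_mono) auto
        then have t': "\<tau> < t" using t by simp
        \<comment> \<open>Beyond \<tau> the singularities at 0 are bounded by their values at
          \<tau>; only the one at \<tau> remains.\<close>
        have "t powr (\<alpha> - 2) \<le> \<tau> powr (\<alpha> - 2)" "t powr (\<alpha> - 1) \<le> \<tau> powr (\<alpha> - 1)"
          using t' \<tau> \<alpha> by (auto intro!: powr_mono2')
        then have "t powr (\<alpha> - 2) + wt \<alpha> \<tau> t \<le> (1 + \<tau> powr (\<alpha> - 2) + \<tau> powr (\<alpha> - 1)) * 1 + 1 * (t - \<tau>) powr (\<alpha> - 1)"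
          using t' by (simp add: wt_def)
        also have "\<dots> \<le> M * 1 + M * (t - \<tau>) powr (\<alpha> - 1)" using M by (intro add_mono mult_right_mono) auto
        finally show "t powr (\<alpha> - 2) + wt \<alpha> \<tau> t \<le> M * (1 + (t - \<tau>) powr (\<alpha> - 1))" by (simp add: distrib_left)
      qed (simp add: add_nonneg_nonneg)
      show "(u x has_real_derivative Ut x t) (at t within ?S) \<and>
          (Ut x has_real_derivative Utt x t) (at t within ?S) \<and>
          ((\<lambda>y. u y t) has_real_derivative Ux x t) (at x within {0..L}) \<and>
          ((\<lambda>y. Ux y t) has_real_derivative Uxx x t) (at x within {0..L}) \<and>
          \<bar>u x t\<bar> \<le> C * (1 + t powr \<alpha>) \<and>
          \<bar>Ut x t\<bar> \<le> C * (1 + t powr (\<alpha> - 1)) \<and>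
          (k = 1 \<longrightarrow> \<bar>Utt x t\<bar> \<le> C * (1 + t powr (\<alpha> - 2))) \<and>
          (k \<ge> 2 \<longrightarrow> \<bar>Utt x t\<bar> \<le> C * (1 + (t - \<tau>) powr (\<alpha> - 1))) \<and>
          \<bar>u x t\<bar> \<le> C \<and> \<bar>Ux x t\<bar> \<le> C \<and> \<bar>Uxx x t\<bar> \<le> C"
        by (intro conjI impI 1 2 3 4 5 6 7 8 9 10)
    qed
  qed
qed

end

section \<open>The decomposition\<close>

text \<open>The decay of the multipliers gives summability for each h, with constants that blow up
  as h tends to 0. The bound itself comes from \<open>abel_bound\<close>: the weighted sum of second
  differences is at most 12 C for every h.\<close>

lemma mlr_multiplier_bound:
  fixes \<alpha> c d :: real and g :: "real \<Rightarrow> real"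
  assumes \<alpha>: "0 < \<alpha>" "\<alpha> < 1" and L: "L > 0" and c: "c > 0" and d: "d \<ge> 0"
    and g: "\<And>y. y \<in> {0..L} \<Longrightarrow> \<bar>g y\<bar> \<le> Bg"
    and gi: "\<And>k::nat. k \<ge> 1 \<Longrightarrow> (\<lambda>y. g y * sin (real k * pi / L * y)) integrable_on {0..L}"
  shows "\<exists>C. \<forall>h>0. \<forall>x.
     summable (\<lambda>n. \<bar>mlr \<alpha> m k ((c * (real (Suc n))\<^sup>2 + d) * h) *
       (2 / L * integral {0..L} (\<lambda>y. g y * sin (real (Suc n) * pi / L * y)) * sin (real (Suc n) * pi / L * x))\<bar>) \<and>
     \<bar>\<Sum>n. mlr \<alpha> m k ((c * (real (Suc n))\<^sup>2 + d) * h) *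
       (2 / L * integral {0..L} (\<lambda>y. g y * sin (real (Suc n) * pi / L * y)) * sin (real (Suc n) * pi / L * x))\<bar> \<le> C"
proof -
  obtain D D2 C where C: "C > 0" and D: "\<And>y. (mlr \<alpha> m k has_real_derivative D y) (at y)"
    and D2: "\<And>y. (D has_real_derivative D2 y) (at y)"
    and b: "\<And>y. y \<ge> 0 \<Longrightarrow> \<bar>mlr \<alpha> m k y\<bar> \<le> C / (1 + y) \<and> \<bar>D y\<bar> \<le> C / (1 + y)\<^sup>2 \<and> y * \<bar>D2 y\<bar> \<le> C / (1 + y)\<^sup>2"
    using mlr_deriv_bounds[OF \<alpha>, of m k] by metis
  have Bg: "Bg \<ge> 0" using g[of 0] L by simp
  have main: "summable (\<lambda>n. \<bar>mlr \<alpha> m k ((c * (real (Suc n))\<^sup>2 + d) * h) *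
       (2 / L * integral {0..L} (\<lambda>y. g y * sin (real (Suc n) * pi / L * y)) * sin (real (Suc n) * pi / L * x))\<bar>) \<and>
     \<bar>\<Sum>n. mlr \<alpha> m k ((c * (real (Suc n))\<^sup>2 + d) * h) *
       (2 / L * integral {0..L} (\<lambda>y. g y * sin (real (Suc n) * pi / L * y)) * sin (real (Suc n) * pi / L * x))\<bar> \<le> Bg * (12 * C)"
    if h: "h > 0" for h x
  proof -
    define a where "a n = 2 / L * integral {0..L} (\<lambda>y. g y * sin (real (Suc n) * pi / L * y)) * sin (real (Suc n) * pi / L * x)" for n
    define Y where "Y \<xi> = (c * \<xi>\<^sup>2 + d) * h" for \<xi>
    define M where "M \<xi> = mlr \<alpha> m k (Y \<xi>)" for \<xi>
    define M1 where "M1 \<xi> = D (Y \<xi>) * (2 * c * h * \<xi>)" for \<xi>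
    define M2 where "M2 \<xi> = D2 (Y \<xi>) * (2 * c * h * \<xi>) * (2 * c * h * \<xi>) + D (Y \<xi>) * (2 * c * h)" for \<xi>
    have Y': "(Y has_real_derivative 2 * c * h * \<xi>) (at \<xi>)" for \<xi>
      unfolding Y_def[abs_def] by (auto intro!: derivative_eq_intros simp: algebra_simps)
    have M': "(M has_real_derivative M1 \<xi>) (at \<xi>)" for \<xi>
      unfolding M_def[abs_def] M1_def by (rule DERIV_chain2[OF D Y'])
    have DY: "((\<lambda>\<xi>. D (Y \<xi>)) has_real_derivative D2 (Y \<xi>) * (2 * c * h * \<xi>)) (at \<xi>)" for \<xi>
      by (rule DERIV_chain2[OF D2 Y'])
    have M1': "(M1 has_real_derivative M2 \<xi>) (at \<xi>)" for \<xi>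
      unfolding M1_def[abs_def] M2_def by (rule derivative_eq_intros DY refl | simp)+
    have Yge: "c * \<xi>\<^sup>2 * h \<le> Y \<xi>" for \<xi> using d h by (simp add: Y_def distrib_right)
    have Y0: "Y \<xi> \<ge> 0" for \<xi> using Yge[of \<xi>] c h by (smt (verit) mult_nonneg_nonneg zero_le_power2)
    have mk: "\<bar>M (real (Suc n))\<bar> \<le> (C / (c * h)) / (real (Suc n))\<^sup>2" for n
    proof -
      have "\<bar>M (real (Suc n))\<bar> \<le> C / (1 + Y (real (Suc n)))" using b[OF Y0] by (simp add: M_def)
      also have "\<dots> \<le> C / (c * (real (Suc n))\<^sup>2 * h)"
        using Yge[of "real (Suc n)"] C c h Y0[of "real (Suc n)"] by (intro divide_left_mono mult_pos_pos) (auto simp del: of_nat_Suc)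
      also have "\<dots> = (C / (c * h)) / (real (Suc n))\<^sup>2" by (simp add: mult_ac)
      finally show ?thesis .
    qed
    \<comment> \<open>By the chain rule \<open>M2\<close> has a term with \<open>D2\<close>, in
      which one factor c \<xi>^2 h is absorbed into \<open>Y \<xi>\<close>, and a term with
      \<open>D\<close>; they contribute 4 and 2.\<close>
    have second: "\<bar>M (real (Suc n)) - 2 * M (real (Suc (Suc n))) + M (real (Suc (Suc (Suc n))))\<bar> \<le>
        6 * C * (c * h / (1 + c * (real (Suc n))\<^sup>2 * h)\<^sup>2)" for n
    proof -
      have "\<bar>M2 \<xi>\<bar> \<le> 6 * C * (c * h / (1 + c * (real (Suc n))\<^sup>2 * h)\<^sup>2)" if \<xi>: "\<xi> \<in> {real (Suc n)..real (Suc n) + 2}" for \<xi>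
      proof -
        have "\<bar>M2 \<xi>\<bar> \<le> \<bar>D2 (Y \<xi>) * (2 * c * h * \<xi>) * (2 * c * h * \<xi>)\<bar> + \<bar>D (Y \<xi>) * (2 * c * h)\<bar>"
          unfolding M2_def by (rule abs_triangle_ineq)
        also have "\<bar>D2 (Y \<xi>) * (2 * c * h * \<xi>) * (2 * c * h * \<xi>)\<bar> = 4 * (c * h) * ((c * \<xi>\<^sup>2 * h) * \<bar>D2 (Y \<xi>)\<bar>)"
          using c h by (simp add: abs_mult power2_eq_square)
        also have "\<dots> \<le> 4 * (c * h) * (Y \<xi> * \<bar>D2 (Y \<xi>)\<bar>)"
          using Yge[of \<xi>] c h by (intro mult_left_mono mult_right_mono) auto
        also have "\<dots> \<le> 4 * (c * h) * (C / (1 + Y \<xi>)\<^sup>2)" using b[OF Y0[of \<xi>]] c h by (intro mult_left_mono) auto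
        also have "\<bar>D (Y \<xi>) * (2 * c * h)\<bar> = 2 * (c * h) * \<bar>D (Y \<xi>)\<bar>" using c h by (simp add: abs_mult)
        also have "\<dots> \<le> 2 * (c * h) * (C / (1 + Y \<xi>)\<^sup>2)" using b[OF Y0[of \<xi>]] c h by (intro mult_left_mono) auto
        also have "4 * (c * h) * (C / (1 + Y \<xi>)\<^sup>2) + 2 * (c * h) * (C / (1 + Y \<xi>)\<^sup>2) = 6 * (c * h) * (C / (1 + Y \<xi>)\<^sup>2)"
          by simp
        also have "\<dots> \<le> 6 * (c * h) * (C / (1 + c * (real (Suc n))\<^sup>2 * h)\<^sup>2)"
        proof (intro mult_left_mono divide_left_mono power_mono)
          have "(real (Suc n))\<^sup>2 \<le> \<xi>\<^sup>2" using \<xi> by (intro power_mono) auto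
          then have "c * (real (Suc n))\<^sup>2 * h \<le> c * \<xi>\<^sup>2 * h" using c h by (intro mult_right_mono mult_left_mono) auto
          then show "1 + c * (real (Suc n))\<^sup>2 * h \<le> 1 + Y \<xi>" using Yge[of \<xi>] by simp
          show "0 < (1 + Y \<xi>)\<^sup>2 * (1 + c * (real (Suc n))\<^sup>2 * h)\<^sup>2"
            using Y0[of \<xi>] c h by (intro mult_pos_pos zero_less_power add_pos_nonneg) auto
        qed (use c h C in \<open>auto intro!: add_nonneg_nonneg mult_nonneg_nonneg\<close>)
        finally show ?thesis by (simp add: mult_ac)
      qed
      then have "\<bar>M (real (Suc n)) - 2 * M (real (Suc n) + 1) + M (real (Suc n) + 2)\<bar> \<le> 6 * C * (c * h / (1 + c * (real (Suc n))\<^sup>2 * h)\<^sup>2)"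
        by (intro second_difference_bound[of _ M M1 M2] M' M1')
      moreover have "real (Suc n) + 1 = real (Suc (Suc n))" "real (Suc n) + 2 = real (Suc (Suc (Suc n)))" by simp_all
      ultimately show ?thesis by simp
    qed
    \<comment> \<open>The weight n + 2 is at most 2 (n + 1), which doubles the constant 6; the
      remaining sum telescopes.\<close>
    have V: "(\<Sum>n<N. real (Suc (Suc n)) * \<bar>M (real (Suc n)) - 2 * M (real (Suc (Suc n))) + M (real (Suc (Suc (Suc n))))\<bar>) \<le> 12 * C" for N
    proof -
      have "(\<Sum>n<N. real (Suc (Suc n)) * \<bar>M (real (Suc n)) - 2 * M (real (Suc (Suc n))) + M (real (Suc (Suc (Suc n))))\<bar>)
        \<le> (\<Sum>n<N. 12 * C * (real (Suc n) * (c * h) / (1 + c * (real (Suc n))\<^sup>2 * h)\<^sup>2))"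
      proof (rule sum_mono)
        fix n
        have "real (Suc (Suc n)) * \<bar>M (real (Suc n)) - 2 * M (real (Suc (Suc n))) + M (real (Suc (Suc (Suc n))))\<bar> \<le>
          (2 * real (Suc n)) * (6 * C * (c * h / (1 + c * (real (Suc n))\<^sup>2 * h)\<^sup>2))"
          by (intro mult_mono second) auto
        then show "real (Suc (Suc n)) * \<bar>M (real (Suc n)) - 2 * M (real (Suc (Suc n))) + M (real (Suc (Suc (Suc n))))\<bar> \<le>
          12 * C * (real (Suc n) * (c * h) / (1 + c * (real (Suc n))\<^sup>2 * h)\<^sup>2)" by (simp add: mult_ac)
      qed
      also have "\<dots> = 12 * C * (\<Sum>n<N. real (Suc n) * (c * h) / (1 + c * (real (Suc n))\<^sup>2 * h)\<^sup>2)"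
        by (simp only: sum_distrib_left)
      also have "\<dots> \<le> 12 * C * 1" using resolvent_sum_bound[OF c h, of N] C by (intro mult_left_mono) auto
      finally show ?thesis by simp
    qed
    have ab: "\<bar>a n\<bar> \<le> 2 * Bg" for n
    proof -
      have "norm (integral {0..L} (\<lambda>y. g y * sin (real (Suc n) * pi / L * y))) \<le> integral {0..L} (\<lambda>y. Bg)"
      proof (rule Henstock_Kurzweil_Integration.integral_norm_bound_integral)
        fix y assume y: "y \<in> {0..L}"
        have "\<bar>g y\<bar> * \<bar>sin (real (Suc n) * pi / L * y)\<bar> \<le> Bg * 1" using g[OF y] Bg by (intro mult_mono) auto
        then show "norm (g y * sin (real (Suc n) * pi / L * y)) \<le> Bg" by (simp add: abs_mult)
      next
        show "(\<lambda>y. g y * sin (real (Suc n) * pi / L * y)) integrable_on {0..L}" by (rule gi) simp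
      qed (rule integrable_const_ivl)
      then have i: "\<bar>integral {0..L} (\<lambda>y. g y * sin (real (Suc n) * pi / L * y))\<bar> \<le> L * Bg" using L by simp
      have "\<bar>a n\<bar> = 2 / L * \<bar>integral {0..L} (\<lambda>y. g y * sin (real (Suc n) * pi / L * y))\<bar> * \<bar>sin (real (Suc n) * pi / L * x)\<bar>"
        using L by (simp add: a_def abs_mult)
      also have "\<dots> \<le> 2 / L * (L * Bg) * 1" using i L Bg by (intro mult_mono) auto
      finally show ?thesis using L by simp
    qed
    have s: "summable (\<lambda>n. \<bar>M (real (Suc n)) * a n\<bar>)"
    proof (rule summable_comparison_test')
      have "summable (\<lambda>n. 1 / (real (Suc n))\<^sup>2)"
        using inverse_power_summable[of 2, where 'a = real] by (subst summable_Suc_iff) (simp add: inverse_eq_divide)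
      then show "summable (\<lambda>n. (C / (c * h)) * (2 * Bg) * (1 / (real (Suc n))\<^sup>2))" by (rule summable_mult)
      fix n
      have "\<bar>M (real (Suc n))\<bar> * \<bar>a n\<bar> \<le> ((C / (c * h)) / (real (Suc n))\<^sup>2) * (2 * Bg)"
        using C c h by (intro mult_mono mk ab) (auto intro!: divide_nonneg_nonneg)
      then show "norm \<bar>M (real (Suc n)) * a n\<bar> \<le> (C / (c * h)) * (2 * Bg) * (1 / (real (Suc n))\<^sup>2)"
        by (simp add: abs_mult mult_ac del: of_nat_Suc)
    qed
    have "\<bar>\<Sum>n. M (real (Suc n)) * a n\<bar> \<le> Bg * (12 * C)"
    proof (rule abel_bound[where A = "C / (c * h)"])
      show "\<bar>\<Sum>j<n. \<Sum>k<j. a k\<bar> \<le> real n * Bg" for n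
        unfolding a_def by (rule fejer_sine_bound[OF L g gi])
    qed (use mk V summable_rabs_cancel[OF s] in auto)
    then show ?thesis using s unfolding M_def Y_def a_def by blast
  qed
  then show ?thesis by blast
qed

text \<open>Fejer means need the natural order of the frequencies, while the eigensystem is listed
  in any order; absolute summability permits the rearrangement. The signs cancel, as each
  eigenfunction occurs twice.\<close>

lemma eigensystem_multiplier_bound:
  assumes \<alpha>: "0 < \<alpha>" "\<alpha> < 1" and L: "L > 0" and p: "p > 0" and a: "a \<le> 0"
    and es: "dirichlet_eigensystem p a L lam X"
    and g: "\<And>y. y \<in> {0..L} \<Longrightarrow> \<bar>g y\<bar> \<le> Bg"
    and gi: "\<And>i. (\<lambda>y. X (Suc i) y * g y) integrable_on {0..L}"
  shows "\<exists>C. \<forall>h>0. \<forall>x\<in>{0..L}.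
     summable (\<lambda>i. \<bar>mlr \<alpha> m k (lam (Suc i) * h) * integral {0..L} (\<lambda>y. X (Suc i) y * g y) * X (Suc i) x\<bar>) \<and>
     \<bar>\<Sum>i. mlr \<alpha> m k (lam (Suc i) * h) * integral {0..L} (\<lambda>y. X (Suc i) y * g y) * X (Suc i) x\<bar> \<le> C"
proof -
  obtain \<sigma> s where \<sigma>: "bij_betw \<sigma> {1..} {1::nat..}"
    and lam: "\<And>i. i \<ge> 1 \<Longrightarrow> lam i = p * (real (\<sigma> i) * pi / L)\<^sup>2 - a"
    and s: "\<And>i. i \<ge> 1 \<Longrightarrow> s i = 1 \<or> s i = (-1 :: real)"
    and X: "\<And>i x. i \<ge> 1 \<Longrightarrow> x \<in> {0..L} \<Longrightarrow> X i x = s i * sqrt (2 / L) * sin (real (\<sigma> i) * pi / L * x)"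
    using eigensystem_form[OF L p es] by metis
  define \<rho> where "\<rho> i = \<sigma> (Suc i) - 1" for i
  have \<sigma>1: "\<sigma> (Suc i) \<ge> 1" for i using \<sigma> by (auto simp: bij_betw_def)
  have \<rho>: "\<sigma> (Suc i) = Suc (\<rho> i)" for i using \<sigma>1[of i] by (simp add: \<rho>_def)
  have bij: "bij_betw \<rho> UNIV UNIV"
    unfolding bij_betw_def
  proof
    show "inj \<rho>"
    proof (rule injI)
      fix i j assume "\<rho> i = \<rho> j"
      then have "\<sigma> (Suc i) = \<sigma> (Suc j)" using \<rho> by simp
      then show "i = j" using \<sigma> by (auto simp: bij_betw_def dest: inj_onD)
    qed
    have "n \<in> range \<rho>" for n
    proof -
      have "Suc n \<in> \<sigma> ` {1..}" using \<sigma> by (auto simp: bij_betw_def)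
      then obtain i0 where i0: "i0 \<ge> 1" "Suc n = \<sigma> i0" by auto
      then obtain i where "i0 = Suc i" by (cases i0) auto
      then have "\<rho> i = n" using \<rho>[of i] i0 by simp
      then show ?thesis by auto
    qed
    then show "range \<rho> = UNIV" by blast
  qed
  define q where "q i = s (Suc i) * sqrt (2 / L)" for i
  have q2: "q i * q i = 2 / L" for i using s[of "Suc i"] L by (auto simp: q_def)
  have q0: "q i \<noteq> 0" for i using q2[of i] L by auto
  have Xq: "X (Suc i) x = q i * sin (real (Suc (\<rho> i)) * pi / L * x)" if "x \<in> {0..L}" for i x
    using X[of "Suc i" x] that by (simp only: q_def \<rho>)
  have gs: "(\<lambda>y. g y * sin (real (Suc (\<rho> i)) * pi / L * y)) integrable_on {0..L}" for i
  proof -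
    have "(\<lambda>y. 1 / q i * (X (Suc i) y * g y)) integrable_on {0..L}" using gi by (rule integrable_on_mult_right)
    then show ?thesis by (rule integrable_eq) (use Xq q0[of i] in \<open>simp del: of_nat_Suc\<close>)
  qed
  have gi': "(\<lambda>y. g y * sin (real k * pi / L * y)) integrable_on {0..L}" if k: "k \<ge> 1" for k
  proof -
    obtain n where n: "k = Suc n" using k by (cases k) auto
    obtain i where "n = \<rho> i" using bij by (auto simp: bij_betw_def)
    then show ?thesis using gs[of i] n by simp
  qed
  define c where "c = p * (pi / L)\<^sup>2"
  have c: "c > 0" using p L by (simp add: c_def)
  have lc: "lam (Suc i) = c * (real (Suc (\<rho> i)))\<^sup>2 + - a" for i
    using lam[of "Suc i"] by (simp only: \<rho>) (simp add: c_def power_mult_distrib power_divide)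
  obtain C where C: "\<forall>h>0. \<forall>x.
     summable (\<lambda>n. \<bar>mlr \<alpha> m k ((c * (real (Suc n))\<^sup>2 + - a) * h) *
       (2 / L * integral {0..L} (\<lambda>y. g y * sin (real (Suc n) * pi / L * y)) * sin (real (Suc n) * pi / L * x))\<bar>) \<and>
     \<bar>\<Sum>n. mlr \<alpha> m k ((c * (real (Suc n))\<^sup>2 + - a) * h) *
       (2 / L * integral {0..L} (\<lambda>y. g y * sin (real (Suc n) * pi / L * y)) * sin (real (Suc n) * pi / L * x))\<bar> \<le> C"
    using mlr_multiplier_bound[OF \<alpha> L c _ g gi', of "- a" m k] a by auto
  show ?thesis
  proof (intro exI[of _ C] allI impI ballI)
    fix h x :: real assume h: "h > 0" and x: "x \<in> {0..L}"
    define F where "F n = mlr \<alpha> m k ((c * (real (Suc n))\<^sup>2 + - a) * h) *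
       (2 / L * integral {0..L} (\<lambda>y. g y * sin (real (Suc n) * pi / L * y)) * sin (real (Suc n) * pi / L * x))" for n
    have F: "summable (\<lambda>n. \<bar>F n\<bar>)" "\<bar>\<Sum>n. F n\<bar> \<le> C" using C h unfolding F_def by blast+
    have eq: "mlr \<alpha> m k (lam (Suc i) * h) * integral {0..L} (\<lambda>y. X (Suc i) y * g y) * X (Suc i) x = F (\<rho> i)" for i
    proof -
      have "integral {0..L} (\<lambda>y. X (Suc i) y * g y) = integral {0..L} (\<lambda>y. q i * (g y * sin (real (Suc (\<rho> i)) * pi / L * y)))"
        using Xq by (intro integral_cong) (simp del: of_nat_Suc)
      then have "integral {0..L} (\<lambda>y. X (Suc i) y * g y) * X (Suc i) x =
        (q i * q i) * (integral {0..L} (\<lambda>y. g y * sin (real (Suc (\<rho> i)) * pi / L * y)) * sin (real (Suc (\<rho> i)) * pi / L * x))"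
        unfolding Xq[OF x] by (simp del: of_nat_Suc)
      then show ?thesis unfolding F_def lc q2 by (simp only: mult.assoc)
    qed
    have "(F has_sum (\<Sum>n. F n)) UNIV"
      using F(1) by (intro norm_summable_imp_has_sum) (auto intro: summable_sums summable_rabs_cancel)
    then have "((\<lambda>i. F (\<rho> i)) has_sum (\<Sum>n. F n)) UNIV" using has_sum_reindex_bij_betw[OF bij, of F] by simp
    then have "(\<lambda>i. F (\<rho> i)) sums (\<Sum>n. F n)" by (rule has_sum_imp_sums)
    then have "(\<Sum>i. F (\<rho> i)) = (\<Sum>n. F n)" by (rule sums_unique[symmetric])
    moreover have "summable ((\<lambda>n. \<bar>F n\<bar>) \<circ> \<rho>)"
      using F(1) bij by (intro summable_reindex) (auto simp: bij_betw_def)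
    ultimately show "summable (\<lambda>i. \<bar>mlr \<alpha> m k (lam (Suc i) * h) * integral {0..L} (\<lambda>y. X (Suc i) y * g y) * X (Suc i) x\<bar>) \<and>
       \<bar>\<Sum>i. mlr \<alpha> m k (lam (Suc i) * h) * integral {0..L} (\<lambda>y. X (Suc i) y * g y) * X (Suc i) x\<bar> \<le> C"
      using F(2) unfolding eq by (simp add: o_def)
  qed
qed

text \<open>Green's identity once per application of the operator. \<open>g\<close> itself is not
  assumed integrable; its product with the eigenfunction is shown to be.\<close>

lemma dirichlet_op_power_coefficient:
  assumes L: "L > 0" and y: "dirichlet_op p a L y (\<lambda>x. \<mu> * y x)" and v: "continuous_on {0..L} v"
    and G: "(dirichlet_op p a L ^^ n) v g"
  shows "((\<lambda>x. y x * g x) has_integral \<mu> ^ n * integral {0..L} (\<lambda>x. y x * v x)) {0..L}"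
  using G
proof (induction n arbitrary: g)
  case 0
  have "continuous_on {0..L} y"
    using y unfolding dirichlet_op_def continuous_on_eq_continuous_within by (meson DERIV_continuous)
  then have "(\<lambda>x. y x * v x) integrable_on {0..L}" by (intro integrable_continuous_real continuous_intros v)
  moreover have "g = v" using 0 by simp
  ultimately show ?case by (simp add: integrable_integral)
next
  case (Suc n)
  then obtain w where w: "(dirichlet_op p a L ^^ n) v w" "dirichlet_op p a L w g" by auto
  have "((\<lambda>x. \<mu> * (y x * w x)) has_integral \<mu> * (\<mu> ^ n * integral {0..L} (\<lambda>x. y x * v x))) {0..L}"
    by (intro has_integral_mult_right Suc.IH w)
  from has_integral_add[OF dirichlet_op_green[OF L w(2) y] this]
  show ?case by (simp add: mult_ac)
qed

context relaxation_source
begin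

text \<open>\<open>J_deriv\<close> gives only left derivatives at the break points, hence no
  continuity across them. The uniform limit of shifted convolutions does, and the continuity of
  \<partial>_t Y rests on it.\<close>

lemma J_cont: "continuous_on {0..T} J"
proof (rule uniform_limit_theorem)
  show "uniform_limit {0..T} (\<lambda>m t. integral {0..t} (\<lambda>s. E (t - s + \<delta> m) * F' s)) J sequentially"
    unfolding J_def using E_F'_abs_integrable
    by (intro shift_convolution_uniform F'_abs_integrable has_integral_integrable[OF shift_by_parts])
      (auto simp: absolutely_integrable_on_def)
  have "continuous_on {0..T} (\<lambda>t. integral {0..t} (\<lambda>s. E (t - s + \<delta> m) * F' s))" for m
  proof (rule continuous_on_eq)
    have "((\<lambda>t. integral {0..t} (\<lambda>s. E1 (t - s + \<delta> m) * F s)) has_real_derivative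
        E1 (0 + \<delta> m) * F t + integral {0..t} (\<lambda>s. E2 (t - s + \<delta> m) * F s)) (at t within {0..T})" if "t \<in> {0..T}" for t
      using convolution_deriv_smooth[OF \<delta>_pos, where K = "\<lambda>r. E1 (r + \<delta> m)" and ?K1.0 = "\<lambda>r. E2 (r + \<delta> m)", OF E1_shift_deriv E2_shift_cont F_cont that]
      by simp
    then have c: "continuous_on {0..T} (\<lambda>t. integral {0..t} (\<lambda>s. E1 (t - s + \<delta> m) * F s))"
      unfolding continuous_on_eq_continuous_within by (meson DERIV_continuous)
    show "continuous_on {0..T} (\<lambda>t. E (\<delta> m) * F t - E (t + \<delta> m) * F 0 + integral {0..t} (\<lambda>s. E1 (t - s + \<delta> m) * F s))"
      using \<delta>_pos[of m] by (intro continuous_intros c F_cont continuous_on_compose2[OF E_cont]) auto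
    show "E (\<delta> m) * F t - E (t + \<delta> m) * F 0 + integral {0..t} (\<lambda>s. E1 (t - s + \<delta> m) * F s) =
      integral {0..t} (\<lambda>s. E (t - s + \<delta> m) * F' s)" if "t \<in> {0..T}" for t
      using integral_unique[OF shift_by_parts[OF that, of m]] by simp
  qed
  then show "\<forall>\<^sub>F m in sequentially. continuous_on {0..T} (\<lambda>t. integral {0..t} (\<lambda>s. E (t - s + \<delta> m) * F' s))"
    by (intro always_eventually allI)
qed simp

end

context mild_coefficients
begin

lemma w1_cont: "continuous_on {0..T} (w1 i)"
proof -
  have "continuous_on {0..T} (J i)"
    using relaxation_source.J_cont[OF source, of i] unfolding J_def[abs_def] relaxation_source.J_def[OF source, abs_def] .
  then show ?thesis unfolding w1_def[abs_def]
    by (intro continuous_intros continuous_on_subset[OF continuous_on_relax[OF \<alpha>]]) auto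
qed

lemma w1_0: "w1 i 0 = F i 0"
  by (simp add: w1_def relax_0 J_def)

end

text \<open>For a fixed point x, with c i the i-th term of the initial expansion at x. Moments up to
  order m converge absolutely; at order m + 1 there is only the bound \<open>C\<close> on the
  multiplier series, for the Euler orders that two time derivatives require.\<close>

locale taylor_remainder =
  fixes \<alpha> C :: real and m :: nat and l c :: "nat \<Rightarrow> real"
  assumes \<alpha>: "0 < \<alpha>" "\<alpha> < 1" and m: "real (m + 1) * \<alpha> > 1" and l_pos: "\<And>i. l i > 0"
    and c: "\<And>j. j \<le> m \<Longrightarrow> summable (\<lambda>i. \<bar>c i\<bar> * l i ^ j)"
    and mlr_series: "\<And>k h. k \<le> 2 \<Longrightarrow> h > 0 \<Longrightarrow> \<bar>\<Sum>i. mlr \<alpha> m k (l i * h) * (l i ^ Suc m * c i)\<bar> \<le> C"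
begin

definition \<gamma> :: "nat \<Rightarrow> real" where
  "\<gamma> j = mlc \<alpha> j * (- 1) ^ j * (\<Sum>i. c i * l i ^ j)"

text \<open>Up to the factor \<alpha>^k this is (t d/dt)^k applied to the Taylor remainder
  \<open>Z 0\<close>.\<close>

definition Z :: "nat \<Rightarrow> real \<Rightarrow> real" where
  "Z k t = (\<Sum>i. c i * mlt \<alpha> k (l i * t powr \<alpha>)) - (\<Sum>j\<le>m. real j ^ k * \<gamma> j * (t powr \<alpha>) ^ j)"

lemma c_summable: "summable (\<lambda>i. \<bar>c i\<bar>)"
  using c[of 0] by simp

lemma c_power_summable: "j \<le> m \<Longrightarrow> summable (\<lambda>i. c i * l i ^ j)"
proof (rule summable_rabs_cancel)
  assume "j \<le> m"
  then show "summable (\<lambda>i. \<bar>c i * l i ^ j\<bar>)" using c[of j] l_pos by (simp add: abs_mult less_imp_le)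
qed

lemma mlt_series_summable:
  assumes "h \<ge> 0"
  shows "summable (\<lambda>i. c i * mlt \<alpha> k (l i * h))"
proof -
  obtain B where B: "\<And>y. y \<ge> 0 \<Longrightarrow> \<bar>mlt \<alpha> k y\<bar> \<le> B" using mlt_bounded[OF \<alpha>] by blast
  show ?thesis
  proof (rule summable_comparison_test')
    show "summable (\<lambda>i. \<bar>c i\<bar> * B)" by (rule summable_mult2[OF c_summable])
    show "norm (c i * mlt \<alpha> k (l i * h)) \<le> \<bar>c i\<bar> * B" for i
      using B[of "l i * h"] assms l_pos[of i] by (simp add: abs_mult mult_left_mono)
  qed
qed

text \<open>The moments up to order m may be summed separately, so the difference of the series is
  the series of the differences. Dividing the latter by h^(m+1) also provides the convergence of the
  multiplier series.\<close>

lemma Z_eq: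
  assumes t: "t > 0"
  shows "Z k t = (t powr \<alpha>) ^ Suc m * (\<Sum>i. mlr \<alpha> m k (l i * t powr \<alpha>) * (l i ^ Suc m * c i))"
proof -
  define h where "h = t powr \<alpha>"
  have h: "h > 0" using t by (simp add: h_def)
  have s: "summable (\<lambda>i. (real j ^ k * (mlc \<alpha> j * (- 1) ^ j) * h ^ j) * (c i * l i ^ j))" if "j \<le> m" for j
    by (rule summable_mult[OF c_power_summable[OF that]])
  define d where "d i = c i * mlt \<alpha> k (l i * h) - (\<Sum>j\<le>m. (real j ^ k * (mlc \<alpha> j * (- 1) ^ j) * h ^ j) * (c i * l i ^ j))" for i
  have d: "d i = h ^ Suc m * (mlr \<alpha> m k (l i * h) * (l i ^ Suc m * c i))" for i
  proof -
    have "(\<Sum>j\<le>m. (real j ^ k * (mlc \<alpha> j * (- 1) ^ j) * h ^ j) * (c i * l i ^ j)) =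
        c i * (\<Sum>j\<le>m. real j ^ k * mlc \<alpha> j * (- 1) ^ j * (l i * h) ^ j)"
      unfolding sum_distrib_left by (rule sum.cong) (auto simp: power_mult_distrib)
    then have "d i = c i * ((l i * h) ^ Suc m * mlr \<alpha> m k (l i * h))"
      unfolding d_def mlr_eq[OF \<alpha>] by (simp add: right_diff_distrib)
    also have "\<dots> = h ^ Suc m * (mlr \<alpha> m k (l i * h) * (l i ^ Suc m * c i))"
      unfolding power_mult_distrib by (simp only: mult_ac)
    finally show ?thesis .
  qed
  have ds: "summable d" unfolding d_def
    by (intro summable_diff mlt_series_summable summable_sum) (use s h in auto)
  have "(\<Sum>j\<le>m. real j ^ k * \<gamma> j * h ^ j) = (\<Sum>j\<le>m. \<Sum>i. (real j ^ k * (mlc \<alpha> j * (- 1) ^ j) * h ^ j) * (c i * l i ^ j))"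
  proof (rule sum.cong)
    fix j assume "j \<in> {..m}"
    then have "(\<Sum>i. (real j ^ k * (mlc \<alpha> j * (- 1) ^ j) * h ^ j) * (c i * l i ^ j)) =
      (real j ^ k * (mlc \<alpha> j * (- 1) ^ j) * h ^ j) * (\<Sum>i. c i * l i ^ j)"
      by (intro suminf_mult c_power_summable) simp
    then show "real j ^ k * \<gamma> j * h ^ j = (\<Sum>i. (real j ^ k * (mlc \<alpha> j * (- 1) ^ j) * h ^ j) * (c i * l i ^ j))"
      by (simp add: \<gamma>_def mult_ac)
  qed simp
  also have "\<dots> = (\<Sum>i. \<Sum>j\<le>m. (real j ^ k * (mlc \<alpha> j * (- 1) ^ j) * h ^ j) * (c i * l i ^ j))"
    by (rule suminf_sum[symmetric]) (use s in auto)
  finally have "Z k t = (\<Sum>i. c i * mlt \<alpha> k (l i * h)) - \<dots>" by (simp add: Z_def h_def)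
  also have "\<dots> = (\<Sum>i. d i)"
    unfolding d_def by (rule suminf_diff[OF mlt_series_summable summable_sum]) (use s h in auto)
  also have "\<dots> = h ^ Suc m * (\<Sum>i. mlr \<alpha> m k (l i * h) * (l i ^ Suc m * c i))"
  proof -
    have "summable (\<lambda>i. 1 / h ^ Suc m * d i)" using ds by (rule summable_mult)
    moreover have "1 / h ^ Suc m * d i = mlr \<alpha> m k (l i * h) * (l i ^ Suc m * c i)" for i
      using h by (simp only: d) (simp add: field_simps)
    ultimately have "summable (\<lambda>i. mlr \<alpha> m k (l i * h) * (l i ^ Suc m * c i))" by (simp only:)
    from suminf_mult[OF this, of "h ^ Suc m"] show ?thesis by (simp only: d)
  qed
  finally show ?thesis by (simp only: h_def)
qed

lemma Z_0: "Z k 0 = 0"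
proof (cases "k = 0")
  case True
  have "(\<Sum>j\<le>m. real j ^ k * \<gamma> j * (0 :: real) ^ j) = \<gamma> 0"
    using True by (simp add: sum.atMost_shift)
  then show ?thesis using True by (simp add: Z_def mlt_0 \<gamma>_def mlc_def)
next
  case False
  then have "(\<Sum>j\<le>m. real j ^ k * \<gamma> j * (0 :: real) ^ j) = 0" by (intro sum.neutral) (auto simp: power_0_left)
  then show ?thesis using False by (simp add: Z_def mlt_0)
qed

lemma Z_bound:
  assumes k: "k \<le> 2" and t: "t \<ge> 0"
  shows "\<bar>Z k t\<bar> \<le> C * t powr (real (m + 1) * \<alpha>)"
proof (cases "t = 0")
  case False
  then have t: "t > 0" using t by simp
  have "(t powr \<alpha>) ^ Suc m = t powr (real (m + 1) * \<alpha>)"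
    using t by (subst powr_realpow[symmetric]) (auto simp: powr_powr mult.commute)
  then have "\<bar>Z k t\<bar> = t powr (real (m + 1) * \<alpha>) * \<bar>\<Sum>i. mlr \<alpha> m k (l i * t powr \<alpha>) * (l i ^ Suc m * c i)\<bar>"
    unfolding Z_eq[OF t] by (simp only: abs_mult) simp
  also have "\<dots> \<le> t powr (real (m + 1) * \<alpha>) * C" using t by (intro mult_left_mono mlr_series k) auto
  finally show ?thesis by (simp add: mult.commute)
qed (simp add: Z_0)

lemma Z_deriv:
  assumes t: "t > 0"
  shows "(Z k has_real_derivative \<alpha> / t * Z (Suc k) t) (at t)"
proof -
  obtain B where B: "\<And>y. y \<ge> 0 \<Longrightarrow> \<bar>mlt \<alpha> (Suc k) y\<bar> \<le> B" using mlt_bounded[OF \<alpha>] by blast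
  have B0: "B \<ge> 0" using order_trans[OF abs_ge_zero B[OF order_refl]] .
  have "((\<lambda>s. \<Sum>i. c i * mlt \<alpha> k (l i * s powr \<alpha>)) has_real_derivative
      (\<Sum>i. c i * (\<alpha> * mlt \<alpha> (Suc k) (l i * t powr \<alpha>) / t))) (at t)"
  proof (rule has_field_derivative_series'(2)[where S = "{t / 2..t + 1}" and ?x0.0 = t
        and f = "\<lambda>i s. c i * mlt \<alpha> k (l i * s powr \<alpha>)" and f' = "\<lambda>i s. c i * (\<alpha> * mlt \<alpha> (Suc k) (l i * s powr \<alpha>) / s)"])
    show "((\<lambda>s. c i * mlt \<alpha> k (l i * s powr \<alpha>)) has_real_derivative c i * (\<alpha> * mlt \<alpha> (Suc k) (l i * s powr \<alpha>) / s)) (at s within {t / 2..t + 1})"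
      if "s \<in> {t / 2..t + 1}" for i s
    proof -
      have "s > 0" using that t by simp
      then show ?thesis
        by (intro has_field_derivative_at_within[OF DERIV_cmult] mlt_powr_deriv \<alpha> l_pos)
    qed
    have "uniform_limit {t / 2..t + 1} (\<lambda>n s. \<Sum>i<n. c i * (\<alpha> * mlt \<alpha> (Suc k) (l i * s powr \<alpha>) / s))
       (\<lambda>s. \<Sum>i. c i * (\<alpha> * mlt \<alpha> (Suc k) (l i * s powr \<alpha>) / s)) sequentially"
    proof (rule Weierstrass_m_test)
      show "summable (\<lambda>i. \<bar>c i\<bar> * (\<alpha> * B / (t / 2)))" by (rule summable_mult2[OF c_summable])
      fix i s assume s: "s \<in> {t / 2..t + 1}"
      have "\<bar>\<alpha> * mlt \<alpha> (Suc k) (l i * s powr \<alpha>) / s\<bar> = \<alpha> * \<bar>mlt \<alpha> (Suc k) (l i * s powr \<alpha>)\<bar> / s"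
        using \<alpha> s t by (simp add: abs_mult)
      also have "\<dots> \<le> \<alpha> * B / (t / 2)"
        using s t \<alpha> B0 l_pos[of i] by (intro frac_le mult_left_mono B) auto
      finally show "norm (c i * (\<alpha> * mlt \<alpha> (Suc k) (l i * s powr \<alpha>) / s)) \<le> \<bar>c i\<bar> * (\<alpha> * B / (t / 2))"
        unfolding real_norm_def abs_mult[of "c i"] by (rule mult_left_mono) simp
    qed
    then show "uniformly_convergent_on {t / 2..t + 1} (\<lambda>n s. \<Sum>i<n. c i * (\<alpha> * mlt \<alpha> (Suc k) (l i * s powr \<alpha>) / s))"
      unfolding uniformly_convergent_on_def by blast
    show "summable (\<lambda>i. c i * mlt \<alpha> k (l i * t powr \<alpha>))" by (rule mlt_series_summable) simp
  qed (use t in auto)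
  moreover have "(\<Sum>i. c i * (\<alpha> * mlt \<alpha> (Suc k) (l i * t powr \<alpha>) / t)) = \<alpha> / t * (\<Sum>i. c i * mlt \<alpha> (Suc k) (l i * t powr \<alpha>))"
    using mlt_series_summable[of "t powr \<alpha>" "Suc k"] by (subst suminf_mult[symmetric]) (auto simp: mult_ac)
  ultimately have A: "((\<lambda>s. \<Sum>i. c i * mlt \<alpha> k (l i * s powr \<alpha>)) has_real_derivative
      \<alpha> / t * (\<Sum>i. c i * mlt \<alpha> (Suc k) (l i * t powr \<alpha>))) (at t)" by (simp only:)
  have "((\<lambda>s. \<Sum>j\<le>m. real j ^ k * \<gamma> j * (s powr \<alpha>) ^ j) has_real_derivative
      (\<Sum>j\<le>m. real j ^ k * \<gamma> j * (real j * (t powr \<alpha>) ^ (j - 1) * (\<alpha> * t powr (\<alpha> - 1))))) (at t)"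
    using t by (auto intro!: derivative_eq_intros sum.cong simp: mult_ac)
  moreover have "(\<Sum>j\<le>m. real j ^ k * \<gamma> j * (real j * (t powr \<alpha>) ^ (j - 1) * (\<alpha> * t powr (\<alpha> - 1)))) =
      \<alpha> / t * (\<Sum>j\<le>m. real j ^ Suc k * \<gamma> j * (t powr \<alpha>) ^ j)"
    unfolding sum_distrib_left
  proof (rule sum.cong)
    fix j
    have "t powr (\<alpha> - 1) = t powr \<alpha> / t" using t by (simp add: powr_diff)
    then show "real j ^ k * \<gamma> j * (real j * (t powr \<alpha>) ^ (j - 1) * (\<alpha> * t powr (\<alpha> - 1))) = \<alpha> / t * (real j ^ Suc k * \<gamma> j * (t powr \<alpha>) ^ j)"
      by (cases j) (simp_all del: of_nat_Suc)
  qed simp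
  ultimately have "((\<lambda>s. \<Sum>j\<le>m. real j ^ k * \<gamma> j * (s powr \<alpha>) ^ j) has_real_derivative
      \<alpha> / t * (\<Sum>j\<le>m. real j ^ Suc k * \<gamma> j * (t powr \<alpha>) ^ j)) (at t)" by (simp only:)
  from DERIV_diff[OF A this] show ?thesis
    unfolding Z_def[abs_def] right_diff_distrib .
qed

lemma powr_quotient:
  fixes t :: real
  assumes "t > 0"
  shows "t powr x / t = t powr (x - 1)"
  using assms by (simp add: powr_diff)

text \<open>The choice of m enters here: (m + 1)\<alpha> - 1 is positive. It makes the derivative of
  the remainder exist, vanish and be continuous at 0.\<close>

lemma remainder_tendsto_0: "((\<lambda>t. C * t powr (real (m + 1) * \<alpha> - 1)) \<longlongrightarrow> 0) (at 0 within {0..T})"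
proof -
  have "((\<lambda>t. C * t powr (real (m + 1) * \<alpha> - 1)) \<longlongrightarrow> C * 0 powr (real (m + 1) * \<alpha> - 1)) (at 0 within {0..T})"
  proof (intro tendsto_mult_left tendsto_powr' tendsto_const tendsto_ident_at disjI2 conjI)
    show "0 < real (m + 1) * \<alpha> - 1" using m by simp
  qed (auto simp: eventually_at_filter)
  then show ?thesis by simp
qed

lemma Z_deriv_at_0: "(Z 0 has_real_derivative 0) (at 0 within {0..T})"
proof -
  have "((\<lambda>t. (Z 0 t - Z 0 0) / (t - 0)) \<longlongrightarrow> 0) (at 0 within {0..T})"
  proof (rule Lim_null_comparison[OF _ remainder_tendsto_0])
    show "\<forall>\<^sub>F t in at 0 within {0..T}. norm ((Z 0 t - Z 0 0) / (t - 0)) \<le> C * t powr (real (m + 1) * \<alpha> - 1)"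
      unfolding eventually_at_filter
    proof (intro always_eventually allI impI)
      fix t :: real assume "t \<noteq> 0" "t \<in> {0..T}"
      then have t: "t > 0" by auto
      have "\<bar>Z 0 t\<bar> / t \<le> C * t powr (real (m + 1) * \<alpha>) / t" using Z_bound[of 0 t] t by (intro divide_right_mono) auto
      then show "norm ((Z 0 t - Z 0 0) / (t - 0)) \<le> C * t powr (real (m + 1) * \<alpha> - 1)"
        using t unfolding times_divide_eq_right[symmetric] powr_quotient[OF t] by (simp add: Z_0)
    qed
  qed
  then show ?thesis unfolding has_field_derivative_iff .
qed

lemma Z1_bound:
  assumes t: "t \<ge> 0"
  shows "\<bar>\<alpha> / t * Z 1 t\<bar> \<le> C * t powr (real (m + 1) * \<alpha> - 1)"
proof (cases "t = 0")
  case False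
  then have t: "t > 0" using t by simp
  have "\<bar>\<alpha> / t * Z 1 t\<bar> = \<alpha> * \<bar>Z 1 t\<bar> / t" using \<alpha> t by (simp add: abs_mult)
  also have "\<dots> \<le> 1 * (C * t powr (real (m + 1) * \<alpha>)) / t"
    using t \<alpha> by (intro divide_right_mono mult_mono Z_bound) auto
  also have "\<dots> = C * t powr (real (m + 1) * \<alpha> - 1)" unfolding powr_quotient[OF t, symmetric] by simp
  finally show ?thesis .
qed simp

lemma Z1_cont: "continuous_on {0..T} (\<lambda>t. \<alpha> / t * Z 1 t)"
  unfolding continuous_on_eq_continuous_within
proof
  fix t assume tT: "t \<in> {0..T}"
  show "continuous (at t within {0..T}) (\<lambda>t. \<alpha> / t * Z 1 t)"
  proof (cases "t = 0")
    case True
    have "\<forall>\<^sub>F t in at 0 within {0..T}. norm (\<alpha> / t * Z 1 t) \<le> C * t powr (real (m + 1) * \<alpha> - 1)"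
      unfolding eventually_at_filter
    proof (intro always_eventually allI impI)
      fix t :: real assume "t \<in> {0..T}"
      then have "t \<ge> 0" by simp
      from Z1_bound[OF this] show "norm (\<alpha> / t * Z 1 t) \<le> C * t powr (real (m + 1) * \<alpha> - 1)" by (simp only: real_norm_def)
    qed
    from Lim_null_comparison[OF this remainder_tendsto_0]
    have "((\<lambda>t. \<alpha> / t * Z 1 t) \<longlongrightarrow> 0) (at 0 within {0..T})" .
    then show ?thesis unfolding True continuous_within by (simp only: div_by_0 mult_zero_left)
  next
    case False
    then have t: "t > 0" using tT by simp
    have "isCont (Z 1) t" using Z_deriv[OF t] by (rule DERIV_isCont)
    then have "isCont (\<lambda>t. \<alpha> / t * Z 1 t) t"
      using t by (intro isCont_mult isCont_divide continuous_const continuous_ident) simp_all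
    then show ?thesis by (rule continuous_at_imp_continuous_at_within)
  qed
qed

text \<open>The second time derivative of \<open>Z 0\<close>, since t^2 d^2/dt^2 is (t d/dt)^2 - t
  d/dt.\<close>

definition Z2 :: "real \<Rightarrow> real" where
  "Z2 t = (\<alpha>\<^sup>2 * Z 2 t - \<alpha> * Z 1 t) / t\<^sup>2"

lemma Z1_deriv:
  assumes t: "t > 0"
  shows "((\<lambda>t. \<alpha> / t * Z 1 t) has_real_derivative Z2 t) (at t)"
proof -
  have "((\<lambda>t. \<alpha> / t) has_real_derivative - \<alpha> / t\<^sup>2) (at t)"
    using t by (auto intro!: derivative_eq_intros simp: power2_eq_square)
  from DERIV_mult[OF this Z_deriv[OF t, of 1]]
  have "((\<lambda>t. \<alpha> / t * Z 1 t) has_real_derivative - \<alpha> / t\<^sup>2 * Z 1 t + \<alpha> / t * Z 2 t * (\<alpha> / t)) (at t)"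
    by (simp add: numeral_2_eq_2)
  moreover have "- \<alpha> / t\<^sup>2 * Z 1 t + \<alpha> / t * Z 2 t * (\<alpha> / t) = Z2 t"
    using t by (simp add: Z2_def field_simps power2_eq_square)
  ultimately show ?thesis by simp
qed

lemma Z2_bound:
  assumes t: "t > 0"
  shows "\<bar>Z2 t\<bar> \<le> 2 * C * t powr (real (m + 1) * \<alpha> - 2)"
proof -
  have a2: "\<alpha>\<^sup>2 \<le> 1" using \<alpha> by (simp add: power_le_one)
  have "\<bar>\<alpha>\<^sup>2 * Z 2 t\<bar> \<le> 1 * (C * t powr (real (m + 1) * \<alpha>))"
    unfolding abs_mult using t a2 by (intro mult_mono Z_bound) auto
  moreover have "\<bar>\<alpha> * Z 1 t\<bar> \<le> 1 * (C * t powr (real (m + 1) * \<alpha>))"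
    unfolding abs_mult using t \<alpha> by (intro mult_mono Z_bound) auto
  ultimately have "\<bar>\<alpha>\<^sup>2 * Z 2 t - \<alpha> * Z 1 t\<bar> \<le> 2 * (C * t powr (real (m + 1) * \<alpha>))" by linarith
  then have "\<bar>Z2 t\<bar> \<le> 2 * (C * t powr (real (m + 1) * \<alpha>)) / t\<^sup>2"
    unfolding Z2_def abs_divide using t by (simp add: divide_right_mono)
  also have "\<dots> = 2 * C * t powr (real (m + 1) * \<alpha> - 2)"
    using t by (simp add: powr_diff powr_numeral)
  finally show ?thesis .
qed

end

section \<open>The part of the solution generated by the source\<close>

lemma series_continuous_on:
  assumes c: "ltail c S W" and W: "\<And>t. t \<in> S \<Longrightarrow> W t \<le> K" and x: "\<And>i. \<bar>x i\<bar> \<le> (B :: real)"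
    and cont: "\<And>i. continuous_on S (c i)"
  shows "continuous_on S (\<lambda>t. \<Sum>i. c i t * x i)"
proof (rule uniform_limit_theorem[OF _ ltail_uniform[OF c W x]])
  show "\<forall>\<^sub>F n in sequentially. continuous_on S (\<lambda>t. \<Sum>i<n. c i t * x i)"
    by (intro always_eventually allI continuous_intros cont)
qed simp_all

text \<open>One constant serves all sequences bounded by B. With the eigenfunction values at a point
  as the sequence, this makes the estimates uniform in space.\<close>

lemma series_abs_bound:
  assumes c: "ltail c S W" and W: "\<And>t. t \<in> S \<Longrightarrow> W t \<ge> 0"
  shows "\<exists>C\<ge>0. \<forall>x. \<forall>t\<in>S. (\<forall>i. \<bar>x i\<bar> \<le> B) \<longrightarrow> summable (\<lambda>i. c i t * x i) \<and> \<bar>\<Sum>i. c i t * x i\<bar> \<le> C * W t"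
proof -
  obtain K where K: "K \<ge> 0" "\<And>t. t \<in> S \<Longrightarrow> summable (\<lambda>i. \<bar>c i t\<bar>)" "\<And>t. t \<in> S \<Longrightarrow> (\<Sum>i. \<bar>c i t\<bar>) \<le> K * W t"
  proof -
    from ltail_bound[OF assms] obtain K where "K \<ge> 0 \<and> (\<forall>t\<in>S. summable (\<lambda>i. \<bar>c i t\<bar>) \<and> (\<Sum>i. \<bar>c i t\<bar>) \<le> K * W t)" ..
    then show thesis by (intro that[of K]) auto
  qed
  show ?thesis
  proof (intro exI[of _ "\<bar>B\<bar> * K"] conjI allI ballI impI)
    show "\<bar>B\<bar> * K \<ge> 0" using K by simp
    fix x :: "nat \<Rightarrow> real" and t assume t: "t \<in> S" and x: "\<forall>i. \<bar>x i\<bar> \<le> B"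
    have le: "\<bar>c i t * x i\<bar> \<le> \<bar>B\<bar> * \<bar>c i t\<bar>" for i
    proof -
      have "\<bar>x i\<bar> \<le> \<bar>B\<bar>" using x[rule_format, of i] by linarith
      then have "\<bar>c i t\<bar> * \<bar>x i\<bar> \<le> \<bar>c i t\<bar> * \<bar>B\<bar>" by (rule mult_left_mono) simp
      then show ?thesis by (simp add: abs_mult mult.commute)
    qed
    have sB: "summable (\<lambda>i. \<bar>B\<bar> * \<bar>c i t\<bar>)" by (rule summable_mult[OF K(2)[OF t]])
    have sa: "summable (\<lambda>i. \<bar>c i t * x i\<bar>)"
      by (rule summable_comparison_test'[OF sB]) (use le in auto)
    then show "summable (\<lambda>i. c i t * x i)" by (rule summable_rabs_cancel)
    have "\<bar>\<Sum>i. c i t * x i\<bar> \<le> (\<Sum>i. \<bar>c i t * x i\<bar>)" by (rule summable_rabs[OF sa])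
    also have "\<dots> \<le> (\<Sum>i. \<bar>B\<bar> * \<bar>c i t\<bar>)" by (rule suminf_le[OF le sa sB])
    also have "\<dots> = \<bar>B\<bar> * (\<Sum>i. \<bar>c i t\<bar>)" by (rule suminf_mult[OF K(2)[OF t]])
    also have "\<dots> \<le> \<bar>B\<bar> * (K * W t)" by (intro mult_left_mono K(3) t) simp
    finally show "\<bar>\<Sum>i. c i t * x i\<bar> \<le> \<bar>B\<bar> * K * W t" by (simp add: mult_ac)
  qed
qed

lemma ltail_series_summable:
  assumes c: "ltail c S W" and W: "\<And>t. t \<in> S \<Longrightarrow> W t \<ge> 0" and t: "t \<in> S" and x: "\<And>i. \<bar>x i\<bar> \<le> B"
  shows "summable (\<lambda>i. c i t * x i)"
proof -
  have "\<exists>C\<ge>0. \<forall>x. \<forall>t\<in>S. (\<forall>i. \<bar>x i\<bar> \<le> B) \<longrightarrow> summable (\<lambda>i. c i t * x i) \<and> \<bar>\<Sum>i. c i t * x i\<bar> \<le> C * W t"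
    by (rule series_abs_bound[OF c W])
  then show ?thesis using t x by blast
qed

context mild_coefficients
begin

lemma F0_tail: "ltail (\<lambda>i t. F i 0) S (\<lambda>_. 1)"
proof (rule constant_tail[OF tail_at_0, where x = 0 and D = 1])
  fix i t show "\<bar>F i 0\<bar> \<le> 1 * 1 * (l i powr 0 * \<bar>F i 0\<bar>)" using l_pos[of i] by simp
qed auto

lemma w1_excess_tail: "ltail (\<lambda>i t. w1 i t - F i 0) {0..T} (\<lambda>_. 1)"
proof -
  have "ltail w1 {0..T} (\<lambda>_. 1)"
    using w1_tail
  proof (rule ltail_le[where K = "l0 powr (0 - 1 / 8)" and V = "\<lambda>_. l0 powr (0 - 1 / 8)" and h = "\<lambda>t. t"])
    fix i t
    have "l i powr 0 \<le> l0 powr (0 - 1 / 8) * l i powr (1 / 8)" by (rule powr_le_powr) simp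
    then have "1 * \<bar>w1 i t\<bar> \<le> l0 powr (0 - 1 / 8) * l i powr (1 / 8) * \<bar>w1 i t\<bar>"
      using l_pos[of i] by (intro mult_right_mono) auto
    then show "\<bar>w1 i t\<bar> \<le> l0 powr (0 - 1 / 8) * \<bar>l i powr (1 / 8) * w1 i t\<bar>" by (simp add: abs_mult)
  qed auto
  moreover have "ltail (\<lambda>i t. - F i 0) {0..T} (\<lambda>_. 1)"
    using F0_tail[of "{0..T}"] by (rule ltail_le[where K = 1 and V = "\<lambda>_. 1" and h = "\<lambda>t. t"]) auto
  ultimately have "ltail (\<lambda>i t. w1 i t + - F i 0) {0..T} (\<lambda>_. 1)" by (rule ltail_add)
  then show ?thesis by simp
qed

text \<open>The sequence x holds the eigenfunction values at a point. \<open>V0\<close> is the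
  convolution part of the solution without its linear term at 0; \<open>V\<close> and
  \<open>V1\<close> are its first and second time derivatives. Removing the linear term makes
  \<open>V0\<close> and \<open>V\<close> vanish at t = 0.\<close>

definition V :: "(nat \<Rightarrow> real) \<Rightarrow> real \<Rightarrow> real" where
  "V x t = (\<Sum>i. (w1 i t - F i 0) * x i)"

definition V0 :: "(nat \<Rightarrow> real) \<Rightarrow> real \<Rightarrow> real" where
  "V0 x t = (\<Sum>i. (w i t - F i 0 * t) * x i)"

definition V1 :: "(nat \<Rightarrow> real) \<Rightarrow> real \<Rightarrow> real" where
  "V1 x t = (\<Sum>i. w2 i t * x i)"

lemma V_0: "V x 0 = 0" "V0 x 0 = 0"
  by (simp_all add: V_def V0_def w1_0 w_0)

lemma V_cont:
  assumes "\<And>i. \<bar>x i\<bar> \<le> B"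
  shows "continuous_on {0..T} (V x)"
  unfolding V_def[abs_def]
  by (rule series_continuous_on[OF w1_excess_tail _ assms, where K = 1]) (auto intro!: continuous_intros w1_cont)

lemma V0_summable:
  assumes x: "\<And>i. \<bar>x i\<bar> \<le> B" and t: "t \<in> {0..T}"
  shows "summable (\<lambda>i. F i 0 * x i)" and "summable (\<lambda>i. (w i t - F i 0 * t) * x i)"
proof -
  have wt: "ltail w {0..T} (\<lambda>_. 1)"
    using w_tail
  proof (rule ltail_le[where K = "l0 powr (0 - 9 / 8)" and V = "\<lambda>_. l0 powr (0 - 9 / 8)" and h = "\<lambda>t. t"])
    fix i t
    have "l i powr 0 \<le> l0 powr (0 - 9 / 8) * l i powr (9 / 8)" by (rule powr_le_powr) simp
    then have "1 * \<bar>w i t\<bar> \<le> l0 powr (0 - 9 / 8) * l i powr (9 / 8) * \<bar>w i t\<bar>"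
      using l_pos[of i] by (intro mult_right_mono) auto
    then show "\<bar>w i t\<bar> \<le> l0 powr (0 - 9 / 8) * \<bar>l i powr (9 / 8) * w i t\<bar>" by (simp add: abs_mult)
  qed auto
  have s: "summable (\<lambda>i. w i t * x i)" "summable (\<lambda>i. F i 0 * x i)"
    by (rule ltail_series_summable[OF wt _ t x], simp, rule ltail_series_summable[OF F0_tail[of "{0..T}"] _ t x], simp)
  then have "summable (\<lambda>i. w i t * x i - t * (F i 0 * x i))" by (intro summable_diff summable_mult)
  then show "summable (\<lambda>i. (w i t - F i 0 * t) * x i)" by (simp add: algebra_simps)
  show "summable (\<lambda>i. F i 0 * x i)" by (rule s)
qed

lemma V0_deriv:
  assumes x: "\<And>i. \<bar>x i\<bar> \<le> B" and t: "t \<in> {0..T}"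
  shows "(V0 x has_real_derivative V x t) (at t within {0..T})"
  unfolding V_def V0_def[abs_def]
proof (rule ltail_series_deriv[OF w1_excess_tail _ _ x _ _ t])
  show "((\<lambda>t. w i t - F i 0 * t) has_real_derivative w1 i s - F i 0) (at s within {0..T})" if "s \<in> {0..T}" for i s
    by (rule DERIV_diff[OF w_deriv[OF that]]) (auto intro!: derivative_eq_intros)
  show "summable (\<lambda>i. (w i s - F i 0 * s) * x i)" if "s \<in> {0..T}" for s
    by (rule V0_summable[OF x that])
qed auto

lemma V_bound: "\<exists>C\<ge>0. \<forall>x. \<forall>t\<in>{0..T}. (\<forall>i. \<bar>x i\<bar> \<le> B) \<longrightarrow> \<bar>V x t\<bar> \<le> C"
proof -
  have "\<exists>C\<ge>0. \<forall>x. \<forall>t\<in>{0..T}. (\<forall>i. \<bar>x i\<bar> \<le> B) \<longrightarrow> summable (\<lambda>i. (w1 i t - F i 0) * x i) \<and> \<bar>\<Sum>i. (w1 i t - F i 0) * x i\<bar> \<le> C * 1"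
    by (rule series_abs_bound[OF w1_excess_tail]) simp
  then show ?thesis unfolding V_def by simp blast
qed

lemma V1_bound: "\<exists>C\<ge>0. \<forall>x. \<forall>t\<in>{0<..T}. (\<forall>i. \<bar>x i\<bar> \<le> B) \<longrightarrow> \<bar>V1 x t\<bar> \<le> C * wt \<alpha> \<tau> t"
proof -
  have "\<exists>C\<ge>0. \<forall>x. \<forall>t\<in>{0<..T}. (\<forall>i. \<bar>x i\<bar> \<le> B) \<longrightarrow> summable (\<lambda>i. w2 i t * x i) \<and> \<bar>\<Sum>i. w2 i t * x i\<bar> \<le> C * wt \<alpha> \<tau> t"
    by (rule series_abs_bound[OF w2_tail]) (rule order.trans[OF zero_le_one wt_ge_1])
  then show ?thesis unfolding V1_def by blast
qed

lemma V_deriv: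
  assumes x: "\<And>i. \<bar>x i\<bar> \<le> B" and t: "t \<in> {0..T} - (\<lambda>j. real j * \<tau>) ` {0..n}"
  shows "(V x has_real_derivative V1 x t) (at t)"
proof -
  have t0: "t \<in> {0<..T}" using t by (cases "t = 0") force+
  obtain j where j: "j < n" "t \<in> {real j * \<tau><..real (Suc j) * \<tau>}"
    using piece_cover[OF \<tau>, of t n] t0 T by auto
  have "t \<noteq> real (Suc j) * \<tau>"
  proof
    assume "t = real (Suc j) * \<tau>"
    then have "t \<in> (\<lambda>j. real j * \<tau>) ` {0..n}" using j(1) by (intro image_eqI[of _ _ "Suc j"]) auto
    then show False using t by blast
  qed
  then have tj: "t \<in> {real j * \<tau><..<real (Suc j) * \<tau>}" using j(2) by auto
  let ?S = "{real j * \<tau><..real (Suc j) * \<tau>}"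
  have "0 \<le> real j * \<tau>" using \<tau> by simp
  moreover have "real (Suc j) * \<tau> \<le> T" unfolding T using j(1) \<tau> by (intro mult_right_mono) auto
  ultimately have ST: "?S \<subseteq> {0<..T}" "?S \<subseteq> {0..T}" by auto
  have sub: "ltail c S W" if "ltail c S' W" "S \<subseteq> S'" for c S S' W
    using that(1) by (rule ltail_le[where K = 1 and V = "\<lambda>_. 1" and h = "\<lambda>t. t"]) (use that(2) in auto)
  have "((\<lambda>t. \<Sum>i. (w1 i t - F i 0) * x i) has_real_derivative (\<Sum>i. w2 i t * x i)) (at t within ?S)"
  proof (rule piece_deriv_series[where W = "wt \<alpha> \<tau>" and ?W0.0 = "\<lambda>_. 1" and B = B, OF j(2)])
    show "ltail w2 ?S (wt \<alpha> \<tau>)" by (rule sub[OF w2_tail ST(1)])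
    show "ltail (\<lambda>i t. w1 i t - F i 0) ?S (\<lambda>_. 1)" by (rule sub[OF w1_excess_tail ST(2)])
    show "\<exists>K. \<forall>t\<in>{r..real (Suc j) * \<tau>}. wt \<alpha> \<tau> t \<le> K" if "real j * \<tau> < r" for r
      using wt_bounded_on_piece[OF \<alpha> \<tau> that] by blast
    show "((\<lambda>t. w1 i t - F i 0) has_real_derivative w2 i s) (at s within ?S)" if "s \<in> ?S" for i s
      using DERIV_diff[OF w1_deriv[OF j(1) that] DERIV_const, of i "F i 0"] by simp
  qed (use x in auto)
  then have "((\<lambda>t. \<Sum>i. (w1 i t - F i 0) * x i) has_real_derivative (\<Sum>i. w2 i t * x i)) (at t within {real j * \<tau><..<real (Suc j) * \<tau>})"
    by (rule has_field_derivative_subset) auto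
  then show ?thesis unfolding V_def[abs_def] V1_def using at_within_open[OF tj open_greaterThanLessThan] by simp
qed

lemma u_split:
  assumes x: "\<And>i. \<bar>x i\<bar> \<le> B" and t: "t \<in> {0..T}"
  shows "(\<Sum>i. u i t * x i) = (\<Sum>i. v0 i * x i * mlt \<alpha> 0 (l i * t powr \<alpha>)) + (\<Sum>i. F i 0 * x i) * t + V0 x t"
proof -
  have "ltail (\<lambda>i t. v0 i * relax \<alpha> (l i) t) {0..T} (\<lambda>_. 1)"
  proof (rule constant_tail[OF v0_tail, where x = 0 and D = Br])
    fix i s assume "s \<in> {0..T}"
    then show "\<bar>v0 i * relax \<alpha> (l i) s\<bar> \<le> Br * 1 * (l i powr 0 * \<bar>v0 i\<bar>)"
      using mult_left_mono[OF Br(2)[of s i], of "\<bar>v0 i\<bar>"] l_pos[of i] by (simp add: abs_mult mult_ac)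
  qed (use Br(1) in auto)
  from ltail_series_summable[OF this _ t x] have v: "summable (\<lambda>i. v0 i * relax \<alpha> (l i) t * x i)" by simp
  note s = V0_summable[OF x t]
  have "(\<Sum>i. v0 i * relax \<alpha> (l i) t * x i) + ((\<Sum>i. F i 0 * x i) * t + V0 x t) =
    (\<Sum>i. v0 i * relax \<alpha> (l i) t * x i + (F i 0 * x i * t + (w i t - F i 0 * t) * x i))"
    unfolding V0_def suminf_mult2[OF s(1)] suminf_add[OF summable_mult2[OF s(1)] s(2)]
    by (rule suminf_add[OF v summable_add[OF summable_mult2[OF s(1)] s(2)]])
  also have "\<dots> = (\<Sum>i. u i t * x i)"
    by (rule suminf_cong) (simp add: u_def algebra_simps)
  finally show ?thesis by (simp add: relax_def mult_ac)
qed

end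

text \<open>The hypothesis bounds the terms by a multiple of 1/l i, because j \<le> m leaves at
  least one power over; this is below a multiple of the summable power -3/4.\<close>

lemma (in dirichlet_basis) inverse_power_tail_summable:
  assumes v: "\<And>i. l i ^ Suc m * \<bar>v i\<bar> \<le> M" and j: "j \<le> m"
  shows "summable (\<lambda>i. \<bar>v i\<bar> * l i ^ j)"
proof -
  obtain l0 where l0: "l0 > 0" "\<And>i. l i \<ge> l0" using l_bounded_below by blast
  have M: "M \<ge> 0" using order.trans[OF _ v[of 0]] l_pos[of 0] by simp
  show ?thesis
  proof (rule summable_comparison_test')
    show "summable (\<lambda>i. M / l0 ^ (m - j) * l0 powr (- (1 / 4)) * l i powr (- (3 / 4)))"
      by (rule summable_mult[OF l_summable])
    fix i
    have li: "l i > 0" by (rule l_pos)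
    have eq: "l i ^ Suc m = l i ^ j * (l i ^ (m - j) * l i)" using j by (simp add: power_add[symmetric] power_Suc2[symmetric] del: power_Suc)
    have "\<bar>v i\<bar> * l i ^ j * (l i ^ (m - j) * l i) \<le> M" using v[of i] unfolding eq by (simp only: mult_ac)
    then have "\<bar>v i\<bar> * l i ^ j \<le> M / (l i ^ (m - j) * l i)" using li by (simp add: pos_le_divide_eq)
    also have "\<dots> \<le> M / (l0 ^ (m - j) * l i)"
      using l0 li M by (intro divide_left_mono mult_right_mono power_mono mult_pos_pos zero_less_power) (auto simp: less_imp_le)
    also have "\<dots> = M / l0 ^ (m - j) * l i powr (- 1)"
      using li by (simp add: powr_minus divide_inverse)
    also have "l i powr (- 1) = l i powr (- (1 / 4)) * l i powr (- (3 / 4))" using li by (simp add: powr_add[symmetric])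
    also have "M / l0 ^ (m - j) * (l i powr (- (1 / 4)) * l i powr (- (3 / 4))) \<le>
        M / l0 ^ (m - j) * (l0 powr (- (1 / 4)) * l i powr (- (3 / 4)))"
      using l0 M by (intro mult_left_mono mult_right_mono powr_mono2') auto
    finally show "norm (\<bar>v i\<bar> * l i ^ j) \<le> M / l0 ^ (m - j) * l0 powr (- (1 / 4)) * l i powr (- (3 / 4))"
      using li by (simp add: abs_mult mult.assoc)
  qed
qed

context delay_problem
begin

lemma initial_coefficients:
  assumes es: "dirichlet_eigensystem p a L lam X"
    and G: "(dirichlet_op p a L ^^ (m + 1)) (\<lambda>x. \<phi> x 0) g"
  shows "((\<lambda>y. X (Suc i) y * g y) has_integral l i ^ Suc m * coef \<phi> i 0) {0..L}"
proof -
  have c: "continuous_on {0..L} (\<lambda>x. \<phi> x 0)" using continuous_on_section(2)[OF \<phi>_cont, of 0] \<tau> by simp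
  have "dirichlet_op p a L (X (Suc i)) (\<lambda>x. lam (Suc i) * X (Suc i) x)"
    using es unfolding dirichlet_eigensystem_def by auto
  from dirichlet_op_power_coefficient[OF L this c G] show ?thesis by (simp add: coef_def X lam)
qed

lemma decomposition:
  assumes p: "p > 0" and a: "a \<le> 0" and es: "dirichlet_eigensystem p a L lam X"
    and m: "real (m + 1) * \<alpha> > 1"
    and G: "(dirichlet_op p a L ^^ (m + 1)) (\<lambda>x. \<phi> x 0) g"
    and g: "\<And>x. x \<in> {0..L} \<Longrightarrow> \<bar>g x\<bar> \<le> Bg"
  shows "\<exists>(\<gamma> :: nat \<Rightarrow> real \<Rightarrow> real) (\<gamma>' :: real \<Rightarrow> real) (Y :: real \<Rightarrow> real \<Rightarrow> real) Y\<^sub>t Y\<^sub>t\<^sub>t.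
          (\<forall>j\<le>m. bounded (\<gamma> j ` {0..L})) \<and> bounded (\<gamma>' ` {0..L}) \<and>
          (\<forall>x\<in>{0..L}. \<forall>t\<in>{0..real K * \<tau>}.
             u x t = (\<Sum>j\<le>m. \<gamma> j x * (t powr \<alpha>) ^ j) + \<gamma>' x * t + Y x t) \<and>
          (\<forall>x\<in>{0..L}. Y x 0 = 0 \<and> Y\<^sub>t x 0 = 0 \<and>
             (\<forall>t\<in>{0..real K * \<tau>}. (Y x has_real_derivative Y\<^sub>t x t) (at t within {0..real K * \<tau>})) \<and>
             continuous_on {0..real K * \<tau>} (Y\<^sub>t x)) \<and>
          (\<exists>C>0. \<forall>x\<in>{0..L}. \<forall>t\<in>{0..real K * \<tau>}.
             \<bar>Y\<^sub>t x t\<bar> \<le> C * (1 + t powr (real (m + 1) * \<alpha> - 1))) \<and>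
          (\<forall>x\<in>{0..L}.
             (\<forall>t\<in>{0..real K * \<tau>} - (\<lambda>j. real j * \<tau>) ` {0..K}.
                (Y\<^sub>t x has_real_derivative Y\<^sub>t\<^sub>t x t) (at t)) \<and>
             Y\<^sub>t\<^sub>t x absolutely_integrable_on {0..real K * \<tau>})"
proof -
  define T where "T = real K * \<tau>"
  obtain D where mcD: "mild_coefficients \<alpha> \<tau> l0 T K l (\<lambda>i. coef \<phi> i 0) source (source' D)"
    and us: "\<And>x t. t \<in> {0<..T} \<Longrightarrow> u x t = (\<Sum>i. mu i t * e i x)"
    using solution_mild unfolding T_def by blast
  interpret mc: mild_coefficients \<alpha> \<tau> l0 T K l "\<lambda>i. coef \<phi> i 0" source "source' D"
    by (rule mcD)
  define v where "v i = coef \<phi> i 0" for i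
  have gi: "((\<lambda>y. X (Suc i) y * g y) has_integral l i ^ Suc m * v i) {0..L}" for i
    unfolding v_def by (rule initial_coefficients[OF es G])
  have vb: "l i ^ Suc m * \<bar>v i\<bar> \<le> integral {0..L} (\<lambda>y. B * \<bar>Bg\<bar>)" for i
  proof -
    have "norm (integral {0..L} (\<lambda>y. X (Suc i) y * g y)) \<le> integral {0..L} (\<lambda>y. B * \<bar>Bg\<bar>)"
    proof (rule Henstock_Kurzweil_Integration.integral_norm_bound_integral)
      fix y assume y: "y \<in> {0..L}"
      have "\<bar>X (Suc i) y\<bar> * \<bar>g y\<bar> \<le> B * \<bar>Bg\<bar>"
        using e_bound[OF y, of i] g[OF y] B unfolding X by (intro mult_mono) auto
      then show "norm (X (Suc i) y * g y) \<le> B * \<bar>Bg\<bar>" by (simp add: abs_mult)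
    qed (use gi in auto)
    moreover have "\<bar>l i ^ Suc m * v i\<bar> = l i ^ Suc m * \<bar>v i\<bar>" using l_pos[of i] by (simp add: abs_mult)
    ultimately show ?thesis using integral_unique[OF gi[of i]] by simp
  qed
  note vs = inverse_power_tail_summable[OF vb]
  \<comment> \<open>One bound for each Euler order k, uniform in h and x; \<open>C\<close> below
    dominates those for the orders 0, 1 and 2.\<close>
  have "\<forall>k. \<exists>C. \<forall>h>0. \<forall>x\<in>{0..L}. \<bar>\<Sum>i. mlr \<alpha> m k (l i * h) * (l i ^ Suc m * (v i * e i x))\<bar> \<le> C"
  proof
    fix k
    obtain C where C: "\<forall>h>0. \<forall>x\<in>{0..L}.
       summable (\<lambda>i. \<bar>mlr \<alpha> m k (lam (Suc i) * h) * integral {0..L} (\<lambda>y. X (Suc i) y * g y) * X (Suc i) x\<bar>) \<and>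
       \<bar>\<Sum>i. mlr \<alpha> m k (lam (Suc i) * h) * integral {0..L} (\<lambda>y. X (Suc i) y * g y) * X (Suc i) x\<bar> \<le> C"
      using eigensystem_multiplier_bound[OF \<alpha> L p a es g has_integral_integrable[OF gi], of m k] ..
    have eq: "mlr \<alpha> m k (lam (Suc i) * h) * integral {0..L} (\<lambda>y. X (Suc i) y * g y) * X (Suc i) x =
       mlr \<alpha> m k (l i * h) * (l i ^ Suc m * (v i * e i x))" for i h x
      unfolding integral_unique[OF gi] lam X by (simp only: mult.assoc)
    show "\<exists>C. \<forall>h>0. \<forall>x\<in>{0..L}. \<bar>\<Sum>i. mlr \<alpha> m k (l i * h) * (l i ^ Suc m * (v i * e i x))\<bar> \<le> C"
      using C unfolding eq by blast
  qed
  from choice[OF this] obtain Cf where Cf: "\<And>k h x. h > 0 \<Longrightarrow> x \<in> {0..L} \<Longrightarrow>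
    \<bar>\<Sum>i. mlr \<alpha> m k (l i * h) * (l i ^ Suc m * (v i * e i x))\<bar> \<le> Cf k" by blast
  define C where "C = \<bar>Cf 0\<bar> + \<bar>Cf 1\<bar> + \<bar>Cf 2\<bar>"
  have CfC: "Cf k \<le> C" if "k \<le> 2" for k
  proof -
    have "k = 0 \<or> k = 1 \<or> k = 2" using that by auto
    then show ?thesis unfolding C_def by (elim disjE) simp_all
  qed
  have R: "taylor_remainder \<alpha> C m l (\<lambda>i. v i * e i x)" if x: "x \<in> {0..L}" for x
  proof
    show "0 < \<alpha>" "\<alpha> < 1" "real (m + 1) * \<alpha> > 1" "l i > 0" for i by (fact \<alpha> m l_pos)+
    show "\<bar>\<Sum>i. mlr \<alpha> m k (l i * h) * (l i ^ Suc m * (v i * e i x))\<bar> \<le> C" if "k \<le> 2" "h > 0" for k h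
      using Cf[OF that(2) x, of k] CfC[OF that(1)] by linarith
    fix j assume j: "j \<le> m"
    show "summable (\<lambda>i. \<bar>v i * e i x\<bar> * l i ^ j)"
    proof (rule summable_comparison_test')
      show "summable (\<lambda>i. B * (\<bar>v i\<bar> * l i ^ j))" by (rule summable_mult[OF vs[OF j]])
      fix i
      have "\<bar>e i x\<bar> * (\<bar>v i\<bar> * l i ^ j) \<le> B * (\<bar>v i\<bar> * l i ^ j)"
        using e_bound[OF x, of i] l_pos[of i] by (intro mult_right_mono) auto
      then show "norm (\<bar>v i * e i x\<bar> * l i ^ j) \<le> B * (\<bar>v i\<bar> * l i ^ j)" using l_pos[of i] by (simp add: abs_mult mult_ac)
    qed
  qed
  define \<gamma> where "\<gamma> j x = taylor_remainder.\<gamma> \<alpha> l (\<lambda>i. v i * e i x) j" for j x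
  define Z where "Z x = taylor_remainder.Z \<alpha> m l (\<lambda>i. v i * e i x)" for x
  define Z2 where "Z2 x = taylor_remainder.Z2 \<alpha> m l (\<lambda>i. v i * e i x)" for x
  note R\<gamma> = taylor_remainder.\<gamma>_def[OF R, folded \<gamma>_def]
  define \<gamma>' where "\<gamma>' x = (\<Sum>i. source i 0 * e i x)" for x
  define S where "S = (\<lambda>j. real j * \<tau>) ` {0..K}"
  define Y where "Y x t = Z x 0 t + mc.V0 (\<lambda>i. e i x) t" for x t
  define Yt where "Yt x t = \<alpha> / t * Z x 1 t + mc.V (\<lambda>i. e i x) t" for x t
  \<comment> \<open>At the break points a second derivative may fail to exist; the default 0 on this
    finite set keeps the majorant below valid.\<close>
  define Ytt where "Ytt x t = (if t \<in> S then 0 else Z2 x t + mc.V1 (\<lambda>i. e i x) t)" for x t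
  have b\<gamma>: "bounded (\<gamma> j ` {0..L})" if j: "j \<le> m" for j
    unfolding bounded_iff
  proof (intro exI ballI)
    fix y assume "y \<in> \<gamma> j ` {0..L}"
    then obtain x where x: "x \<in> {0..L}" "y = \<gamma> j x" by blast
    have "summable (\<lambda>i. \<bar>v i * l i ^ j\<bar>)" using vs[OF j] l_pos by (simp add: abs_mult less_imp_le)
    then have "\<bar>\<Sum>i. v i * l i ^ j * e i x\<bar> \<le> B * (\<Sum>i. \<bar>v i * l i ^ j\<bar>)"
      by (rule series_abs_le) (rule e_bound[OF x(1)])
    then have "\<bar>mlc \<alpha> j * (- 1) ^ j\<bar> * \<bar>\<Sum>i. v i * e i x * l i ^ j\<bar> \<le> \<bar>mlc \<alpha> j * (- 1) ^ j\<bar> * (B * (\<Sum>i. \<bar>v i * l i ^ j\<bar>))"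
      by (intro mult_left_mono) (simp_all add: mult_ac)
    then show "norm y \<le> \<bar>mlc \<alpha> j * (- 1) ^ j\<bar> * (B * (\<Sum>i. \<bar>v i * l i ^ j\<bar>))"
      unfolding x(2) R\<gamma>[OF x(1)] real_norm_def abs_mult[of "mlc \<alpha> j * (- 1) ^ j"] .
  qed
  have b\<gamma>': "bounded (\<gamma>' ` {0..L})"
  proof -
    obtain C' where "\<forall>x\<in>{0..L}. \<forall>t\<in>{0::real}. \<bar>\<Sum>i. source i 0 * e i x\<bar> \<le> C' * 1"
      using series_e_bound[OF mc.F0_tail[of "{0}"]] by auto
    then show ?thesis unfolding bounded_iff \<gamma>'_def by auto
  qed
  have dec: "u x t = (\<Sum>j\<le>m. \<gamma> j x * (t powr \<alpha>) ^ j) + \<gamma>' x * t + Y x t" if x: "x \<in> {0..L}" and t: "t \<in> {0..T}" for x t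
  proof -
    have "u x t = (\<Sum>i. mc.u i t * e i x)"
    proof (cases "t = 0")
      \<comment> \<open>At t = 0 the recursion returns the initial function and not the series. Its
        expansion holds at every point because it is continuous with absolutely summable
        coefficients.\<close>
      case True
      have "continuous_on {0..L} (\<lambda>x. \<phi> x 0)" using continuous_on_section(2)[OF \<phi>_cont, of 0] \<tau> by simp
      moreover have "summable (\<lambda>i. \<bar>integral {0..L} (\<lambda>x. e i x * \<phi> x 0)\<bar>)"
        using vs[of 0] by (simp add: v_def coef_def)
      ultimately have "\<phi> x 0 = (\<Sum>i. integral {0..L} (\<lambda>x. e i x * \<phi> x 0) * e i x)"
        using x by (rule coefficients_determine_continuous)
      then show ?thesis unfolding True u_initial[OF order_refl] mc.u_0 coef_def[symmetric] .
    next
      case False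
      then show ?thesis using us[of t x] t by simp
    qed
    also have "\<dots> = (\<Sum>i. v i * e i x * mlt \<alpha> 0 (l i * t powr \<alpha>)) + \<gamma>' x * t + mc.V0 (\<lambda>i. e i x) t"
      unfolding \<gamma>'_def v_def by (rule mc.u_split[OF e_bound[OF x] t])
    also have "(\<Sum>i. v i * e i x * mlt \<alpha> 0 (l i * t powr \<alpha>)) = Z x 0 t + (\<Sum>j\<le>m. \<gamma> j x * (t powr \<alpha>) ^ j)"
      unfolding Z_def taylor_remainder.Z_def[OF R[OF x]] \<gamma>_def by simp
    finally show ?thesis by (simp add: Y_def)
  qed
  have Yd: "(Y x has_real_derivative Yt x t) (at t within {0..T})" if x: "x \<in> {0..L}" and t: "t \<in> {0..T}" for x t
  proof -
    have "(Z x 0 has_real_derivative \<alpha> / t * Z x 1 t) (at t within {0..T})"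
    proof (cases "t = 0")
      case True
      then show ?thesis using taylor_remainder.Z_deriv_at_0[OF R[OF x], folded Z_def] by simp
    next
      case False
      then have "t > 0" using t by simp
      from taylor_remainder.Z_deriv[OF R[OF x] this, of 0, folded Z_def] show ?thesis
        unfolding One_nat_def by (rule has_field_derivative_at_within)
    qed
    from DERIV_add[OF this mc.V0_deriv[OF e_bound[OF x] t]] show ?thesis
      unfolding Y_def[abs_def] Yt_def .
  qed
  have Yc: "continuous_on {0..T} (Yt x)" if x: "x \<in> {0..L}" for x
    unfolding Yt_def[abs_def]
    by (intro continuous_on_add taylor_remainder.Z1_cont[OF R[OF x], folded Z_def] mc.V_cont[OF e_bound[OF x]])
  obtain CV where CV: "CV \<ge> 0" "\<And>x t. t \<in> {0..T} \<Longrightarrow> x \<in> {0..L} \<Longrightarrow> \<bar>mc.V (\<lambda>i. e i x) t\<bar> \<le> CV"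
  proof -
    from mc.V_bound[of B] obtain c where c: "c \<ge> 0 \<and> (\<forall>x. \<forall>t\<in>{0..T}. (\<forall>i. \<bar>x i\<bar> \<le> B) \<longrightarrow> \<bar>mc.V x t\<bar> \<le> c)" ..
    show thesis using that[OF c[THEN conjunct1]] c[THEN conjunct2, rule_format] e_bound by simp
  qed
  obtain CW where CW: "CW \<ge> 0" "\<And>x t. t \<in> {0<..T} \<Longrightarrow> x \<in> {0..L} \<Longrightarrow> \<bar>mc.V1 (\<lambda>i. e i x) t\<bar> \<le> CW * wt \<alpha> \<tau> t"
  proof -
    from mc.V1_bound[of B] obtain c where c: "c \<ge> 0 \<and> (\<forall>x. \<forall>t\<in>{0<..T}. (\<forall>i. \<bar>x i\<bar> \<le> B) \<longrightarrow> \<bar>mc.V1 x t\<bar> \<le> c * wt \<alpha> \<tau> t)" ..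
    show thesis using that[OF c[THEN conjunct1]] c[THEN conjunct2, rule_format] e_bound by simp
  qed
  have C0: "C \<ge> 0" by (simp add: C_def)
  have Yb: "\<bar>Yt x t\<bar> \<le> (C + CV + 1) * (1 + t powr (real (m + 1) * \<alpha> - 1))" if x: "x \<in> {0..L}" and t: "t \<in> {0..T}" for x t
  proof -
    have "\<bar>\<alpha> / t * Z x 1 t\<bar> \<le> C * t powr (real (m + 1) * \<alpha> - 1)"
      using taylor_remainder.Z1_bound[OF R[OF x], folded Z_def] t by simp
    then have "\<bar>Yt x t\<bar> \<le> C * t powr (real (m + 1) * \<alpha> - 1) + CV * 1"
      using CV(2)[OF t x] unfolding Yt_def by linarith
    also have "\<dots> \<le> (C + CV + 1) * t powr (real (m + 1) * \<alpha> - 1) + (C + CV + 1) * 1"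
      using C0 CV(1) by (intro add_mono mult_right_mono) auto
    finally show ?thesis by (simp add: distrib_left)
  qed
  have S0: "t > 0" if "t \<in> {0..T} - S" for t
  proof -
    have "0 \<in> S" unfolding S_def by (rule image_eqI[of _ _ 0]) auto
    then have "t \<noteq> 0" using that by auto
    then show ?thesis using that by simp
  qed
  have Ydd: "(Yt x has_real_derivative Ytt x t) (at t)" if x: "x \<in> {0..L}" and t: "t \<in> {0..T} - S" for x t
  proof -
    have "(mc.V (\<lambda>i. e i x) has_real_derivative mc.V1 (\<lambda>i. e i x) t) (at t)"
      by (rule mc.V_deriv[OF e_bound[OF x] t[unfolded S_def]])
    from DERIV_add[OF taylor_remainder.Z1_deriv[OF R[OF x] S0[OF t], folded Z_def Z2_def] this] show ?thesis
      unfolding Yt_def[abs_def] Ytt_def using t by simp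
  qed
  have Yi: "Ytt x absolutely_integrable_on {0..T}" if x: "x \<in> {0..L}" for x
  proof (rule absolutely_integrable_integrable_bound)
    have T0: "T > 0" by (rule mc.T_pos)
    \<comment> \<open>The fundamental theorem supplies gauge integrability, so measurability needs
      no separate proof; the majorant is integrable as (m + 1)\<alpha> - 2 > -1.\<close>
    have "(Ytt x has_integral (Yt x T - Yt x 0)) {0..T}"
    proof (rule fundamental_theorem_of_calculus_interior_strong[where S = S])
      show "(Yt x has_vector_derivative Ytt x t) (at t)" if "t \<in> {0<..<T} - S" for t
        using Ydd[OF x, of t] that by (auto simp: has_real_derivative_iff_has_vector_derivative)
    qed (use T0 Yc[OF x] in \<open>auto simp: S_def\<close>)
    then show "Ytt x integrable_on {0..T}" by (rule has_integral_integrable)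
    have "((\<lambda>s. (s - 0) powr ((real (m + 1) * \<alpha> - 1) - 1)) has_integral ((T - 0) powr (real (m + 1) * \<alpha> - 1) / (real (m + 1) * \<alpha> - 1))) {0..T}"
      by (rule has_integral_powr_left) (use m T0 in auto)
    then have "(\<lambda>s. s powr (real (m + 1) * \<alpha> - 2)) integrable_on {0..T}"
      by (intro has_integral_integrable) (simp add: algebra_simps)
    then show "(\<lambda>t. 2 * C * t powr (real (m + 1) * \<alpha> - 2) + CW * wt \<alpha> \<tau> t) integrable_on {0..T}"
      using wt_integrable[OF \<alpha> \<tau> less_imp_le[OF T0]] by (intro integrable_add integrable_on_mult_right)
    fix t assume t: "t \<in> {0..T}"
    show "norm (Ytt x t) \<le> 2 * C * t powr (real (m + 1) * \<alpha> - 2) + CW * wt \<alpha> \<tau> t"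
    proof (cases "t \<in> S")
      case True
      have "0 \<le> CW * wt \<alpha> \<tau> t" using CW(1) wt_ge_1[of \<alpha> \<tau> t] by (intro mult_nonneg_nonneg) auto
      then show ?thesis using True C0 by (simp add: Ytt_def)
    next
      case False
      then have t0: "t > 0" using S0[of t] t by simp
      then have "t \<in> {0<..T}" using t by simp
      from CW(2)[OF this x] taylor_remainder.Z2_bound[OF R[OF x] t0, folded Z2_def]
      show ?thesis using False unfolding Ytt_def by simp
    qed
  qed
  have Y0: "Y x 0 = 0 \<and> Yt x 0 = 0" if x: "x \<in> {0..L}" for x
    using taylor_remainder.Z_0[OF R[OF x], folded Z_def] by (simp add: Y_def Yt_def mc.V_0)
  have C1: "C + CV + 1 > 0" using C0 CV(1) by simp
  show ?thesis
    unfolding T_def[symmetric] S_def[symmetric]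
  proof (rule exI[of _ \<gamma>], rule exI[of _ \<gamma>'], rule exI[of _ Y], rule exI[of _ Yt], rule exI[of _ Ytt], intro conjI allI impI ballI)
    show "\<exists>C>0. \<forall>x\<in>{0..L}. \<forall>t\<in>{0..T}. \<bar>Yt x t\<bar> \<le> C * (1 + t powr (real (m + 1) * \<alpha> - 1))"
      using C1 Yb by blast
  qed (use b\<gamma> b\<gamma>' dec Y0 Yd Yc Ydd Yi in blast)+
qed

end

theorem theorem2p1:
  fixes L p a b \<tau> \<alpha> :: real and K :: nat
    and lam :: "nat \<Rightarrow> real" and X :: "nat \<Rightarrow> real \<Rightarrow> real"
    and \<phi> \<phi>\<^sub>t f f\<^sub>t u :: "real \<Rightarrow> real \<Rightarrow> real"
  assumes "0 < \<alpha>" and "\<alpha> < 1" and "L > 0" and "p > 0" and "a \<le> 0" and "b \<noteq> 0" and "\<tau> > 0"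
    and "K \<ge> 1"
    and "continuous_on ({0..L} \<times> {-\<tau>..0}) (\<lambda>(x, t). \<phi> x t)"
    and "continuous_on ({0..L} \<times> {0..real K * \<tau>}) (\<lambda>(x, t). f x t)"
    and "dirichlet_eigensystem p a L lam X"
    and "\<exists>C. \<forall>t\<in>{0..\<tau>}. G_norm L lam X (3/2) (\<lambda>x. \<phi> x (t - \<tau>)) \<le> ennreal C"
    and "\<And>x t. x \<in> {0..L} \<Longrightarrow> t \<in> {-\<tau><..0} \<Longrightarrow>
           (\<phi> x has_real_derivative \<phi>\<^sub>t x t) (at t within {-\<tau>..0})"
    and "\<exists>C. \<forall>t\<in>{0<..\<tau>}. G_norm L lam X (1/2) (\<lambda>x. \<phi>\<^sub>t x (t - \<tau>))
                 \<le> ennreal (C * (1 + t powr (\<alpha> - 1)))"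
    and "\<exists>C. \<forall>t\<in>{0..real K * \<tau>}. G_norm L lam X (3/2) (\<lambda>x. f x t) \<le> ennreal C"
    and "\<And>x t. x \<in> {0..L} \<Longrightarrow> t \<in> {0<..\<tau>} \<Longrightarrow>
           (f x has_real_derivative f\<^sub>t x t) (at t within {0<..\<tau>})"
    and "\<And>x t. x \<in> {0..L} \<Longrightarrow> t \<in> {\<tau><..real K * \<tau>} \<Longrightarrow>
           (f x has_real_derivative f\<^sub>t x t) (at t within {\<tau><..real K * \<tau>})"
    and "\<exists>C. \<forall>t\<in>{0<..\<tau>}. G_norm L lam X (1/2) (\<lambda>x. f\<^sub>t x t) \<le> ennreal C"
    and "\<exists>C. \<forall>t\<in>{\<tau><..real K * \<tau>}. G_norm L lam X (1/2) (\<lambda>x. f\<^sub>t x t)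
                 \<le> ennreal (C * (1 + (t - \<tau>) powr (\<alpha> - 1)))"
    and "u = delay_sol L \<alpha> lam X b \<tau> \<phi> f K"
  shows
    "(\<exists>C>0. \<forall>k\<in>{1..K}. \<exists>u\<^sub>t u\<^sub>t\<^sub>t u\<^sub>x u\<^sub>x\<^sub>x.
        \<forall>x\<in>{0..L}. \<forall>t\<in>{real (k - 1) * \<tau><..real k * \<tau>}.
          (u x has_real_derivative u\<^sub>t x t) (at t within {real (k - 1) * \<tau><..real k * \<tau>}) \<and>
          (u\<^sub>t x has_real_derivative u\<^sub>t\<^sub>t x t) (at t within {real (k - 1) * \<tau><..real k * \<tau>}) \<and>
          ((\<lambda>y. u y t) has_real_derivative u\<^sub>x x t) (at x within {0..L}) \<and>
          ((\<lambda>y. u\<^sub>x y t) has_real_derivative u\<^sub>x\<^sub>x x t) (at x within {0..L}) \<and>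
          \<bar>u x t\<bar> \<le> C * (1 + t powr \<alpha>) \<and>
          \<bar>u\<^sub>t x t\<bar> \<le> C * (1 + t powr (\<alpha> - 1)) \<and>
          (k = 1 \<longrightarrow> \<bar>u\<^sub>t\<^sub>t x t\<bar> \<le> C * (1 + t powr (\<alpha> - 2))) \<and>
          (k \<ge> 2 \<longrightarrow> \<bar>u\<^sub>t\<^sub>t x t\<bar> \<le> C * (1 + (t - \<tau>) powr (\<alpha> - 1))) \<and>
          \<bar>u x t\<bar> \<le> C \<and> \<bar>u\<^sub>x x t\<bar> \<le> C \<and> \<bar>u\<^sub>x\<^sub>x x t\<bar> \<le> C)
     \<and>
     (\<forall>m g. m = (LEAST n. n \<ge> 1 \<and> real (n + 1) * \<alpha> > 1) \<and>
        (dirichlet_op p a L ^^ (m + 1)) (\<lambda>x. \<phi> x 0) g \<and> (\<exists>C. \<forall>x\<in>{0..L}. \<bar>g x\<bar> \<le> C) \<longrightarrow>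
        (\<exists>(\<gamma> :: nat \<Rightarrow> real \<Rightarrow> real) (\<gamma>' :: real \<Rightarrow> real) (Y :: real \<Rightarrow> real \<Rightarrow> real) Y\<^sub>t Y\<^sub>t\<^sub>t.
          (\<forall>j\<le>m. bounded (\<gamma> j ` {0..L})) \<and> bounded (\<gamma>' ` {0..L}) \<and>
          \<comment> \<open>not \<open>t powr (j * \<alpha>)\<close>, since \<open>0 powr 0 = 0\<close>\<close>
          (\<forall>x\<in>{0..L}. \<forall>t\<in>{0..real K * \<tau>}.
             u x t = (\<Sum>j\<le>m. \<gamma> j x * (t powr \<alpha>) ^ j) + \<gamma>' x * t + Y x t) \<and>
          (\<forall>x\<in>{0..L}. Y x 0 = 0 \<and> Y\<^sub>t x 0 = 0 \<and>
             (\<forall>t\<in>{0..real K * \<tau>}. (Y x has_real_derivative Y\<^sub>t x t) (at t within {0..real K * \<tau>})) \<and>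
             continuous_on {0..real K * \<tau>} (Y\<^sub>t x)) \<and>
          (\<exists>C>0. \<forall>x\<in>{0..L}. \<forall>t\<in>{0..real K * \<tau>}.
             \<bar>Y\<^sub>t x t\<bar> \<le> C * (1 + t powr (real (m + 1) * \<alpha> - 1))) \<and>
          \<comment> \<open>the second derivative need not exist at the break points \<open>j * \<tau>\<close>\<close>
          (\<forall>x\<in>{0..L}.
             (\<forall>t\<in>{0..real K * \<tau>} - (\<lambda>j. real j * \<tau>) ` {0..K}.
                (Y\<^sub>t x has_real_derivative Y\<^sub>t\<^sub>t x t) (at t)) \<and>
             Y\<^sub>t\<^sub>t x absolutely_integrable_on {0..real K * \<tau>})))"
proof -
  note \<alpha> = assms(1,2) and L = assms(3) and p = assms(4) and a = assms(5) and es = assms(11)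
  obtain B e1 e2 where "dirichlet_basis L B (\<lambda>i. lam (Suc i)) (\<lambda>i. X (Suc i)) e1 e2"
    using eigensystem_basis[OF L p a es] by blast
  then interpret db: dirichlet_basis L B "\<lambda>i. lam (Suc i)" "\<lambda>i. X (Suc i)" e1 e2 .
  obtain l0 where l0: "l0 > 0" "\<And>i. lam (Suc i) \<ge> l0" using db.l_bounded_below by blast
  interpret delay_problem L B "\<lambda>i. lam (Suc i)" "\<lambda>i. X (Suc i)" e1 e2 \<alpha> b \<tau> l0 K lam X \<phi> \<phi>\<^sub>t f f\<^sub>t u
    by unfold_locales (fact assms l0 refl)+
  show ?thesis
  proof (intro conjI allI impI, goal_cases)
    case 1
    show ?case by (rule regularity)
  next
    case (2 m g)
    then obtain C where m: "m = (LEAST n. n \<ge> 1 \<and> real (n + 1) * \<alpha> > 1)"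
      and G: "(dirichlet_op p a L ^^ (m + 1)) (\<lambda>x. \<phi> x 0) g" and g: "\<And>x. x \<in> {0..L} \<Longrightarrow> \<bar>g x\<bar> \<le> C"
      by blast
    \<comment> \<open>Any n above 1/\<alpha> shows that the set of admissible m is nonempty, so its
      least element satisfies the inequality.\<close>
    obtain n :: nat where n: "1 / \<alpha> < real n" using reals_Archimedean2 by blast
    have "Suc n \<ge> 1 \<and> real (Suc n + 1) * \<alpha> > 1"
    proof
      have "1 < real n * \<alpha>" using n \<alpha> by (simp add: pos_divide_less_eq)
      also have "\<dots> \<le> real (Suc n + 1) * \<alpha>" using \<alpha> by (intro mult_right_mono) auto
      finally show "real (Suc n + 1) * \<alpha> > 1" .
    qed simp
    then have "real (m + 1) * \<alpha> > 1" unfolding m by (rule LeastI2) simp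
    from decomposition[OF p a es this G g] show ?case .
  qed
qed

end
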